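(* The theories $\mathsf{RCA}_0+\mathsf{RT}(!\omega)$ and $\mathsf{PA}(\{\mathrm{Tr}_i:i\in\mathbb{N}\})$ prove exactly the same sentences of the language of Peano arithmetic.
   Context: A finite set $X\subseteq\mathbb{N}$ is exactly large if $|X|=\min(X)+1$. $\mathsf{RT}(!\omega)$: for every infinite $M\subseteq\mathbb{N}$ and every 2-coloring $C$ of the exactly large subsets of $\mathbb{N}$ there is an infinite $L\subseteq M$ such that $C$ is constant on the exactly large subsets of $L$. $\mathsf{PA}(\{\mathrm{Tr}_i:i\in\mathbb{N}\})$ is Peano arithmetic in the language extended by unary predicates $\mathrm{Tr}_0,\mathrm{Tr}_1,\dots$, with full induction for the extended language, and, for each $n$, axioms saying $\mathrm{Tr}_n$ is a compositional (Tarskian) truth predicate for the language $L_n$ of arithmetic with $\mathrm{Tr}_0,\dots,\mathrm{Tr}_{n-1}$: for closed terms $t,t'$, $\mathrm{Tr}_n(t=t')\leftrightarrow \mathrm{val}(t)=\mathrm{val}(t')$ and $\mathrm{Tr}_n(t\le t')\leftrightarrow\mathrm{val}(t)\le\mathrm{val}(t')$; for $i<n$, $\forall x(\mathrm{Tr}_n(\mathrm{Tr}_i(\bar x))\leftrightarrow\mathrm{Tr}_i(x))$; and for sentences $\varphi,\psi$ of $L_n$: $\mathrm{Tr}_n(\neg\varphi)\leftrightarrow\neg\mathrm{Tr}_n(\varphi)$, $\mathrm{Tr}_n(\varphi\to\psi)\leftrightarrow(\mathrm{Tr}_n(\varphi)\to\mathrm{Tr}_n(\psi))$, $\mathrm{Tr}_n(\exists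 x\varphi(x))\leftrightarrow\exists x\,\mathrm{Tr}_n(\varphi(\bar x))$, where $\bar x$ is the numeral for $x$ and $\mathrm{val}$ evaluates closed terms. *)

theory Defs
  imports Main
begin

section \<open>Syntax\<close>

text \<open>
  One datatype of formulas covers all languages used below; the individual languages are
  subsets of it. Variables are de Bruijn indices, separately for numbers and for sets:
  \<open>Ex\<close> binds number variable \<open>0\<close> and \<open>Ex2\<close> binds set variable \<open>0\<close>.
  \<open>In t X\<close> is the atom \<open>t \<in> X\<close>, and \<open>Tr i t\<close> is the truth predicate with index \<open>i\<close>
  applied to \<open>t\<close>.
\<close>

datatype tm =
    Var nat
  | Zero
  | Succ tm
  | Plus tm tm  (infixl "\<^bold>+" 65)
  | Times tm tm  (infixl "\<^bold>\<cdot>" 70)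

datatype fm =
    Eq tm tm  (infix "\<^bold>=" 50)
  | Le tm tm  (infix "\<^bold>\<le>" 50)
  | In tm nat
  | Tr nat tm
  | Neg fm  ("\<^bold>\<not> _" [40] 40)
  | Imp fm fm  (infixr "\<^bold>\<longrightarrow>" 25)
  | Ex fm
  | Ex2 fm

abbreviation Conj :: "fm \<Rightarrow> fm \<Rightarrow> fm"  (infixr "\<^bold>\<and>" 35)
  where "p \<^bold>\<and> q \<equiv> \<^bold>\<not> (p \<^bold>\<longrightarrow> \<^bold>\<not> q)"

abbreviation Disj :: "fm \<Rightarrow> fm \<Rightarrow> fm"  (infixr "\<^bold>\<or>" 30)
  where "p \<^bold>\<or> q \<equiv> \<^bold>\<not> p \<^bold>\<longrightarrow> q"

abbreviation Iff :: "fm \<Rightarrow> fm \<Rightarrow> fm"  (infixr "\<^bold>\<longleftrightarrow>" 25)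
  where "p \<^bold>\<longleftrightarrow> q \<equiv> (p \<^bold>\<longrightarrow> q) \<^bold>\<and> (q \<^bold>\<longrightarrow> p)"

abbreviation All :: "fm \<Rightarrow> fm"
  where "All p \<equiv> \<^bold>\<not> Ex (\<^bold>\<not> p)"

abbreviation All2 :: "fm \<Rightarrow> fm"
  where "All2 p \<equiv> \<^bold>\<not> Ex2 (\<^bold>\<not> p)"

abbreviation Lt :: "tm \<Rightarrow> tm \<Rightarrow> fm"  (infix "\<^bold><" 50)
  where "t \<^bold>< u \<equiv> Succ t \<^bold>\<le> u"

text \<open>Shifting by \<open>d\<close> all variables from index \<open>c\<close> on, and capture-avoiding substitution for
  variable \<open>k\<close> (lowering the variables above \<open>k\<close>).\<close>

primrec shift_tm :: "nat \<Rightarrow> nat \<Rightarrow> tm \<Rightarrow> tm" where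
  "shift_tm d c (Var i) = Var (if i < c then i else i + d)"
| "shift_tm d c Zero = Zero"
| "shift_tm d c (Succ t) = Succ (shift_tm d c t)"
| "shift_tm d c (t \<^bold>+ u) = shift_tm d c t \<^bold>+ shift_tm d c u"
| "shift_tm d c (t \<^bold>\<cdot> u) = shift_tm d c t \<^bold>\<cdot> shift_tm d c u"

abbreviation lift :: "nat \<Rightarrow> tm \<Rightarrow> tm"
  where "lift d t \<equiv> shift_tm d 0 t"

primrec subst_tm :: "nat \<Rightarrow> tm \<Rightarrow> tm \<Rightarrow> tm" where
  "subst_tm k u (Var i) = (if i < k then Var i else if i = k then u else Var (i - 1))"
| "subst_tm k u Zero = Zero"
| "subst_tm k u (Succ t) = Succ (subst_tm k u t)"
| "subst_tm k u (t \<^bold>+ t') = subst_tm k u t \<^bold>+ subst_tm k u t'"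
| "subst_tm k u (t \<^bold>\<cdot> t') = subst_tm k u t \<^bold>\<cdot> subst_tm k u t'"

primrec shift_fm :: "nat \<Rightarrow> nat \<Rightarrow> fm \<Rightarrow> fm" where
  "shift_fm d c (t \<^bold>= u) = (shift_tm d c t \<^bold>= shift_tm d c u)"
| "shift_fm d c (t \<^bold>\<le> u) = (shift_tm d c t \<^bold>\<le> shift_tm d c u)"
| "shift_fm d c (In t X) = In (shift_tm d c t) X"
| "shift_fm d c (Tr i t) = Tr i (shift_tm d c t)"
| "shift_fm d c (\<^bold>\<not> p) = (\<^bold>\<not> shift_fm d c p)"
| "shift_fm d c (p \<^bold>\<longrightarrow> q) = (shift_fm d c p \<^bold>\<longrightarrow> shift_fm d c q)"
| "shift_fm d c (Ex p) = Ex (shift_fm d (Suc c) p)"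
| "shift_fm d c (Ex2 p) = Ex2 (shift_fm d c p)"

primrec shift2_fm :: "nat \<Rightarrow> nat \<Rightarrow> fm \<Rightarrow> fm" where
  "shift2_fm d c (t \<^bold>= u) = (t \<^bold>= u)"
| "shift2_fm d c (t \<^bold>\<le> u) = (t \<^bold>\<le> u)"
| "shift2_fm d c (In t X) = In t (if X < c then X else X + d)"
| "shift2_fm d c (Tr i t) = Tr i t"
| "shift2_fm d c (\<^bold>\<not> p) = (\<^bold>\<not> shift2_fm d c p)"
| "shift2_fm d c (p \<^bold>\<longrightarrow> q) = (shift2_fm d c p \<^bold>\<longrightarrow> shift2_fm d c q)"
| "shift2_fm d c (Ex p) = Ex (shift2_fm d c p)"
| "shift2_fm d c (Ex2 p) = Ex2 (shift2_fm d (Suc c) p)"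

primrec subst_fm :: "nat \<Rightarrow> tm \<Rightarrow> fm \<Rightarrow> fm" where
  "subst_fm k u (t \<^bold>= t') = (subst_tm k u t \<^bold>= subst_tm k u t')"
| "subst_fm k u (t \<^bold>\<le> t') = (subst_tm k u t \<^bold>\<le> subst_tm k u t')"
| "subst_fm k u (In t X) = In (subst_tm k u t) X"
| "subst_fm k u (Tr i t) = Tr i (subst_tm k u t)"
| "subst_fm k u (\<^bold>\<not> p) = (\<^bold>\<not> subst_fm k u p)"
| "subst_fm k u (p \<^bold>\<longrightarrow> q) = (subst_fm k u p \<^bold>\<longrightarrow> subst_fm k u q)"
| "subst_fm k u (Ex p) = Ex (subst_fm (Suc k) (lift 1 u) p)"
| "subst_fm k u (Ex2 p) = Ex2 (subst_fm k u p)"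

primrec subst2_fm :: "nat \<Rightarrow> nat \<Rightarrow> fm \<Rightarrow> fm" where
  "subst2_fm k Y (t \<^bold>= u) = (t \<^bold>= u)"
| "subst2_fm k Y (t \<^bold>\<le> u) = (t \<^bold>\<le> u)"
| "subst2_fm k Y (In t X) = In t (if X < k then X else if X = k then Y else X - 1)"
| "subst2_fm k Y (Tr i t) = Tr i t"
| "subst2_fm k Y (\<^bold>\<not> p) = (\<^bold>\<not> subst2_fm k Y p)"
| "subst2_fm k Y (p \<^bold>\<longrightarrow> q) = (subst2_fm k Y p \<^bold>\<longrightarrow> subst2_fm k Y q)"
| "subst2_fm k Y (Ex p) = Ex (subst2_fm k Y p)"
| "subst2_fm k Y (Ex2 p) = Ex2 (subst2_fm (Suc k) (Suc Y) p)"

text \<open>All free number variables are below \<open>m\<close>, all free set variables below \<open>n\<close>.\<close>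

primrec closed_tm :: "nat \<Rightarrow> tm \<Rightarrow> bool" where
  "closed_tm m (Var i) = (i < m)"
| "closed_tm m Zero = True"
| "closed_tm m (Succ t) = closed_tm m t"
| "closed_tm m (t \<^bold>+ u) = (closed_tm m t \<and> closed_tm m u)"
| "closed_tm m (t \<^bold>\<cdot> u) = (closed_tm m t \<and> closed_tm m u)"

primrec closed_fm :: "nat \<Rightarrow> nat \<Rightarrow> fm \<Rightarrow> bool" where
  "closed_fm m n (t \<^bold>= u) = (closed_tm m t \<and> closed_tm m u)"
| "closed_fm m n (t \<^bold>\<le> u) = (closed_tm m t \<and> closed_tm m u)"
| "closed_fm m n (In t X) = (closed_tm m t \<and> X < n)"
| "closed_fm m n (Tr i t) = closed_tm m t"
| "closed_fm m n (\<^bold>\<not> p) = closed_fm m n p"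
| "closed_fm m n (p \<^bold>\<longrightarrow> q) = (closed_fm m n p \<and> closed_fm m n q)"
| "closed_fm m n (Ex p) = closed_fm (Suc m) n p"
| "closed_fm m n (Ex2 p) = closed_fm m (Suc n) p"

definition sentence :: "fm \<Rightarrow> bool"
  where "sentence p \<longleftrightarrow> closed_fm 0 0 p"

primrec set_free :: "fm \<Rightarrow> bool" where
  "set_free (t \<^bold>= u) = True"
| "set_free (t \<^bold>\<le> u) = True"
| "set_free (In t X) = False"
| "set_free (Tr i t) = True"
| "set_free (\<^bold>\<not> p) = set_free p"
| "set_free (p \<^bold>\<longrightarrow> q) = (set_free p \<and> set_free q)"
| "set_free (Ex p) = set_free p"
| "set_free (Ex2 p) = False"

primrec truth_free :: "fm \<Rightarrow> bool" where
  "truth_free (t \<^bold>= u) = True"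
| "truth_free (t \<^bold>\<le> u) = True"
| "truth_free (In t X) = True"
| "truth_free (Tr i t) = False"
| "truth_free (\<^bold>\<not> p) = truth_free p"
| "truth_free (p \<^bold>\<longrightarrow> q) = (truth_free p \<and> truth_free q)"
| "truth_free (Ex p) = truth_free p"
| "truth_free (Ex2 p) = truth_free p"

definition lang_PA :: "fm set"
  where "lang_PA = {p. set_free p \<and> truth_free p}"

definition lang_2 :: "fm set"
  where "lang_2 = {p. truth_free p}"

definition lang_Tr :: "fm set"
  where "lang_Tr = {p. set_free p}"


section \<open>Provability\<close>

inductive_set logical_axioms :: "fm set" where
  "(p \<^bold>\<longrightarrow> q \<^bold>\<longrightarrow> p) \<in> logical_axioms"
| "((p \<^bold>\<longrightarrow> q \<^bold>\<longrightarrow> r) \<^bold>\<longrightarrow> (p \<^bold>\<longrightarrow> q) \<^bold>\<longrightarrow> p \<^bold>\<longrightarrow> r) \<in> logical_axioms"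
| "((\<^bold>\<not> p \<^bold>\<longrightarrow> \<^bold>\<not> q) \<^bold>\<longrightarrow> q \<^bold>\<longrightarrow> p) \<in> logical_axioms"
| "(t \<^bold>= t) \<in> logical_axioms"
| "(t \<^bold>= u \<^bold>\<longrightarrow> subst_fm 0 t p \<^bold>\<longrightarrow> subst_fm 0 u p) \<in> logical_axioms"
| "(subst_fm 0 t p \<^bold>\<longrightarrow> Ex p) \<in> logical_axioms"
| "(subst2_fm 0 Y p \<^bold>\<longrightarrow> Ex2 p) \<in> logical_axioms"

text \<open>\<open>proves L T p\<close>: there is a Hilbert-style derivation of \<open>p\<close> from \<open>T\<close> all of whose formulas
  belong to \<open>L\<close>. The rules for the quantifiers carry the usual variable condition: the bound
  variable does not occur in the shifted formula. Free variables in axioms are understood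
  universally, since the rules may be applied to them.\<close>

inductive proves :: "fm set \<Rightarrow> fm set \<Rightarrow> fm \<Rightarrow> bool" for L T where
  logical: "\<lbrakk>p \<in> logical_axioms; p \<in> L\<rbrakk> \<Longrightarrow> proves L T p"
| axiom: "\<lbrakk>p \<in> T; p \<in> L\<rbrakk> \<Longrightarrow> proves L T p"
| mp: "\<lbrakk>proves L T (p \<^bold>\<longrightarrow> q); proves L T p\<rbrakk> \<Longrightarrow> proves L T q"
| ex: "\<lbrakk>proves L T (p \<^bold>\<longrightarrow> shift_fm 1 0 q); (Ex p \<^bold>\<longrightarrow> q) \<in> L\<rbrakk>
    \<Longrightarrow> proves L T (Ex p \<^bold>\<longrightarrow> q)"
| ex2: "\<lbrakk>proves L T (p \<^bold>\<longrightarrow> shift2_fm 1 0 q); (Ex2 p \<^bold>\<longrightarrow> q) \<in> L\<rbrakk>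
    \<Longrightarrow> proves L T (Ex2 p \<^bold>\<longrightarrow> q)"


section \<open>Basic axioms, induction, and the theory RCA0\<close>

definition basic_axioms :: "fm set" where
  "basic_axioms =
    {\<^bold>\<not> (Succ (Var 0) \<^bold>= Zero),
     Succ (Var 0) \<^bold>= Succ (Var 1) \<^bold>\<longrightarrow> Var 0 \<^bold>= Var 1,
     Var 0 \<^bold>+ Zero \<^bold>= Var 0,
     Var 0 \<^bold>+ Succ (Var 1) \<^bold>= Succ (Var 0 \<^bold>+ Var 1),
     Var 0 \<^bold>\<cdot> Zero \<^bold>= Zero,
     Var 0 \<^bold>\<cdot> Succ (Var 1) \<^bold>= Var 0 \<^bold>\<cdot> Var 1 \<^bold>+ Var 0,
     Var 0 \<^bold>\<le> Zero \<^bold>\<longleftrightarrow> Var 0 \<^bold>= Zero,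
     Var 0 \<^bold>\<le> Succ (Var 1) \<^bold>\<longleftrightarrow> (Var 0 \<^bold>\<le> Var 1 \<^bold>\<or> Var 0 \<^bold>= Succ (Var 1))}"

text \<open>Induction on number variable \<open>0\<close> of \<open>p\<close>; the shift makes room for the new bound variable
  in \<open>p (x + 1)\<close>.\<close>

definition induction_axiom :: "fm \<Rightarrow> fm" where
  "induction_axiom p =
    (subst_fm 0 Zero p \<^bold>\<longrightarrow>
     All (p \<^bold>\<longrightarrow> subst_fm 0 (Succ (Var 0)) (shift_fm 1 1 p)) \<^bold>\<longrightarrow>
     All p)"

definition BEx :: "tm \<Rightarrow> fm \<Rightarrow> fm"
  where "BEx t p = Ex (Var 0 \<^bold>\<le> lift 1 t \<^bold>\<and> p)"

definition BAll :: "tm \<Rightarrow> fm \<Rightarrow> fm"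
  where "BAll t p = All (Var 0 \<^bold>\<le> lift 1 t \<^bold>\<longrightarrow> p)"

inductive_set bounded_formulas :: "fm set" where
  "(t \<^bold>= u) \<in> bounded_formulas"
| "(t \<^bold>\<le> u) \<in> bounded_formulas"
| "In t X \<in> bounded_formulas"
| "p \<in> bounded_formulas \<Longrightarrow> (\<^bold>\<not> p) \<in> bounded_formulas"
| "p \<in> bounded_formulas \<Longrightarrow> q \<in> bounded_formulas \<Longrightarrow> (p \<^bold>\<longrightarrow> q) \<in> bounded_formulas"
| "p \<in> bounded_formulas \<Longrightarrow> BEx t p \<in> bounded_formulas"
| "p \<in> bounded_formulas \<Longrightarrow> BAll t p \<in> bounded_formulas"

definition Sigma01 :: "fm set"
  where "Sigma01 = {Ex p |p. p \<in> bounded_formulas}"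

definition Pi01 :: "fm set"
  where "Pi01 = {All p |p. p \<in> bounded_formulas}"

text \<open>\<open>\<forall>x (p x \<longleftrightarrow> q x) \<longrightarrow> \<exists>X \<forall>x (x \<in> X \<longleftrightarrow> p x)\<close> with \<open>X\<close> not free in \<open>p\<close>.\<close>

definition comprehension_axiom :: "fm \<Rightarrow> fm \<Rightarrow> fm" where
  "comprehension_axiom p q =
    (All (p \<^bold>\<longleftrightarrow> q) \<^bold>\<longrightarrow> Ex2 (All (In (Var 0) 0 \<^bold>\<longleftrightarrow> shift2_fm 1 0 p)))"

definition RCA0 :: "fm set" where
  "RCA0 = basic_axioms
     \<union> {induction_axiom p |p. p \<in> Sigma01}
     \<union> {comprehension_axiom p q |p q. p \<in> Sigma01 \<and> q \<in> Pi01}"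


section \<open>Pairs and finite sets in arithmetic\<close>

text \<open>The map \<open>(x, y) \<mapsto> (x + y)\<^sup>2 + x\<close> is injective.\<close>

definition pair :: "tm \<Rightarrow> tm \<Rightarrow> tm"
  where "pair t u = (t \<^bold>+ u) \<^bold>\<cdot> (t \<^bold>+ u) \<^bold>+ t"

text \<open>The number \<open>c = (k, (m, l))\<close> codes the finite set of all \<open>y < k\<close> such that \<open>1 + (y + 1) m\<close>
  divides \<open>l\<close>; every finite set has such codes. Numbers not of this form code the empty set.\<close>

definition mem :: "tm \<Rightarrow> tm \<Rightarrow> fm" where
  "mem y c =
    BEx c (BEx (lift 1 c) (BEx (lift 2 c)
      (lift 3 c \<^bold>= pair (Var 2) (pair (Var 1) (Var 0)) \<^bold>\<and>
       lift 3 y \<^bold>< Var 2 \<^bold>\<and>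
       BEx (Var 0) (Var 1 \<^bold>= Succ (Succ (lift 4 y) \<^bold>\<cdot> Var 2) \<^bold>\<cdot> Var 0))))"

definition Ex_mem :: "tm \<Rightarrow> fm \<Rightarrow> fm"
  where "Ex_mem c p = Ex (mem (Var 0) (lift 1 c) \<^bold>\<and> p)"

definition All_mem :: "tm \<Rightarrow> fm \<Rightarrow> fm"
  where "All_mem c p = All (mem (Var 0) (lift 1 c) \<^bold>\<longrightarrow> p)"

definition All_pair_mem :: "tm \<Rightarrow> fm \<Rightarrow> fm"
  where "All_pair_mem c p = All (All (mem (pair (Var 1) (Var 0)) (lift 2 c) \<^bold>\<longrightarrow> p))"


section \<open>The principle RT(!omega)\<close>

text \<open>A finite set of numbers is represented by its least code, so that a colouring of finite
  sets is the same as a colouring of their representatives.\<close>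

definition least_code :: "tm \<Rightarrow> fm" where
  "least_code c =
    All (Var 0 \<^bold>< lift 1 c \<^bold>\<longrightarrow>
      \<^bold>\<not> All (mem (Var 0) (Var 1) \<^bold>\<longleftrightarrow> mem (Var 0) (lift 2 c)))"

text \<open>The set coded by \<open>c\<close> has \<open>k\<close> elements: some coded set \<open>f\<close> of pairs is (the graph of) a
  bijection from \<open>{x. x < k}\<close> to that set.\<close>

definition has_card :: "tm \<Rightarrow> tm \<Rightarrow> fm" where
  "has_card c k =
    Ex (All (Var 0 \<^bold>< lift 2 k \<^bold>\<longrightarrow> Ex_mem (lift 2 c) (mem (pair (Var 1) (Var 0)) (Var 2))) \<^bold>\<and>
        All_mem (lift 1 c) (Ex (Var 0 \<^bold>< lift 3 k \<^bold>\<and> mem (pair (Var 0) (Var 1)) (Var 2))) \<^bold>\<and>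
        All_pair_mem (Var 0) (All_pair_mem (Var 2)
          (Var 3 \<^bold>= Var 1 \<^bold>\<longleftrightarrow> Var 2 \<^bold>= Var 0)))"

definition exactly_large :: "tm \<Rightarrow> fm" where
  "exactly_large c =
    (least_code c \<^bold>\<and>
     Ex_mem c (All_mem (lift 1 c) (Var 1 \<^bold>\<le> Var 0) \<^bold>\<and> has_card (lift 1 c) (Succ (Var 0))))"

definition infinite_set :: "nat \<Rightarrow> fm"
  where "infinite_set X = All (Ex (Var 1 \<^bold>\<le> Var 0 \<^bold>\<and> In (Var 0) X))"

definition subset :: "nat \<Rightarrow> nat \<Rightarrow> fm"
  where "subset X Y = All (In (Var 0) X \<^bold>\<longrightarrow> In (Var 0) Y)"

definition coded_subset :: "tm \<Rightarrow> nat \<Rightarrow> fm"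
  where "coded_subset c X = All_mem c (In (Var 0) X)"

text \<open>\<open>C\<close> is (the graph of) a function from the exactly large sets to \<open>{0, 1}\<close>.\<close>

definition two_coloring :: "nat \<Rightarrow> fm" where
  "two_coloring C =
    (All (In (Var 0) C \<^bold>\<longrightarrow>
       Ex (Ex (exactly_large (Var 1) \<^bold>\<and> Var 0 \<^bold>\<le> Succ Zero \<^bold>\<and> Var 2 \<^bold>= pair (Var 1) (Var 0)))) \<^bold>\<and>
     All (exactly_large (Var 0) \<^bold>\<longrightarrow>
       (In (pair (Var 0) Zero) C \<^bold>\<longleftrightarrow> \<^bold>\<not> In (pair (Var 0) (Succ Zero)) C)))"

definition RT_exactly_large :: fm where
  "RT_exactly_large =
    All2 (infinite_set 0 \<^bold>\<longrightarrow>
      All2 (two_coloring 0 \<^bold>\<longrightarrow>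
        Ex2 (infinite_set 0 \<^bold>\<and> subset 0 2 \<^bold>\<and>
          Ex (Var 0 \<^bold>\<le> Succ Zero \<^bold>\<and>
            All (exactly_large (Var 0) \<^bold>\<and> coded_subset (Var 0) 0 \<^bold>\<longrightarrow>
              In (pair (Var 0) (Var 1)) 1)))))"


section \<open>Arithmetization of the languages with truth predicates\<close>

text \<open>Codes of terms and formulas. The arguments of the following functions are object-language
  terms denoting the codes (for \<open>code_Var\<close> and the first argument of \<open>code_Tr\<close>: the index).
  A code is greater than the codes of the immediate subexpressions.\<close>

primrec numeral_tm :: "nat \<Rightarrow> tm" where
  "numeral_tm 0 = Zero"
| "numeral_tm (Suc n) = Succ (numeral_tm n)"

definition code_Zero :: tm
  where "code_Zero = pair (numeral_tm 0) Zero"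
definition code_Var :: "tm \<Rightarrow> tm"
  where "code_Var i = pair (numeral_tm 1) i"
definition code_Succ :: "tm \<Rightarrow> tm"
  where "code_Succ t = pair (numeral_tm 2) t"
definition code_Plus :: "tm \<Rightarrow> tm \<Rightarrow> tm"
  where "code_Plus t u = pair (numeral_tm 3) (pair t u)"
definition code_Times :: "tm \<Rightarrow> tm \<Rightarrow> tm"
  where "code_Times t u = pair (numeral_tm 4) (pair t u)"
definition code_Eq :: "tm \<Rightarrow> tm \<Rightarrow> tm"
  where "code_Eq t u = pair (numeral_tm 5) (pair t u)"
definition code_Le :: "tm \<Rightarrow> tm \<Rightarrow> tm"
  where "code_Le t u = pair (numeral_tm 6) (pair t u)"
definition code_Tr :: "tm \<Rightarrow> tm \<Rightarrow> tm"
  where "code_Tr i t = pair (numeral_tm 7) (pair i t)"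
definition code_Neg :: "tm \<Rightarrow> tm"
  where "code_Neg p = pair (numeral_tm 8) p"
definition code_Imp :: "tm \<Rightarrow> tm \<Rightarrow> tm"
  where "code_Imp p q = pair (numeral_tm 9) (pair p q)"
definition code_Ex :: "tm \<Rightarrow> tm"
  where "code_Ex p = pair (numeral_tm 10) p"

text \<open>Each syntactic relation is defined by the existence of a coded set \<open>s\<close> that contains the
  given element and is such that every element of \<open>s\<close> is justified by elements of \<open>s\<close> concerning
  immediate subexpressions.\<close>

text \<open>\<open>z\<close> is the code of the numeral of \<open>x\<close>.\<close>

definition is_numeral :: "tm \<Rightarrow> tm \<Rightarrow> fm" where
  "is_numeral x z =
    Ex (mem (pair (lift 1 x) (lift 1 z)) (Var 0) \<^bold>\<and>
        All_pair_mem (Var 0)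
          (Var 1 \<^bold>= Zero \<^bold>\<and> Var 0 \<^bold>= code_Zero \<^bold>\<or>
           Ex (Ex (mem (pair (Var 1) (Var 0)) (Var 4) \<^bold>\<and>
                   Var 3 \<^bold>= Succ (Var 1) \<^bold>\<and> Var 2 \<^bold>= code_Succ (Var 0)))))"

text \<open>\<open>t\<close> is the code of a term all of whose variables are below \<open>k\<close>.\<close>

definition is_term :: "tm \<Rightarrow> tm \<Rightarrow> fm" where
  "is_term k t =
    Ex (mem (lift 1 t) (Var 0) \<^bold>\<and>
        All_mem (Var 0)
          (Var 0 \<^bold>= code_Zero \<^bold>\<or>
           Ex (Var 0 \<^bold>< lift 3 k \<^bold>\<and> Var 1 \<^bold>= code_Var (Var 0)) \<^bold>\<or>
           Ex_mem (Var 1) (Var 1 \<^bold>= code_Succ (Var 0)) \<^bold>\<or>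
           Ex_mem (Var 1) (Ex_mem (Var 2)
             (Var 2 \<^bold>= code_Plus (Var 1) (Var 0) \<^bold>\<or> Var 2 \<^bold>= code_Times (Var 1) (Var 0)))))"

text \<open>\<open>t\<close> is the code of a closed term with value \<open>v\<close>.\<close>

definition has_value :: "tm \<Rightarrow> tm \<Rightarrow> fm" where
  "has_value t v =
    Ex (mem (pair (lift 1 t) (lift 1 v)) (Var 0) \<^bold>\<and>
        All_pair_mem (Var 0)
          (Var 1 \<^bold>= code_Zero \<^bold>\<and> Var 0 \<^bold>= Zero \<^bold>\<or>
           Ex (Ex (mem (pair (Var 1) (Var 0)) (Var 4) \<^bold>\<and>
                   Var 3 \<^bold>= code_Succ (Var 1) \<^bold>\<and> Var 2 \<^bold>= Succ (Var 0))) \<^bold>\<or>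
           Ex (Ex (mem (pair (Var 1) (Var 0)) (Var 4) \<^bold>\<and>
             Ex (Ex (mem (pair (Var 1) (Var 0)) (Var 6) \<^bold>\<and>
               (Var 5 \<^bold>= code_Plus (Var 3) (Var 1) \<^bold>\<and> Var 4 \<^bold>= Var 2 \<^bold>+ Var 0 \<^bold>\<or>
                Var 5 \<^bold>= code_Times (Var 3) (Var 1) \<^bold>\<and> Var 4 \<^bold>= Var 2 \<^bold>\<cdot> Var 0)))))))"

text \<open>Substituting the closed term with code \<open>z\<close> for variable \<open>k\<close> in the term with code \<open>t\<close> gives
  the term with code \<open>u\<close> (cf. \<open>subst_tm\<close>).\<close>

definition is_subst_tm :: "tm \<Rightarrow> tm \<Rightarrow> tm \<Rightarrow> tm \<Rightarrow> fm" where
  "is_subst_tm k z t u =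
    Ex (mem (pair (lift 1 t) (lift 1 u)) (Var 0) \<^bold>\<and>
        All_pair_mem (Var 0)
          (Var 1 \<^bold>= code_Zero \<^bold>\<and> Var 0 \<^bold>= code_Zero \<^bold>\<or>
           Ex (Var 0 \<^bold>< lift 4 k \<^bold>\<and> Var 2 \<^bold>= code_Var (Var 0) \<^bold>\<and> Var 1 \<^bold>= code_Var (Var 0)) \<^bold>\<or>
           Var 1 \<^bold>= code_Var (lift 3 k) \<^bold>\<and> Var 0 \<^bold>= lift 3 z \<^bold>\<or>
           Ex (lift 4 k \<^bold>\<le> Var 0 \<^bold>\<and>
               Var 2 \<^bold>= code_Var (Succ (Var 0)) \<^bold>\<and> Var 1 \<^bold>= code_Var (Var 0)) \<^bold>\<or>
           Ex (Ex (mem (pair (Var 1) (Var 0)) (Var 4) \<^bold>\<and>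
                   Var 3 \<^bold>= code_Succ (Var 1) \<^bold>\<and> Var 2 \<^bold>= code_Succ (Var 0))) \<^bold>\<or>
           Ex (Ex (mem (pair (Var 1) (Var 0)) (Var 4) \<^bold>\<and>
             Ex (Ex (mem (pair (Var 1) (Var 0)) (Var 6) \<^bold>\<and>
               (Var 5 \<^bold>= code_Plus (Var 3) (Var 1) \<^bold>\<and> Var 4 \<^bold>= code_Plus (Var 2) (Var 0) \<^bold>\<or>
                Var 5 \<^bold>= code_Times (Var 3) (Var 1) \<^bold>\<and> Var 4 \<^bold>= code_Times (Var 2) (Var 0))))))))"

text \<open>\<open>p\<close> is the code of a formula of the language of arithmetic with the truth predicates of index
  less than \<open>n\<close>, all of whose free variables are below \<open>k\<close>. The set \<open>s\<close> consists of pairs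
  \<open>(k, p)\<close>.\<close>

definition is_formula :: "nat \<Rightarrow> tm \<Rightarrow> tm \<Rightarrow> fm" where
  "is_formula n k p =
    Ex (mem (pair (lift 1 k) (lift 1 p)) (Var 0) \<^bold>\<and>
        All_pair_mem (Var 0)
          (Ex (Ex (is_term (Var 3) (Var 1) \<^bold>\<and> is_term (Var 3) (Var 0) \<^bold>\<and>
             (Var 2 \<^bold>= code_Eq (Var 1) (Var 0) \<^bold>\<or> Var 2 \<^bold>= code_Le (Var 1) (Var 0)))) \<^bold>\<or>
           Ex (Ex (Var 1 \<^bold>< numeral_tm n \<^bold>\<and> is_term (Var 3) (Var 0) \<^bold>\<and>
             Var 2 \<^bold>= code_Tr (Var 1) (Var 0))) \<^bold>\<or>
           Ex (mem (pair (Var 2) (Var 0)) (Var 3) \<^bold>\<and> Var 1 \<^bold>= code_Neg (Var 0)) \<^bold>\<or>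
           Ex (Ex (mem (pair (Var 3) (Var 1)) (Var 4) \<^bold>\<and> mem (pair (Var 3) (Var 0)) (Var 4) \<^bold>\<and>
             Var 2 \<^bold>= code_Imp (Var 1) (Var 0))) \<^bold>\<or>
           Ex (mem (pair (Succ (Var 2)) (Var 0)) (Var 3) \<^bold>\<and> Var 1 \<^bold>= code_Ex (Var 0))))"

text \<open>Substituting the closed term with code \<open>z\<close> for variable \<open>k\<close> in the formula with code \<open>p\<close> gives
  the formula with code \<open>q\<close> (cf. \<open>subst_fm\<close>). The set \<open>s\<close> consists of triples \<open>(k, (p, q))\<close>.\<close>

definition is_subst_fm :: "tm \<Rightarrow> tm \<Rightarrow> tm \<Rightarrow> tm \<Rightarrow> fm" where
  "is_subst_fm k z p q =
    Ex (mem (pair (lift 1 k) (pair (lift 1 p) (lift 1 q))) (Var 0) \<^bold>\<and>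
        All (All (All (mem (pair (Var 2) (pair (Var 1) (Var 0))) (Var 3) \<^bold>\<longrightarrow>
          (Ex (Ex (Ex (Ex (
             is_subst_tm (Var 6) (lift 8 z) (Var 3) (Var 2) \<^bold>\<and>
             is_subst_tm (Var 6) (lift 8 z) (Var 1) (Var 0) \<^bold>\<and>
             (Var 5 \<^bold>= code_Eq (Var 3) (Var 1) \<^bold>\<and> Var 4 \<^bold>= code_Eq (Var 2) (Var 0) \<^bold>\<or>
              Var 5 \<^bold>= code_Le (Var 3) (Var 1) \<^bold>\<and> Var 4 \<^bold>= code_Le (Var 2) (Var 0)))))) \<^bold>\<or>
           Ex (Ex (Ex (is_subst_tm (Var 5) (lift 7 z) (Var 1) (Var 0) \<^bold>\<and>
             Var 4 \<^bold>= code_Tr (Var 2) (Var 1) \<^bold>\<and> Var 3 \<^bold>= code_Tr (Var 2) (Var 0)))) \<^bold>\<or>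
           Ex (Ex (mem (pair (Var 4) (pair (Var 1) (Var 0))) (Var 5) \<^bold>\<and>
             Var 3 \<^bold>= code_Neg (Var 1) \<^bold>\<and> Var 2 \<^bold>= code_Neg (Var 0))) \<^bold>\<or>
           Ex (Ex (Ex (Ex (
             mem (pair (Var 6) (pair (Var 3) (Var 2))) (Var 7) \<^bold>\<and>
             mem (pair (Var 6) (pair (Var 1) (Var 0))) (Var 7) \<^bold>\<and>
             Var 5 \<^bold>= code_Imp (Var 3) (Var 1) \<^bold>\<and> Var 4 \<^bold>= code_Imp (Var 2) (Var 0))))) \<^bold>\<or>
           Ex (Ex (mem (pair (Succ (Var 4)) (pair (Var 1) (Var 0))) (Var 5) \<^bold>\<and>
             Var 3 \<^bold>= code_Ex (Var 1) \<^bold>\<and> Var 2 \<^bold>= code_Ex (Var 0))))))))"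


section \<open>The theory PA with truth predicates\<close>

definition truth_Eq :: "nat \<Rightarrow> fm" where
  "truth_Eq n =
    All (All (All (All
      (is_term Zero (Var 3) \<^bold>\<and> is_term Zero (Var 2) \<^bold>\<and>
       has_value (Var 3) (Var 1) \<^bold>\<and> has_value (Var 2) (Var 0) \<^bold>\<longrightarrow>
       (Tr n (code_Eq (Var 3) (Var 2)) \<^bold>\<longleftrightarrow> Var 1 \<^bold>= Var 0)))))"

definition truth_Le :: "nat \<Rightarrow> fm" where
  "truth_Le n =
    All (All (All (All
      (is_term Zero (Var 3) \<^bold>\<and> is_term Zero (Var 2) \<^bold>\<and>
       has_value (Var 3) (Var 1) \<^bold>\<and> has_value (Var 2) (Var 0) \<^bold>\<longrightarrow>
       (Tr n (code_Le (Var 3) (Var 2)) \<^bold>\<longleftrightarrow> Var 1 \<^bold>\<le> Var 0)))))"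

definition truth_Tr :: "nat \<Rightarrow> nat \<Rightarrow> fm" where
  "truth_Tr n i =
    All (All (is_numeral (Var 1) (Var 0) \<^bold>\<longrightarrow>
      (Tr n (code_Tr (numeral_tm i) (Var 0)) \<^bold>\<longleftrightarrow> Tr i (Var 1))))"

definition truth_Neg :: "nat \<Rightarrow> fm" where
  "truth_Neg n =
    All (is_formula n Zero (Var 0) \<^bold>\<longrightarrow>
      (Tr n (code_Neg (Var 0)) \<^bold>\<longleftrightarrow> \<^bold>\<not> Tr n (Var 0)))"

definition truth_Imp :: "nat \<Rightarrow> fm" where
  "truth_Imp n =
    All (All (is_formula n Zero (Var 1) \<^bold>\<and> is_formula n Zero (Var 0) \<^bold>\<longrightarrow>
      (Tr n (code_Imp (Var 1) (Var 0)) \<^bold>\<longleftrightarrow> (Tr n (Var 1) \<^bold>\<longrightarrow> Tr n (Var 0)))))"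

definition truth_Ex :: "nat \<Rightarrow> fm" where
  "truth_Ex n =
    All (is_formula n Zero (code_Ex (Var 0)) \<^bold>\<longrightarrow>
      (Tr n (code_Ex (Var 0)) \<^bold>\<longleftrightarrow>
       Ex (Ex (Ex (is_numeral (Var 2) (Var 1) \<^bold>\<and>
                   is_subst_fm Zero (Var 1) (Var 3) (Var 0) \<^bold>\<and>
                   Tr n (Var 0))))))"

definition truth_axioms :: "nat \<Rightarrow> fm set" where
  "truth_axioms n =
    {truth_Eq n, truth_Le n, truth_Neg n, truth_Imp n, truth_Ex n} \<union> {truth_Tr n i |i. i < n}"

definition PA_Tr :: "fm set" where
  "PA_Tr = basic_axioms
     \<union> {induction_axiom p |p. p \<in> lang_Tr}
     \<union> (\<Union>n. truth_axioms n)"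

end

theory Submission
  imports Defs "HOL-Library.Countable_Set"
begin

text \<open>
  Each inclusion is proved by turning a countable model of one theory into a model of the other
  with the same numbers; the completeness theorem for the calculus supplies the models.

  In a model of \<open>RCA\<^sub>0 + RT(!\<omega>)\<close> arithmetical comprehension holds. Colour an exactly large set
  according to whether two blocks of its elements give the same values when they serve as bounds
  for the successive quantifiers of formulas about a set \<open>U\<close> coding \<open>Tr\<^sub>0, \<dots>, Tr\<^bsub>n-1\<^esub>\<close>. On an
  infinite homogeneous set these values are stable and form a truth set for the language
  \<open>L\<^sub>n\<close>. Iterating this along the standard numbers interprets all the truth predicates.

  In a model of \<open>PA({Tr\<^sub>i})\<close> take as sets all sets definable with parameters. A colouring of the
  exactly large sets definable in \<open>L\<^sub>n\<close> is handled with \<open>Tr\<^sub>n\<close>, which allows one to choose, by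
  recursion inside the model, a descending sequence of \<open>L\<^sub>n\<close>-definable infinite sets, each
  homogeneous for the colouring of the \<open>a\<close>-element sets that remains when the minimum \<open>a\<close> of the
  preceding set is fixed. Such sets exist because Ramsey's theorem has arithmetical
  solutions, uniformly in a nonstandard exponent. The minima with the same colour form the
  homogeneous set.
\<close>

section \<open>Simultaneous substitution\<close>

text \<open>Exact largeness matters because it ties the size of a set to its minimum: a minimum
  \<open>2 k\<close> leaves two blocks of \<open>k\<close> bounds, enough to evaluate every formula
  with code at most \<open>k\<close>, even if its quantifier depth is nonstandard. Ramsey's theorem
  for a fixed standard exponent would reach only bounded depth. Conversely the minima may be
  nonstandard, so Ramsey's theorem is needed for nonstandard exponents. It is proved by induction
  inside the model; the induction formula speaks about all sets definable in \<open>L_n\<close> and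
  is expressible only because \<open>Tr_n\<close> is available.

  Definability is treated semantically, by closure rules for predicates on environments
  (\<open>bd\<close>, \<open>sg\<close>, \<open>dl\<close>, \<open>df\<close>), and the
  constructions are carried out over a type class of discretely ordered semirings. A type cannot
  depend on a model, so a single countable structure has to be fixed as its instance. It is chosen
  as a counterexample to the transfer of models if there is one; proving the transfer for this
  structure, up to isomorphism, therefore proves it for all.\<close>

primrec psub_tm :: "(nat \<Rightarrow> tm) \<Rightarrow> tm \<Rightarrow> tm" where
  "psub_tm \<sigma> (Var i) = \<sigma> i"
| "psub_tm \<sigma> Zero = Zero"
| "psub_tm \<sigma> (Succ t) = Succ (psub_tm \<sigma> t)"
| "psub_tm \<sigma> (t \<^bold>+ u) = psub_tm \<sigma> t \<^bold>+ psub_tm \<sigma> u"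
| "psub_tm \<sigma> (t \<^bold>\<cdot> u) = psub_tm \<sigma> t \<^bold>\<cdot> psub_tm \<sigma> u"

definition up :: "(nat \<Rightarrow> tm) \<Rightarrow> nat \<Rightarrow> tm" where
  "up \<sigma> i = (case i of 0 \<Rightarrow> Var 0 | Suc j \<Rightarrow> lift 1 (\<sigma> j))"

definition up2 :: "(nat \<Rightarrow> nat) \<Rightarrow> nat \<Rightarrow> nat" where
  "up2 \<xi> i = (case i of 0 \<Rightarrow> 0 | Suc j \<Rightarrow> Suc (\<xi> j))"

text \<open>Shift and substitution, for numbers and for sets, are all instances of this operation,
  so composition and the effect on satisfaction are proved once instead of for every pair of
  them.\<close>

primrec psub :: "(nat \<Rightarrow> tm) \<Rightarrow> (nat \<Rightarrow> nat) \<Rightarrow> fm \<Rightarrow> fm" where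
  "psub \<sigma> \<xi> (t \<^bold>= u) = (psub_tm \<sigma> t \<^bold>= psub_tm \<sigma> u)"
| "psub \<sigma> \<xi> (t \<^bold>\<le> u) = (psub_tm \<sigma> t \<^bold>\<le> psub_tm \<sigma> u)"
| "psub \<sigma> \<xi> (In t X) = In (psub_tm \<sigma> t) (\<xi> X)"
| "psub \<sigma> \<xi> (Tr i t) = Tr i (psub_tm \<sigma> t)"
| "psub \<sigma> \<xi> (\<^bold>\<not> p) = (\<^bold>\<not> psub \<sigma> \<xi> p)"
| "psub \<sigma> \<xi> (p \<^bold>\<longrightarrow> q) = (psub \<sigma> \<xi> p \<^bold>\<longrightarrow> psub \<sigma> \<xi> q)"
| "psub \<sigma> \<xi> (Ex p) = Ex (psub (up \<sigma>) \<xi> p)"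
| "psub \<sigma> \<xi> (Ex2 p) = Ex2 (psub \<sigma> (up2 \<xi>) p)"

lemma shift_tm_psub: "shift_tm d c t = psub_tm (\<lambda>i. Var (if i < c then i else i + d)) t"
  by (induction t) auto

lemma subst_tm_psub:
  "subst_tm k u t = psub_tm (\<lambda>i. if i < k then Var i else if i = k then u else Var (i - 1)) t"
  by (induction t) auto

lemma shift_fm_psub: "shift_fm d c p = psub (\<lambda>i. Var (if i < c then i else i + d)) (\<lambda>X. X) p"
proof (induction p arbitrary: c)
  case (Ex p)
  have "up (\<lambda>i. Var (if i < c then i else i + d)) = (\<lambda>i. Var (if i < Suc c then i else i + d))"
    by (auto simp: up_def split: nat.split)
  then show ?case using Ex by simp
next
  case (Ex2 p)
  have "up2 (\<lambda>X. X) = (\<lambda>X. X)" by (auto simp: up2_def split: nat.split)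
  then show ?case using Ex2 by simp
qed (auto simp: shift_tm_psub)

lemma up_Var: "up Var = Var" "up (\<lambda>x. Var x) = Var"
  by (auto simp: up_def split: nat.split)

lemma up2_id: "up2 (\<lambda>X. X) = (\<lambda>X. X)"
  by (auto simp: up2_def split: nat.split)

lemma psub_tm_Var: "psub_tm Var t = t"
  by (induction t) auto

lemma shift2_fm_psub: "shift2_fm d c p = psub Var (\<lambda>X. if X < c then X else X + d) p"
proof (induction p arbitrary: c)
  case (Ex2 p)
  have "up2 (\<lambda>X. if X < c then X else X + d) = (\<lambda>X. if X < Suc c then X else X + d)"
    by (auto simp: up2_def split: nat.split)
  then show ?case using Ex2 by simp
qed (auto simp: psub_tm_Var up_Var)

lemma subst_fm_psub:
  "subst_fm k u p = psub (\<lambda>i. if i < k then Var i else if i = k then u else Var (i - 1)) (\<lambda>X. X) p"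
proof (induction p arbitrary: k u)
  case (Ex p)
  have "up (\<lambda>i. if i < k then Var i else if i = k then u else Var (i - 1))
      = (\<lambda>i. if i < Suc k then Var i else if i = Suc k then lift 1 u else Var (i - 1))"
    by (auto simp: up_def fun_eq_iff split: nat.split)
  then show ?case using Ex by (simp del: One_nat_def)
qed (auto simp: subst_tm_psub up2_id)

lemma subst2_fm_psub:
  "subst2_fm k Y p = psub Var (\<lambda>X. if X < k then X else if X = k then Y else X - 1) p"
proof (induction p arbitrary: k Y)
  case (Ex2 p)
  have "up2 (\<lambda>X. if X < k then X else if X = k then Y else X - 1)
      = (\<lambda>X. if X < Suc k then X else if X = Suc k then Suc Y else X - 1)"
    by (auto simp: up2_def fun_eq_iff split: nat.split)
  then show ?case using Ex2 by simp
qed (auto simp: psub_tm_Var up_Var)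

lemma psub_tm_comp: "psub_tm \<tau> (psub_tm \<sigma> t) = psub_tm (\<lambda>i. psub_tm \<tau> (\<sigma> i)) t"
  by (induction t) auto

lemma up_comp: "psub_tm (up \<tau>) (up \<sigma> i) = up (\<lambda>i. psub_tm \<tau> (\<sigma> i)) i"
  by (cases i) (auto simp: up_def shift_tm_psub psub_tm_comp)

lemma up2_comp: "up2 \<eta> (up2 \<xi> i) = up2 (\<lambda>i. \<eta> (\<xi> i)) i"
  by (cases i) (auto simp: up2_def)

lemma psub_comp: "psub \<tau> \<eta> (psub \<sigma> \<xi> p) = psub (\<lambda>i. psub_tm \<tau> (\<sigma> i)) (\<lambda>i. \<eta> (\<xi> i)) p"
  by (induction p arbitrary: \<tau> \<eta> \<sigma> \<xi>) (auto simp: psub_tm_comp up_comp up2_comp)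

lemma psub_Var: "psub Var (\<lambda>X. X) p = p"
  by (induction p) (auto simp: psub_tm_Var up_Var up2_id)

lemma psub_tm_cong: "closed_tm m t \<Longrightarrow> (\<And>i. i < m \<Longrightarrow> \<sigma> i = \<tau> i) \<Longrightarrow> psub_tm \<sigma> t = psub_tm \<tau> t"
  by (induction t) auto

lemma psub_cong:
  "closed_fm m n p \<Longrightarrow> (\<And>i. i < m \<Longrightarrow> \<sigma> i = \<tau> i) \<Longrightarrow> (\<And>i. i < n \<Longrightarrow> \<xi> i = \<eta> i)
    \<Longrightarrow> psub \<sigma> \<xi> p = psub \<tau> \<eta> p"
proof (induction p arbitrary: m n \<sigma> \<tau> \<xi> \<eta>)
  case (Ex p)
  have "psub (up \<sigma>) \<xi> p = psub (up \<tau>) \<eta> p"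
  proof (rule Ex.IH)
    show "closed_fm (Suc m) n p" using Ex.prems(1) by simp
    show "up \<sigma> i = up \<tau> i" if "i < Suc m" for i
      using that Ex.prems(2) by (cases i) (auto simp: up_def)
  qed (use Ex.prems(3) in auto)
  then show ?case by simp
next
  case (Ex2 p)
  have "psub \<sigma> (up2 \<xi>) p = psub \<tau> (up2 \<eta>) p"
  proof (rule Ex2.IH)
    show "closed_fm m (Suc n) p" using Ex2.prems(1) by simp
    show "up2 \<xi> i = up2 \<eta> i" if "i < Suc n" for i
      using that Ex2.prems(3) by (cases i) (auto simp: up2_def)
  qed (use Ex2.prems(2) in auto)
  then show ?case by simp
next
  case (Imp p q)
  have "psub \<sigma> \<xi> p = psub \<tau> \<eta> p" "psub \<sigma> \<xi> q = psub \<tau> \<eta> q"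
    by (rule Imp.IH[of m n]; use Imp.prems in auto)+
  then show ?case by simp
next
  case (Neg p)
  have "psub \<sigma> \<xi> p = psub \<tau> \<eta> p"
    by (rule Neg.IH[of m n]; use Neg.prems in auto)
  then show ?case by simp
qed (auto intro: psub_tm_cong)

lemma closed_tm_mono: "closed_tm m t \<Longrightarrow> m \<le> m' \<Longrightarrow> closed_tm m' t"
  by (induction t) auto

lemma closed_fm_mono: "closed_fm m n p \<Longrightarrow> m \<le> m' \<Longrightarrow> n \<le> n' \<Longrightarrow> closed_fm m' n' p"
  by (induction p arbitrary: m n m' n') (auto intro: closed_tm_mono)

lemma closed_tm_ex: "\<exists>m. closed_tm m t"
proof (induction t)
  case (Plus t u) then show ?case using closed_tm_mono by (metis closed_tm.simps(4) linear)
next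
  case (Times t u) then show ?case using closed_tm_mono by (metis closed_tm.simps(5) linear)
qed auto

lemma closed_fm_ex: "\<exists>m. closed_fm m m p"
proof (induction p)
  case (Eq t u) obtain a b where "closed_tm a t" "closed_tm b u" using closed_tm_ex by metis
  then have "closed_fm (max a b) (max a b) (t \<^bold>= u)" by (auto intro: closed_tm_mono)
  then show ?case ..
next
  case (Le t u) obtain a b where "closed_tm a t" "closed_tm b u" using closed_tm_ex by metis
  then have "closed_fm (max a b) (max a b) (t \<^bold>\<le> u)" by (auto intro: closed_tm_mono)
  then show ?case ..
next
  case (In t X) obtain a where "closed_tm a t" using closed_tm_ex by metis
  then have "closed_fm (max a (Suc X)) (max a (Suc X)) (In t X)" by (auto intro: closed_tm_mono)
  then show ?case ..
next
  case (Tr t X) show ?case using closed_tm_ex by auto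
next
  case (Imp p q) then obtain a b where "closed_fm a a p" "closed_fm b b q" by auto
  then have "closed_fm (max a b) (max a b) (p \<^bold>\<longrightarrow> q)" by (auto intro: closed_fm_mono)
  then show ?case ..
next
  case (Ex p) then show ?case by (metis closed_fm.simps(7) closed_fm_mono le_Suc_eq order_refl)
next
  case (Ex2 p) then show ?case by (metis closed_fm.simps(8) closed_fm_mono le_Suc_eq order_refl)
qed auto

section \<open>Semantics\<close>

definition cns :: "'a \<Rightarrow> (nat \<Rightarrow> 'a) \<Rightarrow> nat \<Rightarrow> 'a"  (infixr "##" 65)
  where "(x ## e) = case_nat x e"

lemma cns_simps [simp]:
  "(x ## e) 0 = x" "(x ## e) (Suc i) = e i" "(x ## e) 1 = e 0"
  "(x ## e) (numeral k) = e (pred_numeral k)" "(x ## e) (i + 1) = e i"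
  by (auto simp: cns_def numeral_eq_Suc)

lemma cns_shift [simp]: "(\<lambda>i. (x ## e) (i + numeral k)) = (\<lambda>i. e (i + pred_numeral k))"
  "(\<lambda>i. (x ## e) (Suc i)) = e" "(\<lambda>i. (x ## e) (i + 1)) = e" "(\<lambda>i. (x ## e) (Suc (i + n))) = (\<lambda>i. e (i + n))"
  by (auto simp: numeral_eq_Suc)

lemma cns_eqI: "(\<And>i. f (Suc i) = e i) \<Longrightarrow> f 0 = x \<Longrightarrow> f = x ## e"
  by (auto simp: fun_eq_iff cns_def split: nat.split)

text \<open>One kind of structure serves both languages: set quantifiers range over
  \<open>sts\<close> as in Henkin semantics, and \<open>trs\<close> interprets the truth predicates.
  Exchanging one of these components leaves the number part unchanged, which is what the model
  constructions exploit.\<close>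

record 'a mdl =
  zr :: 'a
  sc :: "'a \<Rightarrow> 'a"
  pl :: "'a \<Rightarrow> 'a \<Rightarrow> 'a"
  ti :: "'a \<Rightarrow> 'a \<Rightarrow> 'a"
  le :: "'a \<Rightarrow> 'a \<Rightarrow> bool"
  sts :: "'a set set"
  trs :: "nat \<Rightarrow> 'a set"

primrec ev :: "('a, 'b) mdl_scheme \<Rightarrow> (nat \<Rightarrow> 'a) \<Rightarrow> tm \<Rightarrow> 'a" where
  "ev M e (Var i) = e i"
| "ev M e Zero = zr M"
| "ev M e (Succ t) = sc M (ev M e t)"
| "ev M e (t \<^bold>+ u) = pl M (ev M e t) (ev M e u)"
| "ev M e (t \<^bold>\<cdot> u) = ti M (ev M e t) (ev M e u)"

primrec sat :: "('a, 'b) mdl_scheme \<Rightarrow> (nat \<Rightarrow> 'a) \<Rightarrow> (nat \<Rightarrow> 'a set) \<Rightarrow> fm \<Rightarrow> bool" where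
  "sat M e X (t \<^bold>= u) = (ev M e t = ev M e u)"
| "sat M e X (t \<^bold>\<le> u) = le M (ev M e t) (ev M e u)"
| "sat M e X (In t Y) = (ev M e t \<in> X Y)"
| "sat M e X (Tr i t) = (ev M e t \<in> trs M i)"
| "sat M e X (\<^bold>\<not> p) = (\<not> sat M e X p)"
| "sat M e X (p \<^bold>\<longrightarrow> q) = (sat M e X p \<longrightarrow> sat M e X q)"
| "sat M e X (Ex p) = (\<exists>x. sat M (x ## e) X p)"
| "sat M e X (Ex2 p) = (\<exists>A\<in>sts M. sat M e (A ## X) p)"

lemma ev_psub: "ev M e (psub_tm \<sigma> t) = ev M (\<lambda>i. ev M e (\<sigma> i)) t"
  by (induction t) auto

lemma ev_shift: "ev M e (shift_tm d c t) = ev M (\<lambda>i. e (if i < c then i else i + d)) t"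
  by (simp add: shift_tm_psub ev_psub)

lemma ev_lift [simp]: "ev M e (lift d t) = ev M (\<lambda>i. e (i + d)) t"
  by (simp add: ev_shift)

lemma sat_psub: "sat M e X (psub \<sigma> \<xi> p) = sat M (\<lambda>i. ev M e (\<sigma> i)) (\<lambda>i. X (\<xi> i)) p"
proof (induction p arbitrary: e X \<sigma> \<xi>)
  case (Ex p)
  have "(\<lambda>i. ev M (x ## e) (up \<sigma> i)) = x ## (\<lambda>i. ev M e (\<sigma> i))" for x
    by (rule cns_eqI) (auto simp: up_def)
  then show ?case using Ex by simp
next
  case (Ex2 p)
  have "(\<lambda>i. (A ## X) (up2 \<xi> i)) = A ## (\<lambda>i. X (\<xi> i))" for A
    by (rule cns_eqI) (auto simp: up2_def)
  then show ?case using Ex2 by simp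
qed (auto simp: ev_psub)

lemma sat_subst: "sat M e X (subst_fm 0 u p) = sat M (ev M e u ## e) X p"
proof -
  have "(\<lambda>i. ev M e (if i < 0 then Var i else if i = 0 then u else Var (i - 1))) = ev M e u ## e"
    by (rule cns_eqI) auto
  then show ?thesis by (simp add: subst_fm_psub sat_psub)
qed

lemma sat_subst2: "sat M e X (subst2_fm 0 Y p) = sat M e (X Y ## X) p"
proof -
  have "(\<lambda>i. X (if i < 0 then i else if i = 0 then Y else i - 1)) = X Y ## X"
    by (rule cns_eqI) auto
  then show ?thesis by (simp add: subst2_fm_psub sat_psub)
qed

lemma sat_shift: "sat M e X (shift_fm d c p) = sat M (\<lambda>i. e (if i < c then i else i + d)) X p"
  by (simp add: shift_fm_psub sat_psub)

lemma sat_shift2: "sat M e X (shift2_fm d c p) = sat M e (\<lambda>i. X (if i < c then i else i + d)) p"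
  by (simp add: shift2_fm_psub sat_psub)

definition valid :: "('a, 'b) mdl_scheme \<Rightarrow> fm \<Rightarrow> bool" where
  "valid M p \<longleftrightarrow> (\<forall>e X. range X \<subseteq> sts M \<longrightarrow> sat M e X p)"

lemma range_cns: "range X \<subseteq> S \<Longrightarrow> A \<in> S \<Longrightarrow> range (A ## X) \<subseteq> S"
  by (force simp: cns_def split: nat.split)

text \<open>In the two quantifier rules the premise is used at an environment extended by the
  witness, and the shift of \<open>q\<close> makes its value independent of that witness.\<close>

theorem soundness:
  assumes "proves L T p" and T: "\<And>q. q \<in> T \<Longrightarrow> q \<in> L \<Longrightarrow> valid M q"
  shows "valid M p"
  using assms(1)
proof induction
  case (logical p)
  show ?case
    using logical(1) by cases (auto simp: valid_def sat_subst sat_subst2)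
next
  case (ex p q)
  show ?case unfolding valid_def sat.simps
  proof (intro allI impI, elim exE)
    fix e X x
    assume *: "range X \<subseteq> sts M" "sat M (x ## e) X p"
    then have "sat M (x ## e) X (shift_fm 1 0 q)" using ex(3) unfolding valid_def by simp
    then show "sat M e X q" by (simp add: sat_shift)
  qed
next
  case (ex2 p q)
  show ?case unfolding valid_def sat.simps
  proof (intro allI impI, elim bexE)
    fix e X A
    assume *: "range X \<subseteq> sts M" "A \<in> sts M" "sat M e (A ## X) p"
    then have "range (A ## X) \<subseteq> sts M" by (intro range_cns)
    then have "sat M e (A ## X) (shift2_fm 1 0 q)" using ex2(3) *(3) unfolding valid_def by simp
    then show "sat M e X q" by (simp add: sat_shift2)
  qed
next
  case (axiom p) then show ?case by (rule T)
qed (auto simp: valid_def)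

section \<open>Completeness\<close>

text \<open>A contradiction that lies in every language considered, since equations always
  do.\<close>

abbreviation Fls :: fm where "Fls \<equiv> \<^bold>\<not> (Zero \<^bold>= Zero)"

text \<open>Derivations may not leave the language, so each closure property used in the
  completeness proof has to be listed. For \<open>Ex2\<close> only passage to the subformula is
  required, as \<open>lang_Tr\<close> has no such formulas.\<close>

locale lang =
  fixes L :: "fm set"
  assumes L_imp [simp]: "(p \<^bold>\<longrightarrow> q) \<in> L \<longleftrightarrow> p \<in> L \<and> q \<in> L"
    and L_neg [simp]: "(\<^bold>\<not> p) \<in> L \<longleftrightarrow> p \<in> L"
    and L_ex [simp]: "Ex p \<in> L \<longleftrightarrow> p \<in> L"
    and L_ex2: "Ex2 p \<in> L \<Longrightarrow> p \<in> L"
    and L_psub [simp]: "p \<in> L \<Longrightarrow> psub \<sigma> \<xi> p \<in> L"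
    and L_eq [simp]: "(t \<^bold>= u) \<in> L"
    and L_le [simp]: "(t \<^bold>\<le> u) \<in> L"
    and L_In: "In t X \<in> L \<Longrightarrow> In u Y \<in> L"
    and L_Tr: "Tr i t \<in> L \<Longrightarrow> Tr i u \<in> L"
begin

lemma L_subst [simp]: "p \<in> L \<Longrightarrow> subst_fm k u p \<in> L"
  by (simp add: subst_fm_psub)

lemma L_subst2 [simp]: "p \<in> L \<Longrightarrow> subst2_fm k Y p \<in> L"
  by (simp add: subst2_fm_psub)

lemma L_shift [simp]: "p \<in> L \<Longrightarrow> shift_fm k u p \<in> L"
  by (simp add: shift_fm_psub)

lemma L_shift2 [simp]: "p \<in> L \<Longrightarrow> shift2_fm k u p \<in> L"
  by (simp add: shift2_fm_psub)

lemma proves_L: "proves L T p \<Longrightarrow> p \<in> L"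
  by (induction rule: proves.induct) auto

text \<open>Hypotheses may be used only in modus ponens, while the quantifier rules remain confined
  to \<open>proves\<close>. This keeps the deduction theorem free of conditions on
  variables.\<close>

inductive hyp :: "fm set \<Rightarrow> fm set \<Rightarrow> fm \<Rightarrow> bool" for T \<Gamma> where
  prv: "proves L T p \<Longrightarrow> hyp T \<Gamma> p"
| asm: "p \<in> \<Gamma> \<Longrightarrow> p \<in> L \<Longrightarrow> hyp T \<Gamma> p"
| mp: "hyp T \<Gamma> (p \<^bold>\<longrightarrow> q) \<Longrightarrow> hyp T \<Gamma> p \<Longrightarrow> hyp T \<Gamma> q"

lemma hyp_L: "hyp T \<Gamma> p \<Longrightarrow> p \<in> L"
  by (induction rule: hyp.induct) (auto dest: proves_L)

lemma hyp_mono: "hyp T \<Gamma> p \<Longrightarrow> \<Gamma> \<subseteq> \<Delta> \<Longrightarrow> hyp T \<Delta> p"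
  by (induction rule: hyp.induct) (auto intro: hyp.intros)

lemma hyp_cut: "hyp T \<Gamma> p \<Longrightarrow> (\<And>q. q \<in> \<Gamma> \<Longrightarrow> q \<in> L \<Longrightarrow> hyp T \<Delta> q) \<Longrightarrow> hyp T \<Delta> p"
  by (induction rule: hyp.induct) (auto intro: hyp.intros)

lemma hyp_empty: "hyp T {} p \<Longrightarrow> proves L T p"
  by (induction rule: hyp.induct) (auto intro: proves.intros)

lemma hyp_ax: "p \<in> logical_axioms \<Longrightarrow> p \<in> L \<Longrightarrow> hyp T \<Gamma> p"
  by (intro prv proves.logical)

lemma hyp_K: "hyp T \<Gamma> p \<Longrightarrow> q \<in> L \<Longrightarrow> hyp T \<Gamma> (q \<^bold>\<longrightarrow> p)"
  by (rule mp[OF hyp_ax]) (auto intro: logical_axioms.intros dest: hyp_L)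

lemma hyp_refl: assumes "p \<in> L" shows "hyp T \<Gamma> (p \<^bold>\<longrightarrow> p)"
proof -
  have "hyp T \<Gamma> ((p \<^bold>\<longrightarrow> (p \<^bold>\<longrightarrow> p) \<^bold>\<longrightarrow> p) \<^bold>\<longrightarrow> (p \<^bold>\<longrightarrow> p \<^bold>\<longrightarrow> p) \<^bold>\<longrightarrow> p \<^bold>\<longrightarrow> p)"
    "hyp T \<Gamma> (p \<^bold>\<longrightarrow> (p \<^bold>\<longrightarrow> p) \<^bold>\<longrightarrow> p)" "hyp T \<Gamma> (p \<^bold>\<longrightarrow> p \<^bold>\<longrightarrow> p)"
    using assms by (auto intro!: hyp_ax logical_axioms.intros)
  then show ?thesis by (blast intro: mp)
qed

lemma ded: assumes "hyp T (insert q \<Gamma>) p" "q \<in> L" shows "hyp T \<Gamma> (q \<^bold>\<longrightarrow> p)"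
  using assms(1)
proof induction
  case (prv p) then show ?case by (intro hyp_K hyp.prv assms)
next
  case (asm p) then show ?case by (cases "p = q") (auto intro: hyp_refl hyp_K hyp.asm assms)
next
  case (mp p r)
  have "hyp T \<Gamma> ((q \<^bold>\<longrightarrow> p \<^bold>\<longrightarrow> r) \<^bold>\<longrightarrow> (q \<^bold>\<longrightarrow> p) \<^bold>\<longrightarrow> q \<^bold>\<longrightarrow> r)"
    using mp(3,4) hyp_L by (intro hyp_ax logical_axioms.intros) fastforce
  then show ?case using mp(3,4) hyp.mp by blast
qed

lemma exfalso: assumes "hyp T \<Gamma> p" "hyp T \<Gamma> (\<^bold>\<not> p)" "q \<in> L" shows "hyp T \<Gamma> q"
proof -
  have "hyp T \<Gamma> (\<^bold>\<not> q \<^bold>\<longrightarrow> \<^bold>\<not> p)" using assms by (intro hyp_K) auto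
  moreover have "hyp T \<Gamma> ((\<^bold>\<not> q \<^bold>\<longrightarrow> \<^bold>\<not> p) \<^bold>\<longrightarrow> p \<^bold>\<longrightarrow> q)"
    using assms by (intro hyp_ax logical_axioms.intros) (auto dest: hyp_L)
  ultimately show ?thesis using assms(1) mp by blast
qed

lemma hyp_triv: "hyp T \<Gamma> (Zero \<^bold>= Zero)"
  by (intro hyp_ax logical_axioms.intros) auto

lemma by_contra: assumes "hyp T (insert (\<^bold>\<not> p) \<Gamma>) Fls" "p \<in> L" shows "hyp T \<Gamma> p"
proof -
  have "hyp T \<Gamma> (\<^bold>\<not> p \<^bold>\<longrightarrow> Fls)" using assms by (intro ded) auto
  moreover have "hyp T \<Gamma> ((\<^bold>\<not> p \<^bold>\<longrightarrow> Fls) \<^bold>\<longrightarrow> (Zero \<^bold>= Zero) \<^bold>\<longrightarrow> p)"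
    using assms by (intro hyp_ax logical_axioms.intros) auto
  ultimately show ?thesis using mp hyp_triv by blast
qed

lemma neg_neg: assumes "hyp T \<Gamma> (\<^bold>\<not> \<^bold>\<not> p)" shows "hyp T \<Gamma> p"
proof (rule by_contra)
  have "p \<in> L" using assms hyp_L by fastforce
  then show "p \<in> L" .
  show "hyp T (insert (\<^bold>\<not> p) \<Gamma>) Fls"
    by (rule exfalso[of T _ "\<^bold>\<not> p"])
      (use \<open>p \<in> L\<close> in \<open>auto intro: hyp.asm hyp_mono[OF assms]\<close>)
qed

lemma neg_intro: assumes "hyp T (insert p \<Gamma>) Fls" "p \<in> L" shows "hyp T \<Gamma> (\<^bold>\<not> p)"
proof (rule by_contra)
  show "hyp T (insert (\<^bold>\<not> \<^bold>\<not> p) \<Gamma>) Fls"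
  proof (rule hyp_cut[OF assms(1)])
    fix q assume "q \<in> insert p \<Gamma>" "q \<in> L"
    moreover have "hyp T (insert (\<^bold>\<not> \<^bold>\<not> p) \<Gamma>) p"
      by (rule neg_neg, rule hyp.asm) (use assms(2) in auto)
    ultimately show "hyp T (insert (\<^bold>\<not> \<^bold>\<not> p) \<Gamma>) q" by (auto intro: hyp.asm)
  qed
qed (use assms in simp)

lemma imp_intro: assumes "hyp T \<Gamma> (\<^bold>\<not> p) \<or> hyp T \<Gamma> q" "p \<in> L" "q \<in> L" shows "hyp T \<Gamma> (p \<^bold>\<longrightarrow> q)"
proof (rule ded)
  show "hyp T (insert p \<Gamma>) q" using assms
    by (metis exfalso hyp.asm hyp_mono insertI1 subset_insertI)
qed fact

text \<open>Instantiation is not a primitive rule: a provable \<open>p\<close> makes its negation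
  imply \<open>Fls\<close>, the rule \<open>ex\<close> puts \<open>Ex\<close> in front of that
  negation, and the axiom for \<open>Ex\<close> then refutes every instance of the negation.\<close>

lemma proves_gen: assumes "proves L T p" shows "proves L T (subst_fm 0 t p)"
proof -
  have p: "p \<in> L" using assms proves_L by blast
  have "hyp T {} (\<^bold>\<not> p \<^bold>\<longrightarrow> shift_fm 1 0 Fls)"
  proof (rule ded)
    show "hyp T {\<^bold>\<not> p} (shift_fm 1 0 Fls)"
      by (rule exfalso[of _ _ p]) (use assms p in \<open>auto intro: hyp.asm hyp.prv\<close>)
  qed (use p in auto)
  then have "proves L T (Ex (\<^bold>\<not> p) \<^bold>\<longrightarrow> Fls)"
    using p by (intro proves.ex hyp_empty) auto
  then have 1: "hyp T {} (Ex (\<^bold>\<not> p) \<^bold>\<longrightarrow> Fls)" by (rule hyp.prv)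
  have 2: "hyp T {} (subst_fm 0 t (\<^bold>\<not> p) \<^bold>\<longrightarrow> Ex (\<^bold>\<not> p))"
    using p by (intro hyp_ax logical_axioms.intros) auto
  have 3: "hyp T {\<^bold>\<not> subst_fm 0 t p} (subst_fm 0 t (\<^bold>\<not> p))"
    using p by (auto intro: hyp.asm)
  have "hyp T {\<^bold>\<not> subst_fm 0 t p} Fls"
    by (rule hyp.mp[OF hyp_mono[OF 1 empty_subsetI] hyp.mp[OF hyp_mono[OF 2 empty_subsetI] 3]])
  then have "hyp T {} (subst_fm 0 t p)" by (rule by_contra) (use p in auto)
  then show ?thesis by (rule hyp_empty)
qed

text \<open>The extra hypothesis is there because the detour goes through an \<open>Ex2\<close>
  formula, which has to belong to the language.\<close>

lemma proves_gen2: assumes "proves L T p" "Ex2 (\<^bold>\<not> p) \<in> L" shows "proves L T (subst2_fm 0 Y p)"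
proof -
  have p: "p \<in> L" using assms proves_L by blast
  have "hyp T {} (\<^bold>\<not> p \<^bold>\<longrightarrow> shift2_fm 1 0 Fls)"
  proof (rule ded)
    show "hyp T {\<^bold>\<not> p} (shift2_fm 1 0 Fls)"
      by (rule exfalso[of _ _ p]) (use assms p in \<open>auto intro: hyp.asm hyp.prv\<close>)
  qed (use p in auto)
  then have "proves L T (Ex2 (\<^bold>\<not> p) \<^bold>\<longrightarrow> Fls)"
    using p assms(2) by (intro proves.ex2 hyp_empty) auto
  then have 1: "hyp T {} (Ex2 (\<^bold>\<not> p) \<^bold>\<longrightarrow> Fls)" by (rule hyp.prv)
  have 2: "hyp T {} (subst2_fm 0 Y (\<^bold>\<not> p) \<^bold>\<longrightarrow> Ex2 (\<^bold>\<not> p))"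
    using p assms(2) by (intro hyp_ax logical_axioms.intros) auto
  have 3: "hyp T {\<^bold>\<not> subst2_fm 0 Y p} (subst2_fm 0 Y (\<^bold>\<not> p))"
    using p by (auto intro: hyp.asm)
  have "hyp T {\<^bold>\<not> subst2_fm 0 Y p} Fls"
    by (rule hyp.mp[OF hyp_mono[OF 1 empty_subsetI] hyp.mp[OF hyp_mono[OF 2 empty_subsetI] 3]])
  then have "hyp T {} (subst2_fm 0 Y p)" by (rule by_contra) (use p in auto)
  then show ?thesis by (rule hyp_empty)
qed

text \<open>A simultaneous substitution is reached by instantiating variable 0 repeatedly, once for
  each variable below a bound \<open>N\<close>.\<close>

lemma proves_psub1:
  assumes "proves L T p" shows "proves L T (psub \<sigma> (\<lambda>X. X) p)"
proof -
  obtain N where N: "closed_fm N N p" using closed_fm_ex by blast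
  \<comment> \<open>After \<open>j\<close> rounds the terms already inserted are shifted by
    \<open>N - j\<close>, the number of instantiations still to come; each round removes one level
    of this shift.\<close>
  have "proves L T (psub (\<lambda>i. if i < j then lift (N - j) (\<sigma> i) else Var (i - j)) (\<lambda>X. X) p)"
    if "j \<le> N" for j
    using that
  proof (induction j)
    case 0
    then show ?case using assms psub_Var by simp
  next
    case (Suc j)
    have "psub_tm (\<lambda>i. if i < 0 then Var i else if i = 0 then lift (N - Suc j) (\<sigma> j) else Var (i - 1))
          (if i < j then lift (N - j) (\<sigma> i) else Var (i - j))
      = (if i < Suc j then lift (N - Suc j) (\<sigma> i) else Var (i - Suc j))" for i
    proof (cases "i < j")
      case True
      have "N - j = Suc (N - Suc j)" using Suc.prems by simp
      with True show ?thesis by (simp add: shift_tm_psub psub_tm_comp)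
    qed (auto simp: less_Suc_eq)
    then have "subst_fm 0 (lift (N - Suc j) (\<sigma> j))
          (psub (\<lambda>i. if i < j then lift (N - j) (\<sigma> i) else Var (i - j)) (\<lambda>X. X) p)
      = psub (\<lambda>i. if i < Suc j then lift (N - Suc j) (\<sigma> i) else Var (i - Suc j)) (\<lambda>X. X) p"
      by (simp add: subst_fm_psub psub_comp del: One_nat_def)
    then show ?case using proves_gen[OF Suc.IH, of "lift (N - Suc j) (\<sigma> j)"] Suc.prems by simp
  qed
  from this[OF order_refl]
  have "proves L T (psub (\<lambda>i. if i < N then lift (N - N) (\<sigma> i) else Var (i - N)) (\<lambda>X. X) p)" .
  also have "psub (\<lambda>i. if i < N then lift (N - N) (\<sigma> i) else Var (i - N)) (\<lambda>X. X) p = psub \<sigma> (\<lambda>X. X) p"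
    by (rule psub_cong[OF N]) (auto simp: shift_tm_psub psub_tm_Var)
  finally show ?thesis .
qed

end

text \<open>The alternatives are the two languages of interest: in \<open>lang_Tr\<close> set
  variables do not occur, so renaming them is vacuous, and \<open>lang_2\<close> is closed under
  \<open>Ex2\<close>, so \<open>proves_gen2\<close> applies.\<close>

locale lang_ex2 = lang +
  assumes L_cases: "(\<forall>p \<in> L. closed_fm m n p \<longrightarrow> closed_fm m 0 p) \<or> (\<forall>p. Ex2 p \<in> L \<longleftrightarrow> p \<in> L)"
begin

lemma proves_psub:
  assumes "proves L T p" shows "proves L T (psub \<sigma> \<xi> p)"
proof -
  obtain N where N: "closed_fm N N p" using closed_fm_ex by blast
  have pL: "p \<in> L" using assms proves_L by blast
  have "proves L T (psub Var \<xi> p)"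
    using L_cases[of N N]
  proof
    assume "\<forall>p \<in> L. closed_fm N N p \<longrightarrow> closed_fm N 0 p"
    then have "closed_fm N 0 p" using N pL by blast
    then have "psub Var \<xi> p = psub Var (\<lambda>X. X) p" by (rule psub_cong) auto
    then show ?thesis using assms psub_Var by simp
  next
    assume E: "\<forall>p. Ex2 p \<in> L \<longleftrightarrow> p \<in> L"
    have "proves L T (psub Var (\<lambda>i. if i < j then \<xi> i + (N - j) else i - j) p)" if "j \<le> N" for j
      using that
    proof (induction j)
      case 0
      then show ?case using assms psub_Var by simp
    next
      case (Suc j)
      have "(\<lambda>i. (\<lambda>X. if X < 0 then X else if X = 0 then \<xi> j + (N - Suc j) else X - 1)
            (if i < j then \<xi> i + (N - j) else i - j))
        = (\<lambda>i. if i < Suc j then \<xi> i + (N - Suc j) else i - Suc j)"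
        using Suc.prems by (auto simp: fun_eq_iff less_Suc_eq)
      then have "subst2_fm 0 (\<xi> j + (N - Suc j)) (psub Var (\<lambda>i. if i < j then \<xi> i + (N - j) else i - j) p)
        = psub Var (\<lambda>i. if i < Suc j then \<xi> i + (N - Suc j) else i - Suc j) p"
        by (simp add: subst2_fm_psub psub_comp psub_tm_Var)
      moreover have "psub Var (\<lambda>i. if i < j then \<xi> i + (N - j) else i - j) p \<in> L" using pL by simp
      ultimately show ?case
        using proves_gen2[OF Suc.IH, of "\<xi> j + (N - Suc j)"] Suc.prems E by simp
    qed
    from this[OF order_refl]
    have "proves L T (psub Var (\<lambda>i. if i < N then \<xi> i + (N - N) else i - N) p)" .
    also have "psub Var (\<lambda>i. if i < N then \<xi> i + (N - N) else i - N) p = psub Var \<xi> p"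
      by (rule psub_cong[OF N]) auto
    finally show ?thesis .
  qed
  from proves_psub1[OF this, of \<sigma>] show ?thesis by (simp add: psub_comp)
qed

section \<open>Henkin witnesses by fresh variables\<close>

lemma ded_list: "hyp T (set ps \<union> \<Gamma>) p \<Longrightarrow> set ps \<subseteq> L \<Longrightarrow> hyp T \<Gamma> (foldr Imp ps p)"
proof (induction ps arbitrary: \<Gamma>)
  case (Cons q ps)
  have "hyp T (insert q \<Gamma>) (foldr Imp ps p)" using Cons by simp
  then show ?case using Cons.prems by (simp add: ded)
qed simp

lemma foldr_elim: "hyp T \<Gamma> (foldr Imp ps p) \<Longrightarrow> set ps \<subseteq> \<Gamma> \<Longrightarrow> set ps \<subseteq> L \<Longrightarrow> hyp T \<Gamma> p"
proof (induction ps)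
  case (Cons q ps)
  then have "hyp T \<Gamma> (q \<^bold>\<longrightarrow> foldr Imp ps p)" "hyp T \<Gamma> q" by (auto intro: hyp.asm)
  then show ?case using Cons hyp.mp by simp
qed simp

lemma closed_foldr: "closed_fm m n (foldr Imp ps p) \<longleftrightarrow> (\<forall>q\<in>set ps. closed_fm m n q) \<and> closed_fm m n p"
  by (induction ps) auto

lemma foldr_L: "foldr Imp ps p \<in> L \<longleftrightarrow> set ps \<subseteq> L \<and> p \<in> L"
  by (induction ps) auto

text \<open>Since \<Gamma> is finite, a variable beyond all of its free variables can serve as the
  witness, and no new constants are needed.\<close>

lemma ex_witness:
  assumes "finite \<Gamma>" "\<Gamma> \<subseteq> L" "Ex q \<in> \<Gamma>" "\<not> hyp T \<Gamma> Fls"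
  shows "\<exists>m. \<not> hyp T (insert (subst_fm 0 (Var m) q) \<Gamma>) Fls"
proof -
  obtain ps where ps: "set ps = \<Gamma>" using assms(1) finite_list by blast
  obtain m where "closed_fm m m (foldr Imp ps Fls)" using closed_fm_ex by blast
  then have m: "closed_fm m m (foldr Imp ps Fls)" "closed_fm m m (Ex q)"
    using assms(3) ps by (auto simp: closed_foldr)
  let ?R = "foldr Imp ps Fls" and ?q' = "subst_fm 0 (Var m) q"
  have qL: "q \<in> L" using assms by auto
  have False if "hyp T (insert ?q' \<Gamma>) Fls"
  proof -
    have "hyp T {?q'} ?R" using that ps assms by (intro ded_list) auto
    then have "hyp T {} (?q' \<^bold>\<longrightarrow> ?R)" using qL by (intro ded) auto
    then have "proves L T (?q' \<^bold>\<longrightarrow> ?R)" by (rule hyp_empty)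
    \<comment> \<open>The renaming sends the fresh variable to 0 and moves every other variable up
      by one. This turns the instance into \<open>q\<close> and the refutation \<open>?R\<close>
      into its shift, as the rule \<open>ex\<close> demands.\<close>
    from proves_psub[OF this, of "\<lambda>i. Var (if i = m then 0 else Suc i)" "\<lambda>X. X"]
    have "proves L T (psub (\<lambda>i. Var (if i = m then 0 else Suc i)) (\<lambda>X. X) ?q' \<^bold>\<longrightarrow>
      psub (\<lambda>i. Var (if i = m then 0 else Suc i)) (\<lambda>X. X) ?R)" by simp
    also have "psub (\<lambda>i. Var (if i = m then 0 else Suc i)) (\<lambda>X. X) ?R = shift_fm 1 0 ?R"
      unfolding shift_fm_psub by (rule psub_cong[OF m(1)]) auto
    also have "psub (\<lambda>i. Var (if i = m then 0 else Suc i)) (\<lambda>X. X) ?q' = psub Var (\<lambda>X. X) q"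
      unfolding subst_fm_psub psub_comp by (rule psub_cong[of "Suc m" m]) (use m(2) in auto)
    finally have "proves L T (q \<^bold>\<longrightarrow> shift_fm 1 0 ?R)" by (simp add: psub_Var)
    then have "proves L T (Ex q \<^bold>\<longrightarrow> ?R)"
      using qL ps assms by (intro proves.ex) (auto simp: foldr_L)
    then have "hyp T \<Gamma> ?R" using assms(2,3) hyp.prv hyp.asm hyp.mp by blast
    then have "hyp T \<Gamma> Fls" by (rule foldr_elim) (use ps assms in auto)
    then show False using assms by blast
  qed
  then show ?thesis by blast
qed

lemma ex2_witness:
  assumes "finite \<Gamma>" "\<Gamma> \<subseteq> L" "Ex2 q \<in> \<Gamma>" "\<not> hyp T \<Gamma> Fls"
  shows "\<exists>m. \<not> hyp T (insert (subst2_fm 0 m q) \<Gamma>) Fls"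
proof -
  obtain ps where ps: "set ps = \<Gamma>" using assms(1) finite_list by blast
  obtain m where "closed_fm m m (foldr Imp ps Fls)" using closed_fm_ex by blast
  then have m: "closed_fm m m (foldr Imp ps Fls)" "closed_fm m m (Ex2 q)"
    using assms(3) ps by (auto simp: closed_foldr)
  let ?R = "foldr Imp ps Fls" and ?q' = "subst2_fm 0 m q"
  have qL: "q \<in> L" "Ex2 q \<in> L" using assms L_ex2 by auto
  have False if "hyp T (insert ?q' \<Gamma>) Fls"
  proof -
    have "hyp T {?q'} ?R" using that ps assms by (intro ded_list) auto
    then have "hyp T {} (?q' \<^bold>\<longrightarrow> ?R)" using qL by (intro ded) auto
    then have "proves L T (?q' \<^bold>\<longrightarrow> ?R)" by (rule hyp_empty)
    from proves_psub[OF this, of Var "\<lambda>i. if i = m then 0 else Suc i"]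
    have "proves L T (psub Var (\<lambda>i. if i = m then 0 else Suc i) ?q' \<^bold>\<longrightarrow>
      psub Var (\<lambda>i. if i = m then 0 else Suc i) ?R)" by simp
    also have "psub Var (\<lambda>i. if i = m then 0 else Suc i) ?R = shift2_fm 1 0 ?R"
      unfolding shift2_fm_psub by (rule psub_cong[OF m(1)]) auto
    also have "psub Var (\<lambda>i. if i = m then 0 else Suc i) ?q' = psub Var (\<lambda>X. X) q"
      unfolding subst2_fm_psub psub_comp by (rule psub_cong[of m "Suc m"]) (use m(2) in auto)
    finally have "proves L T (q \<^bold>\<longrightarrow> shift2_fm 1 0 ?R)" by (simp add: psub_Var)
    then have "proves L T (Ex2 q \<^bold>\<longrightarrow> ?R)"
      using qL ps assms by (intro proves.ex2) (auto simp: foldr_L)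
    then have "hyp T \<Gamma> ?R" using assms(2,3) hyp.prv hyp.asm hyp.mp by blast
    then have "hyp T \<Gamma> Fls" by (rule foldr_elim) (use ps assms in auto)
    then show False using assms by blast
  qed
  then show ?thesis by blast
qed

text \<open>Stages are kept finite so that a fresh variable is always left. If \<open>p\<close> is
  rejected, its inconsistency with the stage is recorded, which later makes its negation
  derivable.\<close>

lemma henkin_step:
  assumes "finite \<Gamma>" "\<Gamma> \<subseteq> L" "\<not> hyp T \<Gamma> Fls"
  shows "\<exists>\<Delta>. finite \<Delta> \<and> \<Delta> \<subseteq> L \<and> \<not> hyp T \<Delta> Fls \<and> \<Gamma> \<subseteq> \<Delta> \<and>
    (p \<in> L \<longrightarrow> p \<notin> \<Delta> \<longrightarrow> hyp T (insert p \<Gamma>) Fls) \<and>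
    (\<forall>q. p = Ex q \<longrightarrow> p \<in> \<Delta> \<longrightarrow> (\<exists>m. subst_fm 0 (Var m) q \<in> \<Delta>)) \<and>
    (\<forall>q. p = Ex2 q \<longrightarrow> p \<in> \<Delta> \<longrightarrow> (\<exists>m. subst2_fm 0 m q \<in> \<Delta>))"
proof (cases "p \<in> L \<and> \<not> hyp T (insert p \<Gamma>) Fls")
  case False
  have "hyp T \<Gamma> Fls" if "p \<in> \<Gamma>" "p \<in> L"
    using that False by (simp add: insert_absorb)
  then show ?thesis using False assms by (intro exI[of _ \<Gamma>]) auto
next
  case True
  let ?\<Gamma> = "insert p \<Gamma>"
  have *: "finite ?\<Gamma>" "?\<Gamma> \<subseteq> L" "\<not> hyp T ?\<Gamma> Fls" using True assms by auto
  consider q where "p = Ex q" | q where "p = Ex2 q" | "\<forall>q. p \<noteq> Ex q \<and> p \<noteq> Ex2 q" by blast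
  then show ?thesis
  proof cases
    case 1
    then obtain m where "\<not> hyp T (insert (subst_fm 0 (Var m) q) ?\<Gamma>) Fls" using ex_witness[OF *(1,2) _ *(3)] by blast
    then show ?thesis using * 1 by (intro exI[of _ "insert (subst_fm 0 (Var m) q) ?\<Gamma>"]) auto
  next
    case 2
    then obtain m where "\<not> hyp T (insert (subst2_fm 0 m q) ?\<Gamma>) Fls" using ex2_witness[OF *(1,2) _ *(3)] by blast
    then show ?thesis using * 2 L_ex2 by (intro exI[of _ "insert (subst2_fm 0 m q) ?\<Gamma>"]) auto
  next
    case 3
    then show ?thesis using * by (intro exI[of _ ?\<Gamma>]) auto
  qed
qed

end

section \<open>Maximal consistent sets and the term model\<close>

instance tm :: countable by countable_datatype
instance fm :: countable by countable_datatype

text \<open>Number quantifiers are witnessed by arbitrary terms, but set quantifiers only by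
  variables, as there are no compound set terms.\<close>

definition henkin :: "fm set \<Rightarrow> fm set \<Rightarrow> bool" where
  "henkin L \<Delta> \<longleftrightarrow> \<Delta> \<subseteq> L \<and>
     (\<forall>p. p \<in> L \<longrightarrow> ((\<^bold>\<not> p) \<in> \<Delta> \<longleftrightarrow> p \<notin> \<Delta>)) \<and>
     (\<forall>p q. p \<in> L \<longrightarrow> q \<in> L \<longrightarrow> ((p \<^bold>\<longrightarrow> q) \<in> \<Delta> \<longleftrightarrow> (p \<in> \<Delta> \<longrightarrow> q \<in> \<Delta>))) \<and>
     (\<forall>q. Ex q \<in> L \<longrightarrow> (Ex q \<in> \<Delta> \<longleftrightarrow> (\<exists>t. subst_fm 0 t q \<in> \<Delta>))) \<and>
     (\<forall>q. Ex2 q \<in> L \<longrightarrow> (Ex2 q \<in> \<Delta> \<longleftrightarrow> (\<exists>m. subst2_fm 0 m q \<in> \<Delta>)))"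

context lang_ex2 begin

text \<open>Lindenbaum's construction along an enumeration of all formulas, starting from the
  negation of \<open>p\<close>.\<close>

lemma henkin_ex:
  assumes "\<not> proves L T p" "p \<in> L"
  shows "\<exists>\<Delta>. henkin L \<Delta> \<and> p \<notin> \<Delta> \<and> (\<forall>q. proves L T q \<longrightarrow> q \<in> \<Delta>)"
proof -
  define P where "P n \<Gamma> \<longleftrightarrow> finite \<Gamma> \<and> \<Gamma> \<subseteq> L \<and> \<not> hyp T \<Gamma> Fls \<and> (\<^bold>\<not> p) \<in> \<Gamma>" for n :: nat and \<Gamma>
  define Q where "Q n \<Gamma> \<Delta> \<longleftrightarrow> \<Gamma> \<subseteq> \<Delta> \<and>
    (from_nat n \<in> L \<longrightarrow> from_nat n \<notin> \<Delta> \<longrightarrow> hyp T (insert (from_nat n) \<Gamma>) Fls) \<and>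
    (\<forall>q. from_nat n = Ex q \<longrightarrow> from_nat n \<in> \<Delta> \<longrightarrow> (\<exists>m. subst_fm 0 (Var m) q \<in> \<Delta>)) \<and>
    (\<forall>q. from_nat n = Ex2 q \<longrightarrow> from_nat n \<in> \<Delta> \<longrightarrow> (\<exists>m. subst2_fm 0 m q \<in> \<Delta>))" for n \<Gamma> \<Delta>
  have "\<not> hyp T {\<^bold>\<not> p} Fls" using assms by (metis by_contra hyp_empty)
  then have P0: "P 0 {\<^bold>\<not> p}" using assms by (auto simp: P_def)
  have "\<exists>f. \<forall>n. P n (f n) \<and> Q n (f n) (f (Suc n))"
  proof (rule dependent_nat_choice)
    show "\<exists>x. P 0 x" using P0 by blast
    fix x n assume "P n x"
    then show "\<exists>y. P (Suc n) y \<and> Q n x y"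
      using henkin_step[of x T "from_nat n"] unfolding P_def Q_def by blast
  qed
  then obtain f where f: "\<And>n. P n (f n)" "\<And>n. Q n (f n) (f (Suc n))" by blast
  have mono1: "f n \<subseteq> f (Suc n)" for n using f(2)[of n] unfolding Q_def by blast
  have mono: "f m \<subseteq> f n" if "m \<le> n" for m n
    by (rule lift_Suc_mono_le[of f, OF mono1 that])
  define \<Delta> where "\<Delta> = (\<Union>n. f n)"
  have fL: "f n \<subseteq> L" and cons: "\<not> hyp T (f n) Fls" for n using f(1) by (auto simp: P_def)
  have comp: "hyp T \<Delta> q \<Longrightarrow> \<exists>n. hyp T (f n) q" for q
  proof (induction rule: hyp.induct)
    case (mp q r)
    then obtain m n where "hyp T (f m) (q \<^bold>\<longrightarrow> r)" "hyp T (f n) q" by blast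
    then have "hyp T (f (max m n)) (q \<^bold>\<longrightarrow> r)" "hyp T (f (max m n)) q"
      using mono[of m "max m n"] mono[of n "max m n"] by (auto intro: hyp_mono)
    then show ?case by (blast intro: hyp.mp)
  qed (auto simp: \<Delta>_def intro: hyp.prv hyp.asm)
  have cD: "\<not> hyp T \<Delta> Fls" using comp cons by blast
  have max: "q \<in> \<Delta> \<or> hyp T \<Delta> (\<^bold>\<not> q)" if "q \<in> L" for q
  \<comment> \<open>The formula \<open>q\<close> is treated at stage \<open>to_nat q\<close>; being
    absent afterwards means that it was found inconsistent there.\<close>
  proof (cases "q \<in> f (Suc (to_nat q))")
    case False
    then have "hyp T (insert q (f (to_nat q))) Fls" using f(2)[of "to_nat q"] that by (auto simp: Q_def)
    then have "hyp T (f (to_nat q)) (\<^bold>\<not> q)" by (rule neg_intro) (use that in auto)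
    then have "hyp T \<Delta> (\<^bold>\<not> q)" by (rule hyp_mono) (auto simp: \<Delta>_def)
    then show ?thesis by simp
  qed (auto simp: \<Delta>_def)
  have DL: "\<Delta> \<subseteq> L" using fL by (auto simp: \<Delta>_def)
  have prv: "hyp T \<Delta> q \<longleftrightarrow> q \<in> \<Delta>" if "q \<in> L" for q
    using max[OF that] cD exfalso[of T \<Delta> q Fls] that hyp.asm by auto
  have neg: "(\<^bold>\<not> q) \<in> \<Delta> \<longleftrightarrow> q \<notin> \<Delta>" if "q \<in> L" for q
    using that prv[of "\<^bold>\<not> q"] prv[of q] max[of q] cD exfalso[of T \<Delta> q Fls] by auto
  have imp: "(q \<^bold>\<longrightarrow> r) \<in> \<Delta> \<longleftrightarrow> (q \<in> \<Delta> \<longrightarrow> r \<in> \<Delta>)" if "q \<in> L" "r \<in> L" for q r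
  proof
    assume "(q \<^bold>\<longrightarrow> r) \<in> \<Delta>"
    then have "hyp T \<Delta> (q \<^bold>\<longrightarrow> r)" using prv[of "q \<^bold>\<longrightarrow> r"] that by simp
    then show "q \<in> \<Delta> \<longrightarrow> r \<in> \<Delta>" using prv[of q] prv[of r] that hyp.mp[of T \<Delta> q r] by simp
  next
    assume "q \<in> \<Delta> \<longrightarrow> r \<in> \<Delta>"
    then have "hyp T \<Delta> (\<^bold>\<not> q) \<or> hyp T \<Delta> r"
      using neg[of q] prv[of "\<^bold>\<not> q"] prv[of r] that by auto
    then have "hyp T \<Delta> (q \<^bold>\<longrightarrow> r)" using that by (rule imp_intro)
    then show "(q \<^bold>\<longrightarrow> r) \<in> \<Delta>" using prv[of "q \<^bold>\<longrightarrow> r"] that by simp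
  qed
  have ex: "Ex q \<in> \<Delta> \<longleftrightarrow> (\<exists>t. subst_fm 0 t q \<in> \<Delta>)" if "Ex q \<in> L" for q
  proof
    assume "Ex q \<in> \<Delta>"
    \<comment> \<open>A witness is added only at the stage belonging to \<open>Ex q\<close>. A
      member of \<Delta> cannot have been rejected at that stage, so it is present in time.\<close>
    have "Ex q \<in> f (Suc (to_nat (Ex q)))"
    proof (rule ccontr)
      assume "Ex q \<notin> f (Suc (to_nat (Ex q)))"
      then have "hyp T (insert (Ex q) (f (to_nat (Ex q)))) Fls"
        using f(2)[of "to_nat (Ex q)"] that by (auto simp: Q_def)
      then have "hyp T \<Delta> Fls" by (rule hyp_mono) (use \<open>Ex q \<in> \<Delta>\<close> in \<open>auto simp: \<Delta>_def\<close>)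
      then show False using cD by blast
    qed
    then show "\<exists>t. subst_fm 0 t q \<in> \<Delta>" using f(2)[of "to_nat (Ex q)"] by (auto simp: Q_def \<Delta>_def)
  next
    assume "\<exists>t. subst_fm 0 t q \<in> \<Delta>"
    then obtain t where t: "subst_fm 0 t q \<in> \<Delta>" by blast
    have "hyp T \<Delta> (subst_fm 0 t q \<^bold>\<longrightarrow> Ex q)"
      using that by (intro hyp_ax logical_axioms.intros) auto
    moreover have "hyp T \<Delta> (subst_fm 0 t q)" using DL t by (blast intro: hyp.asm)
    ultimately have "hyp T \<Delta> (Ex q)" using hyp.mp by blast
    then show "Ex q \<in> \<Delta>" using prv that by blast
  qed
  have ex2: "Ex2 q \<in> \<Delta> \<longleftrightarrow> (\<exists>t. subst2_fm 0 t q \<in> \<Delta>)" if "Ex2 q \<in> L" for q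
  proof
    assume "Ex2 q \<in> \<Delta>"
    have "Ex2 q \<in> f (Suc (to_nat (Ex2 q)))"
    proof (rule ccontr)
      assume "Ex2 q \<notin> f (Suc (to_nat (Ex2 q)))"
      then have "hyp T (insert (Ex2 q) (f (to_nat (Ex2 q)))) Fls"
        using f(2)[of "to_nat (Ex2 q)"] that by (auto simp: Q_def)
      then have "hyp T \<Delta> Fls" by (rule hyp_mono) (use \<open>Ex2 q \<in> \<Delta>\<close> in \<open>auto simp: \<Delta>_def\<close>)
      then show False using cD by blast
    qed
    then show "\<exists>t. subst2_fm 0 t q \<in> \<Delta>" using f(2)[of "to_nat (Ex2 q)"] by (auto simp: Q_def \<Delta>_def)
  next
    assume "\<exists>t. subst2_fm 0 t q \<in> \<Delta>"
    then obtain t where t: "subst2_fm 0 t q \<in> \<Delta>" by blast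
    have "hyp T \<Delta> (subst2_fm 0 t q \<^bold>\<longrightarrow> Ex2 q)"
      using that L_ex2 by (intro hyp_ax logical_axioms.intros) auto
    moreover have "hyp T \<Delta> (subst2_fm 0 t q)" using DL t by (blast intro: hyp.asm)
    ultimately have "hyp T \<Delta> (Ex2 q)" using hyp.mp by blast
    then show "Ex2 q \<in> \<Delta>" using prv that by blast
  qed
  have "(\<^bold>\<not> p) \<in> \<Delta>" using f(1)[of 0] by (auto simp: P_def \<Delta>_def)
  then have "p \<notin> \<Delta>" using neg assms by blast
  moreover have "q \<in> \<Delta>" if "proves L T q" for q using prv that hyp.prv proves_L by blast
  moreover have "henkin L \<Delta>" unfolding henkin_def using DL neg imp ex ex2 by blast
  ultimately show ?thesis by blast
qed

text \<open>The term model modulo the equations in \<Delta>, transported to the type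
  \<open>nat\<close>. The hypothesis \<open>T_inf\<close> makes the quotient infinite, hence in
  bijection with \<open>nat\<close>; a common carrier type is what later allows one structure to be
  chosen among all of them.\<close>

theorem completeness:
  assumes p: "\<not> proves L T p" "p \<in> L"
    and T_inf: "\<And>m n. m \<noteq> n \<Longrightarrow> proves L T (\<^bold>\<not> (numeral_tm m \<^bold>= numeral_tm n))"
  shows "\<exists>(M :: nat mdl) e X. range X \<subseteq> sts M \<and> \<not> sat M e X p \<and> (\<forall>q. proves L T q \<longrightarrow> valid M q)"
proof -
  obtain \<Delta> where \<Delta>: "henkin L \<Delta>" "p \<notin> \<Delta>" "\<And>q. proves L T q \<Longrightarrow> q \<in> \<Delta>"
    using henkin_ex[OF p] by blast
  have DL: "\<Delta> \<subseteq> L"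
    and neg: "\<And>q. q \<in> L \<Longrightarrow> (\<^bold>\<not> q) \<in> \<Delta> \<longleftrightarrow> q \<notin> \<Delta>"
    and imp: "\<And>q r. q \<in> L \<Longrightarrow> r \<in> L \<Longrightarrow> (q \<^bold>\<longrightarrow> r) \<in> \<Delta> \<longleftrightarrow> (q \<in> \<Delta> \<longrightarrow> r \<in> \<Delta>)"
    and ex: "\<And>q. Ex q \<in> L \<Longrightarrow> Ex q \<in> \<Delta> \<longleftrightarrow> (\<exists>t. subst_fm 0 t q \<in> \<Delta>)"
    and ex2: "\<And>q. Ex2 q \<in> L \<Longrightarrow> Ex2 q \<in> \<Delta> \<longleftrightarrow> (\<exists>m. subst2_fm 0 m q \<in> \<Delta>)"
    using \<Delta>(1) unfolding henkin_def by blast+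
  define R where "R = {(t, u). (t \<^bold>= u) \<in> \<Delta>}"
  have refl: "(t \<^bold>= t) \<in> \<Delta>" for t
    by (intro \<Delta>(3) proves.logical logical_axioms.intros) auto
  have repl: "subst_fm 0 u q \<in> \<Delta>" if "(t \<^bold>= u) \<in> \<Delta>" "subst_fm 0 t q \<in> \<Delta>" "q \<in> L" for t u q
  proof -
    have "(t \<^bold>= u \<^bold>\<longrightarrow> subst_fm 0 t q \<^bold>\<longrightarrow> subst_fm 0 u q) \<in> \<Delta>"
      by (intro \<Delta>(3) proves.logical logical_axioms.intros) (use that in auto)
    then show ?thesis using that by (simp add: imp)
  qed
  have l0: "subst_tm 0 u (lift 1 t) = t" for t u
    by (simp add: subst_tm_psub shift_tm_psub psub_tm_comp psub_tm_Var)
  have sym: "(u \<^bold>= t) \<in> \<Delta>" if "(t \<^bold>= u) \<in> \<Delta>" for t u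
    using repl[of t u "Var 0 \<^bold>= lift 1 t"] that refl[of t] by (simp only: subst_fm.simps subst_tm.simps l0) simp
  have tran: "(t \<^bold>= v) \<in> \<Delta>" if "(t \<^bold>= u) \<in> \<Delta>" "(u \<^bold>= v) \<in> \<Delta>" for t u v
    using repl[of u v "lift 1 t \<^bold>= Var 0"] that by (simp only: subst_fm.simps subst_tm.simps l0) simp
  have equiv: "equiv UNIV R"
    by (intro equivI refl_onI symI transI) (auto simp: R_def refl sym intro: tran)
  define Q where "Q = UNIV // R"
  have "countable Q" unfolding Q_def quotient_def by auto
  have num: "m = n" if "(numeral_tm m \<^bold>= numeral_tm n) \<in> \<Delta>" for m n
    using \<Delta>(3)[OF T_inf[of m n]] that neg[of "numeral_tm m \<^bold>= numeral_tm n"] by auto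
  have "inj (\<lambda>n. R `` {numeral_tm n})"
  proof (rule injI)
    fix m n assume "R `` {numeral_tm m} = R `` {numeral_tm n}"
    then have "(numeral_tm m, numeral_tm n) \<in> R" by (simp add: eq_equiv_class_iff[OF equiv])
    then show "m = n" using num by (simp add: R_def)
  qed
  moreover have "range (\<lambda>n. R `` {numeral_tm n}) \<subseteq> Q" unfolding Q_def quotient_def by auto
  ultimately have "infinite Q" using range_inj_infinite infinite_super by blast
  define g where "g = to_nat_on Q"
  have g: "bij_betw g Q UNIV" unfolding g_def using \<open>countable Q\<close> \<open>infinite Q\<close> by (rule to_nat_on_infinite)
  define cls where "cls t = g (R `` {t})" for t
  have clsQ: "R `` {t} \<in> Q" for t unfolding Q_def by (simp add: quotientI)
  have cls_eq: "cls t = cls u \<longleftrightarrow> (t \<^bold>= u) \<in> \<Delta>" for t u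
  proof -
    have "cls t = cls u \<longleftrightarrow> R `` {t} = R `` {u}"
      unfolding cls_def using inj_on_eq_iff[OF bij_betw_imp_inj_on[OF g] clsQ clsQ] .
    also have "\<dots> \<longleftrightarrow> (t, u) \<in> R" by (simp add: eq_equiv_class_iff[OF equiv])
    finally show ?thesis by (simp add: R_def)
  qed
  have cls_surj: "\<exists>t. x = cls t" for x
  proof -
    obtain c where "c \<in> Q" "x = g c" using g by (metis UNIV_I bij_betw_def imageE)
    then show ?thesis unfolding Q_def cls_def by (auto elim!: quotientE)
  qed
  define rep where "rep x = (SOME t. x = cls t)" for x
  have rep: "cls (rep x) = x" for x unfolding rep_def using someI_ex[OF cls_surj[of x]] by simp
  define ext where "ext X = {cls t |t. In t X \<in> \<Delta>}" for X
  define M :: "nat mdl" where "M = \<lparr>zr = cls Zero, sc = (\<lambda>x. cls (Succ (rep x))),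
     pl = (\<lambda>x y. cls (rep x \<^bold>+ rep y)), ti = (\<lambda>x y. cls (rep x \<^bold>\<cdot> rep y)),
     le = (\<lambda>x y. (rep x \<^bold>\<le> rep y) \<in> \<Delta>), sts = range ext,
     trs = (\<lambda>i. {cls t |t. Tr i t \<in> \<Delta>})\<rparr>"
  have repcls: "(rep (cls t) \<^bold>= t) \<in> \<Delta>" "(t \<^bold>= rep (cls t)) \<in> \<Delta>" for t
    using rep cls_eq sym by metis+
  have cS: "cls (Succ t) = cls (Succ u)" if "(t \<^bold>= u) \<in> \<Delta>" for t u
  proof -
    have "(Succ t \<^bold>= Succ u) \<in> \<Delta>"
      using repl[of t u "Succ (lift 1 t) \<^bold>= Succ (Var 0)"] that refl
      by (simp only: subst_fm.simps subst_tm.simps l0) simp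
    then show ?thesis by (simp add: cls_eq)
  qed
  have cP: "cls (t \<^bold>+ t') = cls (u \<^bold>+ u')" if "(t \<^bold>= u) \<in> \<Delta>" "(t' \<^bold>= u') \<in> \<Delta>" for t u t' u'
  proof -
    have "(t \<^bold>+ t' \<^bold>= u \<^bold>+ t') \<in> \<Delta>"
      using repl[of t u "lift 1 t \<^bold>+ lift 1 t' \<^bold>= Var 0 \<^bold>+ lift 1 t'"] that refl
      by (simp only: subst_fm.simps subst_tm.simps l0) simp
    moreover have "(u \<^bold>+ t' \<^bold>= u \<^bold>+ u') \<in> \<Delta>"
      using repl[of t' u' "lift 1 u \<^bold>+ lift 1 t' \<^bold>= lift 1 u \<^bold>+ Var 0"] that refl
      by (simp only: subst_fm.simps subst_tm.simps l0) simp
    ultimately show ?thesis using tran by (simp add: cls_eq)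
  qed
  have cT: "cls (t \<^bold>\<cdot> t') = cls (u \<^bold>\<cdot> u')" if "(t \<^bold>= u) \<in> \<Delta>" "(t' \<^bold>= u') \<in> \<Delta>" for t u t' u'
  proof -
    have "(t \<^bold>\<cdot> t' \<^bold>= u \<^bold>\<cdot> t') \<in> \<Delta>"
      using repl[of t u "lift 1 t \<^bold>\<cdot> lift 1 t' \<^bold>= Var 0 \<^bold>\<cdot> lift 1 t'"] that refl
      by (simp only: subst_fm.simps subst_tm.simps l0) simp
    moreover have "(u \<^bold>\<cdot> t' \<^bold>= u \<^bold>\<cdot> u') \<in> \<Delta>"
      using repl[of t' u' "lift 1 u \<^bold>\<cdot> lift 1 t' \<^bold>= lift 1 u \<^bold>\<cdot> Var 0"] that refl
      by (simp only: subst_fm.simps subst_tm.simps l0) simp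
    ultimately show ?thesis using tran by (simp add: cls_eq)
  qed
  have cL: "(u \<^bold>\<le> u') \<in> \<Delta>" if "(t \<^bold>= u) \<in> \<Delta>" "(t' \<^bold>= u') \<in> \<Delta>" "(t \<^bold>\<le> t') \<in> \<Delta>" for t u t' u'
  proof -
    have "(u \<^bold>\<le> t') \<in> \<Delta>"
      using repl[of t u "Var 0 \<^bold>\<le> lift 1 t'"] that
      by (simp only: subst_fm.simps subst_tm.simps l0) simp
    then show ?thesis
      using repl[of t' u' "lift 1 u \<^bold>\<le> Var 0"] that
      by (simp only: subst_fm.simps subst_tm.simps l0) simp
  qed
  have cL_iff: "(rep (cls t) \<^bold>\<le> rep (cls u)) \<in> \<Delta> \<longleftrightarrow> (t \<^bold>\<le> u) \<in> \<Delta>" for t u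
    using cL repcls by meson
  have evM: "ev M (\<lambda>i. cls (\<sigma> i)) t = cls (psub_tm \<sigma> t)" for \<sigma> t
  proof (induction t)
    case (Succ t) then show ?case using cS repcls by (simp add: M_def)
  next
    case (Plus t u) then show ?case using cP repcls by (simp add: M_def)
  next
    case (Times t u) then show ?case using cT repcls by (simp add: M_def)
  qed (auto simp: M_def)
  have cIn: "In u X \<in> \<Delta>" if "(t \<^bold>= u) \<in> \<Delta>" "In t X \<in> \<Delta>" for t u X
    using repl[of t u "In (Var 0) X"] that DL L_In by (metis subsetD subst_fm.simps(3) subst_tm.simps(1) less_numeral_extra(3))
  have cTr: "Tr i u \<in> \<Delta>" if "(t \<^bold>= u) \<in> \<Delta>" "Tr i t \<in> \<Delta>" for t u i
    using repl[of t u "Tr i (Var 0)"] that DL L_Tr by (metis subsetD subst_fm.simps(4) subst_tm.simps(1) less_numeral_extra(3))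
  have truth: "sat M (\<lambda>i. cls (Var i)) (\<lambda>i. ext i) q \<longleftrightarrow> q \<in> \<Delta>" if "q \<in> L" for q
    using that
  \<comment> \<open>Instances of a quantified formula are not subformulas, but substitution
    preserves \<open>size\<close>.\<close>
  proof (induction "size q" arbitrary: q rule: less_induct)
    case less
    have sz: "size (psub \<sigma> \<xi> r) = size r" for \<sigma> \<xi> r
    proof (induction r arbitrary: \<sigma> \<xi>)
    qed auto
    have evq: "ev M (\<lambda>i. cls (Var i)) t = cls t" for t using evM[of Var t] by (simp add: psub_tm_Var)
    show ?case
    proof (cases q)
      case (Eq t u) then show ?thesis by (simp add: evq cls_eq)
    next
      case (Le t u) then show ?thesis by (simp add: evq) (simp add: M_def cL_iff)
    next
      case (In t X) then show ?thesis using refl[of t] by (auto simp: evq ext_def cls_eq intro: cIn sym)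
    next
      case (Tr i t)
      have "trs M i = {cls t |t. Tr i t \<in> \<Delta>}" by (simp add: M_def)
      then show ?thesis using Tr refl[of t] by (auto simp: evq cls_eq intro: cTr sym)
    next
      case (Neg r) then show ?thesis using less by (simp add: neg)
    next
      case (Imp r s) then show ?thesis using less by (simp add: imp)
    next
      case (Ex r)
      have "sat M (\<lambda>i. cls (Var i)) (\<lambda>i. ext i) q \<longleftrightarrow>
          (\<exists>t. sat M (cls t ## (\<lambda>i. cls (Var i))) (\<lambda>i. ext i) r)"
        using Ex cls_surj by (metis sat.simps(7))
      also have "\<dots> \<longleftrightarrow> (\<exists>t. sat M (\<lambda>i. cls (Var i)) (\<lambda>i. ext i) (subst_fm 0 t r))"
        by (simp add: sat_subst evq)
      also have "\<dots> \<longleftrightarrow> (\<exists>t. subst_fm 0 t r \<in> \<Delta>)"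
        using less Ex sz by (auto simp: subst_fm_psub)
      finally show ?thesis using ex[of r] less.prems Ex by simp
    next
      case (Ex2 r)
      have "sat M (\<lambda>i. cls (Var i)) (\<lambda>i. ext i) q \<longleftrightarrow>
          (\<exists>Y. sat M (\<lambda>i. cls (Var i)) (ext Y ## (\<lambda>i. ext i)) r)"
        using Ex2 by (simp add: M_def)
      also have "\<dots> \<longleftrightarrow> (\<exists>Y. sat M (\<lambda>i. cls (Var i)) (\<lambda>i. ext i) (subst2_fm 0 Y r))"
        by (simp add: sat_subst2)
      also have "\<dots> \<longleftrightarrow> (\<exists>Y. subst2_fm 0 Y r \<in> \<Delta>)"
        using less Ex2 sz L_ex2 by (auto simp: subst2_fm_psub)
      finally show ?thesis using ex2[of r] less.prems Ex2 by simp
    qed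
  qed
  \<comment> \<open>Every assignment comes from a substitution of terms for number variables and of
    variables for set variables, and theorems are closed under such substitutions.\<close>
  have "valid M q" if "proves L T q" for q
    unfolding valid_def
  proof (intro allI impI)
    fix e and X :: "nat \<Rightarrow> nat set" assume X: "range X \<subseteq> sts M"
    have "\<forall>i. \<exists>Y. X i = ext Y" using X by (auto simp: M_def)
    then obtain \<xi> where \<xi>: "\<And>i. X i = ext (\<xi> i)" by metis
    have "psub (\<lambda>i. rep (e i)) \<xi> q \<in> \<Delta>" using proves_psub[OF that] \<Delta>(3) by blast
    then have "sat M (\<lambda>i. cls (Var i)) (\<lambda>i. ext i) (psub (\<lambda>i. rep (e i)) \<xi> q)" using truth DL by blast
    moreover have "ev M (\<lambda>i. cls (Var i)) t = cls t" for t using evM[of Var t] by (simp add: psub_tm_Var)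
    moreover have "(\<lambda>i. cls (rep (e i))) = e" "(\<lambda>i. ext (\<xi> i)) = X" using \<xi> rep by auto
    ultimately show "sat M e X q" by (simp only: sat_psub)
  qed
  moreover have "\<not> sat M (\<lambda>i. cls (Var i)) (\<lambda>i. ext i) p" using truth p \<Delta>(2) by blast
  moreover have "range (\<lambda>i. ext i) \<subseteq> sts M" by (simp add: M_def)
  ultimately show ?thesis by blast
qed

end

lemma closed_fm_set_free: "set_free p \<Longrightarrow> closed_fm m n p \<Longrightarrow> closed_fm m 0 p"
  by (induction p arbitrary: m n) auto

lemma set_free_psub: "set_free (psub \<sigma> \<xi> p) = set_free p"
  by (induction p arbitrary: \<sigma> \<xi>) auto

lemma truth_free_psub: "truth_free (psub \<sigma> \<xi> p) = truth_free p"
  by (induction p arbitrary: \<sigma> \<xi>) auto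

interpretation L2: lang_ex2 lang_2
  by unfold_locales (auto simp: lang_2_def truth_free_psub)

interpretation LTr: lang_ex2 lang_Tr
  by unfold_locales (auto simp: lang_Tr_def set_free_psub closed_fm_set_free)

section \<open>Discretely ordered semirings\<close>

text \<open>Peano arithmetic without its induction scheme, in algebraic form. As a type class it
  gives access to algebraic simplification; the price is that models have to be turned into
  types.\<close>

class arith = linordered_semidom + canonically_ordered_monoid_add +
  assumes discrete1: "a < b \<Longrightarrow> a + 1 \<le> b"
begin

lemma Suc_le: "a + 1 \<le> b \<longleftrightarrow> a < b"
  using discrete1 less_add_one less_le_trans by blast

lemma less_Suc [simp]: "a < b + 1 \<longleftrightarrow> a \<le> b"
  by (metis Suc_le add_le_cancel_right)

lemma zero_or_Suc: "a = 0 \<or> (\<exists>b. a = b + 1)"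
proof (cases "a = 0")
  case False
  then have "1 \<le> a" using discrete1[of 0 a] zero_less_iff_neq_zero by auto
  then show ?thesis by (metis add.commute le_iff_add)
qed simp

lemma less_Suc_cases: "a < b + 1 \<longleftrightarrow> a < b \<or> a = b"
  by (simp add: le_less)

lemma Suc_neq_0 [simp]: "a + 1 \<noteq> 0" "0 \<noteq> a + 1"
  by (auto simp: add_eq_0_iff_both_eq_0)

lemma le_mult: "b \<noteq> 0 \<Longrightarrow> a \<le> a * b"
  by (metis add.commute add_le_same_cancel2 distrib_left le_add_same_cancel1 mult.right_neutral zero_le zero_or_Suc)

end

definition pr :: "'a::arith \<Rightarrow> 'a \<Rightarrow> 'a" where
  "pr a b = (a + b) * (a + b) + a"

text \<open>With \<open>s = a + b\<close> the value lies between the squares of \<open>s\<close> and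
  \<open>s + 1\<close>, so it determines \<open>s\<close>.\<close>

lemma pr_less: assumes "a + b < c + d" shows "pr a b < pr c d"
proof -
  have "a + b + 1 \<le> c + d" using assms by (simp add: Suc_le)
  then have "(a + b + 1) * (a + b + 1) \<le> (c + d) * (c + d)" by (intro mult_mono) auto
  moreover have "(a + b) * (a + b) + a < (a + b + 1) * (a + b + 1)"
  proof -
    have *: "(a + b + 1) * (a + b + 1) = ((a + b) * (a + b) + a) + (a + b + b) + 1"
      by (simp add: algebra_simps)
    show ?thesis unfolding * less_Suc by simp
  qed
  moreover have "(c + d) * (c + d) \<le> pr c d" by (simp add: pr_def)
  ultimately show ?thesis unfolding pr_def by (metis order.strict_trans1 order.strict_trans2)
qed

lemma pr_inject [simp]: "pr a b = pr c d \<longleftrightarrow> a = c \<and> b = d"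
proof
  assume eq: "pr a b = pr c d"
  have s: "a + b = c + d" using pr_less[of a b c d] pr_less[of c d a b] eq by (metis less_irrefl linorder_neqE)
  then have "a = c" using eq unfolding pr_def by simp
  then show "a = c \<and> b = d" using s by simp
qed simp

lemma pr_le1 [simp]: "a \<le> pr a b" by (simp add: pr_def)

lemma pr_le2 [simp]: "b \<le> pr a b"
proof (cases "b = 0")
  case False
  then have "b \<le> b * (a + b)" by (intro le_mult) auto
  also have "\<dots> \<le> (a + b) * (a + b)" by (intro mult_right_mono) auto
  also have "\<dots> \<le> pr a b" by (simp add: pr_def)
  finally show ?thesis .
qed simp

text \<open>A nonzero tag makes a code strictly larger than its argument, which is what justifies
  induction on codes of syntax.\<close>

lemma pr_less2: "a \<noteq> 0 \<Longrightarrow> b < pr a b"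
proof -
  assume a: "a \<noteq> 0"
  have "b < a + b" using a by (simp add: zero_less_iff_neq_zero)
  also have "\<dots> \<le> (a + b) * (a + b)" using a by (intro le_mult) auto
  also have "\<dots> \<le> pr a b" by (simp add: pr_def)
  finally show ?thesis .
qed

lemma pr_0 [simp]: "pr 0 0 = 0" by (simp add: pr_def)

lemma pr_eq_0 [simp]: "pr a b = 0 \<longleftrightarrow> a = 0 \<and> b = 0"
  by (metis pr_0 pr_inject)

section \<open>Definability with parameters\<close>

text \<open>Elements and sets of the model occur directly as parameters of these terms and formulas.
  Definability becomes a property of predicates on environments that is closed under simple rules,
  without bookkeeping of free variables.\<close>

datatype 'a xtm = XV nat | XC 'a | XAdd "'a xtm" "'a xtm" | XMul "'a xtm" "'a xtm"

text \<open>Bounded quantification is primitive so that Delta-0 formulas can be recognized from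
  their shape by \<open>xbnd\<close>.\<close>

datatype 'a xfm =
    XEq "'a xtm" "'a xtm" | XLe "'a xtm" "'a xtm" | XIn "'a xtm" "'a set"
  | XNeg "'a xfm" | XImp "'a xfm" "'a xfm" | XBEx "'a xtm" "'a xfm" | XEx "'a xfm"

primrec xev :: "(nat \<Rightarrow> 'a::arith) \<Rightarrow> 'a xtm \<Rightarrow> 'a" where
  "xev e (XV i) = e i"
| "xev e (XC c) = c"
| "xev e (XAdd t u) = xev e t + xev e u"
| "xev e (XMul t u) = xev e t * xev e u"

primrec xsat :: "(nat \<Rightarrow> 'a::arith) \<Rightarrow> 'a xfm \<Rightarrow> bool" where
  "xsat e (XEq t u) = (xev e t = xev e u)"
| "xsat e (XLe t u) = (xev e t \<le> xev e u)"
| "xsat e (XIn t A) = (xev e t \<in> A)"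
| "xsat e (XNeg p) = (\<not> xsat e p)"
| "xsat e (XImp p q) = (xsat e p \<longrightarrow> xsat e q)"
| "xsat e (XBEx t p) = (\<exists>x\<le>xev e t. xsat (x ## e) p)"
| "xsat e (XEx p) = (\<exists>x. xsat (x ## e) p)"

primrec xsets :: "'a xfm \<Rightarrow> 'a set set" where
  "xsets (XEq t u) = {}"
| "xsets (XLe t u) = {}"
| "xsets (XIn t A) = {A}"
| "xsets (XNeg p) = xsets p"
| "xsets (XImp p q) = xsets p \<union> xsets q"
| "xsets (XBEx t p) = xsets p"
| "xsets (XEx p) = xsets p"

primrec xbnd :: "'a xfm \<Rightarrow> bool" where
  "xbnd (XEq t u) = True"
| "xbnd (XLe t u) = True"
| "xbnd (XIn t A) = True"
| "xbnd (XNeg p) = xbnd p"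
| "xbnd (XImp p q) = (xbnd p \<and> xbnd q)"
| "xbnd (XBEx t p) = xbnd p"
| "xbnd (XEx p) = False"

primrec xsub_tm :: "(nat \<Rightarrow> 'a xtm) \<Rightarrow> 'a xtm \<Rightarrow> 'a xtm" where
  "xsub_tm \<sigma> (XV i) = \<sigma> i"
| "xsub_tm \<sigma> (XC c) = XC c"
| "xsub_tm \<sigma> (XAdd t u) = XAdd (xsub_tm \<sigma> t) (xsub_tm \<sigma> u)"
| "xsub_tm \<sigma> (XMul t u) = XMul (xsub_tm \<sigma> t) (xsub_tm \<sigma> u)"

abbreviation xlift :: "'a xtm \<Rightarrow> 'a xtm" where
  "xlift \<equiv> xsub_tm (\<lambda>i. XV (Suc i))"

primrec xsub :: "(nat \<Rightarrow> 'a xtm) \<Rightarrow> 'a xfm \<Rightarrow> 'a xfm" where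
  "xsub \<sigma> (XEq t u) = XEq (xsub_tm \<sigma> t) (xsub_tm \<sigma> u)"
| "xsub \<sigma> (XLe t u) = XLe (xsub_tm \<sigma> t) (xsub_tm \<sigma> u)"
| "xsub \<sigma> (XIn t A) = XIn (xsub_tm \<sigma> t) A"
| "xsub \<sigma> (XNeg p) = XNeg (xsub \<sigma> p)"
| "xsub \<sigma> (XImp p q) = XImp (xsub \<sigma> p) (xsub \<sigma> q)"
| "xsub \<sigma> (XBEx t p) = XBEx (xsub_tm \<sigma> t) (xsub (XV 0 ## (\<lambda>i. xlift (\<sigma> i))) p)"
| "xsub \<sigma> (XEx p) = XEx (xsub (XV 0 ## (\<lambda>i. xlift (\<sigma> i))) p)"

lemma xev_sub: "xev e (xsub_tm \<sigma> t) = xev (\<lambda>i. xev e (\<sigma> i)) t"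
  by (induction t) auto

lemma xsat_sub: "xsat e (xsub \<sigma> p) = xsat (\<lambda>i. xev e (\<sigma> i)) p"
proof (induction p arbitrary: e \<sigma>)
  case (XBEx t p)
  have "(\<lambda>i. xev (x ## e) ((XV 0 ## (\<lambda>i. xlift (\<sigma> i))) i)) = x ## (\<lambda>i. xev e (\<sigma> i))" for x
    by (rule cns_eqI) (auto simp: xev_sub)
  then show ?case using XBEx by (simp add: xev_sub)
next
  case (XEx p)
  have "(\<lambda>i. xev (x ## e) ((XV 0 ## (\<lambda>i. xlift (\<sigma> i))) i)) = x ## (\<lambda>i. xev e (\<sigma> i))" for x
    by (rule cns_eqI) (auto simp: xev_sub)
  then show ?case using XEx by (simp add: xev_sub)
qed (auto simp: xev_sub)

lemma xsets_sub [simp]: "xsets (xsub \<sigma> p) = xsets p"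
  by (induction p arbitrary: \<sigma>) auto

lemma xbnd_sub [simp]: "xbnd (xsub \<sigma> p) = xbnd p"
  by (induction p arbitrary: \<sigma>) auto

definition tmd :: "((nat \<Rightarrow> 'a::arith) \<Rightarrow> 'a) \<Rightarrow> bool" where
  "tmd f \<longleftrightarrow> (\<exists>t. \<forall>e. f e = xev e t)"

lemma tmd_intros:
  "tmd (\<lambda>e. e i)" "tmd (\<lambda>e. c)"
  "tmd f \<Longrightarrow> tmd g \<Longrightarrow> tmd (\<lambda>e. f e + g e)"
  "tmd f \<Longrightarrow> tmd g \<Longrightarrow> tmd (\<lambda>e. f e * g e)"
  unfolding tmd_def by (metis xev.simps)+

lemma tmd_pr: "tmd f \<Longrightarrow> tmd g \<Longrightarrow> tmd (\<lambda>e. pr (f e) (g e))"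
  unfolding pr_def by (intro tmd_intros)

lemmas tmi = tmd_intros tmd_pr

text \<open>Delta-0 definability with set parameters from \<open>S\<close>.\<close>

definition bd :: "'a set set \<Rightarrow> ((nat \<Rightarrow> 'a::arith) \<Rightarrow> bool) \<Rightarrow> bool" where
  "bd S P \<longleftrightarrow> (\<exists>p. xsets p \<subseteq> S \<and> xbnd p \<and> (\<forall>e. P e = xsat e p))"

lemma bdI: "xsets p \<subseteq> S \<Longrightarrow> xbnd p \<Longrightarrow> (\<And>e. P e = xsat e p) \<Longrightarrow> bd S P"
  by (auto simp: bd_def)

lemma bd_eq: "tmd f \<Longrightarrow> tmd g \<Longrightarrow> bd S (\<lambda>e. f e = g e)"
  unfolding tmd_def by (elim exE) (rule bdI[where p = "XEq _ _"], auto)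

lemma bd_le: "tmd f \<Longrightarrow> tmd g \<Longrightarrow> bd S (\<lambda>e. f e \<le> g e)"
  unfolding tmd_def by (elim exE) (rule bdI[where p = "XLe _ _"], auto)

lemma bd_in: "tmd f \<Longrightarrow> A \<in> S \<Longrightarrow> bd S (\<lambda>e. f e \<in> A)"
  unfolding tmd_def by (elim exE) (rule bdI[where p = "XIn _ _"], auto)

lemma bd_not: "bd S P \<Longrightarrow> bd S (\<lambda>e. \<not> P e)"
  unfolding bd_def[of S P] by (elim exE) (rule bdI[where p = "XNeg _"], auto)

lemma bd_imp: "bd S P \<Longrightarrow> bd S Q \<Longrightarrow> bd S (\<lambda>e. P e \<longrightarrow> Q e)"
  unfolding bd_def[of S P] bd_def[of S Q] by (elim exE) (rule bdI[where p = "XImp _ _"], auto)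

lemma bd_conj: "bd S P \<Longrightarrow> bd S Q \<Longrightarrow> bd S (\<lambda>e. P e \<and> Q e)"
  using bd_not[OF bd_imp[OF _ bd_not], of S P Q] by simp

lemma bd_disj: "bd S P \<Longrightarrow> bd S Q \<Longrightarrow> bd S (\<lambda>e. P e \<or> Q e)"
  using bd_imp[OF bd_not, of S P Q] by (simp add: disj_imp)

lemma bd_iff: "bd S P \<Longrightarrow> bd S Q \<Longrightarrow> bd S (\<lambda>e. P e \<longleftrightarrow> Q e)"
  unfolding iff_conv_conj_imp by (intro bd_conj bd_imp)

lemma bd_less: "tmd f \<Longrightarrow> tmd g \<Longrightarrow> bd S (\<lambda>e. f e < g e)"
  unfolding not_le[symmetric] by (intro bd_not bd_le)

text \<open>The bound variable and the rest of the environment are kept apart in \<open>P\<close>,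
  so that unification can pass through the quantifier and \<open>intro\<close> can establish
  definability by itself.\<close>

lemma bd_bex: assumes "tmd f" "bd S (\<lambda>e. P (e 0) (\<lambda>i. e (Suc i)))"
  shows "bd S (\<lambda>e. \<exists>x\<le>f e. P x e)"
proof -
  obtain t where t: "\<And>e. f e = xev e t" using assms(1) by (auto simp: tmd_def)
  obtain p where p: "xsets p \<subseteq> S" "xbnd p" "\<And>e. P (e 0) (\<lambda>i. e (Suc i)) = xsat e p"
    using assms(2) by (auto simp: bd_def)
  have "P x e = xsat (x ## e) p" for x e using p(3)[of "x ## e"] by simp
  then show ?thesis using p t by (intro bdI[where p = "XBEx t p"]) auto
qed

lemma bd_ball: assumes "tmd f" "bd S (\<lambda>e. P (e 0) (\<lambda>i. e (Suc i)))"
  shows "bd S (\<lambda>e. \<forall>x\<le>f e. P x e)"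
  using bd_not[OF bd_bex[OF assms(1), where P = "\<lambda>x e. \<not> P x e", OF bd_not[OF assms(2)]]] by simp

lemma bd_sub: assumes "bd S P" "\<And>i. tmd (\<sigma> i)" shows "bd S (\<lambda>e. P (\<lambda>i. \<sigma> i e))"
proof -
  obtain p where p: "xsets p \<subseteq> S" "xbnd p" "\<And>e. P e = xsat e p"
    using assms(1) by (auto simp: bd_def)
  obtain \<tau> where "\<And>i e. \<sigma> i e = xev e (\<tau> i)" using assms(2) unfolding tmd_def by metis
  then show ?thesis using p by (intro bdI[where p = "xsub \<tau> p"]) (auto simp: xsat_sub)
qed

lemmas bdi = bd_eq bd_le bd_in bd_not bd_imp bd_conj bd_disj bd_iff bd_less bd_bex bd_ball

lemma tmd_cns: "tmd f \<Longrightarrow> (\<And>i. tmd (\<lambda>e. g e i)) \<Longrightarrow> tmd (\<lambda>e. (f e ## g e) i)"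
  by (cases i) (auto simp: cns_def)

text \<open>Sigma-1 definability with set parameters from \<open>S\<close>; the witness occupies
  variable 0 of the Delta-0 matrix.\<close>

definition sg :: "'a set set \<Rightarrow> ((nat \<Rightarrow> 'a::arith) \<Rightarrow> bool) \<Rightarrow> bool" where
  "sg S P \<longleftrightarrow> (\<exists>Q. bd S Q \<and> (\<forall>e. P e \<longleftrightarrow> (\<exists>y. Q (y ## e))))"

lemma sgI: "bd S Q \<Longrightarrow> (\<And>e. P e \<longleftrightarrow> (\<exists>y. Q (y ## e))) \<Longrightarrow> sg S P"
  by (auto simp: sg_def)

lemma sg_bd: "bd S P \<Longrightarrow> sg S P"
  by (rule sgI[where Q = "\<lambda>e. P (\<lambda>i. e (Suc i))"]) (auto intro: bd_sub tmi)

lemma sg_sub: assumes "sg S P" "\<And>i. tmd (\<sigma> i)" shows "sg S (\<lambda>e. P (\<lambda>i. \<sigma> i e))"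
proof -
  obtain Q where Q: "bd S Q" "\<And>e. P e \<longleftrightarrow> (\<exists>y. Q (y ## e))" using assms by (auto simp: sg_def)
  define \<tau> where "\<tau> = (\<lambda>i e. (e 0 ## (\<lambda>i. \<sigma> i (\<lambda>j. e (Suc j)))) i)"
  have *: "tmd (\<lambda>e. \<sigma> i (\<lambda>j. e (Suc j)))" for i
  proof -
    obtain t where "\<And>e. \<sigma> i e = xev e t" using assms(2) unfolding tmd_def by metis
    then show ?thesis unfolding tmd_def by (intro exI[of _ "xlift t"]) (simp add: xev_sub)
  qed
  have "tmd (\<tau> i)" for i unfolding \<tau>_def by (intro tmd_cns tmi *)
  then have "bd S (\<lambda>e. Q (\<lambda>i. \<tau> i e))" by (rule bd_sub[OF Q(1)])
  then show ?thesis by (rule sgI) (auto simp: Q \<tau>_def)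
qed

text \<open>Two adjacent unbounded quantifiers are contracted by letting one new number bound both
  witnesses.\<close>

lemma sg_ex: assumes "sg S (\<lambda>e. P (e 0) (\<lambda>i. e (Suc i)))" shows "sg S (\<lambda>e. \<exists>x. P x e)"
proof -
  obtain Q where Q: "bd S Q" "\<And>e. P (e 0) (\<lambda>i. e (Suc i)) \<longleftrightarrow> (\<exists>y. Q (y ## e))"
    using assms by (auto simp: sg_def)
  have P: "P x e \<longleftrightarrow> (\<exists>y. Q (y ## x ## e))" for x e using Q(2)[of "x ## e"] by simp
  have b: "bd S (\<lambda>e. \<exists>x\<le>e 0. \<exists>y\<le>e 0. Q (\<lambda>i. (y ## x ## (\<lambda>i. e (Suc i))) i))"
    by (intro bdi tmi bd_sub[OF Q(1)] tmd_cns)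
  show ?thesis
  proof (rule sgI[OF b])
    fix e
    show "(\<exists>x. P x e) \<longleftrightarrow> (\<exists>z. \<exists>x\<le>(z ## e) 0. \<exists>y\<le>(z ## e) 0. Q (\<lambda>i. (y ## x ## (\<lambda>i. (z ## e) (Suc i))) i))"
      by (auto simp: P) (metis linear)
  qed
qed

lemma sg_conj: assumes "sg S P" "sg S Q" shows "sg S (\<lambda>e. P e \<and> Q e)"
proof -
  obtain P' where P': "bd S P'" "\<And>e. P e \<longleftrightarrow> (\<exists>y. P' (y ## e))" using assms by (auto simp: sg_def)
  obtain Q' where Q': "bd S Q'" "\<And>e. Q e \<longleftrightarrow> (\<exists>y. Q' (y ## e))" using assms by (auto simp: sg_def)
  have "sg S (\<lambda>e. \<exists>y z. P' (\<lambda>i. (y ## e) i) \<and> Q' (\<lambda>i. (z ## e) i))"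
    by (intro sg_ex sg_bd bdi bd_sub[OF P'(1)] bd_sub[OF Q'(1)] tmd_cns tmi)
  then show ?thesis by (simp add: P' Q')
qed

lemma sg_disj: assumes "sg S P" "sg S Q" shows "sg S (\<lambda>e. P e \<or> Q e)"
proof -
  obtain P' where P': "bd S P'" "\<And>e. P e \<longleftrightarrow> (\<exists>y. P' (y ## e))" using assms by (auto simp: sg_def)
  obtain Q' where Q': "bd S Q'" "\<And>e. Q e \<longleftrightarrow> (\<exists>y. Q' (y ## e))" using assms by (auto simp: sg_def)
  have "sg S (\<lambda>e. \<exists>y. P' (\<lambda>i. (y ## e) i) \<or> Q' (\<lambda>i. (y ## e) i))"
    by (intro sg_ex sg_bd bdi bd_sub[OF P'(1)] bd_sub[OF Q'(1)] tmd_cns tmi)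
  then show ?thesis by (simp add: P' Q' ex_disj_distrib)
qed

lemma sg_cong: "sg S P \<Longrightarrow> (\<And>e. P e = Q e) \<Longrightarrow> sg S Q"
  by (simp add: sg_def)

text \<open>Delta-1 definability. The notion \<open>fn\<close> below is its analogue for functions,
  where a Sigma-1 graph suffices because the functions are total.\<close>

definition dl :: "'a set set \<Rightarrow> ((nat \<Rightarrow> 'a::arith) \<Rightarrow> bool) \<Rightarrow> bool" where
  "dl S P \<longleftrightarrow> sg S P \<and> sg S (\<lambda>e. \<not> P e)"

definition fn :: "'a set set \<Rightarrow> ((nat \<Rightarrow> 'a::arith) \<Rightarrow> 'a) \<Rightarrow> bool" where
  "fn S f \<longleftrightarrow> sg S (\<lambda>e. e 0 = f (\<lambda>i. e (Suc i)))"

lemma dl_bd: "bd S P \<Longrightarrow> dl S P"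
  by (auto simp: dl_def intro: sg_bd bd_not)

lemma dl_sg: "dl S P \<Longrightarrow> sg S P" and dl_nsg: "dl S P \<Longrightarrow> sg S (\<lambda>e. \<not> P e)"
  by (auto simp: dl_def)

lemma dl_not: "dl S P \<Longrightarrow> dl S (\<lambda>e. \<not> P e)"
  by (auto simp: dl_def)

lemma dl_conj: "dl S P \<Longrightarrow> dl S Q \<Longrightarrow> dl S (\<lambda>e. P e \<and> Q e)"
  unfolding dl_def de_Morgan_conj by (intro conjI sg_conj sg_disj) auto

lemma dl_imp: "dl S P \<Longrightarrow> dl S Q \<Longrightarrow> dl S (\<lambda>e. P e \<longrightarrow> Q e)"
  using dl_not[OF dl_conj[OF _ dl_not], of S P Q] by simp

lemma dl_disj: "dl S P \<Longrightarrow> dl S Q \<Longrightarrow> dl S (\<lambda>e. P e \<or> Q e)"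
  using dl_imp[OF dl_not, of S P Q] by (simp add: disj_imp)

lemma dl_iff: "dl S P \<Longrightarrow> dl S Q \<Longrightarrow> dl S (\<lambda>e. P e \<longleftrightarrow> Q e)"
  unfolding iff_conv_conj_imp by (intro dl_conj dl_imp)

lemma dl_cong: "dl S P \<Longrightarrow> (\<And>e. P e = Q e) \<Longrightarrow> dl S Q"
  by (subgoal_tac "P = Q") auto

text \<open>The value of \<open>f\<close> becomes the witness of an existential quantifier over its
  graph, which is how functions that are not terms can be substituted into Sigma-1
  predicates.\<close>

lemma sg_let: assumes "fn S f" "sg S (\<lambda>e. P (e 0) (\<lambda>i. e (Suc i)))" shows "sg S (\<lambda>e. P (f e) e)"
proof -
  have "sg S (\<lambda>e. \<exists>u. u = f e \<and> P u e)"
    by (intro sg_ex sg_conj assms(2) assms(1)[unfolded fn_def])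
  then show ?thesis by simp
qed

lemma fn_sub: "fn S f \<Longrightarrow> (\<And>i. tmd (\<sigma> i)) \<Longrightarrow> fn S (\<lambda>e. f (\<lambda>i. \<sigma> i e))"
proof -
  assume f: "fn S f" and \<sigma>: "\<And>i. tmd (\<sigma> i)"
  have *: "tmd (\<lambda>e. \<sigma> i (\<lambda>j. e (Suc j)))" for i
  proof -
    obtain t where "\<And>e. \<sigma> i e = xev e t" using \<sigma> unfolding tmd_def by metis
    then show ?thesis unfolding tmd_def by (intro exI[of _ "xlift t"]) (simp add: xev_sub)
  qed
  have "sg S (\<lambda>e. (\<lambda>i. (e 0 ## (\<lambda>i. \<sigma> i (\<lambda>j. e (Suc j)))) i) 0
      = f (\<lambda>i. (\<lambda>i. (e 0 ## (\<lambda>i. \<sigma> i (\<lambda>j. e (Suc j)))) i) (Suc i)))"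
    using f unfolding fn_def by (rule sg_sub) (intro tmd_cns tmi *)
  then show ?thesis by (simp add: fn_def)
qed

lemma fn_Suc: "fn S f \<Longrightarrow> fn S (\<lambda>e. f (\<lambda>i. e (Suc i)))"
  by (rule fn_sub[where \<sigma> = "\<lambda>i e. e (Suc i)"]) (assumption, rule tmi)

lemma sg_app1: "sg S (\<lambda>e. P (e 0)) \<Longrightarrow> fn S f \<Longrightarrow> sg S (\<lambda>e. P (f e))"
  using sg_let[of S f "\<lambda>u e. P u"] by simp

lemma sg_app2: assumes "sg S (\<lambda>e. P (e 0) (e 1))" "fn S f" "fn S g" shows "sg S (\<lambda>e. P (f e) (g e))"
proof -
  have "sg S (\<lambda>e. \<exists>v. v = g e \<and> (\<exists>u. u = f e \<and> P u v))"
    using assms(1) by (intro sg_ex sg_conj assms(3)[unfolded fn_def] fn_Suc[OF assms(2), unfolded fn_def]) simp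
  then show ?thesis by simp
qed

lemma sg_app3: assumes "sg S (\<lambda>e. P (e 0) (e 1) (e 2))" "fn S f" "fn S g" "fn S h"
  shows "sg S (\<lambda>e. P (f e) (g e) (h e))"
proof -
  have "sg S (\<lambda>e. \<exists>w. w = h e \<and> (\<exists>v. v = g e \<and> (\<exists>u. u = f e \<and> P u v w)))"
    using assms(1) by (intro sg_ex sg_conj assms(4)[unfolded fn_def] fn_Suc[OF assms(3), unfolded fn_def]
       fn_Suc[OF fn_Suc[OF assms(2)], unfolded fn_def]) (simp add: numeral_2_eq_2)
  then show ?thesis by simp
qed

text \<open>Totality of \<open>f\<close> lets the negation pass inside: both \<open>P\<close> and
  its negation are applied to the unique value.\<close>

lemma dl_app1: "dl S (\<lambda>e. P (e 0)) \<Longrightarrow> fn S f \<Longrightarrow> dl S (\<lambda>e. P (f e))"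
  unfolding dl_def using sg_app1[of S P] sg_app1[of S "\<lambda>u. \<not> P u"] by blast

lemma dl_app2: "dl S (\<lambda>e. P (e 0) (e 1)) \<Longrightarrow> fn S f \<Longrightarrow> fn S g \<Longrightarrow> dl S (\<lambda>e. P (f e) (g e))"
  unfolding dl_def using sg_app2[of S P] sg_app2[of S "\<lambda>u v. \<not> P u v"] by blast

lemma dl_app3: "dl S (\<lambda>e. P (e 0) (e 1) (e 2)) \<Longrightarrow> fn S f \<Longrightarrow> fn S g \<Longrightarrow> fn S h
    \<Longrightarrow> dl S (\<lambda>e. P (f e) (g e) (h e))"
  unfolding dl_def using sg_app3[of S P] sg_app3[of S "\<lambda>u v w. \<not> P u v w"] by blast

lemma fn_tmd: "tmd f \<Longrightarrow> fn S f"
proof -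
  assume "tmd f"
  then obtain t where "\<And>e. f e = xev e t" by (auto simp: tmd_def)
  then have "tmd (\<lambda>e. f (\<lambda>i. e (Suc i)))"
    unfolding tmd_def by (intro exI[of _ "xlift t"]) (simp add: xev_sub)
  then show ?thesis unfolding fn_def by (intro sg_bd bdi tmi)
qed

lemma dl_eq: "fn S f \<Longrightarrow> fn S g \<Longrightarrow> dl S (\<lambda>e. f e = g e)"
  by (rule dl_app2[where P = "(=)", OF dl_bd[OF bd_eq[OF tmi(1) tmi(1)]]])

lemma dl_le: "fn S f \<Longrightarrow> fn S g \<Longrightarrow> dl S (\<lambda>e. f e \<le> g e)"
  by (rule dl_app2[where P = "(\<le>)", OF dl_bd[OF bd_le[OF tmi(1) tmi(1)]]])

lemma dl_less: "fn S f \<Longrightarrow> fn S g \<Longrightarrow> dl S (\<lambda>e. f e < g e)"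
  by (rule dl_app2[where P = "(<)", OF dl_bd[OF bd_less[OF tmi(1) tmi(1)]]])

lemma dl_in: "fn S f \<Longrightarrow> A \<in> S \<Longrightarrow> dl S (\<lambda>e. f e \<in> A)"
  by (rule dl_app1[where P = "\<lambda>x. x \<in> A", OF dl_bd[OF bd_in[OF tmi(1)]]])

lemma fn_app2: assumes "tmd (\<lambda>e. h (e 0) (e 1))" "fn S f" "fn S g" shows "fn S (\<lambda>e. h (f e) (g e))"
  unfolding fn_def
proof (rule sg_app3[where P = "\<lambda>u v w. u = h v w"])
  obtain t where t: "\<And>e. h (e 0) (e 1) = xev e t" using assms(1) unfolding tmd_def by auto
  have "h (e 1) (e 2) = xev e (xlift t)" for e
    using t[of "\<lambda>i. e (Suc i)"] by (simp add: xev_sub numeral_2_eq_2)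
  then have "tmd (\<lambda>e. h (e 1) (e 2))" unfolding tmd_def by blast
  then show "sg S (\<lambda>e. e 0 = h (e 1) (e 2))" by (intro sg_bd bdi tmi)
qed (use assms fn_Suc in \<open>auto intro: fn_tmd tmi\<close>)

lemma fn_add: "fn S f \<Longrightarrow> fn S g \<Longrightarrow> fn S (\<lambda>e. f e + g e)"
  by (rule fn_app2[where h = "(+)"]) (intro tmi)

lemma fn_mult: "fn S f \<Longrightarrow> fn S g \<Longrightarrow> fn S (\<lambda>e. f e * g e)"
  by (rule fn_app2[where h = "(*)"]) (intro tmi)

lemma fn_pr: "fn S f \<Longrightarrow> fn S g \<Longrightarrow> fn S (\<lambda>e. pr (f e) (g e))"
  by (rule fn_app2[where h = pr]) (intro tmi)

lemma fn_var: "fn S (\<lambda>e. e i)" and fn_const: "fn S (\<lambda>e. c)"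
  by (intro fn_tmd tmi)+

lemma dl_const: "dl S (\<lambda>e. b)"
proof -
  have "dl S (\<lambda>e. (0::'a) = 0)" "dl S (\<lambda>e. (0::'a) = 1)" by (intro dl_eq fn_const)+
  then show ?thesis by (cases b) auto
qed

lemmas fni = fn_var fn_const fn_add fn_mult fn_pr
lemmas dli = dl_not dl_conj dl_imp dl_disj dl_iff dl_eq dl_le dl_less dl_in

lemma sg_not: "dl S P \<Longrightarrow> sg S (\<lambda>e. \<not> P e)" by (rule dl_nsg)
lemma sg_imp: "dl S P \<Longrightarrow> sg S Q \<Longrightarrow> sg S (\<lambda>e. P e \<longrightarrow> Q e)"
  unfolding imp_conv_disj by (intro sg_disj dl_nsg)
lemma sg_iff: "dl S P \<Longrightarrow> dl S Q \<Longrightarrow> sg S (\<lambda>e. P e \<longleftrightarrow> Q e)"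
  by (intro dl_sg dl_iff)
lemmas sgi = sg_conj sg_disj sg_ex sg_not sg_imp sg_iff dl_eq[THEN dl_sg] dl_le[THEN dl_sg]
  dl_less[THEN dl_sg] dl_in[THEN dl_sg]

section \<open>Finite sets in models of \<open>RCA\<^sub>0\<close>\<close>

definition elm :: "'a::arith \<Rightarrow> 'a \<Rightarrow> bool" where
  "elm c y \<longleftrightarrow> (\<exists>k m l. c = pr k (pr m l) \<and> y < k \<and> (y + 1) * m + 1 dvd l)"

definition els :: "'a::arith \<Rightarrow> 'a set" where
  "els c = {y. elm c y}"

text \<open>All components of a code are bounded by it, and the quotient by the dividend. This makes
  membership Delta-0 and matches the object formula \<open>mem\<close>.\<close>

lemma elm_bounded: "elm c y \<longleftrightarrow> (\<exists>k\<le>c. \<exists>m\<le>c. \<exists>l\<le>c. c = pr k (pr m l) \<and> y < k \<and> (\<exists>q\<le>l. l = ((y + 1) * m + 1) * q))"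
proof -
  have "q \<le> ((y + 1) * m + 1) * q" for m q :: 'a
    by (simp add: distrib_right)
  then have "(y + 1) * m + 1 dvd l \<longleftrightarrow> (\<exists>q\<le>l. l = ((y + 1) * m + 1) * q)" for m l
    unfolding dvd_def by metis
  moreover have "k \<le> pr k (pr m l) \<and> m \<le> pr k (pr m l) \<and> l \<le> pr k (pr m l)" for k m l :: 'a
    using pr_le1 pr_le2 order_trans by metis
  ultimately show ?thesis unfolding elm_def by metis
qed

lemma bd_elm: "bd S (\<lambda>e. elm (e 0) (e 1))"
  unfolding elm_bounded by (intro bdi tmi)

lemma dl_els: "fn S f \<Longrightarrow> fn S g \<Longrightarrow> dl S (\<lambda>e. f e \<in> els (g e))"
  unfolding els_def mem_Collect_eq by (rule dl_app2[where P = elm, OF dl_bd[OF bd_elm]])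

lemma elm_less: "y \<in> els c \<Longrightarrow> y < c"
  unfolding els_def elm_def by (auto intro: less_le_trans[OF _ pr_le1])

text \<open>The semantic content of \<open>RCA0\<close>: Sigma-1 induction and Delta-1 comprehension
  with arbitrary parameters.\<close>

locale rca =
  fixes S :: "'a::arith set set"
  assumes ind: "bd S P \<Longrightarrow> \<exists>y. P (y ## 0 ## e) \<Longrightarrow>
      (\<And>x. \<exists>y. P (y ## x ## e) \<Longrightarrow> \<exists>y. P (y ## (x + 1) ## e)) \<Longrightarrow> \<exists>y. P (y ## x ## e)"
    and comp: "bd S P \<Longrightarrow> bd S Q \<Longrightarrow> (\<And>x. (\<exists>y. P (y ## x ## e)) \<longleftrightarrow> (\<forall>y. Q (y ## x ## e))) \<Longrightarrow>
      {x. \<exists>y. P (y ## x ## e)} \<in> S"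
begin

lemma sg_induct:
  assumes "sg S (\<lambda>e. P (e 0))" "P 0" "\<And>x. P x \<Longrightarrow> P (x + 1)" shows "P x"
proof -
  obtain Q where Q: "bd S Q" "\<And>e. P (e 0) \<longleftrightarrow> (\<exists>y. Q (y ## e))" using assms(1) by (auto simp: sg_def)
  define e0 where "e0 = (\<lambda>i::nat. 0::'a)"
  have P: "P x \<longleftrightarrow> (\<exists>y. Q (y ## x ## e0))" for x using Q(2)[of "x ## e0"] by simp
  show ?thesis using ind[OF Q(1), of e0 x] assms(2,3) unfolding P by blast
qed

lemma dl_comp: assumes "dl S (\<lambda>e. P (e 0))" shows "{x. P x} \<in> S"
proof -
  obtain Q where Q: "bd S Q" "\<And>e. P (e 0) \<longleftrightarrow> (\<exists>y. Q (y ## e))"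
    using assms(1) by (auto simp: sg_def dl_def)
  obtain R where R: "bd S R" "\<And>e. \<not> P (e 0) \<longleftrightarrow> (\<exists>y. R (y ## e))"
    using assms(1) by (auto simp: sg_def dl_def)
  define e0 where "e0 = (\<lambda>i::nat. 0::'a)"
  have P: "P x \<longleftrightarrow> (\<exists>y. Q (y ## x ## e0))" for x using Q(2)[of "x ## e0"] by simp
  have P': "\<not> P x \<longleftrightarrow> (\<exists>y. R (y ## x ## e0))" for x using R(2)[of "x ## e0"] by simp
  have "{x. \<exists>y. Q (y ## x ## e0)} \<in> S"
    using comp[OF Q(1) bd_not[OF R(1)], of e0] P P' by blast
  then show ?thesis unfolding P .
qed

text \<open>Counting down from a failure at \<open>x\<close> turns this into Sigma-1 induction on
  \<open>j\<close>: there is a failure at \<open>x - j\<close>, hence finally one at 0.\<close>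

lemma pi_induct:
  assumes P: "sg S (\<lambda>e. \<not> P (e 0))" and "P 0" "\<And>x. P x \<Longrightarrow> P (x + 1)" shows "P x"
proof (rule ccontr)
  assume "\<not> P x"
  have "j \<le> x \<longrightarrow> (\<exists>i. i + j = x \<and> \<not> P i)" for j
  proof (rule sg_induct[where P = "\<lambda>j. j \<le> x \<longrightarrow> (\<exists>i. i + j = x \<and> \<not> P i)"])
    show "sg S (\<lambda>e. e 0 \<le> x \<longrightarrow> (\<exists>i. i + e 0 = x \<and> \<not> P i))"
      by (intro sg_imp dl_le fni sg_ex sg_conj dl_eq[THEN dl_sg] P)
    show "0 \<le> x \<longrightarrow> (\<exists>i. i + 0 = x \<and> \<not> P i)" using \<open>\<not> P x\<close> by simp
    fix j assume IH: "j \<le> x \<longrightarrow> (\<exists>i. i + j = x \<and> \<not> P i)"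
    show "j + 1 \<le> x \<longrightarrow> (\<exists>i. i + (j + 1) = x \<and> \<not> P i)"
    proof
      assume j: "j + 1 \<le> x"
      then have "j \<le> x" using Suc_le less_imp_le by blast
      then obtain i where i: "i + j = x" "\<not> P i" using IH by blast
      have "i \<noteq> 0" using i j by (metis Suc_le add_0 less_irrefl)
      then obtain i' where "i = i' + 1" using zero_or_Suc by blast
      then show "\<exists>i. i + (j + 1) = x \<and> \<not> P i" using i assms(3) by (metis add.assoc add.commute)
    qed
  qed
  from this[of x] obtain i where "i + x = x" "\<not> P i" by auto
  then show False using assms(2) by simp
qed

text \<open>Sigma-1 collection: by induction on \<open>j\<close> the witnesses for all
  \<open>x \<le> j\<close> have a common bound, so the bounded quantifier can be moved inside the
  unbounded one.\<close>

lemma sg_ball: assumes f: "fn S f" and P: "sg S (\<lambda>e. P (e 0) (\<lambda>i. e (Suc i)))"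
  shows "sg S (\<lambda>e. \<forall>x\<le>f e. P x e)"
proof -
  obtain Q where Q: "bd S Q" "\<And>e. P (e 0) (\<lambda>i. e (Suc i)) \<longleftrightarrow> (\<exists>y. Q (y ## e))"
    using P by (auto simp: sg_def)
  have PQ: "P x e \<longleftrightarrow> (\<exists>y. Q (y ## x ## e))" for x e using Q(2)[of "x ## e"] by simp
  have *: "(\<forall>x\<le>b. P x e) \<longleftrightarrow> (\<exists>B. \<forall>x\<le>b. \<exists>y\<le>B. Q (\<lambda>i. (y ## x ## e) i))" for b e
  proof
    assume A: "\<forall>x\<le>b. P x e"
    have "j \<le> b \<longrightarrow> (\<exists>B. \<forall>x\<le>j. \<exists>y\<le>B. Q (\<lambda>i. (y ## x ## e) i))" for j
    proof (rule sg_induct[where P = "\<lambda>j. j \<le> b \<longrightarrow> (\<exists>B. \<forall>x\<le>j. \<exists>y\<le>B. Q (\<lambda>i. (y ## x ## e) i))"])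
      show "sg S (\<lambda>v. v 0 \<le> b \<longrightarrow> (\<exists>B. \<forall>x\<le>v 0. \<exists>y\<le>B. Q (\<lambda>i. (y ## x ## e) i)))"
        by (intro sg_imp dl_le fni sg_ex sg_bd bd_ball bd_bex bd_sub[OF Q(1)] tmd_cns tmi)
      show "0 \<le> b \<longrightarrow> (\<exists>B. \<forall>x\<le>0. \<exists>y\<le>B. Q (\<lambda>i. (y ## x ## e) i))"
      proof -
        obtain y where "Q (y ## 0 ## e)" using A PQ zero_le by blast
        then show ?thesis by auto
      qed
      fix j assume IH: "j \<le> b \<longrightarrow> (\<exists>B. \<forall>x\<le>j. \<exists>y\<le>B. Q (\<lambda>i. (y ## x ## e) i))"
      show "j + 1 \<le> b \<longrightarrow> (\<exists>B. \<forall>x\<le>j + 1. \<exists>y\<le>B. Q (\<lambda>i. (y ## x ## e) i))"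
      proof
        assume j: "j + 1 \<le> b"
        then have "j \<le> b" using Suc_le less_imp_le by blast
        then obtain B where B: "\<forall>x\<le>j. \<exists>y\<le>B. Q (\<lambda>i. (y ## x ## e) i)" using IH by blast
        obtain y where y: "Q (\<lambda>i. (y ## (j + 1) ## e) i)" using A PQ j by auto
        have "\<exists>y'\<le>B + y. Q (\<lambda>i. (y' ## x ## e) i)" if "x \<le> j + 1" for x
        proof (cases "x = j + 1")
          case True then show ?thesis using y by (intro exI[of _ y]) (simp add: add_increasing)
        next
          case False
          then have "x \<le> j" using that by (metis less_Suc le_less)
          then obtain y' where "y' \<le> B" "Q (\<lambda>i. (y' ## x ## e) i)" using B by blast
          then show ?thesis by (intro exI[of _ y']) (simp add: add_increasing2)
        qed
        then show "\<exists>B. \<forall>x\<le>j + 1. \<exists>y\<le>B. Q (\<lambda>i. (y ## x ## e) i)" by blast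
      qed
    qed
    from this[of b] show "\<exists>B. \<forall>x\<le>b. \<exists>y\<le>B. Q (\<lambda>i. (y ## x ## e) i)" by blast
  qed (use PQ in auto)
  have "sg S (\<lambda>e. (\<lambda>b e. \<exists>B. \<forall>x\<le>b. \<exists>y\<le>B. Q (\<lambda>i. (y ## x ## e) i)) (f e) e)"
    by (rule sg_let[OF f]) (intro sg_ex sg_bd bd_ball bd_bex bd_sub[OF Q(1)] tmd_cns tmi)
  then show ?thesis by (simp add: *)
qed

lemma sg_bex: assumes f: "fn S f" and P: "sg S (\<lambda>e. P (e 0) (\<lambda>i. e (Suc i)))"
  shows "sg S (\<lambda>e. \<exists>x\<le>f e. P x e)"
  using fn_Suc[OF f] P by (intro sgi fni)

lemma sg_ball_less: assumes f: "fn S f" and P: "sg S (\<lambda>e. P (e 0) (\<lambda>i. e (Suc i)))"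
  shows "sg S (\<lambda>e. \<forall>x<f e. P x e)"
proof -
  have "sg S (\<lambda>e. \<forall>x\<le>f e. x < f e \<longrightarrow> P x e)"
    using fn_Suc[OF f] P by (intro sg_ball f sgi dli fni)
  then show ?thesis by (rule sg_cong) auto
qed

lemma sg_bex_less: assumes f: "fn S f" and P: "sg S (\<lambda>e. P (e 0) (\<lambda>i. e (Suc i)))"
  shows "sg S (\<lambda>e. \<exists>x<f e. P x e)"
  using fn_Suc[OF f] P by (intro sgi fni)

lemma sg_ball_els: assumes f: "fn S f" and P: "sg S (\<lambda>e. P (e 0) (\<lambda>i. e (Suc i)))"
  shows "sg S (\<lambda>e. \<forall>x\<in>els (f e). P x e)"
proof -
  have "sg S (\<lambda>e. \<forall>x<f e. x \<in> els (f e) \<longrightarrow> P x e)"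
    using fn_Suc[OF f] P by (intro sg_ball_less f sgi dl_els fni)
  then show ?thesis by (rule sg_cong) (auto dest: elm_less)
qed

lemma sg_bex_els: assumes f: "fn S f" and P: "sg S (\<lambda>e. P (e 0) (\<lambda>i. e (Suc i)))"
  shows "sg S (\<lambda>e. \<exists>x\<in>els (f e). P x e)"
  using fn_Suc[OF f] P unfolding Bex_def by (intro sgi dl_els[THEN dl_sg] fni)

lemma dl_qs:
  assumes f: "fn S f" and P: "dl S (\<lambda>e. P (e 0) (\<lambda>i. e (Suc i)))"
  shows dl_ball: "dl S (\<lambda>e. \<forall>x\<le>f e. P x e)" and dl_bex: "dl S (\<lambda>e. \<exists>x\<le>f e. P x e)"
    and dl_ball_less: "dl S (\<lambda>e. \<forall>x<f e. P x e)" and dl_bex_less: "dl S (\<lambda>e. \<exists>x<f e. P x e)"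
    and dl_ball_els: "dl S (\<lambda>e. \<forall>x\<in>els (f e). P x e)" and dl_bex_els: "dl S (\<lambda>e. \<exists>x\<in>els (f e). P x e)"
proof -
  note p = P[THEN dl_sg] P[THEN dl_nsg]
  show "dl S (\<lambda>e. \<forall>x\<le>f e. P x e)" "dl S (\<lambda>e. \<exists>x\<le>f e. P x e)"
    "dl S (\<lambda>e. \<forall>x<f e. P x e)" "dl S (\<lambda>e. \<exists>x<f e. P x e)"
    "dl S (\<lambda>e. \<forall>x\<in>els (f e). P x e)" "dl S (\<lambda>e. \<exists>x\<in>els (f e). P x e)"
    using sg_ball[of f P, OF f p(1)] sg_bex[of f "\<lambda>x e. \<not> P x e", OF f p(2)]
      sg_ball[of f "\<lambda>x e. \<not> P x e", OF f p(2)] sg_bex[of f P, OF f p(1)]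
      sg_ball_less[of f P, OF f p(1)] sg_bex_less[of f "\<lambda>x e. \<not> P x e", OF f p(2)]
      sg_ball_less[of f "\<lambda>x e. \<not> P x e", OF f p(2)] sg_bex_less[of f P, OF f p(1)]
      sg_ball_els[of f P, OF f p(1)] sg_bex_els[of f "\<lambda>x e. \<not> P x e", OF f p(2)]
      sg_ball_els[of f "\<lambda>x e. \<not> P x e", OF f p(2)] sg_bex_els[of f P, OF f p(1)]
    unfolding dl_def by simp_all
qed

lemmas dlq = dli dl_els dl_ball dl_bex dl_ball_less dl_bex_less dl_ball_els dl_bex_els
lemmas sgq = sg_conj sg_disj sg_not sg_imp sg_iff dl_eq[THEN dl_sg] dl_le[THEN dl_sg]
  dl_less[THEN dl_sg] dl_in[THEN dl_sg] dl_els[THEN dl_sg] sg_ball sg_bex sg_ball_less sg_bex_less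
  sg_ball_els sg_bex_els sg_ex

lemma dl_least:
  assumes P: "dl S (\<lambda>e. P (e 0))" and "P x"
  shows "\<exists>x. P x \<and> (\<forall>y<x. \<not> P y)"
proof (rule ccontr)
  assume N: "\<not> ?thesis"
  have "\<forall>y\<le>x. \<not> P y" for x
  proof (rule sg_induct[where P = "\<lambda>x. \<forall>y\<le>x. \<not> P y"])
    have "dl S (\<lambda>e. P (e 0))" by (rule P)
    then show "sg S (\<lambda>e. \<forall>y\<le>e 0. \<not> P y)" by (intro sgq fni)
    show "\<forall>y\<le>0. \<not> P y" using N by auto
    fix x assume "\<forall>y\<le>x. \<not> P y"
    then have "\<not> P (x + 1)" using N by (metis less_Suc)
    then show "\<forall>y\<le>x + 1. \<not> P y" using \<open>\<forall>y\<le>x. \<not> P y\<close> by (metis less_Suc le_less)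
  qed
  then show False using \<open>P x\<close> by blast
qed

text \<open>Plays the role of a factorial: a common multiple \<open>m\<close> of all small numbers
  makes the moduli \<open>1 + (y + 1) m\<close> pairwise coprime, as in Goedel's beta
  function.\<close>

lemma common_multiple: fixes k :: 'a shows "\<exists>m::'a. m \<noteq> 0 \<and> (\<forall>j\<le>k. j \<noteq> 0 \<longrightarrow> (\<exists>q. m = j * q))"
proof -
  have "\<exists>m::'a. m \<noteq> 0 \<and> (\<forall>j\<le>k. j \<noteq> 0 \<longrightarrow> (\<exists>q. m = j * q))"
  proof (rule sg_induct[where P = "\<lambda>k. \<exists>m::'a. m \<noteq> 0 \<and> (\<forall>j\<le>k. j \<noteq> 0 \<longrightarrow> (\<exists>q. m = j * q))"])
    show "sg S (\<lambda>e. \<exists>m::'a. m \<noteq> 0 \<and> (\<forall>j\<le>e 0. j \<noteq> 0 \<longrightarrow> (\<exists>q. m = j * q)))"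
      by (intro sgq dlq fni)
    show "\<exists>m::'a. m \<noteq> 0 \<and> (\<forall>j\<le>0. j \<noteq> 0 \<longrightarrow> (\<exists>q. m = j * q))" by (rule exI[of _ 1]) simp
    fix k assume "\<exists>m::'a. m \<noteq> 0 \<and> (\<forall>j\<le>k. j \<noteq> 0 \<longrightarrow> (\<exists>q. m = j * q))"
    then obtain m where m: "m \<noteq> 0" "\<And>j. j \<le> k \<Longrightarrow> j \<noteq> 0 \<Longrightarrow> \<exists>q. m = j * q" by blast
    have "\<exists>q. m * (k + 1) = j * q" if "j \<le> k + 1" "j \<noteq> 0" for j
    proof (cases "j = k + 1")
      case True then show ?thesis by (metis mult.commute)
    next
      case False
      then have "j \<le> k" using that by (metis less_Suc le_less)
      then show ?thesis using m(2) that by (metis mult.assoc)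
    qed
    moreover have "m * (k + 1) \<noteq> 0" using m(1) by (simp add: add_eq_0_iff_both_eq_0)
    ultimately show "\<exists>m::'a. m \<noteq> 0 \<and> (\<forall>j\<le>k + 1. j \<noteq> 0 \<longrightarrow> (\<exists>q. m = j * q))" by blast
  qed
  then show ?thesis .
qed

end

text \<open>With \<open>s = m (y + 1)\<close> the assumption on \<open>c\<close> says that \<open>m (y + 1)\<^sup>2 / d\<close> is,
  up to sign, an inverse of \<open>c\<close> modulo \<open>s + 1\<close>.\<close>

lemma dvd_cancel:
  fixes s :: "'a::arith"
  assumes "s + 1 dvd l * c" and c: "c * w = (s + 1) * w + s * s \<or> c * w + s * s = (s + 1) * w"
  shows "s + 1 dvd l"
proof -
  have "s + 1 dvd l * c * w" using assms(1) by simp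
  moreover have "l * c * w = l * w * (s + 1) + l * (s * s) \<or> l * c * w + l * (s * s) = l * w * (s + 1)"
  proof -
    have "l * (c * w) = l * ((s + 1) * w) + l * (s * s) \<or> l * (c * w) + l * (s * s) = l * ((s + 1) * w)"
      using c by (metis distrib_left)
    then show ?thesis by (simp only: mult_ac)
  qed
  ultimately have "s + 1 dvd l * (s * s)"
    by (metis dvd_add_right_iff dvd_triv_right)
  \<comment> \<open>Modulo \<open>s + 1\<close> the square \<open>s * s\<close> is 1. Adding
    \<open>2 l (s + 1)\<close> gives a form of this fact that needs no subtraction.\<close>
  then have "s + 1 dvd l * (s * s) + (s + 1) * (l + l)" by simp
  also have "l * (s * s) + (s + 1) * (l + l) = (s + 1) * (l * (s + 1)) + l"
    by (simp add: algebra_simps)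
  finally show ?thesis by (metis dvd_add_right_iff dvd_triv_left)
qed

text \<open>The difference \<open>d\<close> of the two indices divides \<open>m\<close>, which
  yields the inverse required by \<open>dvd_cancel\<close>; primes and greatest common divisors are
  thereby avoided.\<close>

lemma modulus_dvd_cancel:
  fixes m :: "'a::arith"
  assumes m: "\<forall>j\<le>k. j \<noteq> 0 \<longrightarrow> (\<exists>q. m = j * q)" and jk: "i < k" "y < k" "i \<noteq> y"
    and dvd: "(y + 1) * m + 1 dvd l * ((i + 1) * m + 1)"
  shows "(y + 1) * m + 1 dvd l"
proof -
  obtain d where d: "d \<noteq> 0" "i = y + d \<or> y = i + d" "d \<le> k"
  proof (cases "i \<le> y")
    case True
    then obtain d where d: "y = i + d" by (metis le_iff_add)
    have "d \<le> y" unfolding d by simp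
    then have "d \<le> k" using jk(2) by order
    moreover have "d \<noteq> 0" using d jk(3) by auto
    ultimately show ?thesis using that[of d] d by blast
  next
    case False
    then obtain d where d: "i = y + d" by (metis le_iff_add linear)
    have "d \<le> i" unfolding d by simp
    then have "d \<le> k" using jk(1) by order
    moreover have "d \<noteq> 0" using d jk(3) by auto
    ultimately show ?thesis using that[of d] d by blast
  qed
  obtain q where q: "m = d * q" using m d by blast
  define w where "w = (y + 1) * (y + 1) * q"
  show ?thesis
  proof (rule dvd_cancel[OF dvd, of w])
    show "((i + 1) * m + 1) * w = ((y + 1) * m + 1) * w + (y + 1) * m * ((y + 1) * m) \<or>
      ((i + 1) * m + 1) * w + (y + 1) * m * ((y + 1) * m) = ((y + 1) * m + 1) * w"
      using d(2)
    proof
      assume i: "i = y + d"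
      show ?thesis unfolding w_def q i by (intro disjI1) (simp add: algebra_simps)
    next
      assume y: "y = i + d"
      have "((i + 1) * m + 1) * w + (y + 1) * m * ((y + 1) * m) = ((i + d + 1) * m + 1) * w"
        unfolding w_def q by (simp add: algebra_simps)
      then show ?thesis using y by simp
    qed
  qed
qed

context rca
begin

text \<open>The number \<open>l\<close> is the product of the moduli of the elements of
  \<open>A\<close> below \<open>j\<close>, built by induction on \<open>j\<close>. Divisibility is
  expressed with a quotient bounded by \<open>l\<close> to keep the induction formula
  Sigma-1.\<close>

lemma code_ex: assumes A: "A \<in> S" shows "\<exists>c. els c = {y. y < k \<and> y \<in> A}"
proof -
  obtain m where m0: "m \<noteq> 0" and m: "\<forall>j\<le>k. j \<noteq> 0 \<longrightarrow> (\<exists>q. m = j * q)"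
    using common_multiple[of k] by blast
  have dq: "(y + 1) * m + 1 dvd l \<longleftrightarrow> (\<exists>q\<le>l. l = ((y + 1) * m + 1) * q)" for y l
  proof -
    have "q \<le> ((y + 1) * m + 1) * q" for m q :: 'a by (simp add: distrib_right)
    then show ?thesis unfolding dvd_def by metis
  qed
  have "j \<le> k \<longrightarrow> (\<exists>l. \<forall>y<k. (\<exists>q\<le>l. l = ((y + 1) * m + 1) * q) \<longleftrightarrow> y < j \<and> y \<in> A)" for j
  proof (rule sg_induct[where P = "\<lambda>j. j \<le> k \<longrightarrow> (\<exists>l. \<forall>y<k. (\<exists>q\<le>l. l = ((y + 1) * m + 1) * q) \<longleftrightarrow> y < j \<and> y \<in> A)"])
    show "sg S (\<lambda>e. e 0 \<le> k \<longrightarrow> (\<exists>l. \<forall>y<k. (\<exists>q\<le>l. l = ((y + 1) * m + 1) * q) \<longleftrightarrow> y < e 0 \<and> y \<in> A))"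
      by (intro sgq dlq fni A)
    \<comment> \<open>The empty product: since \<open>m\<close> is nonzero, no modulus divides
      1.\<close>
    have "\<not> (y + 1) * m + 1 dvd 1" for y
    proof
      assume "(y + 1) * m + 1 dvd 1"
      then obtain q where q: "1 = ((y + 1) * m + 1) * q" by (auto simp: dvd_def)
      have "(y + 1) * m \<noteq> 0" using m0 by simp
      then have "1 < (y + 1) * m + 1" by (simp add: zero_less_iff_neq_zero)
      moreover have "q \<noteq> 0" using q by auto
      ultimately show False using q le_mult by (metis not_less)
    qed
    then show "0 \<le> k \<longrightarrow> (\<exists>l. \<forall>y<k. (\<exists>q\<le>l. l = ((y + 1) * m + 1) * q) \<longleftrightarrow> y < 0 \<and> y \<in> A)"
      unfolding dq[symmetric] by (intro impI exI[of _ 1]) simp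
    fix j assume IH: "j \<le> k \<longrightarrow> (\<exists>l. \<forall>y<k. (\<exists>q\<le>l. l = ((y + 1) * m + 1) * q) \<longleftrightarrow> y < j \<and> y \<in> A)"
    show "j + 1 \<le> k \<longrightarrow> (\<exists>l. \<forall>y<k. (\<exists>q\<le>l. l = ((y + 1) * m + 1) * q) \<longleftrightarrow> y < j + 1 \<and> y \<in> A)"
      unfolding dq[symmetric]
    proof
      assume jk: "j + 1 \<le> k"
      then have j: "j < k" "j \<le> k" using Suc_le less_imp_le by blast+
      obtain l where "\<forall>y<k. (y + 1) * m + 1 dvd l \<longleftrightarrow> y < j \<and> y \<in> A"
        using IH[unfolded dq[symmetric]] j(2) by (elim impE exE) auto
      then have l: "(y + 1) * m + 1 dvd l \<longleftrightarrow> y < j \<and> y \<in> A" if "y < k" for y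
        using that by simp
      show "\<exists>l. \<forall>y<k. (y + 1) * m + 1 dvd l \<longleftrightarrow> y < j + 1 \<and> y \<in> A"
      proof (cases "j \<in> A")
        case True
        have "(y + 1) * m + 1 dvd l * ((j + 1) * m + 1) \<longleftrightarrow> y < j + 1 \<and> y \<in> A" if "y < k" for y
        proof (cases "y = j")
          case False
          have "(y + 1) * m + 1 dvd l * ((j + 1) * m + 1) \<longleftrightarrow> (y + 1) * m + 1 dvd l"
          proof
            assume dv: "(y + 1) * m + 1 dvd l * ((j + 1) * m + 1)"
            have "j \<noteq> y" using False by simp
            then show "(y + 1) * m + 1 dvd l"
              using modulus_dvd_cancel[OF m j(1) that _ dv] by blast
          qed (rule dvd_mult2)
          moreover have "y < j + 1 \<longleftrightarrow> y < j" using False by (simp add: le_less)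
          ultimately show ?thesis using l[OF that] by simp
        qed (use True in simp)
        then show ?thesis by blast
      next
        case False
        have "(y < j + 1 \<and> y \<in> A) \<longleftrightarrow> (y < j \<and> y \<in> A)" for y
          using False by (auto simp: le_less)
        then show ?thesis using l by auto
      qed
    qed
  qed
  from this[of k, unfolded dq[symmetric]] obtain l
    where "\<forall>y<k. (y + 1) * m + 1 dvd l \<longleftrightarrow> y < k \<and> y \<in> A" by auto
  then have l: "(y + 1) * m + 1 dvd l \<longleftrightarrow> y \<in> A" if "y < k" for y
    using that by simp
  then have "els (pr k (pr m l)) = {y. y < k \<and> y \<in> A}"
    unfolding els_def elm_def by auto
  then show ?thesis ..
qed

text \<open>Finiteness in the sense of the model, where the number of elements may be nonstandard;
  by \<open>finsI\<close> every bounded member of \<open>S\<close> is finite.\<close>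

definition fins :: "'a set \<Rightarrow> bool" where
  "fins F \<longleftrightarrow> (\<exists>c. F = els c)"

lemma els_S [simp]: "els c \<in> S"
  using dl_comp[of "\<lambda>x. x \<in> els c"] by (simp add: dl_els fni)

lemma finsI: "F \<in> S \<Longrightarrow> (\<And>x. x \<in> F \<Longrightarrow> x < k) \<Longrightarrow> fins F"
  unfolding fins_def using code_ex[of F k] by (metis (no_types, lifting) Collect_cong Collect_mem_eq)

lemma fins_S: "fins F \<Longrightarrow> F \<in> S"
  by (auto simp: fins_def)

lemma fins_bounded: "fins F \<Longrightarrow> \<exists>k. \<forall>x\<in>F. x < k"
  unfolding fins_def using elm_less by blast

lemma S_Un: "A \<in> S \<Longrightarrow> B \<in> S \<Longrightarrow> A \<union> B \<in> S"
  using dl_comp[of "\<lambda>x. x \<in> A \<or> x \<in> B"] by (simp add: Un_def dlq fni)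

lemma S_Diff: "A \<in> S \<Longrightarrow> B \<in> S \<Longrightarrow> A - B \<in> S"
  using dl_comp[of "\<lambda>x. x \<in> A \<and> x \<notin> B"] by (simp add: set_diff_eq dlq fni)

lemma S_sing: "{y} \<in> S"
  using dl_comp[of "\<lambda>x. x = y"] by (simp add: dlq fni)

lemma S_empty: "{} \<in> S"
  using S_Diff[OF S_sing[of 0] S_sing[of 0]] by simp

lemma fins_empty: "fins {}"
  by (rule finsI[OF S_empty]) simp

lemma fins_subset: "fins F \<Longrightarrow> A \<in> S \<Longrightarrow> A \<subseteq> F \<Longrightarrow> fins A"
  using fins_bounded finsI by (metis subsetD)

lemma fins_Un: assumes "fins F" "fins G" shows "fins (F \<union> G)"
proof -
  obtain k l where "\<forall>x\<in>F. x < k" "\<forall>x\<in>G. x < l" using assms fins_bounded by metis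
  then have "x < k + l" if "x \<in> F \<union> G" for x
    using that by (metis Un_iff add_increasing add_increasing2 less_le_trans order_refl zero_le)
  then show ?thesis using assms fins_S S_Un finsI by blast
qed

lemma fins_insert: "fins F \<Longrightarrow> fins (insert y F)"
proof -
  have "fins {y}" by (rule finsI[OF S_sing, of _ "y + 1"]) simp
  then show "fins F \<Longrightarrow> fins (insert y F)" using fins_Un[of "{y}" F] by simp
qed

end

subsection \<open>Cardinality\<close>

definition hb :: "'a::arith \<Rightarrow> 'a \<Rightarrow> 'a set \<Rightarrow> bool" where
  "hb f k F \<longleftrightarrow> (\<forall>x<k. \<exists>y\<in>F. pr x y \<in> els f) \<and> (\<forall>y\<in>F. \<exists>x<k. pr x y \<in> els f) \<and>
     (\<forall>x y. pr x y \<in> els f \<longrightarrow> (\<forall>x' y'. pr x' y' \<in> els f \<longrightarrow> (x = x' \<longleftrightarrow> y = y')))"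

definition hcard :: "'a::arith set \<Rightarrow> 'a \<Rightarrow> bool" where
  "hcard F k \<longleftrightarrow> (\<exists>f. hb f k F)"

text \<open>In contrast to \<open>hb\<close>, no stray pairs outside the domain and range are
  allowed, so that pairs can be removed and exchanged freely. By \<open>hcard_bijg\<close> the two
  notions give the same cardinalities.\<close>

definition bijg :: "'a::arith set \<Rightarrow> 'a \<Rightarrow> 'a set \<Rightarrow> bool" where
  "bijg G k F \<longleftrightarrow> (\<forall>x<k. \<exists>y. pr x y \<in> G) \<and> (\<forall>y\<in>F. \<exists>x. pr x y \<in> G) \<and>
     (\<forall>x y. pr x y \<in> G \<longrightarrow> x < k \<and> y \<in> F) \<and>
     (\<forall>x y x' y'. pr x y \<in> G \<longrightarrow> pr x' y' \<in> G \<longrightarrow> (x = x' \<longleftrightarrow> y = y'))"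

lemma bijg_dom: "bijg G k F \<Longrightarrow> x < k \<Longrightarrow> \<exists>y. pr x y \<in> G"
  and bijg_rng: "bijg G k F \<Longrightarrow> y \<in> F \<Longrightarrow> \<exists>x. pr x y \<in> G"
  and bijg_in: "bijg G k F \<Longrightarrow> pr x y \<in> G \<Longrightarrow> x < k \<and> y \<in> F"
  and bijg_inj: "bijg G k F \<Longrightarrow> pr x y \<in> G \<Longrightarrow> pr x' y' \<in> G \<Longrightarrow> x = x' \<longleftrightarrow> y = y'"
  unfolding bijg_def by blast+

lemma bijgI:
  assumes "\<And>x. x < k \<Longrightarrow> \<exists>y. pr x y \<in> G" "\<And>y. y \<in> F \<Longrightarrow> \<exists>x. pr x y \<in> G"
    "\<And>x y. pr x y \<in> G \<Longrightarrow> x < k \<and> y \<in> F"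
    "\<And>x y x' y'. pr x y \<in> G \<Longrightarrow> pr x' y' \<in> G \<Longrightarrow> x = x' \<longleftrightarrow> y = y'"
  shows "bijg G k F"
  unfolding bijg_def using assms by blast

lemma bijg_remove:
  assumes G: "bijg G (k + 1) F" and y: "pr k y \<in> G"
  shows "bijg (G - {pr k y}) k (F - {y})"
proof (rule bijgI)
  fix x assume "x < k"
  moreover then have "x < k + 1" by simp
  ultimately show "\<exists>y'. pr x y' \<in> G - {pr k y}" using bijg_dom[OF G] by fastforce
next
  fix z assume z: "z \<in> F - {y}"
  then obtain x where "pr x z \<in> G" using bijg_rng[OF G] by blast
  then show "\<exists>x. pr x z \<in> G - {pr k y}" using z by auto
next
  fix x z assume xz: "pr x z \<in> G - {pr k y}"
  then have "x \<noteq> k" "z \<noteq> y" using bijg_inj[OF G, of x z k y] y by auto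
  then show "x < k \<and> z \<in> F - {y}" using bijg_in[OF G, of x z] xz by (auto simp: le_less)
qed (use bijg_inj[OF G] in blast)

definition lcode :: "'a::arith \<Rightarrow> bool" where
  "lcode c \<longleftrightarrow> (\<forall>d<c. els d \<noteq> els c)"

definition xl :: "'a::arith \<Rightarrow> bool" where
  "xl c \<longleftrightarrow> lcode c \<and> (\<exists>a\<in>els c. (\<forall>y\<in>els c. a \<le> y) \<and> hcard (els c) (a + 1))"

definition inf_set :: "'a::arith set \<Rightarrow> bool" where
  "inf_set X \<longleftrightarrow> (\<forall>x. \<exists>y\<ge>x. y \<in> X)"

context rca
begin

lemma dl_hb: "dl S (\<lambda>e. hb (e 0) (e 1) (els (e 2)))"
proof -
  have "dl S (\<lambda>e. (\<forall>x<e 1. \<exists>y\<in>els (e 2). pr x y \<in> els (e 0)) \<and> (\<forall>y\<in>els (e 2). \<exists>x<e 1. pr x y \<in> els (e 0)) \<and>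
     (\<forall>x<e 0. \<forall>y<e 0. pr x y \<in> els (e 0) \<longrightarrow> (\<forall>x'<e 0. \<forall>y'<e 0. pr x' y' \<in> els (e 0) \<longrightarrow> (x = x' \<longleftrightarrow> y = y'))))"
    by (intro dlq fni)
  moreover have "pr x y \<in> els f \<Longrightarrow> x < f \<and> y < f" for x y f :: 'a
    using elm_less pr_le1 pr_le2 order.strict_trans1 by metis
  ultimately show ?thesis unfolding hb_def by (elim dl_cong) blast
qed

lemma dl_hbi: "fn S f \<Longrightarrow> fn S g \<Longrightarrow> fn S h \<Longrightarrow> dl S (\<lambda>e. hb (f e) (g e) (els (h e)))"
  by (rule dl_app3[where P = "\<lambda>f k c. hb f k (els c)", OF dl_hb])

lemma hcard_bijg: assumes F: "fins F" shows "hcard F k \<longleftrightarrow> (\<exists>G. fins G \<and> bijg G k F)"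
proof
  assume "hcard F k"
  then obtain f where f: "hb f k F" by (auto simp: hcard_def)
  define G where "G = {p. p \<in> els f \<and> (\<exists>x\<le>p. \<exists>y\<le>p. p = pr x y \<and> x < k \<and> y \<in> F)}"
  have "G \<in> S" unfolding G_def by (rule dl_comp) (intro dlq fni fins_S F)
  then have "fins G" by (rule fins_subset[rotated]) (auto simp: G_def fins_def)
  moreover have "pr x y \<in> G \<longleftrightarrow> pr x y \<in> els f \<and> x < k \<and> y \<in> F" for x y
    unfolding G_def by auto
  then have "bijg G k F" using f unfolding bijg_def hb_def by simp blast
  ultimately show "\<exists>G. fins G \<and> bijg G k F" by blast
next
  assume "\<exists>G. fins G \<and> bijg G k F"
  then obtain f where "bijg (els f) k F" by (auto simp: fins_def)
  then have "hb f k F" unfolding bijg_def hb_def by blast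
  then show "hcard F k" by (auto simp: hcard_def)
qed

lemma hcard_empty: "hcard {} (0::'a)"
  unfolding hcard_bijg[OF fins_empty] by (intro exI[of _ "{}"]) (auto simp: fins_empty bijg_def)

lemma hcard_0: "fins F \<Longrightarrow> hcard F 0 \<longleftrightarrow> F = {}"
  using hcard_empty by (auto simp: hcard_def hb_def)

lemma hcard_insert: assumes "fins F" "hcard F k" "y \<notin> F" shows "hcard (insert y F) (k + 1)"
proof -
  obtain G where G: "fins G" "bijg G k F" using assms hcard_bijg by blast
  have "x = k \<Longrightarrow> pr x z \<notin> G" for x z using G(2) by (auto simp: bijg_def)
  then have "bijg (insert (pr k y) G) (k + 1) (insert y F)"
    using G(2) assms(3) unfolding bijg_def less_Suc_cases by simp blast
  then show ?thesis using fins_insert[OF G(1)] hcard_bijg[OF fins_insert[OF assms(1)]] by blast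
qed

text \<open>The pigeonhole principle by Pi-1 induction on \<open>k\<close>: the image
  \<open>y\<close> of the last index is deleted from both bijections.\<close>

lemma hcard_unique: assumes "fins F" "hcard F k" "hcard F k'" shows "k = k'"
proof -
  have "\<not> (\<exists>(c::'a) f k' f'. hb f k (els c) \<and> hb f' k' (els c) \<and> k \<noteq> k')"
  proof (rule pi_induct[where P = "\<lambda>k. \<not> (\<exists>(c::'a) f k' f'. hb f k (els c) \<and> hb f' k' (els c) \<and> k \<noteq> k')"])
    show "sg S (\<lambda>e. \<not> \<not> (\<exists>(c::'a) f k' f'. hb f (e 0) (els c) \<and> hb f' k' (els c) \<and> e 0 \<noteq> k'))"
      unfolding not_not by (intro sgq dlq fni dl_hbi[THEN dl_sg])
    show "\<not> (\<exists>(c::'a) f k' f'. hb f 0 (els c) \<and> hb f' k' (els c) \<and> 0 \<noteq> k')"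
    proof (intro notI, elim exE conjE)
      fix c f k' f' :: 'a
      assume "hb f 0 (els c)" "hb f' k' (els c)" "0 \<noteq> k'"
      moreover have "0 < k'" using \<open>0 \<noteq> k'\<close> zero_less_iff_neq_zero by blast
      ultimately show False unfolding hb_def by auto
    qed
    fix k assume IH: "\<not> (\<exists>(c::'a) f k' f'. hb f k (els c) \<and> hb f' k' (els c) \<and> k \<noteq> k')"
    show "\<not> (\<exists>(c::'a) f k' f'. hb f (k + 1) (els c) \<and> hb f' k' (els c) \<and> k + 1 \<noteq> k')"
    proof (intro notI, elim exE conjE)
      fix c f k' f' :: 'a
      assume A: "hb f (k + 1) (els c)" "hb f' k' (els c)" "k + 1 \<noteq> k'"
      let ?F = "els c"
      have F: "fins ?F" by (auto simp: fins_def)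
      obtain G G' where G: "fins G" "bijg G (k + 1) ?F" and G': "fins G'" "bijg G' k' ?F"
        using A hcard_bijg[OF F] unfolding hcard_def by metis
      have "k < k + 1" by simp
      then obtain y where y: "pr k y \<in> G" "y \<in> ?F" using G(2) unfolding bijg_def by blast
      have F': "fins (?F - {y})" using F by (rule fins_subset) (auto intro: S_Diff S_sing)
      have "fins (G - {pr k y})" using G(1) by (rule fins_subset) (auto intro: S_Diff S_sing fins_S G)
      moreover have "bijg (G - {pr k y}) k (?F - {y})"
        using G(2) y(1) by (rule bijg_remove)
      ultimately have c1: "hcard (?F - {y}) k" using hcard_bijg[OF F'] by blast
      have "k' \<noteq> 0" using G'(2) y unfolding bijg_def by fastforce
      then obtain j where j: "k' = j + 1" using zero_or_Suc by blast
      obtain i where i: "pr i y \<in> G'" using G'(2) y unfolding bijg_def by blast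
      \<comment> \<open>In the second bijection \<open>y\<close> may sit at an index
        \<open>i\<close> other than the last one \<open>j\<close>. Both pairs are taken out, and the
        value \<open>z\<close> at \<open>j\<close> is then moved to \<open>i\<close>.\<close>
      define H where "H = {p. p \<in> G' \<union> {} \<and> (\<exists>a\<le>p. \<exists>b\<le>p. p = pr a b \<and> a \<noteq> j \<and> a \<noteq> i)}"
      have "H \<in> S" unfolding H_def by (rule dl_comp) (intro dlq fni S_Un S_empty fins_S G')
      have H: "pr a b \<in> H \<longleftrightarrow> pr a b \<in> G' \<and> a \<noteq> j \<and> a \<noteq> i" for a b
        unfolding H_def by auto
      have fH: "fins H" using G'(1) \<open>H \<in> S\<close> by (rule fins_subset) (auto simp: H_def)
      note dom = bijg_dom[OF G'(2)] and rng = bijg_rng[OF G'(2)]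
        and inn = bijg_in[OF G'(2)] and inj = bijg_inj[OF G'(2)]
      have "\<exists>H'. fins H' \<and> bijg H' j (?F - {y})"
      proof (cases "i = j")
        case True
        have "bijg (G' - {pr j y}) j (?F - {y})"
          using G'(2) i unfolding j True by (rule bijg_remove)
        moreover have "fins (G' - {pr j y})" using G'(1) by (rule fins_subset) (auto intro: S_Diff S_sing fins_S G')
        ultimately show ?thesis by blast
      next
        case False
        have "j < k'" using j by simp
        then obtain z where z: "pr j z \<in> G'" using dom by blast
        have zy: "z \<noteq> y" using inj[OF z i] False by simp
        have zF: "z \<in> ?F" using inn[OF z] by simp
        have ij: "i < j" using inn[OF i] False j by (simp add: le_less)
        have "bijg (insert (pr i z) H) j (?F - {y})"
        proof (rule bijgI)
          fix x assume x: "x < j"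
          show "\<exists>b. pr x b \<in> insert (pr i z) H"
          proof (cases "x = i")
            case False
            obtain b where "pr x b \<in> G'" using dom[of x] less_imp_le[OF x] j by auto
            then show ?thesis using False x H by auto
          qed auto
        next
          fix b assume b: "b \<in> ?F - {y}"
          show "\<exists>x. pr x b \<in> insert (pr i z) H"
          proof (cases "b = z")
            case False
            obtain x where x: "pr x b \<in> G'" using rng b by blast
            have "x \<noteq> j" "x \<noteq> i" using inj[OF x z] inj[OF x i] b False by auto
            then show ?thesis using H x by blast
          qed auto
        next
          fix x b assume xb: "pr x b \<in> insert (pr i z) H"
          show "x < j \<and> b \<in> ?F - {y}"
          proof (cases "pr x b = pr i z")
            case True
            then show ?thesis using ij zy zF by simp
          next
            case False
            then have x: "pr x b \<in> G'" "x \<noteq> j" "x \<noteq> i" using xb H by auto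
            then have "b \<noteq> y" using inj[OF x(1) i] by simp
            then show ?thesis using inn[OF x(1)] x(2) j by (simp add: le_less)
          qed
        next
          fix x b x' b' assume "pr x b \<in> insert (pr i z) H" "pr x' b' \<in> insert (pr i z) H"
          then consider "x = i" "b = z" "x' = i" "b' = z"
            | "x = i" "b = z" "pr x' b' \<in> G'" "x' \<noteq> j" "x' \<noteq> i"
            | "x' = i" "b' = z" "pr x b \<in> G'" "x \<noteq> j" "x \<noteq> i"
            | "pr x b \<in> G'" "pr x' b' \<in> G'"
            using H by auto
          then show "x = x' \<longleftrightarrow> b = b'"
          proof cases
            case 2 then show ?thesis using inj[OF z 2(3)] by auto
          next
            case 3 then show ?thesis using inj[OF 3(3) z] by auto
          next
            case 4 then show ?thesis by (rule inj)
          qed auto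
        qed
        then show ?thesis using fins_insert[OF fH] by blast
      qed
      then have c2: "hcard (?F - {y}) j" using hcard_bijg[OF F'] by blast
      obtain c' where "?F - {y} = els c'" using F' by (auto simp: fins_def)
      then have "k = j" using c1 c2 IH unfolding hcard_def by metis
      then show False using A(3) j by simp
    qed
  qed
  then show ?thesis using assms unfolding fins_def hcard_def by blast
qed

text \<open>Induction on \<open>j\<close> for the part of the set below \<open>j\<close>. A coded
  subset \<open>d\<close> stands for this part because the induction formula must speak of
  codes.\<close>

lemma hcard_ex: assumes "fins F" shows "\<exists>k. hcard F k"
proof -
  obtain c where c: "F = els c" using assms by (auto simp: fins_def)
  have "\<exists>d. (\<forall>y\<in>els d. y < j \<and> y \<in> els c) \<and> (\<forall>y\<in>els c. y < j \<longrightarrow> y \<in> els d) \<and> (\<exists>f k. hb f k (els d))" for j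
  proof (rule sg_induct[where P = "\<lambda>j. \<exists>d. (\<forall>y\<in>els d. y < j \<and> y \<in> els c) \<and> (\<forall>y\<in>els c. y < j \<longrightarrow> y \<in> els d) \<and> (\<exists>f k. hb f k (els d))"])
    show "sg S (\<lambda>e. \<exists>d. (\<forall>y\<in>els d. y < e 0 \<and> y \<in> els c) \<and> (\<forall>y\<in>els c. y < e 0 \<longrightarrow> y \<in> els d) \<and> (\<exists>f k. hb f k (els d)))"
      by (intro sgq dlq fni dl_hbi[THEN dl_sg])
    obtain d :: 'a where d: "{} = els d" using fins_empty unfolding fins_def by blast
    then show "\<exists>d. (\<forall>y\<in>els d. y < 0 \<and> y \<in> els c) \<and> (\<forall>y\<in>els c. y < 0 \<longrightarrow> y \<in> els d) \<and> (\<exists>f k. hb f k (els d))"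
      using hcard_empty unfolding hcard_def by (intro exI[of _ d]) (auto simp flip: d)
    fix j
    assume "\<exists>d. (\<forall>y\<in>els d. y < j \<and> y \<in> els c) \<and> (\<forall>y\<in>els c. y < j \<longrightarrow> y \<in> els d) \<and> (\<exists>f k. hb f k (els d))"
    then obtain d f k where d: "\<forall>y\<in>els d. y < j \<and> y \<in> els c" "\<forall>y\<in>els c. y < j \<longrightarrow> y \<in> els d" "hb f k (els d)"
      by blast
    show "\<exists>d. (\<forall>y\<in>els d. y < j + 1 \<and> y \<in> els c) \<and> (\<forall>y\<in>els c. y < j + 1 \<longrightarrow> y \<in> els d) \<and> (\<exists>f k. hb f k (els d))"
    proof (cases "j \<in> els c")
      case False
      then have "(\<forall>y\<in>els d. y < j + 1 \<and> y \<in> els c) \<and> (\<forall>y\<in>els c. y < j + 1 \<longrightarrow> y \<in> els d)"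
        using d less_Suc_cases by metis
      then show ?thesis using d(3) by blast
    next
      case True
      have fd: "fins (els d)" by (auto simp: fins_def)
      obtain d' where d': "els d' = insert j (els d)" using fins_insert[OF fd] unfolding fins_def by metis
      have "hcard (insert j (els d)) (k + 1)" using d fd by (intro hcard_insert) (auto simp: hcard_def)
      then have "\<exists>f k. hb f k (els d')" unfolding d' hcard_def by blast
      moreover have "(\<forall>y\<in>els d'. y < j + 1 \<and> y \<in> els c) \<and> (\<forall>y\<in>els c. y < j + 1 \<longrightarrow> y \<in> els d')"
        unfolding d' less_Suc_cases using d True by blast
      ultimately show ?thesis by blast
    qed
  qed
  from this[of c] obtain d where d: "\<forall>y\<in>els d. y \<in> els c" "\<forall>y\<in>els c. y < c \<longrightarrow> y \<in> els d" "\<exists>f k. hb f k (els d)"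
    by blast
  then have "els d = els c" using elm_less by blast
  then show ?thesis using d c by (auto simp: hcard_def)
qed

lemma hcard_remove: "fins F \<Longrightarrow> y \<notin> F \<Longrightarrow> hcard (insert y F) (k + 1) \<Longrightarrow> hcard F k"
  using hcard_ex hcard_insert hcard_unique fins_insert by (metis add_right_cancel)

text \<open>By existence and uniqueness of cardinalities, failing to have a given one means having a
  different one, which is again Sigma-1.\<close>

lemma dl_hcard: "fn S f \<Longrightarrow> fn S g \<Longrightarrow> dl S (\<lambda>e. hcard (els (f e)) (g e))"
proof (rule dl_app2[where P = "\<lambda>c k. hcard (els c) k"])
  have 1: "sg S (\<lambda>e. hcard (els (e 0)) (e 1))"
    unfolding hcard_def by (intro sgq fni dl_hbi[THEN dl_sg])
  have "sg S (\<lambda>e. \<exists>k. k \<noteq> e 1 \<and> (\<exists>f. hb f k (els (e 0))))"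
    by (intro sgq dlq fni dl_hbi[THEN dl_sg])
  then have "sg S (\<lambda>e. \<not> hcard (els (e 0)) (e 1))"
  proof (rule sg_cong)
    fix e :: "nat \<Rightarrow> 'a"
    have F: "fins (els (e 0))" by (auto simp: fins_def)
    show "(\<exists>k. k \<noteq> e 1 \<and> (\<exists>f. hb f k (els (e 0)))) = (\<not> hcard (els (e 0)) (e 1))"
      using hcard_ex[OF F] hcard_unique[OF F] unfolding hcard_def by metis
  qed
  then show "dl S (\<lambda>e. hcard (els (e 0)) (e 1))" using 1 by (simp add: dl_def)
qed

lemma dl_els_eq: "fn S f \<Longrightarrow> fn S g \<Longrightarrow> dl S (\<lambda>e. els (f e) = els (g e))"
proof (rule dl_app2[where P = "\<lambda>c d. els c = els d"])
  have "dl S (\<lambda>e. (\<forall>y\<in>els (e 0). y \<in> els (e 1)) \<and> (\<forall>y\<in>els (e 1). y \<in> els (e 0)))"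
    by (intro dlq fni)
  then show "dl S (\<lambda>e. els (e 0) = els (e 1))" by (rule dl_cong) auto
qed

lemma dl_lcode: "fn S f \<Longrightarrow> dl S (\<lambda>e. lcode (f e))"
  by (rule dl_app1[where P = lcode]) (unfold lcode_def, intro dlq dl_els_eq fni)

lemma dl_xl: "fn S f \<Longrightarrow> dl S (\<lambda>e. xl (f e))"
  by (rule dl_app1[where P = xl]) (unfold xl_def, intro dlq dl_lcode dl_hcard fni)

lemma lcode_ex: fixes c :: 'a shows "\<exists>d. lcode d \<and> els d = els c"
proof -
  have "\<exists>d. els d = els c \<and> (\<forall>d'<d. els d' \<noteq> els c)"
    by (rule dl_least[where P = "\<lambda>d. els d = els c" and x = c]) (intro dl_els_eq fni, rule refl)
  then show ?thesis unfolding lcode_def by metis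
qed

lemma lcode_fins: "fins F \<Longrightarrow> \<exists>d. lcode d \<and> els d = F"
  using lcode_ex unfolding fins_def by metis

lemma lcode_unique: "lcode c \<Longrightarrow> lcode d \<Longrightarrow> els c = els d \<Longrightarrow> c = d"
  unfolding lcode_def by (metis linorder_neqE)

text \<open>The source of all blocks used below. The size \<open>k\<close> may be nonstandard, so
  the induction takes place in the model.\<close>

lemma subset_of_card:
  assumes L: "L \<in> S" "inf_set L"
  shows "\<exists>F. fins F \<and> F \<subseteq> L \<and> (\<forall>y\<in>F. b < y) \<and> hcard F k"
proof -
  have "\<exists>c. (\<forall>y\<in>els c. y \<in> L \<and> b < y) \<and> (\<exists>f. hb f k (els c))"
  proof (rule sg_induct[where P = "\<lambda>k. \<exists>c. (\<forall>y\<in>els c. y \<in> L \<and> b < y) \<and> (\<exists>f. hb f k (els c))"])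
    show "sg S (\<lambda>e. \<exists>c. (\<forall>y\<in>els c. y \<in> L \<and> b < y) \<and> (\<exists>f. hb f (e 0) (els c)))"
      by (intro sgq dlq fni L dl_hbi[THEN dl_sg])
    show "\<exists>c. (\<forall>y\<in>els c. y \<in> L \<and> b < y) \<and> (\<exists>f. hb f 0 (els c))"
      using hcard_empty fins_empty unfolding hcard_def fins_def by (metis empty_iff)
    fix k assume "\<exists>c. (\<forall>y\<in>els c. y \<in> L \<and> b < y) \<and> (\<exists>f. hb f k (els c))"
    then obtain c f where c: "\<forall>y\<in>els c. y \<in> L \<and> b < y" "hb f k (els c)" by blast
    have F: "fins (els c)" by (auto simp: fins_def)
    obtain y where y: "y \<ge> b + c + 1" "y \<in> L" using L by (auto simp: inf_set_def)
    then have "b + c < y" by (simp add: Suc_le)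
    then have "y \<notin> els c" "b < y" using elm_less[of y c] by (metis add_increasing zero_le less_le_not_le order.strict_trans1 order_refl add_increasing2)+
    then have "hcard (insert y (els c)) (k + 1)" using c F by (intro hcard_insert) (auto simp: hcard_def)
    moreover obtain c' where "els c' = insert y (els c)" using fins_insert[OF F] unfolding fins_def by metis
    ultimately show "\<exists>c. (\<forall>y\<in>els c. y \<in> L \<and> b < y) \<and> (\<exists>f. hb f (k + 1) (els c))"
      using c(1) y(2) \<open>b < y\<close> unfolding hcard_def by (metis insert_iff)
  qed
  then show ?thesis unfolding fins_def hcard_def by blast
qed

end

section \<open>From \<open>RT(!\<omega>)\<close> to arithmetical comprehension\<close>

definition col :: "'a::arith set \<Rightarrow> bool" where
  "col C \<longleftrightarrow> (\<forall>x\<in>C. \<exists>c i. xl c \<and> i \<le> 1 \<and> x = pr c i) \<and> (\<forall>c. xl c \<longrightarrow> (pr c 0 \<in> C \<longleftrightarrow> pr c 1 \<notin> C))"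

definition rtx :: "'a::arith set set \<Rightarrow> bool" where
  "rtx S \<longleftrightarrow> (\<forall>M\<in>S. inf_set M \<longrightarrow> (\<forall>C\<in>S. col C \<longrightarrow>
     (\<exists>L\<in>S. inf_set L \<and> L \<subseteq> M \<and> (\<exists>i\<le>1. \<forall>c. xl c \<and> els c \<subseteq> L \<longrightarrow> pr c i \<in> C))))"

text \<open>The value 0 outside the range of pairing makes the projection total, as
  \<open>fn\<close> presupposes.\<close>

definition u1 :: "'a::arith \<Rightarrow> 'a" where
  "u1 z = (if \<exists>x y. z = pr x y then (THE x. \<exists>y. z = pr x y) else 0)"

definition u2 :: "'a::arith \<Rightarrow> 'a" where
  "u2 z = (if \<exists>x y. z = pr x y then (THE y. \<exists>x. z = pr x y) else 0)"

lemma u_pr [simp]: "u1 (pr x y) = x" "u2 (pr x y) = y"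
  unfolding u1_def u2_def by auto

text \<open>Environments are cut off after finitely many variables and packed into one number;
  membership of that number in a set can then replace a formula.\<close>

primrec dec :: "nat \<Rightarrow> 'a::arith \<Rightarrow> 'a" where
  "dec 0 z = u1 z"
| "dec (Suc i) z = dec i (u2 z)"

primrec tup :: "nat \<Rightarrow> (nat \<Rightarrow> 'a::arith) \<Rightarrow> 'a" where
  "tup 0 e = 0"
| "tup (Suc n) e = pr (e 0) (tup n (\<lambda>i. e (Suc i)))"

lemma dec_tup: "i < n \<Longrightarrow> dec i (tup n e) = e i"
  by (induction n arbitrary: i e) (auto simp: less_Suc_eq_0_disj)

abbreviation XPr :: "'a xtm \<Rightarrow> 'a xtm \<Rightarrow> 'a xtm" where
  "XPr t u \<equiv> XAdd (XMul (XAdd t u) (XAdd t u)) t"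

primrec xtup :: "nat \<Rightarrow> nat \<Rightarrow> 'a::arith xtm" where
  "xtup 0 k = XC 0"
| "xtup (Suc n) k = XPr (XV k) (xtup n (Suc k))"

lemma xev_xtup: "xev e (xtup n k) = tup n (\<lambda>i. e (i + k))"
  by (induction n arbitrary: k) (auto simp: pr_def)

lemma xev_bound: "\<exists>n. \<forall>e e'. (\<forall>i<n. e i = e' i) \<longrightarrow> xev e t = xev e' t"
proof (induction t)
  case (XAdd t u)
  then obtain m n where "\<forall>e e'. (\<forall>i<m. e i = e' i) \<longrightarrow> xev e t = xev e' t"
    "\<forall>e e'. (\<forall>i<n. e i = e' i) \<longrightarrow> xev e u = xev e' u" by blast
  then have "\<forall>e e'. (\<forall>i<max m n. e i = e' i) \<longrightarrow> xev e (XAdd t u) = xev e' (XAdd t u)"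
    by (metis less_max_iff_disj xev.simps(3))
  then show ?case ..
next
  case (XMul t u)
  then obtain m n where "\<forall>e e'. (\<forall>i<m. e i = e' i) \<longrightarrow> xev e t = xev e' t"
    "\<forall>e e'. (\<forall>i<n. e i = e' i) \<longrightarrow> xev e u = xev e' u" by blast
  then have "\<forall>e e'. (\<forall>i<max m n. e i = e' i) \<longrightarrow> xev e (XMul t u) = xev e' (XMul t u)"
    by (metis less_max_iff_disj xev.simps(4))
  then show ?case ..
qed auto

lemma xsat_bound: "\<exists>n. \<forall>e e'. (\<forall>i<n. e i = e' i) \<longrightarrow> xsat e p = xsat e' p"
proof (induction p)
  case (XEq t u)
  obtain m n where "\<forall>e e'. (\<forall>i<m. e i = e' i) \<longrightarrow> xev e t = xev e' t"
    "\<forall>e e'. (\<forall>i<n. e i = e' i) \<longrightarrow> xev e u = xev e' u" using xev_bound by metis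
  then show ?case by (intro exI[of _ "max m n"]) (metis less_max_iff_disj xsat.simps(1))
next
  case (XLe t u)
  obtain m n where "\<forall>e e'. (\<forall>i<m. e i = e' i) \<longrightarrow> xev e t = xev e' t"
    "\<forall>e e'. (\<forall>i<n. e i = e' i) \<longrightarrow> xev e u = xev e' u" using xev_bound by metis
  then show ?case by (intro exI[of _ "max m n"]) (metis less_max_iff_disj xsat.simps(2))
next
  case (XIn t A)
  then show ?case using xev_bound[of t] by (metis xsat.simps(3))
next
  case (XNeg p)
  then show ?case by (metis xsat.simps(4))
next
  case (XImp p q)
  then obtain m n where "\<forall>e e'. (\<forall>i<m. e i = e' i) \<longrightarrow> xsat e p = xsat e' p"
    "\<forall>e e'. (\<forall>i<n. e i = e' i) \<longrightarrow> xsat e q = xsat e' q" by blast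
  then show ?case by (intro exI[of _ "max m n"]) (metis less_max_iff_disj xsat.simps(5))
next
  case (XBEx t p)
  obtain m where m: "\<forall>e e'. (\<forall>i<m. e i = e' i) \<longrightarrow> xev e t = xev e' t" using xev_bound by metis
  obtain n where n: "\<forall>e e'. (\<forall>i<n. e i = e' i) \<longrightarrow> xsat e p = xsat e' p" using XBEx by blast
  have "xsat e (XBEx t p) = xsat e' (XBEx t p)" if "\<forall>i<max m n. e i = e' i" for e e'
  proof -
    have "xev e t = xev e' t" using m that by auto
    moreover have "xsat (x ## e) p = xsat (x ## e') p" for x
      using that by (intro n[rule_format]) (auto simp: cns_def split: nat.split)
    ultimately show ?thesis by simp
  qed
  then show ?case by blast
next
  case (XEx p)
  then obtain n where n: "\<forall>e e'. (\<forall>i<n. e i = e' i) \<longrightarrow> xsat e p = xsat e' p" by blast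
  have "xsat e (XEx p) = xsat e' (XEx p)" if "\<forall>i<n. e i = e' i" for e e'
  proof -
    have "xsat (x ## e) p = xsat (x ## e') p" for x
      using that by (intro n[rule_format]) (auto simp: cns_def split: nat.split)
    then show ?thesis by simp
  qed
  then show ?case by blast
qed

context rca
begin

lemma fn_u1: "fn S f \<Longrightarrow> fn S (\<lambda>e. u1 (f e))" and fn_u2: "fn S f \<Longrightarrow> fn S (\<lambda>e. u2 (f e))"
proof -
  have "dl S (\<lambda>e. (\<exists>y\<le>e 1. e 1 = pr (e 0) y) \<or> (\<not> (\<exists>x\<le>e 1. \<exists>y\<le>e 1. e 1 = pr x y)) \<and> e 0 = 0)"
    by (intro dlq fni)
  moreover have "(\<exists>y\<le>z. z = pr x y) \<or> (\<not> (\<exists>x\<le>z. \<exists>y\<le>z. z = pr x y)) \<and> x = 0 \<longleftrightarrow> x = u1 z" for x z :: 'a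
  proof (cases "\<exists>x y. z = pr x y")
    case True
    then obtain a b where z: "z = pr a b" by blast
    then have "\<exists>x\<le>z. \<exists>y\<le>z. z = pr x y" by auto
    then show ?thesis unfolding z by auto
  qed (auto simp: u1_def)
  ultimately have "dl S (\<lambda>e. e 0 = u1 (e 1))" by simp
  then have *: "sg S (\<lambda>e. e 0 = u1 (e 1))" by (rule dl_sg)
  have "dl S (\<lambda>e. (\<exists>x\<le>e 1. e 1 = pr x (e 0)) \<or> (\<not> (\<exists>x\<le>e 1. \<exists>y\<le>e 1. e 1 = pr x y)) \<and> e 0 = 0)"
    by (intro dlq fni)
  moreover have "(\<exists>x\<le>z. z = pr x y) \<or> (\<not> (\<exists>x\<le>z. \<exists>y\<le>z. z = pr x y)) \<and> y = 0 \<longleftrightarrow> y = u2 z" for y z :: 'a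
  proof (cases "\<exists>x y. z = pr x y")
    case True
    then obtain a b where z: "z = pr a b" by blast
    then have "\<exists>x\<le>z. \<exists>y\<le>z. z = pr x y" by auto
    then show ?thesis unfolding z by auto
  qed (auto simp: u2_def)
  ultimately have "dl S (\<lambda>e. e 0 = u2 (e 1))" by simp
  then have **: "sg S (\<lambda>e. e 0 = u2 (e 1))" by (rule dl_sg)
  assume f: "fn S f"
  show "fn S (\<lambda>e. u1 (f e))" unfolding fn_def
    by (rule sg_app2[where P = "\<lambda>x z. x = u1 z", OF * fn_var fn_Suc[OF f]])
  show "fn S (\<lambda>e. u2 (f e))" unfolding fn_def
    by (rule sg_app2[where P = "\<lambda>x z. x = u2 z", OF ** fn_var fn_Suc[OF f]])
qed

lemma fn_dec: "fn S f \<Longrightarrow> fn S (\<lambda>e. dec i (f e))"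
  by (induction i arbitrary: f) (auto intro: fn_u1 fn_u2)

text \<open>The variables are replaced by components of a code one at a time; \<open>k\<close> is a
  standard number, so this is an induction outside the model.\<close>

lemma sg_dec: assumes P: "sg S P" shows "sg S (\<lambda>v. P (\<lambda>i. if i < k then dec i (v 0) else v (Suc i)))"
proof (induction k)
  case 0
  show ?case using sg_sub[OF P, of "\<lambda>i v. v (Suc i)"] by (simp add: tmi)
next
  case (Suc k)
  define R where "R = (\<lambda>u v. P (\<lambda>i. if i < k then dec i (v 0) else if i = k then u else v (Suc i)))"
  define \<sigma> :: "nat \<Rightarrow> (nat \<Rightarrow> 'a) \<Rightarrow> 'a"
    where "\<sigma> = (\<lambda>i w. w (if i = 0 then 1 else if i = Suc k then 0 else Suc i))"
  have "sg S (\<lambda>w. P (\<lambda>i. if i < k then dec i (\<sigma> 0 w) else \<sigma> (Suc i) w))"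
    using sg_sub[OF Suc, of \<sigma>] by (auto simp: \<sigma>_def intro: tmi)
  moreover have "P (\<lambda>i. if i < k then dec i (\<sigma> 0 w) else \<sigma> (Suc i) w) = R (w 0) (\<lambda>i. w (Suc i))" for w
    unfolding R_def by (rule arg_cong[where f = P]) (auto simp: \<sigma>_def)
  ultimately have "sg S (\<lambda>w. R (w 0) (\<lambda>i. w (Suc i)))" by (rule sg_cong)
  then have "sg S (\<lambda>v. R (dec k (v 0)) v)" by (rule sg_let[where P = R, OF fn_dec[OF fn_var]])
  moreover have "R (dec k (v 0)) v = P (\<lambda>i. if i < Suc k then dec i (v 0) else v (Suc i))" for v
    unfolding R_def by (rule arg_cong[where f = P]) (auto simp: less_Suc_eq)
  ultimately show ?case by (rule sg_cong)
qed

lemma hcard_le: fixes k :: 'a assumes "fins F" "\<And>y. y \<in> F \<Longrightarrow> y < a" "hcard F k" shows "k \<le> a"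
proof -
  have "\<not> (\<exists>c f k. (\<forall>y\<in>els c. y < a) \<and> hb f k (els c) \<and> a < k)"
  proof (rule pi_induct[where P = "\<lambda>a. \<not> (\<exists>c f k. (\<forall>y\<in>els c. y < a) \<and> hb f k (els c) \<and> a < k)"])
    show "sg S (\<lambda>e. \<not> \<not> (\<exists>c f k. (\<forall>y\<in>els c. y < e 0) \<and> hb f k (els c) \<and> e 0 < k))"
      unfolding not_not by (intro sgq dlq fni dl_hbi[THEN dl_sg])
    show "\<not> (\<exists>c f (k::'a). (\<forall>y\<in>els c. y < 0) \<and> hb f k (els c) \<and> 0 < k)"
    proof (intro notI, elim exE conjE)
      fix c f k :: 'a assume A: "\<forall>y\<in>els c. y < 0" "hb f k (els c)" "0 < k"
      then obtain y where "y \<in> els c" unfolding hb_def by blast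
      then show False using A(1) by auto
    qed
    fix a :: 'a assume IH: "\<not> (\<exists>c f k. (\<forall>y\<in>els c. y < a) \<and> hb f k (els c) \<and> a < k)"
    show "\<not> (\<exists>c f k. (\<forall>y\<in>els c. y < a + 1) \<and> hb f k (els c) \<and> a + 1 < k)"
    proof (intro notI, elim exE conjE)
      fix c f k :: 'a assume A: "\<forall>y\<in>els c. y < a + 1" "hb f k (els c)" "a + 1 < k"
      have F: "fins (els c - {a})" by (rule fins_subset[of "els c"]) (auto simp: fins_def intro: S_Diff S_sing)
      obtain d where d: "els c - {a} = els d" using F by (auto simp: fins_def)
      obtain j where j: "hcard (els d) j" using hcard_ex[OF F] d by auto
      have "\<forall>y\<in>els d. y < a" using A(1) unfolding d[symmetric] by (auto simp: le_less)
      then have "j \<le> a" using IH j unfolding hcard_def by (metis not_less)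
      have "hcard (els c) k" using A(2) by (auto simp: hcard_def)
      have "k = j \<or> k = j + 1"
      proof (cases "a \<in> els c")
        case True
        then have "els c = insert a (els d)" using d by auto
        then have "hcard (els c) (j + 1)" using hcard_insert[of "els d" j a] j F d by auto
        then show ?thesis using hcard_unique[of "els c"] \<open>hcard (els c) k\<close> by (auto simp: fins_def)
      next
        case False
        then have "els c = els d" using d by auto
        then show ?thesis using hcard_unique[of "els c"] \<open>hcard (els c) k\<close> j by (auto simp: fins_def)
      qed
      then have "k \<le> a + 1" using \<open>j \<le> a\<close> by (auto intro: add_mono order_trans[of _ a])
      then show False using A(3) by simp
    qed
  qed
  then show ?thesis using assms unfolding fins_def hcard_def by (metis not_less)
qed

lemma xl_of:
  assumes "fins F" "\<And>y. y \<in> F \<Longrightarrow> a < y" "hcard F a"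
  shows "\<exists>c. xl c \<and> els c = insert a F"
proof -
  obtain c where c: "lcode c" "els c = insert a F" using lcode_fins fins_insert assms(1) by metis
  have "a \<notin> F" using assms(2) by blast
  then have "hcard (els c) (a + 1)" using hcard_insert assms c by metis
  then have "xl c" unfolding xl_def using c assms(2) by (auto intro: less_imp_le)
  then show ?thesis using c by blast
qed

lemma inf_setD: "inf_set L \<Longrightarrow> \<exists>y\<in>L. b < y"
  unfolding inf_set_def by (metis Suc_le)

lemma S_UNIV: "UNIV \<in> S"
  using dl_comp[of "\<lambda>x. True", OF dl_const] by simp

end

locale rca_rt = rca +
  assumes rt: "rtx S"
begin

lemma rt_set:
  assumes "M \<in> S" "inf_set M" "D \<in> S"
  shows "\<exists>L\<in>S. inf_set L \<and> L \<subseteq> M \<and>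
    ((\<forall>c. xl c \<and> els c \<subseteq> L \<longrightarrow> c \<in> D) \<or> (\<forall>c. xl c \<and> els c \<subseteq> L \<longrightarrow> c \<notin> D))"
proof -
  define C where "C = {z. \<exists>c\<le>z. \<exists>i\<le>z. z = pr c i \<and> xl c \<and> (i = 0 \<and> c \<in> D \<or> i = 1 \<and> c \<notin> D)}"
  have C: "pr c i \<in> C \<longleftrightarrow> xl c \<and> (i = 0 \<and> c \<in> D \<or> i = 1 \<and> c \<notin> D)" for c i
    unfolding C_def by auto
  have "C \<in> S" unfolding C_def by (rule dl_comp) (intro dlq fni dl_xl assms)
  moreover have "col C" unfolding col_def by (auto simp: C) (auto simp: C_def)
  ultimately obtain L i where "L \<in> S" "inf_set L" "L \<subseteq> M" "\<forall>c. xl c \<and> els c \<subseteq> L \<longrightarrow> pr c i \<in> C"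
    using rt assms unfolding rtx_def by metis
  then show ?thesis unfolding C by (cases "i = 0") (intro bexI[of _ L], auto)+
qed

text \<open>The projection becomes Delta-1 in a homogeneous set. A set lies in \<open>D\<close> if
  any two of its elements \<open>b < d\<close> above the minimum \<open>a\<close> bound witnesses
  for the same numbers \<open>x < a\<close>. If all exactly large subsets of \<open>L\<close> lie in
  \<open>D\<close>, then an element of \<open>L\<close> above \<open>a\<close> already bounds a
  witness for every \<open>x < a\<close> that has one.\<close>

lemma sigma_comp: assumes A: "A \<in> S" shows "{x. \<exists>y. pr x y \<in> A} \<in> S"
proof -
  define D where "D = {c. \<forall>a\<in>els c. (\<forall>z\<in>els c. a \<le> z) \<longrightarrow> (\<forall>b\<in>els c. \<forall>d\<in>els c. a < b \<and> b < d \<longrightarrow>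
    (\<forall>x<a. (\<exists>y\<le>d. pr x y \<in> A) \<longrightarrow> (\<exists>y\<le>b. pr x y \<in> A)))}"
  have "D \<in> S" unfolding D_def by (rule dl_comp) (intro dlq fni A)
  moreover have "inf_set (UNIV :: 'a set)" unfolding inf_set_def by blast
  ultimately obtain L where L: "L \<in> S" "inf_set L"
    and h: "(\<forall>c. xl c \<and> els c \<subseteq> L \<longrightarrow> c \<in> D) \<or> (\<forall>c. xl c \<and> els c \<subseteq> L \<longrightarrow> c \<notin> D)"
    using rt_set[OF S_UNIV, of D] by blast
  have ND: False if ND: "\<forall>c. xl c \<and> els c \<subseteq> L \<longrightarrow> c \<notin> D"
  proof -
    obtain a where a: "a \<in> L" using L(2) unfolding inf_set_def by blast
    \<comment> \<open>A set outside \<open>D\<close> with minimum \<open>a\<close> and its other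
      elements beyond \<open>d\<close> exhibits a number \<open>x < a\<close> with a witness, but
      with none up to \<open>d\<close>. Repeating this collects \<open>j\<close> such numbers for
      every \<open>j\<close>, although there are only \<open>a\<close> numbers below
      \<open>a\<close>.\<close>
    have "\<exists>c d. (\<forall>x\<in>els c. x < a \<and> (\<exists>y\<le>d. pr x y \<in> A)) \<and> d \<in> L \<and> a \<le> d \<and> (\<exists>f. hb f j (els c))" for j
    proof (rule sg_induct[where P = "\<lambda>j. \<exists>c d. (\<forall>x\<in>els c. x < a \<and> (\<exists>y\<le>d. pr x y \<in> A)) \<and> d \<in> L \<and> a \<le> d \<and> (\<exists>f. hb f j (els c))"])
      show "sg S (\<lambda>e. \<exists>c d. (\<forall>x\<in>els c. x < a \<and> (\<exists>y\<le>d. pr x y \<in> A)) \<and> d \<in> L \<and> a \<le> d \<and> (\<exists>f. hb f (e 0) (els c)))"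
        by (intro sgq dlq fni A L dl_hbi[THEN dl_sg])
      obtain c :: 'a where "{} = els c" using fins_empty by (auto simp: fins_def)
      then show "\<exists>c d. (\<forall>x\<in>els c. x < a \<and> (\<exists>y\<le>d. pr x y \<in> A)) \<and> d \<in> L \<and> a \<le> d \<and> (\<exists>f. hb f 0 (els c))"
        using a hcard_empty unfolding hcard_def by (metis empty_iff order_refl)
      fix j assume "\<exists>c d. (\<forall>x\<in>els c. x < a \<and> (\<exists>y\<le>d. pr x y \<in> A)) \<and> d \<in> L \<and> a \<le> d \<and> (\<exists>f. hb f j (els c))"
      then obtain c d f where c: "\<forall>x\<in>els c. x < a \<and> (\<exists>y\<le>d. pr x y \<in> A)" "d \<in> L" "a \<le> d" "hb f j (els c)"
        by blast
      obtain F where F: "fins F" "F \<subseteq> L" "\<forall>y\<in>F. d < y" "hcard F a" using subset_of_card[OF L] by metis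
      have aF: "a < y" if "y \<in> F" for y using F(3) c(3) that by (meson order.strict_trans1)
      obtain s where s: "xl s" "els s = insert a F" using xl_of[OF F(1) aF F(4)] by blast
      then have "s \<notin> D" using ND F(2) a by simp
      then obtain a' b' d' x where x: "a' \<in> els s" "\<forall>z\<in>els s. a' \<le> z" "b' \<in> els s" "d' \<in> els s" "a' < b'" "b' < d'"
        "x < a'" "\<exists>y\<le>d'. pr x y \<in> A" "\<not> (\<exists>y\<le>b'. pr x y \<in> A)"
        unfolding D_def by blast
      have "a' = a" using x(1,2) s(2) aF by (metis insert_iff less_le_not_le)
      then have b: "b' \<in> F" "d' \<in> F" using x(3-6) s(2) by auto
      then have "d < b'" "d < d'" using F(3) by blast+
      then have "x \<notin> els c" using c(1) x(9) by (meson less_imp_le order_trans)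
      moreover have fc: "fins (els c)" by (auto simp: fins_def)
      ultimately have "hcard (insert x (els c)) (j + 1)" using c(4) by (intro hcard_insert) (auto simp: hcard_def)
      moreover obtain c' where c': "els c' = insert x (els c)" using fins_insert[OF fc] by (metis fins_def)
      moreover have "\<forall>z\<in>els c'. z < a \<and> (\<exists>y\<le>d'. pr z y \<in> A)"
      proof
        fix z assume z: "z \<in> els c'"
        show "z < a \<and> (\<exists>y\<le>d'. pr z y \<in> A)"
        proof (cases "z = x")
          case True
          then show ?thesis using x(7,8) \<open>a' = a\<close> by simp
        next
          case False
          then obtain y where "z < a" "y \<le> d" "pr z y \<in> A" using c(1) z c' by auto
          then show ?thesis using \<open>d < d'\<close> by (auto intro!: exI[of _ y])
        qed
      qed
      moreover have "d' \<in> L" "a \<le> d'" using b F(2) aF by (auto intro: less_imp_le)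
      ultimately show "\<exists>c d. (\<forall>x\<in>els c. x < a \<and> (\<exists>y\<le>d. pr x y \<in> A)) \<and> d \<in> L \<and> a \<le> d \<and> (\<exists>f. hb f (j + 1) (els c))"
        unfolding hcard_def by (intro exI[of _ c'] exI[of _ d']) simp
    qed
    from this[of "a + 1"] obtain c where "\<forall>x\<in>els c. x < a" "hcard (els c) (a + 1)" unfolding hcard_def by blast
    then have "a + 1 \<le> a" by (intro hcard_le[of "els c"]) (auto simp: fins_def)
    then show False by (simp add: Suc_le)
  qed
  then have h: "\<forall>c. xl c \<and> els c \<subseteq> L \<longrightarrow> c \<in> D" using h by blast
  \<comment> \<open>An arbitrary witness \<open>y\<close> is placed below some \<open>d\<close> of
    \<open>L\<close>, and \<open>a\<close>, \<open>b\<close>, \<open>d\<close> are completed to an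
    exactly large set. This requires \<open>a\<close> to be at least 2, since \<open>b\<close> and
    \<open>d\<close> count among the \<open>a\<close> elements above the minimum.\<close>
  have key: "\<exists>y\<le>b. pr x y \<in> A" if ab: "a \<in> L" "b \<in> L" "a < b" "1 < a" "x < a" and y: "pr x y \<in> A" for a b x y
  proof -
    obtain d where d: "d \<in> L" "b + y < d" using inf_setD L by blast
    then have d: "d \<in> L" "b < d" "y \<le> d"
      by (auto intro: order.strict_trans1[of b "b + y"] less_imp_le[OF order.strict_trans1[of y "b + y"]])
    have "1 + 1 \<le> a" using ab(4) Suc_le[of 1 a] by simp
    then obtain j where "a = 1 + 1 + j" unfolding le_iff_add by blast
    then have j: "a = j + 1 + 1" by (simp only: ac_simps)
    obtain F where F: "fins F" "F \<subseteq> L" "\<forall>y\<in>F. d < y" "hcard F j" using subset_of_card[OF L] by metis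
    have "b < z" if "z \<in> F" for z using F(3) that d(2) by (meson order.strict_trans)
    then have "hcard (insert b (insert d F)) (j + 1 + 1)"
      using F d by (intro hcard_insert fins_insert) auto
    moreover have "a < y" if "y \<in> insert b (insert d F)" for y
      using that ab(3) order.strict_trans[OF ab(3) d(2)] F(3) by (auto intro: order.strict_trans[of a d])
    ultimately obtain c where c: "xl c" "els c = insert a (insert b (insert d F))"
      using xl_of[of "insert b (insert d F)" a] F j fins_insert by metis
    then have "c \<in> D" using h F(2) ab d by simp
    moreover have "\<forall>z\<in>els c. a \<le> z" using \<open>\<And>y. y \<in> insert b (insert d F) \<Longrightarrow> a < y\<close> c by (auto intro: less_imp_le)
    moreover have "a \<in> els c" "b \<in> els c" "d \<in> els c" using c by auto
    ultimately have "(\<exists>y\<le>d. pr x y \<in> A) \<longrightarrow> (\<exists>y\<le>b. pr x y \<in> A)"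
      using ab(3,5) d(2) unfolding D_def by blast
    then show ?thesis using d(3) y by blast
  qed
  have ex: "\<exists>a\<in>L. \<exists>b\<in>L. a < b \<and> 1 < a \<and> x < a" for x
  proof -
    obtain a where a: "a \<in> L" "x + 1 < a" using inf_setD L by blast
    obtain b where "b \<in> L" "a < b" using inf_setD L by blast
    moreover have "1 < a" "x < a" using a(2) by (auto intro: order.strict_trans1[of _ "x + 1"])
    ultimately show ?thesis using a by blast
  qed
  have "dl S (\<lambda>e. \<exists>y. pr (e 0) y \<in> A)"
    unfolding dl_def
  proof
    show "sg S (\<lambda>e. \<exists>y. pr (e 0) y \<in> A)" by (intro sgq fni A)
    \<comment> \<open>Having no witness is Sigma-1: it suffices to find two elements of
      \<open>L\<close> above the argument and to search up to the larger one.\<close>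
    have "sg S (\<lambda>e. \<exists>a b. a \<in> L \<and> b \<in> L \<and> a < b \<and> 1 < a \<and> e 0 < a \<and> \<not> (\<exists>y\<le>b. pr (e 0) y \<in> A))"
      by (intro sgq dlq fni A L)
    then show "sg S (\<lambda>e. \<not> (\<exists>y. pr (e 0) y \<in> A))"
      by (rule sg_cong) (use key ex in \<open>blast\<close>)
  qed
  then show ?thesis by (rule dl_comp)
qed

lemma sg_comp: assumes "sg S (\<lambda>e. P (e 0))" shows "{x. P x} \<in> S"
proof -
  obtain Q where Q: "bd S Q" "\<And>e. P (e 0) \<longleftrightarrow> (\<exists>y. Q (y ## e))" using assms by (auto simp: sg_def)
  have P: "P x \<longleftrightarrow> (\<exists>y. Q (y ## x ## (\<lambda>i. 0)))" for x using Q(2)[of "x ## (\<lambda>i. 0)"] by simp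
  have "{z. \<exists>x\<le>z. \<exists>y\<le>z. z = pr x y \<and> Q (\<lambda>i. (y ## x ## (\<lambda>i. 0)) i)} \<in> S" (is "?A \<in> S")
    by (rule dl_comp) (intro dlq fni dl_bd bd_sub[OF Q(1)] tmd_cns tmi)
  then have "{x. \<exists>y. pr x y \<in> ?A} \<in> S" by (rule sigma_comp)
  then show ?thesis unfolding P by auto
qed

text \<open>Each unbounded quantifier is absorbed into a set parameter: the set of codes of tuples
  satisfying the quantified formula belongs to \<open>S\<close> by Sigma-1 comprehension.\<close>

lemma xfm_bounded: "xsets p \<subseteq> S \<Longrightarrow> \<exists>q. xsets q \<subseteq> S \<and> xbnd q \<and> (\<forall>e. xsat e p = xsat e q)"
proof (induction p)
  case (XNeg p)
  then obtain q where "xsets q \<subseteq> S" "xbnd q" "\<forall>e. xsat e p = xsat e q" by auto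
  then show ?case by (intro exI[of _ "XNeg q"]) auto
next
  case (XImp p q)
  then obtain p' q' where "xsets p' \<subseteq> S" "xbnd p'" "\<forall>e. xsat e p = xsat e p'"
    "xsets q' \<subseteq> S" "xbnd q'" "\<forall>e. xsat e q = xsat e q'" by auto
  then show ?case by (intro exI[of _ "XImp p' q'"]) auto
next
  case (XBEx t p)
  then obtain q where "xsets q \<subseteq> S" "xbnd q" "\<forall>e. xsat e p = xsat e q" by auto
  then show ?case by (intro exI[of _ "XBEx t q"]) auto
next
  case (XEx p)
  then obtain q where q: "xsets q \<subseteq> S" "xbnd q" "\<And>e. xsat e p = xsat e q" by auto
  obtain n where n: "\<And>e e'. (\<forall>i<n. e i = e' i) \<Longrightarrow> xsat e (XEx q) = xsat e' (XEx q)" using xsat_bound by metis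
  have "sg S (\<lambda>e. xsat e (XEx q))" using q by (intro sgI[of S "\<lambda>e. xsat e q"]) (auto simp: bd_def)
  then have "sg S (\<lambda>v. xsat (\<lambda>i. if i < n then dec i (v 0) else v (Suc i)) (XEx q))" by (rule sg_dec)
  moreover have "xsat (\<lambda>i. if i < n then dec i (v 0) else v (Suc i)) (XEx q) = xsat (\<lambda>i. dec i (v 0)) (XEx q)" for v
    by (rule n) auto
  ultimately have "sg S (\<lambda>v. xsat (\<lambda>i. dec i (v 0)) (XEx q))" by simp
  then have A: "{z. xsat (\<lambda>i. dec i z) (XEx q)} \<in> S" by (rule sg_comp)
  have "xsat e (XEx p) = xsat e (XIn (xtup n 0) {z. xsat (\<lambda>i. dec i z) (XEx q)})" for e
  proof -
    have "xsat e (XEx p) = xsat e (XEx q)" using q by simp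
    also have "\<dots> = xsat (\<lambda>i. dec i (tup n e)) (XEx q)" by (rule n) (auto simp: dec_tup)
    finally show ?thesis by (simp add: xev_xtup)
  qed
  then show ?case using A by (intro exI[of _ "XIn (xtup n 0) {z. xsat (\<lambda>i. dec i z) (XEx q)}"]) auto
next
  case (XEq t u) then show ?case by (intro exI[of _ "XEq t u"]) auto
next
  case (XLe t u) then show ?case by (intro exI[of _ "XLe t u"]) auto
next
  case (XIn t A) then show ?case by (intro exI[of _ "XIn t A"]) auto
qed

lemma arith_comp: assumes "xsets p \<subseteq> S" shows "{x. xsat (x ## e) p} \<in> S"
proof -
  obtain q where q: "xsets q \<subseteq> S" "xbnd q" "\<And>e. xsat e p = xsat e q" using xfm_bounded[OF assms] by blast
  have "bd S (\<lambda>e. xsat e q)" using q by (auto simp: bd_def)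
  then have "bd S (\<lambda>v. xsat (\<lambda>i. (v 0 ## e) i) q)"
    by (rule bd_sub[where \<sigma> = "\<lambda>i v. (v 0 ## e) i"]) (intro tmd_cns tmi)
  then have "{x. xsat (x ## e) q} \<in> S" by (intro dl_comp dl_bd) simp
  then show ?thesis using q by simp
qed

end

section \<open>Models of arithmetical comprehension\<close>

text \<open>Arithmetical definability with set parameters from \<open>S\<close>; the rules repeat
  those for \<open>bd\<close>, now without bounds on the quantifiers.\<close>

definition df :: "'a set set \<Rightarrow> ((nat \<Rightarrow> 'a::arith) \<Rightarrow> bool) \<Rightarrow> bool" where
  "df S P \<longleftrightarrow> (\<exists>p. xsets p \<subseteq> S \<and> (\<forall>e. P e = xsat e p))"

lemma dfI: "xsets p \<subseteq> S \<Longrightarrow> (\<And>e. P e = xsat e p) \<Longrightarrow> df S P"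
  by (auto simp: df_def)

lemma df_bd: "bd S P \<Longrightarrow> df S P"
  by (auto simp: bd_def df_def)

lemma df_cong: "df S P \<Longrightarrow> (\<And>e. P e = Q e) \<Longrightarrow> df S Q"
  by (simp add: df_def)

lemma df_not: "df S P \<Longrightarrow> df S (\<lambda>e. \<not> P e)"
  unfolding df_def[of S P] by (elim exE) (rule dfI[where p = "XNeg _"], auto)

lemma df_imp: "df S P \<Longrightarrow> df S Q \<Longrightarrow> df S (\<lambda>e. P e \<longrightarrow> Q e)"
  unfolding df_def[of S P] df_def[of S Q] by (elim exE) (rule dfI[where p = "XImp _ _"], auto)

lemma df_conj: "df S P \<Longrightarrow> df S Q \<Longrightarrow> df S (\<lambda>e. P e \<and> Q e)"
  using df_not[OF df_imp[OF _ df_not], of S P Q] by simp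

lemma df_disj: "df S P \<Longrightarrow> df S Q \<Longrightarrow> df S (\<lambda>e. P e \<or> Q e)"
  using df_imp[OF df_not, of S P Q] by (simp add: disj_imp)

lemma df_iff: "df S P \<Longrightarrow> df S Q \<Longrightarrow> df S (\<lambda>e. P e \<longleftrightarrow> Q e)"
  unfolding iff_conv_conj_imp by (intro df_conj df_imp)

lemma df_ex: assumes "df S (\<lambda>e. P (e 0) (\<lambda>i. e (Suc i)))" shows "df S (\<lambda>e. \<exists>x. P x e)"
proof -
  obtain p where p: "xsets p \<subseteq> S" "\<And>e. P (e 0) (\<lambda>i. e (Suc i)) = xsat e p"
    using assms by (auto simp: df_def)
  have "P x e = xsat (x ## e) p" for x e using p(2)[of "x ## e"] by simp
  then show ?thesis using p by (intro dfI[where p = "XEx p"]) auto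
qed

lemma df_all: "df S (\<lambda>e. P (e 0) (\<lambda>i. e (Suc i))) \<Longrightarrow> df S (\<lambda>e. \<forall>x. P x e)"
  using df_not[OF df_ex[where P = "\<lambda>x e. \<not> P x e", OF df_not]] by simp

lemma df_sub: assumes "df S P" "\<And>i. tmd (\<sigma> i)" shows "df S (\<lambda>e. P (\<lambda>i. \<sigma> i e))"
proof -
  obtain p where p: "xsets p \<subseteq> S" "\<And>e. P e = xsat e p" using assms(1) by (auto simp: df_def)
  obtain \<tau> where "\<And>i e. \<sigma> i e = xev e (\<tau> i)" using assms(2) unfolding tmd_def by metis
  then show ?thesis using p by (intro dfI[where p = "xsub \<tau> p"]) (auto simp: xsat_sub)
qed

lemma df_sg: "sg S P \<Longrightarrow> df S P"
proof -
  assume "sg S P"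
  then obtain Q where Q: "bd S Q" "\<And>e. P e \<longleftrightarrow> (\<exists>y. Q (y ## e))" by (auto simp: sg_def)
  have "df S (\<lambda>e. \<exists>y. Q (\<lambda>i. (y ## e) i))"
    by (intro df_ex df_sub[OF df_bd[OF Q(1)]] tmd_cns tmi)
  then show ?thesis by (rule df_cong) (simp add: Q)
qed

lemma df_dl: "dl S P \<Longrightarrow> df S P"
  by (auto simp: dl_def intro: df_sg)

definition fd :: "'a set set \<Rightarrow> ((nat \<Rightarrow> 'a::arith) \<Rightarrow> 'a) \<Rightarrow> bool" where
  "fd S f \<longleftrightarrow> df S (\<lambda>e. e 0 = f (\<lambda>i. e (Suc i)))"

lemma fd_fn: "fn S f \<Longrightarrow> fd S f"
  by (auto simp: fn_def fd_def intro: df_sg)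

lemma fd_Suc: assumes "fd S f" shows "fd S (\<lambda>e. f (\<lambda>i. e (Suc i)))"
proof -
  have "df S (\<lambda>e. (\<lambda>i. (e 0 ## (\<lambda>i. e (Suc (Suc i)))) i) 0 = f (\<lambda>i. (\<lambda>i. (e 0 ## (\<lambda>i. e (Suc (Suc i)))) i) (Suc i)))"
    using assms unfolding fd_def by (rule df_sub) (intro tmd_cns tmi)
  then show ?thesis by (simp add: fd_def)
qed

lemma df_let: assumes "fd S f" "df S (\<lambda>e. P (e 0) (\<lambda>i. e (Suc i)))" shows "df S (\<lambda>e. P (f e) e)"
proof -
  have "df S (\<lambda>e. \<exists>u. u = f e \<and> P u e)"
    by (intro df_ex df_conj assms(2) assms(1)[unfolded fd_def])
  then show ?thesis by simp
qed

lemma df_app1: "df S (\<lambda>e. P (e 0)) \<Longrightarrow> fd S f \<Longrightarrow> df S (\<lambda>e. P (f e))"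
  using df_let[of S f "\<lambda>u e. P u"] by simp

lemma df_app2: assumes "df S (\<lambda>e. P (e 0) (e 1))" "fd S f" "fd S g" shows "df S (\<lambda>e. P (f e) (g e))"
proof -
  have "df S (\<lambda>e. \<exists>v. v = g e \<and> (\<exists>u. u = f e \<and> P u v))"
    using assms(1) by (intro df_ex df_conj assms(3)[unfolded fd_def] fd_Suc[OF assms(2), unfolded fd_def]) simp
  then show ?thesis by simp
qed

lemma df_app3: assumes "df S (\<lambda>e. P (e 0) (e 1) (e 2))" "fd S f" "fd S g" "fd S h"
  shows "df S (\<lambda>e. P (f e) (g e) (h e))"
proof -
  have "df S (\<lambda>e. \<exists>w. w = h e \<and> (\<exists>v. v = g e \<and> (\<exists>u. u = f e \<and> P u v w)))"
    using assms(1) by (intro df_ex df_conj assms(4)[unfolded fd_def] fd_Suc[OF assms(3), unfolded fd_def]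
       fd_Suc[OF fd_Suc[OF assms(2)], unfolded fd_def]) (simp add: numeral_2_eq_2)
  then show ?thesis by simp
qed

lemma df_app4: assumes "df S (\<lambda>e. P (e 0) (e 1) (e 2) (e 3))" "fd S f" "fd S g" "fd S h" "fd S k"
  shows "df S (\<lambda>e. P (f e) (g e) (h e) (k e))"
proof -
  have "df S (\<lambda>e. \<exists>x. x = k e \<and> (\<exists>w. w = h e \<and> (\<exists>v. v = g e \<and> (\<exists>u. u = f e \<and> P u v w x))))"
    using assms(1) by (intro df_ex df_conj assms(5)[unfolded fd_def] fd_Suc[OF assms(4), unfolded fd_def]
       fd_Suc[OF fd_Suc[OF assms(3)], unfolded fd_def] fd_Suc[OF fd_Suc[OF fd_Suc[OF assms(2)]], unfolded fd_def])
      (simp add: numeral_2_eq_2 numeral_3_eq_3)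
  then show ?thesis by simp
qed

lemma fd_app1: "df S (\<lambda>e. e 0 = h (e 1)) \<Longrightarrow> fd S f \<Longrightarrow> fd S (\<lambda>e. h (f e))"
  unfolding fd_def[of _ "\<lambda>e. h (f e)"]
  by (rule df_app2[where P = "\<lambda>u v. u = h v"]) (auto intro: fd_fn fn_var fd_Suc)

lemma fd_app2: assumes "df S (\<lambda>e. e 0 = h (e 1) (e 2))" "fd S f" "fd S g" shows "fd S (\<lambda>e. h (f e) (g e))"
  unfolding fd_def
  by (rule df_app3[where P = "\<lambda>u v w. u = h v w", OF assms(1) fd_fn[OF fn_var] fd_Suc[OF assms(2)] fd_Suc[OF assms(3)]])

lemma df_eq: "fd S f \<Longrightarrow> fd S g \<Longrightarrow> df S (\<lambda>e. f e = g e)"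
  by (rule df_app2[where P = "(=)", OF df_bd[OF bd_eq[OF tmi(1) tmi(1)]]])

lemma df_le: "fd S f \<Longrightarrow> fd S g \<Longrightarrow> df S (\<lambda>e. f e \<le> g e)"
  by (rule df_app2[where P = "(\<le>)", OF df_bd[OF bd_le[OF tmi(1) tmi(1)]]])

lemma df_less: "fd S f \<Longrightarrow> fd S g \<Longrightarrow> df S (\<lambda>e. f e < g e)"
  by (rule df_app2[where P = "(<)", OF df_bd[OF bd_less[OF tmi(1) tmi(1)]]])

lemma df_in: "fd S f \<Longrightarrow> A \<in> S \<Longrightarrow> df S (\<lambda>e. f e \<in> A)"
  by (rule df_app1[where P = "\<lambda>x. x \<in> A", OF df_bd[OF bd_in[OF tmi(1)]]])

lemma df_els: "fd S f \<Longrightarrow> fd S g \<Longrightarrow> df S (\<lambda>e. f e \<in> els (g e))"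
  by (rule df_app2[where P = "\<lambda>x c. x \<in> els c", OF df_dl[OF dl_els[OF fn_var fn_var]]])

lemma df_const: "df S (\<lambda>e. b)"
  by (rule df_dl[OF dl_const])

lemma df_ball_els: assumes "fd S f" "df S (\<lambda>e. P (e 0) (\<lambda>i. e (Suc i)))"
  shows "df S (\<lambda>e. \<forall>x\<in>els (f e). P x e)" "df S (\<lambda>e. \<exists>x\<in>els (f e). P x e)"
  unfolding Ball_def Bex_def
  by (intro df_all df_ex df_imp df_conj df_els fd_fn[OF fn_var] fd_Suc assms)+

lemma df_ball_S: assumes "A \<in> S" "df S (\<lambda>e. P (e 0) (\<lambda>i. e (Suc i)))"
  shows "df S (\<lambda>e. \<forall>x\<in>A. P x e)" "df S (\<lambda>e. \<exists>x\<in>A. P x e)"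
  unfolding Ball_def Bex_def
  by (intro df_all df_ex df_imp df_conj df_in fd_fn[OF fn_var] fd_Suc assms)+

lemma fd_add: "fd S f \<Longrightarrow> fd S g \<Longrightarrow> fd S (\<lambda>e. f e + g e)"
  by (rule fd_app2[where h = "(+)"]) (auto intro!: df_dl dli fni)

lemma fd_mult: "fd S f \<Longrightarrow> fd S g \<Longrightarrow> fd S (\<lambda>e. f e * g e)"
  by (rule fd_app2[where h = "(*)"]) (auto intro!: df_dl dli fni)

lemma fd_pr: "fd S f \<Longrightarrow> fd S g \<Longrightarrow> fd S (\<lambda>e. pr (f e) (g e))"
  by (rule fd_app2[where h = pr]) (auto intro!: df_dl dli fni)

lemma df_sub_els: "fd S f \<Longrightarrow> A \<in> S \<Longrightarrow> df S (\<lambda>e. els (f e) \<subseteq> A)"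
  unfolding subset_eq by (intro df_ball_els df_in fd_fn[OF fn_var])

lemma df_sub_els2: "fd S f \<Longrightarrow> fd S g \<Longrightarrow> df S (\<lambda>e. els (f e) \<subseteq> els (g e))"
  unfolding subset_eq by (intro df_ball_els df_els fd_fn[OF fn_var] fd_Suc)

lemmas fdi = fd_fn[OF fn_var] fd_fn[OF fn_const] fd_add fd_mult fd_pr
lemmas dfi = df_not df_conj df_disj df_imp df_iff df_ex df_all df_ball_els df_ball_S df_eq df_le df_less
  df_els df_in df_sub_els df_sub_els2

lemma df_inf_set: assumes "df S (\<lambda>e. P (e 0) (\<lambda>i. e (Suc i)))" shows "df S (\<lambda>e. inf_set {x. P x e})"
proof -
  have "df S (\<lambda>e. P (e 0) (\<lambda>i. e (Suc (Suc i))))"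
    using df_sub[OF assms, of "\<lambda>i e. e (if i = 0 then 0 else Suc i)"] by (simp add: tmi)
  then show ?thesis unfolding inf_set_def mem_Collect_eq by (intro dfi fdi)
qed

text \<open>Induction for sets is enough here, because comprehension turns every arithmetical
  predicate into a set.\<close>

locale aca =
  fixes S :: "'a::arith set set"
  assumes aind: "A \<in> S \<Longrightarrow> 0 \<in> A \<Longrightarrow> (\<And>x. x \<in> A \<Longrightarrow> x + 1 \<in> A) \<Longrightarrow> x \<in> A"
    and acomp: "df S P \<Longrightarrow> {x. P (x ## e)} \<in> S"
begin

sublocale rca
proof
  fix P e x
  assume P: "bd S P" and z: "\<exists>y. P (y ## 0 ## e)"
    and s: "\<And>x. \<exists>y. P (y ## x ## e) \<Longrightarrow> \<exists>y. P (y ## (x + 1) ## e)"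
  have "sg S (\<lambda>e. \<exists>y. P (y ## e))" using P by (rule sgI) simp
  then have "{x. \<exists>y. P (y ## x ## e)} \<in> S" by (intro acomp df_sg)
  from aind[OF this, of x] show "\<exists>y. P (y ## x ## e)" using z s by simp
next
  fix P Q e
  assume P: "bd S P"
  have "sg S (\<lambda>e. \<exists>y. P (y ## e))" using P by (rule sgI) simp
  then show "{x. \<exists>y. P (y ## x ## e)} \<in> S" by (intro acomp df_sg)
qed

lemma df_comp: "df S (\<lambda>e. P (e 0)) \<Longrightarrow> {x. P x} \<in> S"
  using acomp[of "\<lambda>e. P (e 0)"] by simp

lemma induct: "df S (\<lambda>e. P (e 0)) \<Longrightarrow> P 0 \<Longrightarrow> (\<And>x. P x \<Longrightarrow> P (x + 1)) \<Longrightarrow> P x"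
  using aind[of "{x. P x}" x] df_comp[of P] by simp

lemma less_induct': assumes "df S (\<lambda>e. P (e 0))" "\<And>x. (\<And>y. y < x \<Longrightarrow> P y) \<Longrightarrow> P x" shows "P x"
proof -
  have "\<forall>y<x. P y" for x
  proof (rule induct[where P = "\<lambda>x. \<forall>y<x. P y"])
    show "df S (\<lambda>e. \<forall>y<e 0. P y)" by (intro dfi fdi assms(1))
    show "\<forall>y<x + 1. P y" if "\<forall>y<x. P y" for x
      using that assms(2)[of x] by (auto simp: le_less)
  qed simp
  then show ?thesis using assms(2) by blast
qed

lemma least: assumes "df S (\<lambda>e. P (e 0))" "P x" shows "\<exists>x. P x \<and> (\<forall>y<x. \<not> P y)"
  using less_induct'[of "\<lambda>x. \<not> P x" x] assms df_not by blast

lemma collection: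
  assumes P: "df S (\<lambda>e. P (e 0) (e 1))" and ex: "\<And>x. x < a \<Longrightarrow> \<exists>y. P x y"
  shows "\<exists>B. \<forall>x<a. \<exists>y\<le>B. P x y"
proof -
  have P': "df S (\<lambda>e. P (f e) (g e))" if "fd S f" "fd S g" for f g using df_app2[OF P that] .
  have "j \<le> a \<longrightarrow> (\<exists>B. \<forall>x<j. \<exists>y\<le>B. P x y)" for j
  proof (rule induct[where P = "\<lambda>j. j \<le> a \<longrightarrow> (\<exists>B. \<forall>x<j. \<exists>y\<le>B. P x y)"])
    show "df S (\<lambda>e. e 0 \<le> a \<longrightarrow> (\<exists>B. \<forall>x<e 0. \<exists>y\<le>B. P x y))" by (intro dfi fdi P')
    fix j assume IH: "j \<le> a \<longrightarrow> (\<exists>B. \<forall>x<j. \<exists>y\<le>B. P x y)"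
    show "j + 1 \<le> a \<longrightarrow> (\<exists>B. \<forall>x<j + 1. \<exists>y\<le>B. P x y)"
    proof
      assume "j + 1 \<le> a"
      then have j: "j < a" by (simp add: Suc_le)
      then obtain B where B: "\<forall>x<j. \<exists>y\<le>B. P x y" using IH by auto
      obtain y where y: "P j y" using ex j by blast
      have "\<exists>y'\<le>B + y. P x y'" if "x < j + 1" for x
      proof (cases "x = j")
        case True then show ?thesis using y by (intro exI[of _ y]) (simp add: add_increasing)
      next
        case False
        then have "x < j" using that less_Suc_cases by blast
        then obtain y' where "y' \<le> B" "P x y'" using B by blast
        then show ?thesis by (intro exI[of _ y']) (simp add: add_increasing2)
      qed
      then show "\<exists>B. \<forall>x<j + 1. \<exists>y\<le>B. P x y" by blast
    qed
  qed auto
  then show ?thesis by blast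
qed

text \<open>The number \<open>N\<close> of classes may be nonstandard: if every class were bounded,
  \<open>collection\<close> would give a common bound.\<close>

lemma inf_pigeon:
  assumes U: "U \<in> S" "inf_set U" and R: "df S (\<lambda>e. R (e 0) (e 1))"
    and ex: "\<And>x. x \<in> U \<Longrightarrow> \<exists>v<N. R x v"
  shows "\<exists>v<N. inf_set {x\<in>U. R x v}"
proof (rule ccontr)
  have R': "df S (\<lambda>e. R (f e) (g e))" if "fd S f" "fd S g" for f g using df_app2[OF R that] .
  assume "\<not> ?thesis"
  then have "\<exists>b. \<forall>x. x \<ge> b \<longrightarrow> x \<in> U \<longrightarrow> \<not> R x v" if "v < N" for v
    using that unfolding inf_set_def by blast
  then have "\<exists>B. \<forall>v<N. \<exists>b\<le>B. \<forall>x. x \<ge> b \<longrightarrow> x \<in> U \<longrightarrow> \<not> R x v"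
  proof (rule collection[rotated])
    show "df S (\<lambda>e. \<forall>x\<ge>e 1. x \<in> U \<longrightarrow> \<not> R x (e 0))" by (intro dfi fdi U R')
  qed
  then obtain B where B: "\<forall>v<N. \<exists>b\<le>B. \<forall>x. x \<ge> b \<longrightarrow> x \<in> U \<longrightarrow> \<not> R x v" by blast
  obtain x where x: "x \<ge> B" "x \<in> U" using U(2) by (auto simp: inf_set_def)
  obtain v where "v < N" "R x v" using ex x by blast
  then show False using B x by (meson order_trans)
qed

text \<open>Choosing the least suitable successor makes the sequence unique, hence arithmetically
  definable through coded finite approximations.\<close>

lemma dependent_choice:
  assumes St: "df S (\<lambda>e. St (e 0) (e 1))" and Inv: "df S (\<lambda>e. Inv (e 0))" and w0: "Inv w0"
    and step: "\<And>w. Inv w \<Longrightarrow> \<exists>v. St w v \<and> Inv v"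
  shows "\<exists>f. df S (\<lambda>e. e 0 = f (e 1)) \<and> f 0 = w0 \<and> (\<forall>i. Inv (f i) \<and> St (f i) (f (i + 1)))"
proof -
  have St': "df S (\<lambda>e. St (f e) (g e))" if "fd S f" "fd S g" for f g using df_app2[OF St that] .
  have Inv': "df S (\<lambda>e. Inv (f e))" if "fd S f" for f using df_app1[OF Inv that] .
  define H where "H w v \<longleftrightarrow> (St w v \<and> Inv v) \<and> (\<forall>u<v. \<not> (St w u \<and> Inv u))" for w v
  have H': "df S (\<lambda>e. H (f e) (g e))" if "fd S f" "fd S g" for f g
    by (rule df_app2[where P = H, OF _ that]) (unfold H_def, intro dfi fdi St' Inv')
  have H_ex: "\<exists>v. H w v" if "Inv w" for w
    unfolding H_def using step[OF that] by (elim exE) (rule least, intro dfi fdi St' Inv')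
  have H_fun: "H w v \<Longrightarrow> H w v' \<Longrightarrow> v = v'" for w v v' unfolding H_def by (meson linorder_neqE)
  have H_Inv: "H w v \<Longrightarrow> Inv v \<and> St w v" for w v by (simp add: H_def)
  \<comment> \<open>An approximation only has to justify each of its pairs by a predecessor in it.
    It need not be a function; functionality is proved afterwards by induction on the index.\<close>
  define Ok where "Ok c \<longleftrightarrow> (\<forall>j u. pr j u \<in> els c \<longrightarrow> j = 0 \<and> u = w0 \<or>
     (\<exists>j' u'. j = j' + 1 \<and> pr j' u' \<in> els c \<and> H u' u))" for c
  define Q where "Q i w \<longleftrightarrow> (\<exists>c. pr i w \<in> els c \<and> Ok c)" for i w
  have Q': "df S (\<lambda>e. Q (f e) (g e))" if "fd S f" "fd S g" for f g
    by (rule df_app2[where P = Q, OF _ that]) (unfold Q_def Ok_def, intro dfi fdi H')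
  have Q0: "Q 0 w0"
  proof -
    obtain c where "els c = {pr 0 w0}" using fins_insert[OF fins_empty] unfolding fins_def by metis
    then show ?thesis unfolding Q_def Ok_def by (intro exI[of _ c]) simp
  qed
  have QS: "Q (i + 1) v" if qh: "Q i w" "H w v" for i w v
  proof -
    obtain c where c: "pr i w \<in> els c" "Ok c" using qh by (auto simp: Q_def)
    have "fins (els c)" by (auto simp: fins_def)
    then obtain d where d: "els d = insert (pr (i + 1) v) (els c)" using fins_insert unfolding fins_def by metis
    have "Ok d" unfolding Ok_def d using c qh unfolding Ok_def by (metis insert_iff pr_inject)
    then show ?thesis unfolding Q_def using d by auto
  qed
  have Q_inv: "i = 0 \<and> w = w0 \<or> (\<exists>j u. i = j + 1 \<and> Q j u \<and> H u w)" if "Q i w" for i w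
    using that unfolding Q_def Ok_def by blast
  have Q_ex: "\<exists>w. Q i w \<and> Inv w" for i
  proof (rule induct[where P = "\<lambda>i. \<exists>w. Q i w \<and> Inv w"])
    show "df S (\<lambda>e. \<exists>w. Q (e 0) w \<and> Inv w)" by (intro dfi fdi Q' Inv')
    show "\<exists>w. Q 0 w \<and> Inv w" using Q0 w0 by blast
    fix i assume "\<exists>w. Q i w \<and> Inv w"
    then show "\<exists>w. Q (i + 1) w \<and> Inv w" using QS H_ex H_Inv by blast
  qed
  have Q_fun: "\<forall>w w'. Q i w \<longrightarrow> Q i w' \<longrightarrow> w = w'" for i
  proof (rule induct[where P = "\<lambda>i. \<forall>w w'. Q i w \<longrightarrow> Q i w' \<longrightarrow> w = w'"])
    show "df S (\<lambda>e. \<forall>w w'. Q (e 0) w \<longrightarrow> Q (e 0) w' \<longrightarrow> w = w')" by (intro dfi fdi Q')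
    show "\<forall>w w'. Q 0 w \<longrightarrow> Q 0 w' \<longrightarrow> w = w'" using Q_inv Suc_neq_0 by metis
    fix i assume IH: "\<forall>w w'. Q i w \<longrightarrow> Q i w' \<longrightarrow> w = w'"
    show "\<forall>w w'. Q (i + 1) w \<longrightarrow> Q (i + 1) w' \<longrightarrow> w = w'"
    proof (intro allI impI)
      fix w w' assume "Q (i + 1) w" "Q (i + 1) w'"
      then obtain u u' where "Q i u" "H u w" "Q i u'" "H u' w'"
        using Q_inv[of "i + 1"] Suc_neq_0 by (metis add_right_cancel)
      then show "w = w'" using IH H_fun by blast
    qed
  qed
  define f where "f i = (THE w. Q i w)" for i
  have f: "Q i w \<longleftrightarrow> w = f i" for i w
    unfolding f_def using Q_ex[of i] Q_fun[of i] theI[of "Q i"] by (metis the_equality)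
  have "df S (\<lambda>e. Q (e 1) (e 0))" by (intro Q' fdi)
  then have "df S (\<lambda>e. e 0 = f (e 1))" by (simp add: f)
  moreover have "f 0 = w0" using Q0 f by simp
  moreover have "Inv (f i) \<and> St (f i) (f (i + 1))" for i
  proof -
    have "Inv (f i)" using Q_ex[of i] f by auto
    then obtain v where "H (f i) v" using H_ex by blast
    then have "Q (i + 1) v" using QS f by blast
    then have "v = f (i + 1)" by (simp add: f)
    then show ?thesis using \<open>Inv (f i)\<close> \<open>H (f i) v\<close> H_Inv by blast
  qed
  ultimately show ?thesis by blast
qed

lemma df_hcard: "fd S f \<Longrightarrow> fd S g \<Longrightarrow> df S (\<lambda>e. hcard (els (f e)) (g e))"
  by (rule df_app2[where P = "\<lambda>c k. hcard (els c) k", OF df_dl[OF dl_hcard[OF fn_var fn_var]]])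

lemma df_lcode: "fd S f \<Longrightarrow> df S (\<lambda>e. lcode (f e))"
  by (rule df_app1[where P = lcode, OF df_dl[OF dl_lcode[OF fn_var]]])

lemma df_xl: "fd S f \<Longrightarrow> df S (\<lambda>e. xl (f e))"
  by (rule df_app1[where P = xl, OF df_dl[OF dl_xl[OF fn_var]]])

text \<open>The power set of an initial segment is finite in the model, which bounds the number of
  patterns in pigeonhole arguments. A set below \<open>n + 1\<close> either avoids \<open>n\<close>
  or arises from a set below \<open>n\<close> by adding \<open>n\<close>, and
  \<open>collection\<close> bounds the codes of the latter kind.\<close>

lemma codes_bounded: fixes n :: 'a shows "\<exists>B. \<forall>c. lcode c \<and> (\<forall>y\<in>els c. y < n) \<longrightarrow> c < B"
proof (rule induct[where P = "\<lambda>n. \<exists>B. \<forall>c. lcode c \<and> (\<forall>y\<in>els c. y < n) \<longrightarrow> c < B"])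
  show "df S (\<lambda>e. \<exists>B. \<forall>c. lcode c \<and> (\<forall>y\<in>els c. y < e 0) \<longrightarrow> c < B)"
    by (intro dfi fdi df_lcode)
  have "\<exists>c. lcode c \<and> els c = ({} :: 'a set)" by (rule lcode_fins[OF fins_empty])
  then obtain c :: 'a where c: "lcode c" "els c = {}" by blast
  have "d < c + 1" if "lcode d" "\<forall>y\<in>els d. y < 0" for d
    using lcode_unique[OF that(1) c(1)] that c by auto
  then show "\<exists>B. \<forall>c. lcode c \<and> (\<forall>y\<in>els c. y < (0::'a)) \<longrightarrow> c < B" by blast
  fix n :: 'a assume "\<exists>B. \<forall>c. lcode c \<and> (\<forall>y\<in>els c. y < n) \<longrightarrow> c < B"
  then obtain B where B: "\<And>c. lcode c \<Longrightarrow> \<forall>y\<in>els c. y < n \<Longrightarrow> c < B" by blast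
  have "\<exists>B'. \<forall>c<B. \<exists>d\<le>B'. lcode d \<and> (\<forall>y\<in>els d. y \<in> els c \<or> y = n) \<and> (\<forall>y\<in>els c. y \<in> els d) \<and> n \<in> els d"
  proof (rule collection[where P = "\<lambda>c d. lcode d \<and> (\<forall>y\<in>els d. y \<in> els c \<or> y = n) \<and> (\<forall>y\<in>els c. y \<in> els d) \<and> n \<in> els d"])
    fix c
    have "fins (insert n (els c))" by (rule fins_insert) (auto simp: fins_def)
    then obtain d where "lcode d" "els d = insert n (els c)" using lcode_fins by blast
    then show "\<exists>d. lcode d \<and> (\<forall>y\<in>els d. y \<in> els c \<or> y = n) \<and> (\<forall>y\<in>els c. y \<in> els d) \<and> n \<in> els d"
      by (intro exI[of _ d]) auto
  qed (intro dfi fdi df_lcode)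
  then obtain B' where B': "\<And>c. c < B \<Longrightarrow> \<exists>d\<le>B'. lcode d \<and> els d = insert n (els c)"
    by (smt (verit) insert_iff subsetI subset_antisym)
  have "c < B + B' + 1" if c: "lcode c" "\<forall>y\<in>els c. y < n + 1" for c
  proof (cases "n \<in> els c")
    case False
    then have "\<forall>y\<in>els c. y < n" using c by (auto simp: le_less)
    then have "c < B" using B c by blast
    also have "B \<le> B + B' + 1" by (simp add: add.assoc)
    finally show ?thesis .
  next
    case True
    have "fins (els c - {n})" by (rule fins_subset[of "els c"]) (auto simp: fins_def intro: S_Diff S_sing)
    then obtain d where d: "lcode d" "els d = els c - {n}" using lcode_fins by blast
    then have "\<forall>y\<in>els d. y < n" using c by (auto simp: le_less)
    then have "d < B" using B d by blast
    then obtain c' where c': "c' \<le> B'" "lcode c'" "els c' = insert n (els d)" using B' by blast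
    then have "c' = c" using d True c(1) by (intro lcode_unique) auto
    then have "c \<le> B'" using c' by simp
    also have "B' \<le> B + B'" by simp
    finally show ?thesis by simp
  qed
  then show "\<exists>B. \<forall>c. lcode c \<and> (\<forall>y\<in>els c. y < n + 1) \<longrightarrow> c < B" by blast
qed

end

lemma (in rca_rt) aca: "aca S"
proof
  fix A x assume A: "A \<in> S" "0 \<in> A" and s: "\<And>x. x \<in> A \<Longrightarrow> x + 1 \<in> A"
  have "sg S (\<lambda>e. e 0 \<in> A)" by (intro sgq fni A)
  then show "x \<in> A" using A(2) s by (rule sg_induct[where P = "\<lambda>x. x \<in> A"])
next
  fix P e assume "df S P"
  then obtain p where "xsets p \<subseteq> S" "\<And>e. P e = xsat e p" by (auto simp: df_def)
  then show "{x. P (x ## e)} \<in> S" using arith_comp[of p e] by simp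
qed

section \<open>Syntax inside a model\<close>

text \<open>These abbreviations evaluate the term-level code constructors of \<^const>\<open>code_Var\<close> etc.\<close>

abbreviation "cVar i \<equiv> pr 1 i"
abbreviation "cSucc t \<equiv> pr 2 t"
abbreviation "cPlus t u \<equiv> pr 3 (pr t u)"
abbreviation "cTimes t u \<equiv> pr 4 (pr t u)"
abbreviation "cEq t u \<equiv> pr 5 (pr t u)"
abbreviation "cLe t u \<equiv> pr 6 (pr t u)"
abbreviation "cTr i t \<equiv> pr 7 (pr i t)"
abbreviation "cNeg p \<equiv> pr 8 p"
abbreviation "cImp p q \<equiv> pr 9 (pr p q)"
abbreviation "cEx p \<equiv> pr 10 p"

definition Num :: "'a::arith \<Rightarrow> 'a \<Rightarrow> bool" where
  "Num x z \<longleftrightarrow> (\<exists>s. pr x z \<in> els s \<and> (\<forall>a b. pr a b \<in> els s \<longrightarrow>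
     a = 0 \<and> b = 0 \<or> (\<exists>a' b'. pr a' b' \<in> els s \<and> a = a' + 1 \<and> b = cSucc b')))"

definition Trm :: "'a::arith \<Rightarrow> 'a \<Rightarrow> bool" where
  "Trm k t \<longleftrightarrow> (\<exists>s. t \<in> els s \<and> (\<forall>y. y \<in> els s \<longrightarrow> y = 0 \<or> (\<exists>i<k. y = cVar i) \<or>
     (\<exists>a. a \<in> els s \<and> y = cSucc a) \<or>
     (\<exists>a b. a \<in> els s \<and> b \<in> els s \<and> (y = cPlus a b \<or> y = cTimes a b))))"

definition Val :: "'a::arith \<Rightarrow> 'a \<Rightarrow> bool" where
  "Val t v \<longleftrightarrow> (\<exists>s. pr t v \<in> els s \<and> (\<forall>a b. pr a b \<in> els s \<longrightarrow>
     a = 0 \<and> b = 0 \<or> (\<exists>a' b'. pr a' b' \<in> els s \<and> a = cSucc a' \<and> b = b' + 1) \<or>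
     (\<exists>a' b' a'' b''. pr a' b' \<in> els s \<and> pr a'' b'' \<in> els s \<and>
        (a = cPlus a' a'' \<and> b = b' + b'' \<or> a = cTimes a' a'' \<and> b = b' * b''))))"

definition SubT :: "'a::arith \<Rightarrow> 'a \<Rightarrow> 'a \<Rightarrow> 'a \<Rightarrow> bool" where
  "SubT k z t u \<longleftrightarrow> (\<exists>s. pr t u \<in> els s \<and> (\<forall>a b. pr a b \<in> els s \<longrightarrow>
     a = 0 \<and> b = 0 \<or> (\<exists>i<k. a = cVar i \<and> b = cVar i) \<or> a = cVar k \<and> b = z \<or>
     (\<exists>i\<ge>k. a = cVar (i + 1) \<and> b = cVar i) \<or>
     (\<exists>a' b'. pr a' b' \<in> els s \<and> a = cSucc a' \<and> b = cSucc b') \<or>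
     (\<exists>a' b' a'' b''. pr a' b' \<in> els s \<and> pr a'' b'' \<in> els s \<and>
        (a = cPlus a' a'' \<and> b = cPlus b' b'' \<or> a = cTimes a' a'' \<and> b = cTimes b' b''))))"

definition Form :: "nat \<Rightarrow> 'a::arith \<Rightarrow> 'a \<Rightarrow> bool" where
  "Form n k p \<longleftrightarrow> (\<exists>s. pr k p \<in> els s \<and> (\<forall>j q. pr j q \<in> els s \<longrightarrow>
     (\<exists>t u. Trm j t \<and> Trm j u \<and> (q = cEq t u \<or> q = cLe t u)) \<or>
     (\<exists>i t. i < of_nat n \<and> Trm j t \<and> q = cTr i t) \<or>
     (\<exists>q'. pr j q' \<in> els s \<and> q = cNeg q') \<or>
     (\<exists>q' q''. pr j q' \<in> els s \<and> pr j q'' \<in> els s \<and> q = cImp q' q'') \<or>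
     (\<exists>q'. pr (j + 1) q' \<in> els s \<and> q = cEx q')))"

text \<open>Formulas of quantifier depth at most \<open>d\<close>.\<close>

definition Dp :: "nat \<Rightarrow> 'a::arith \<Rightarrow> 'a \<Rightarrow> 'a \<Rightarrow> bool" where
  "Dp n k p d \<longleftrightarrow> (\<exists>s. pr k (pr p d) \<in> els s \<and> (\<forall>j q d. pr j (pr q d) \<in> els s \<longrightarrow>
     (\<exists>t u. Trm j t \<and> Trm j u \<and> (q = cEq t u \<or> q = cLe t u)) \<or>
     (\<exists>i t. i < of_nat n \<and> Trm j t \<and> q = cTr i t) \<or>
     (\<exists>q'. pr j (pr q' d) \<in> els s \<and> q = cNeg q') \<or>
     (\<exists>q' q''. pr j (pr q' d) \<in> els s \<and> pr j (pr q'' d) \<in> els s \<and> q = cImp q' q'') \<or>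
     (\<exists>q' d'. pr (j + 1) (pr q' d') \<in> els s \<and> q = cEx q' \<and> d = d' + 1)))"

definition Sub :: "'a::arith \<Rightarrow> 'a \<Rightarrow> 'a \<Rightarrow> 'a \<Rightarrow> bool" where
  "Sub k z p q \<longleftrightarrow> (\<exists>s. pr k (pr p q) \<in> els s \<and> (\<forall>j p q. pr j (pr p q) \<in> els s \<longrightarrow>
     (\<exists>t t' u u'. SubT j z t t' \<and> SubT j z u u' \<and>
        (p = cEq t u \<and> q = cEq t' u' \<or> p = cLe t u \<and> q = cLe t' u')) \<or>
     (\<exists>i t t'. SubT j z t t' \<and> p = cTr i t \<and> q = cTr i t') \<or>
     (\<exists>p' q'. pr j (pr p' q') \<in> els s \<and> p = cNeg p' \<and> q = cNeg q') \<or>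
     (\<exists>p' q' p'' q''. pr j (pr p' q') \<in> els s \<and> pr j (pr p'' q'') \<in> els s \<and>
        p = cImp p' p'' \<and> q = cImp q' q'') \<or>
     (\<exists>p' q'. pr (j + 1) (pr p' q') \<in> els s \<and> p = cEx p' \<and> q = cEx q')))"

lemma arg_less [simp]:
  fixes a b n :: "'a::arith"
  assumes "n \<noteq> 0"
  shows "a < pr n a" "a < pr n (pr a b)" "b < pr n (pr a b)"
proof -
  show "a < pr n a" using assms by (rule pr_less2)
  show "a < pr n (pr a b)" using pr_less2[OF assms, of "pr a b"] pr_le1[of a b] by order
  show "b < pr n (pr a b)" using pr_less2[OF assms, of "pr a b"] pr_le2[of b a] by order
qed

text \<open>Monotone operators in which at most two premises support each conclusion; every clause
  in the definitions of syntax is of this kind.\<close>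

definition fin2 :: "(('i \<Rightarrow> bool) \<Rightarrow> bool) \<Rightarrow> bool" where
  "fin2 P \<longleftrightarrow> (\<forall>M N. P M \<longrightarrow> (\<forall>p. M p \<longrightarrow> N p) \<longrightarrow> P N) \<and>
     (\<forall>M. P M \<longrightarrow> (\<exists>p q. P (\<lambda>r. M r \<and> (r = p \<or> r = q))))"

lemma fin2_mono: "fin2 P \<Longrightarrow> P M \<Longrightarrow> (\<And>p. M p \<Longrightarrow> N p) \<Longrightarrow> P N"
  unfolding fin2_def by blast

lemma fin2_or: "fin2 P \<Longrightarrow> fin2 Q \<Longrightarrow> fin2 (\<lambda>M. P M \<or> Q M)"
  unfolding fin2_def by meson

lemma fin2_ex: "(\<And>x. fin2 (P x)) \<Longrightarrow> fin2 (\<lambda>M. \<exists>x. P x M)"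
  unfolding fin2_def by meson

lemma fin2_const: "fin2 (\<lambda>M. c)"
  unfolding fin2_def by simp

lemma fin2_1: "fin2 (\<lambda>M. M a \<and> c)"
  unfolding fin2_def by blast

lemma fin2_2: "fin2 (\<lambda>M. M a \<and> M b \<and> c)"
  unfolding fin2_def by blast

lemmas fin2_intros = fin2_or fin2_ex fin2_2 fin2_1 fin2_const

context aca
begin

text \<open>Coded derivations of the two premises are united and the conclusion is added;
  monotonicity keeps the older entries justified. In this way each syntactic relation satisfies its
  own recursion equation.\<close>

lemma derivation_fix:
  fixes enc :: "'i \<Rightarrow> 'a"
  assumes inj: "inj enc" and fin2: "\<And>i. fin2 (P i)"
    and J: "\<And>i. J i \<longleftrightarrow> (\<exists>s. enc i \<in> els s \<and> (\<forall>j. enc j \<in> els s \<longrightarrow> P j (\<lambda>p. enc p \<in> els s)))"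
  shows "J i \<longleftrightarrow> P i J"
proof
  note mono = fin2_mono[OF fin2]
  assume "J i"
  then obtain s where s: "enc i \<in> els s" "\<forall>j. enc j \<in> els s \<longrightarrow> P j (\<lambda>p. enc p \<in> els s)"
    by (auto simp: J)
  show "P i J"
  proof (rule mono)
    show "P i (\<lambda>p. enc p \<in> els s)" using s by blast
    show "J p" if "enc p \<in> els s" for p using s that J by blast
  qed
next
  note mono = fin2_mono[OF fin2]
  assume "P i J"
  then obtain p q where pq: "P i (\<lambda>r. J r \<and> (r = p \<or> r = q))"
    using fin2[of i] unfolding fin2_def by blast
  have *: "\<exists>F. fins F \<and> (J r \<longrightarrow> enc r \<in> F) \<and> (\<forall>j. enc j \<in> F \<longrightarrow> P j (\<lambda>p. enc p \<in> F))" for r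
  proof (cases "J r")
    case True
    then obtain s where "enc r \<in> els s" "\<forall>j. enc j \<in> els s \<longrightarrow> P j (\<lambda>p. enc p \<in> els s)"
      by (auto simp: J)
    then show ?thesis by (intro exI[of _ "els s"]) (auto simp: fins_def)
  next
    case False
    then show ?thesis using fins_empty by (intro exI[of _ "{}"]) auto
  qed
  obtain F where F: "fins F" "J p \<longrightarrow> enc p \<in> F" "\<forall>j. enc j \<in> F \<longrightarrow> P j (\<lambda>p. enc p \<in> F)"
    using *[of p] by blast
  obtain G where G: "fins G" "J q \<longrightarrow> enc q \<in> G" "\<forall>j. enc j \<in> G \<longrightarrow> P j (\<lambda>p. enc p \<in> G)"
    using *[of q] by blast
  obtain s where s: "els s = insert (enc i) (F \<union> G)"
    using fins_insert[OF fins_Un[OF F(1) G(1)]] by (metis fins_def)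
  have "P j (\<lambda>p. enc p \<in> els s)" if j: "enc j \<in> els s" for j
  proof -
    consider "enc j \<in> F" | "enc j \<in> G" | "j = i" using j s inj by (auto dest: injD)
    then show ?thesis
    proof cases
      case 1
      then have "P j (\<lambda>p. enc p \<in> F)" using F(3) by blast
      then show ?thesis by (rule mono) (simp add: s)
    next
      case 2
      then have "P j (\<lambda>p. enc p \<in> G)" using G(3) by blast
      then show ?thesis by (rule mono) (simp add: s)
    next
      case 3
      have "P i (\<lambda>p. enc p \<in> els s)" using pq by (rule mono) (use F(2) G(2) s in auto)
      then show ?thesis using 3 by simp
    qed
  qed
  moreover have "enc i \<in> els s" using s by simp
  ultimately show "J i" unfolding J by blast
qed

lemma Num_fix: fixes x :: 'a shows
  "Num x z \<longleftrightarrow> x = 0 \<and> z = 0 \<or> (\<exists>a' b'. Num a' b' \<and> x = a' + 1 \<and> z = cSucc b')"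
proof -
  have "(\<lambda>(x :: 'a, z :: 'a). Num x z) (x, z) \<longleftrightarrow> (\<lambda>(a, b) M. a = 0 \<and> b = 0 \<or> (\<exists>a' b'. M (a',b') \<and> a = a' + 1 \<and> b = cSucc b'))
     (x, z) (\<lambda>(x :: 'a, z :: 'a). Num x z)"
  proof (rule derivation_fix[where enc = "\<lambda>(x, y). pr x y" and J = "\<lambda>(x :: 'a, z :: 'a). Num x z" and
      P = "\<lambda>(a, b) M. a = 0 \<and> b = 0 \<or> (\<exists>a' b'. M (a',b') \<and> a = a' + 1 \<and> b = cSucc b')"])
    show "fin2 ((\<lambda>(a, b) M. a = 0 \<and> b = 0 \<or> (\<exists>a' b'. M (a',b') \<and> a = a' + 1 \<and> b = cSucc b')) i)" for i
      by (cases i) (simp only: prod.case, intro fin2_intros)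
  qed (simp_all only: inj_def split_paired_all split_paired_All split_paired_Ex prod.case prod.inject pr_inject Num_def simp_thms)
  then show ?thesis by simp
qed

lemma Trm_fix: fixes t :: 'a shows
  "Trm k t \<longleftrightarrow> t = 0 \<or> (\<exists>i<k. t = cVar i) \<or> (\<exists>a. Trm k a \<and> t = cSucc a) \<or>
     (\<exists>a b. Trm k a \<and> Trm k b \<and> (t = cPlus a b \<or> t = cTimes a b))"
proof -
  have "(Trm k) t \<longleftrightarrow> (\<lambda>t M. t = 0 \<or> (\<exists>i<k. t = cVar i) \<or> (\<exists>a. M a \<and> t = cSucc a) \<or>
     (\<exists>a b. M a \<and> M b \<and> (t = cPlus a b \<or> t = cTimes a b)))
     t (Trm k)"
  proof (rule derivation_fix[where enc = "\<lambda>x. x" and J = "Trm k" and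
      P = "\<lambda>t M. t = 0 \<or> (\<exists>i<k. t = cVar i) \<or> (\<exists>a. M a \<and> t = cSucc a) \<or>
     (\<exists>a b. M a \<and> M b \<and> (t = cPlus a b \<or> t = cTimes a b))"])
    show "fin2 ((\<lambda>t M. t = 0 \<or> (\<exists>i<k. t = cVar i) \<or> (\<exists>a. M a \<and> t = cSucc a) \<or>
     (\<exists>a b. M a \<and> M b \<and> (t = cPlus a b \<or> t = cTimes a b))) i)" for i
      by (intro fin2_intros)
  qed (simp_all only: inj_def Trm_def simp_thms)
  then show ?thesis by simp
qed

lemma Val_fix: fixes t :: 'a shows
  "Val t v \<longleftrightarrow> t = 0 \<and> v = 0 \<or> (\<exists>a b. Val a b \<and> t = cSucc a \<and> v = b + 1) \<or>
     (\<exists>a b a' b'. Val a b \<and> Val a' b' \<and> (t = cPlus a a' \<and> v = b + b' \<or> t = cTimes a a' \<and> v = b * b'))"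
proof -
  have "(\<lambda>(x :: 'a, z :: 'a). Val x z) (t, v) \<longleftrightarrow> (\<lambda>(t, v) M. t = 0 \<and> v = 0 \<or> (\<exists>a b. M (a,b) \<and> t = cSucc a \<and> v = b + 1) \<or>
     (\<exists>a b a' b'. M (a,b) \<and> M (a',b') \<and> (t = cPlus a a' \<and> v = b + b' \<or> t = cTimes a a' \<and> v = b * b')))
     (t, v) (\<lambda>(x :: 'a, z :: 'a). Val x z)"
  proof (rule derivation_fix[where enc = "\<lambda>(x, y). pr x y" and J = "\<lambda>(x :: 'a, z :: 'a). Val x z" and
      P = "\<lambda>(t, v) M. t = 0 \<and> v = 0 \<or> (\<exists>a b. M (a,b) \<and> t = cSucc a \<and> v = b + 1) \<or>
     (\<exists>a b a' b'. M (a,b) \<and> M (a',b') \<and> (t = cPlus a a' \<and> v = b + b' \<or> t = cTimes a a' \<and> v = b * b'))"])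
    show "fin2 ((\<lambda>(t, v) M. t = 0 \<and> v = 0 \<or> (\<exists>a b. M (a,b) \<and> t = cSucc a \<and> v = b + 1) \<or>
     (\<exists>a b a' b'. M (a,b) \<and> M (a',b') \<and> (t = cPlus a a' \<and> v = b + b' \<or> t = cTimes a a' \<and> v = b * b'))) i)" for i
      by (cases i) (simp only: prod.case, intro fin2_intros)
  qed (simp_all only: inj_def split_paired_all split_paired_All split_paired_Ex prod.case prod.inject pr_inject Val_def simp_thms)
  then show ?thesis by simp
qed

lemma SubT_fix: fixes t :: 'a shows
  "SubT k z t u \<longleftrightarrow> t = 0 \<and> u = 0 \<or> (\<exists>i<k. t = cVar i \<and> u = cVar i) \<or> t = cVar k \<and> u = z \<or>
     (\<exists>i\<ge>k. t = cVar (i + 1) \<and> u = cVar i) \<or> (\<exists>a b. SubT k z a b \<and> t = cSucc a \<and> u = cSucc b) \<or>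
     (\<exists>a b a' b'. SubT k z a b \<and> SubT k z a' b' \<and>
        (t = cPlus a a' \<and> u = cPlus b b' \<or> t = cTimes a a' \<and> u = cTimes b b'))"
proof -
  have "(\<lambda>(x, y). SubT k z x y) (t, u) \<longleftrightarrow> (\<lambda>(t, u) M. t = 0 \<and> u = 0 \<or> (\<exists>i<k. t = cVar i \<and> u = cVar i) \<or> t = cVar k \<and> u = z \<or>
     (\<exists>i\<ge>k. t = cVar (i + 1) \<and> u = cVar i) \<or> (\<exists>a b. M (a,b) \<and> t = cSucc a \<and> u = cSucc b) \<or>
     (\<exists>a b a' b'. M (a,b) \<and> M (a',b') \<and>
        (t = cPlus a a' \<and> u = cPlus b b' \<or> t = cTimes a a' \<and> u = cTimes b b')))
     (t, u) (\<lambda>(x, y). SubT k z x y)"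
  proof (rule derivation_fix[where enc = "\<lambda>(x, y). pr x y" and J = "\<lambda>(x, y). SubT k z x y" and
      P = "\<lambda>(t, u) M. t = 0 \<and> u = 0 \<or> (\<exists>i<k. t = cVar i \<and> u = cVar i) \<or> t = cVar k \<and> u = z \<or>
     (\<exists>i\<ge>k. t = cVar (i + 1) \<and> u = cVar i) \<or> (\<exists>a b. M (a,b) \<and> t = cSucc a \<and> u = cSucc b) \<or>
     (\<exists>a b a' b'. M (a,b) \<and> M (a',b') \<and>
        (t = cPlus a a' \<and> u = cPlus b b' \<or> t = cTimes a a' \<and> u = cTimes b b'))"])
    show "fin2 ((\<lambda>(t, u) M. t = 0 \<and> u = 0 \<or> (\<exists>i<k. t = cVar i \<and> u = cVar i) \<or> t = cVar k \<and> u = z \<or>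
     (\<exists>i\<ge>k. t = cVar (i + 1) \<and> u = cVar i) \<or> (\<exists>a b. M (a,b) \<and> t = cSucc a \<and> u = cSucc b) \<or>
     (\<exists>a b a' b'. M (a,b) \<and> M (a',b') \<and>
        (t = cPlus a a' \<and> u = cPlus b b' \<or> t = cTimes a a' \<and> u = cTimes b b'))) i)" for i
      by (cases i) (simp only: prod.case, intro fin2_intros)
  qed (simp_all only: inj_def split_paired_all split_paired_All split_paired_Ex prod.case prod.inject pr_inject SubT_def simp_thms)
  then show ?thesis by simp
qed

lemma Form_fix: fixes p :: 'a shows
  "Form n k p \<longleftrightarrow> (\<exists>t u. Trm k t \<and> Trm k u \<and> (p = cEq t u \<or> p = cLe t u)) \<or>
     (\<exists>i t. i < of_nat n \<and> Trm k t \<and> p = cTr i t) \<or> (\<exists>q. Form n k q \<and> p = cNeg q) \<or>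
     (\<exists>q q'. Form n k q \<and> Form n k q' \<and> p = cImp q q') \<or> (\<exists>q. Form n (k + 1) q \<and> p = cEx q)"
proof -
  have "(\<lambda>(x :: 'a, y :: 'a). Form n x y) (k, p) \<longleftrightarrow> (\<lambda>(k, p) M. (\<exists>t u. Trm k t \<and> Trm k u \<and> (p = cEq t u \<or> p = cLe t u)) \<or>
     (\<exists>i t. i < of_nat n \<and> Trm k t \<and> p = cTr i t) \<or> (\<exists>q. M (k,q) \<and> p = cNeg q) \<or>
     (\<exists>q q'. M (k,q) \<and> M (k,q') \<and> p = cImp q q') \<or> (\<exists>q. M (k + 1,q) \<and> p = cEx q))
     (k, p) (\<lambda>(x :: 'a, y :: 'a). Form n x y)"
  proof (rule derivation_fix[where enc = "\<lambda>(x, y). pr x y" and J = "\<lambda>(x :: 'a, y :: 'a). Form n x y" and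
      P = "\<lambda>(k, p) M. (\<exists>t u. Trm k t \<and> Trm k u \<and> (p = cEq t u \<or> p = cLe t u)) \<or>
     (\<exists>i t. i < of_nat n \<and> Trm k t \<and> p = cTr i t) \<or> (\<exists>q. M (k,q) \<and> p = cNeg q) \<or>
     (\<exists>q q'. M (k,q) \<and> M (k,q') \<and> p = cImp q q') \<or> (\<exists>q. M (k + 1,q) \<and> p = cEx q)"])
    show "fin2 ((\<lambda>(k, p) M. (\<exists>t u. Trm k t \<and> Trm k u \<and> (p = cEq t u \<or> p = cLe t u)) \<or>
     (\<exists>i t. i < of_nat n \<and> Trm k t \<and> p = cTr i t) \<or> (\<exists>q. M (k,q) \<and> p = cNeg q) \<or>
     (\<exists>q q'. M (k,q) \<and> M (k,q') \<and> p = cImp q q') \<or> (\<exists>q. M (k + 1,q) \<and> p = cEx q)) i)" for i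
      by (cases i) (simp only: prod.case, intro fin2_intros)
  qed (simp_all only: inj_def split_paired_all split_paired_All split_paired_Ex prod.case prod.inject pr_inject Form_def simp_thms)
  then show ?thesis by simp
qed

lemma Dp_fix: fixes p :: 'a shows
  "Dp n k p d \<longleftrightarrow> (\<exists>t u. Trm k t \<and> Trm k u \<and> (p = cEq t u \<or> p = cLe t u)) \<or>
     (\<exists>i t. i < of_nat n \<and> Trm k t \<and> p = cTr i t) \<or> (\<exists>q. Dp n k q d \<and> p = cNeg q) \<or>
     (\<exists>q q'. Dp n k q d \<and> Dp n k q' d \<and> p = cImp q q') \<or>
     (\<exists>q d'. Dp n (k + 1) q d' \<and> p = cEx q \<and> d = d' + 1)"
proof -
  have "(\<lambda>(x :: 'a, y :: 'a, d :: 'a). Dp n x y d) (k, p, d) \<longleftrightarrow> (\<lambda>(k, p, d) M. (\<exists>t u. Trm k t \<and> Trm k u \<and> (p = cEq t u \<or> p = cLe t u)) \<or>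
     (\<exists>i t. i < of_nat n \<and> Trm k t \<and> p = cTr i t) \<or> (\<exists>q. M (k,q,d) \<and> p = cNeg q) \<or>
     (\<exists>q q'. M (k,q,d) \<and> M (k,q',d) \<and> p = cImp q q') \<or>
     (\<exists>q d'. M (k + 1,q,d') \<and> p = cEx q \<and> d = d' + 1))
     (k, p, d) (\<lambda>(x :: 'a, y :: 'a, d :: 'a). Dp n x y d)"
  proof (rule derivation_fix[where enc = "\<lambda>(x, y, z). pr x (pr y z)" and J = "\<lambda>(x :: 'a, y :: 'a, d :: 'a). Dp n x y d" and
      P = "\<lambda>(k, p, d) M. (\<exists>t u. Trm k t \<and> Trm k u \<and> (p = cEq t u \<or> p = cLe t u)) \<or>
     (\<exists>i t. i < of_nat n \<and> Trm k t \<and> p = cTr i t) \<or> (\<exists>q. M (k,q,d) \<and> p = cNeg q) \<or>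
     (\<exists>q q'. M (k,q,d) \<and> M (k,q',d) \<and> p = cImp q q') \<or>
     (\<exists>q d'. M (k + 1,q,d') \<and> p = cEx q \<and> d = d' + 1)"])
    show "fin2 ((\<lambda>(k, p, d) M. (\<exists>t u. Trm k t \<and> Trm k u \<and> (p = cEq t u \<or> p = cLe t u)) \<or>
     (\<exists>i t. i < of_nat n \<and> Trm k t \<and> p = cTr i t) \<or> (\<exists>q. M (k,q,d) \<and> p = cNeg q) \<or>
     (\<exists>q q'. M (k,q,d) \<and> M (k,q',d) \<and> p = cImp q q') \<or>
     (\<exists>q d'. M (k + 1,q,d') \<and> p = cEx q \<and> d = d' + 1)) i)" for i
      by (cases i) (simp only: prod.case, intro fin2_intros)
  qed (simp_all only: inj_def split_paired_all split_paired_All split_paired_Ex prod.case prod.inject pr_inject Dp_def simp_thms)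
  then show ?thesis by simp
qed

lemma Sub_fix: fixes p :: 'a shows
  "Sub k z p q \<longleftrightarrow> (\<exists>t t' u u'. SubT k z t t' \<and> SubT k z u u' \<and>
        (p = cEq t u \<and> q = cEq t' u' \<or> p = cLe t u \<and> q = cLe t' u')) \<or>
     (\<exists>i t t'. SubT k z t t' \<and> p = cTr i t \<and> q = cTr i t') \<or>
     (\<exists>p' q'. Sub k z p' q' \<and> p = cNeg p' \<and> q = cNeg q') \<or>
     (\<exists>p' q' p'' q''. Sub k z p' q' \<and> Sub k z p'' q'' \<and> p = cImp p' p'' \<and> q = cImp q' q'') \<or>
     (\<exists>p' q'. Sub (k + 1) z p' q' \<and> p = cEx p' \<and> q = cEx q')"
proof -
  have "(\<lambda>(x, y, d). Sub x z y d) (k, p, q) \<longleftrightarrow> (\<lambda>(k, p, q) M. (\<exists>t t' u u'. SubT k z t t' \<and> SubT k z u u' \<and>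
        (p = cEq t u \<and> q = cEq t' u' \<or> p = cLe t u \<and> q = cLe t' u')) \<or>
     (\<exists>i t t'. SubT k z t t' \<and> p = cTr i t \<and> q = cTr i t') \<or>
     (\<exists>p' q'. M (k,p',q') \<and> p = cNeg p' \<and> q = cNeg q') \<or>
     (\<exists>p' q' p'' q''. M (k,p',q') \<and> M (k,p'',q'') \<and> p = cImp p' p'' \<and> q = cImp q' q'') \<or>
     (\<exists>p' q'. M (k + 1,p',q') \<and> p = cEx p' \<and> q = cEx q'))
     (k, p, q) (\<lambda>(x, y, d). Sub x z y d)"
  proof (rule derivation_fix[where enc = "\<lambda>(x, y, z). pr x (pr y z)" and J = "\<lambda>(x, y, d). Sub x z y d" and
      P = "\<lambda>(k, p, q) M. (\<exists>t t' u u'. SubT k z t t' \<and> SubT k z u u' \<and>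
        (p = cEq t u \<and> q = cEq t' u' \<or> p = cLe t u \<and> q = cLe t' u')) \<or>
     (\<exists>i t t'. SubT k z t t' \<and> p = cTr i t \<and> q = cTr i t') \<or>
     (\<exists>p' q'. M (k,p',q') \<and> p = cNeg p' \<and> q = cNeg q') \<or>
     (\<exists>p' q' p'' q''. M (k,p',q') \<and> M (k,p'',q'') \<and> p = cImp p' p'' \<and> q = cImp q' q'') \<or>
     (\<exists>p' q'. M (k + 1,p',q') \<and> p = cEx p' \<and> q = cEx q')"])
    show "fin2 ((\<lambda>(k, p, q) M. (\<exists>t t' u u'. SubT k z t t' \<and> SubT k z u u' \<and>
        (p = cEq t u \<and> q = cEq t' u' \<or> p = cLe t u \<and> q = cLe t' u')) \<or>
     (\<exists>i t t'. SubT k z t t' \<and> p = cTr i t \<and> q = cTr i t') \<or>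
     (\<exists>p' q'. M (k,p',q') \<and> p = cNeg p' \<and> q = cNeg q') \<or>
     (\<exists>p' q' p'' q''. M (k,p',q') \<and> M (k,p'',q'') \<and> p = cImp p' p'' \<and> q = cImp q' q'') \<or>
     (\<exists>p' q'. M (k + 1,p',q') \<and> p = cEx p' \<and> q = cEx q')) i)" for i
      by (cases i) (simp only: prod.case, intro fin2_intros)
  qed (simp_all only: inj_def split_paired_all split_paired_All split_paired_Ex prod.case prod.inject pr_inject Sub_def simp_thms)
  then show ?thesis by simp
qed

end

lemma zero_eq_pr [simp]: "0 = pr a b \<longleftrightarrow> a = 0 \<and> b = 0"
  using pr_eq_0[of a b] by metis

context aca
begin

lemma df_Num: "fd S f \<Longrightarrow> fd S g \<Longrightarrow> df S (\<lambda>e. Num (f e) (g e))"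
  by (rule df_app2[where P = Num]) (unfold Num_def, intro dfi fdi)

lemma df_Trm: "fd S f \<Longrightarrow> fd S g \<Longrightarrow> df S (\<lambda>e. Trm (f e) (g e))"
  by (rule df_app2[where P = Trm]) (unfold Trm_def, intro dfi fdi)

lemma df_Val: "fd S f \<Longrightarrow> fd S g \<Longrightarrow> df S (\<lambda>e. Val (f e) (g e))"
  by (rule df_app2[where P = Val]) (unfold Val_def, intro dfi fdi)

lemma df_SubT: "fd S f \<Longrightarrow> fd S g \<Longrightarrow> fd S h \<Longrightarrow> fd S k \<Longrightarrow> df S (\<lambda>e. SubT (f e) (g e) (h e) (k e))"
  by (rule df_app4[where P = SubT]) (unfold SubT_def, intro dfi fdi)

lemma df_Form: "fd S f \<Longrightarrow> fd S g \<Longrightarrow> df S (\<lambda>e. Form n (f e) (g e))"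
  by (rule df_app2[where P = "Form n"]) (unfold Form_def, intro dfi fdi df_Trm)

lemma df_Dp: "fd S f \<Longrightarrow> fd S g \<Longrightarrow> fd S h \<Longrightarrow> df S (\<lambda>e. Dp n (f e) (g e) (h e))"
  by (rule df_app3[where P = "Dp n"]) (unfold Dp_def, intro dfi fdi df_Trm)

lemma df_Sub: "fd S f \<Longrightarrow> fd S g \<Longrightarrow> fd S h \<Longrightarrow> fd S k \<Longrightarrow> df S (\<lambda>e. Sub (f e) (g e) (h e) (k e))"
  by (rule df_app4[where P = Sub]) (unfold Sub_def, intro dfi fdi df_SubT)

lemmas dfs = dfi df_Num df_Trm df_Val df_SubT df_Form df_Dp df_Sub df_hcard df_lcode df_xl

lemma Trm_simps [simp]:
  fixes t :: 'a shows
  "Trm k 0" "Trm k (cVar i) \<longleftrightarrow> i < k" "Trm k (cSucc t) \<longleftrightarrow> Trm k t"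
  "Trm k (cPlus t u) \<longleftrightarrow> Trm k t \<and> Trm k u" "Trm k (cTimes t u) \<longleftrightarrow> Trm k t \<and> Trm k u"
  by (subst Trm_fix, (auto)[1])+

lemma SubT_simps [simp]:
  fixes t :: 'a shows
  "SubT k z 0 u \<longleftrightarrow> u = 0"
  "SubT k z (cVar i) u \<longleftrightarrow> i < k \<and> u = cVar i \<or> i = k \<and> u = z \<or> (\<exists>j\<ge>k. i = j + 1 \<and> u = cVar j)"
  "SubT k z (cSucc t) u \<longleftrightarrow> (\<exists>t'. SubT k z t t' \<and> u = cSucc t')"
  "SubT k z (cPlus t v) u \<longleftrightarrow> (\<exists>t' v'. SubT k z t t' \<and> SubT k z v v' \<and> u = cPlus t' v')"
  "SubT k z (cTimes t v) u \<longleftrightarrow> (\<exists>t' v'. SubT k z t t' \<and> SubT k z v v' \<and> u = cTimes t' v')"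
  by (subst SubT_fix, (auto)[1])+

lemma Val_simps [simp]:
  fixes t :: 'a shows
  "Val 0 v \<longleftrightarrow> v = 0" "Val (cSucc t) v \<longleftrightarrow> (\<exists>w. Val t w \<and> v = w + 1)"
  "Val (cPlus t u) v \<longleftrightarrow> (\<exists>w w'. Val t w \<and> Val u w' \<and> v = w + w')"
  "Val (cTimes t u) v \<longleftrightarrow> (\<exists>w w'. Val t w \<and> Val u w' \<and> v = w * w')"
  by (subst Val_fix, (auto)[1])+

lemma Form_simps [simp]:
  fixes p :: 'a shows
  "Form n k (cEq t u) \<longleftrightarrow> Trm k t \<and> Trm k u" "Form n k (cLe t u) \<longleftrightarrow> Trm k t \<and> Trm k u"
  "Form n k (cTr i t) \<longleftrightarrow> i < of_nat n \<and> Trm k t" "Form n k (cNeg p) \<longleftrightarrow> Form n k p"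
  "Form n k (cImp p q) \<longleftrightarrow> Form n k p \<and> Form n k q" "Form n k (cEx p) \<longleftrightarrow> Form n (k + 1) p"
  by (subst Form_fix, (auto)[1])+

lemma Dp_simps [simp]:
  fixes p :: 'a shows
  "Dp n k (cEq t u) d \<longleftrightarrow> Trm k t \<and> Trm k u" "Dp n k (cLe t u) d \<longleftrightarrow> Trm k t \<and> Trm k u"
  "Dp n k (cTr i t) d \<longleftrightarrow> i < of_nat n \<and> Trm k t" "Dp n k (cNeg p) d \<longleftrightarrow> Dp n k p d"
  "Dp n k (cImp p q) d \<longleftrightarrow> Dp n k p d \<and> Dp n k q d" "Dp n k (cEx p) d \<longleftrightarrow> (\<exists>d'. Dp n (k + 1) p d' \<and> d = d' + 1)"
  by (subst Dp_fix, (auto)[1])+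

lemma Sub_simps [simp]:
  fixes p :: 'a shows
  "Sub k z (cEq t u) q \<longleftrightarrow> (\<exists>t' u'. SubT k z t t' \<and> SubT k z u u' \<and> q = cEq t' u')"
  "Sub k z (cLe t u) q \<longleftrightarrow> (\<exists>t' u'. SubT k z t t' \<and> SubT k z u u' \<and> q = cLe t' u')"
  "Sub k z (cTr i t) q \<longleftrightarrow> (\<exists>t'. SubT k z t t' \<and> q = cTr i t')"
  "Sub k z (cNeg p) q \<longleftrightarrow> (\<exists>p'. Sub k z p p' \<and> q = cNeg p')"
  "Sub k z (cImp p r) q \<longleftrightarrow> (\<exists>p' r'. Sub k z p p' \<and> Sub k z r r' \<and> q = cImp p' r')"
  "Sub k z (cEx p) q \<longleftrightarrow> (\<exists>p'. Sub (k + 1) z p p' \<and> q = cEx p')"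
  by (subst Sub_fix, (auto)[1])+

lemma Trm_induct:
  assumes "df S (\<lambda>e. P (e 0))" "Trm k t" "P 0" "\<And>i. i < k \<Longrightarrow> P (cVar i)"
    "\<And>t. Trm k t \<Longrightarrow> P t \<Longrightarrow> P (cSucc t)"
    "\<And>t u. Trm k t \<Longrightarrow> Trm k u \<Longrightarrow> P t \<Longrightarrow> P u \<Longrightarrow> P (cPlus t u)"
    "\<And>t u. Trm k t \<Longrightarrow> Trm k u \<Longrightarrow> P t \<Longrightarrow> P u \<Longrightarrow> P (cTimes t u)"
  shows "P t"
proof -
  have "Trm k t \<longrightarrow> P t"
  proof (rule less_induct'[where P = "\<lambda>t. Trm k t \<longrightarrow> P t"])
    show "df S (\<lambda>e. Trm k (e 0) \<longrightarrow> P (e 0))" by (intro dfs fdi assms(1))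
    fix t assume IH: "\<And>y. y < t \<Longrightarrow> Trm k y \<longrightarrow> P y"
    show "Trm k t \<longrightarrow> P t"
    proof
      assume "Trm k t"
      from Trm_fix[THEN iffD1, OF this] consider "t = 0" | i where "i < k" "t = cVar i" | a where "Trm k a" "t = cSucc a"
        | a b where "Trm k a" "Trm k b" "t = cPlus a b" | a b where "Trm k a" "Trm k b" "t = cTimes a b"
        by blast
      then show "P t"
      proof cases
        case 1 then show ?thesis using assms(3) by simp
      next
        case 2 then show ?thesis using assms(4) by simp
      next
        case 3
        then have "P a" using IH[of a] by simp
        then show ?thesis using assms(5) 3 by simp
      next
        case 4
        then have "P a" "P b" using IH[of a] IH[of b] by simp_all
        then show ?thesis using assms(6) 4 by simp
      next
        case 5
        then have "P a" "P b" using IH[of a] IH[of b] by simp_all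
        then show ?thesis using assms(7) 5 by simp
      qed
    qed
  qed
  then show ?thesis using assms(2) by blast
qed

lemma Form_induct:
  assumes P: "df S (\<lambda>e. P (e 0) (e 1))" and "Form n k p"
    and "\<And>k t u. Trm k t \<Longrightarrow> Trm k u \<Longrightarrow> P k (cEq t u)"
    and "\<And>k t u. Trm k t \<Longrightarrow> Trm k u \<Longrightarrow> P k (cLe t u)"
    and "\<And>k i t. i < of_nat n \<Longrightarrow> Trm k t \<Longrightarrow> P k (cTr i t)"
    and "\<And>k p. Form n k p \<Longrightarrow> P k p \<Longrightarrow> P k (cNeg p)"
    and "\<And>k p q. Form n k p \<Longrightarrow> Form n k q \<Longrightarrow> P k p \<Longrightarrow> P k q \<Longrightarrow> P k (cImp p q)"
    and "\<And>k p. Form n (k + 1) p \<Longrightarrow> P (k + 1) p \<Longrightarrow> P k (cEx p)"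
  shows "P k p"
proof -
  have P': "df S (\<lambda>e. P (f e) (g e))" if "fd S f" "fd S g" for f g using df_app2[OF P that] .
  have "\<forall>k. Form n k p \<longrightarrow> P k p"
  proof (rule less_induct'[where P = "\<lambda>p. \<forall>k. Form n k p \<longrightarrow> P k p"])
    show "df S (\<lambda>e. \<forall>k. Form n k (e 0) \<longrightarrow> P k (e 0))" by (intro dfs fdi P')
    fix p assume IH: "\<And>q. q < p \<Longrightarrow> \<forall>k. Form n k q \<longrightarrow> P k q"
    show "\<forall>k. Form n k p \<longrightarrow> P k p"
    proof (intro allI impI)
      fix k assume "Form n k p"
      from Form_fix[THEN iffD1, OF this] consider t u where "Trm k t" "Trm k u" "p = cEq t u" | t u where "Trm k t" "Trm k u" "p = cLe t u"
        | i t where "i < of_nat n" "Trm k t" "p = cTr i t" | q where "Form n k q" "p = cNeg q"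
        | q r where "Form n k q" "Form n k r" "p = cImp q r" | q where "Form n (k + 1) q" "p = cEx q"
        by blast
      then show "P k p"
      proof cases
        case 1 then show ?thesis using assms(3) by simp
      next
        case 2 then show ?thesis using assms(4) by simp
      next
        case 3 then show ?thesis using assms(5) by simp
      next
        case 4
        then have "P k q" using IH[of q] by simp
        then show ?thesis using assms(6) 4 by simp
      next
        case 5
        then have "P k q" "P k r" using IH[of q] IH[of r] by simp_all
        then show ?thesis using assms(7) 5 by simp
      next
        case 6
        then have "P (k + 1) q" using IH[of q] by simp
        then show ?thesis using assms(8) 6 by simp
      qed
    qed
  qed
  then show ?thesis using assms(2) by blast
qed

lemma num_ex: fixes x :: 'a shows "\<exists>z. Num x z"
  by (rule induct[where P = "\<lambda>x. \<exists>z. Num x z"], intro dfs fdi) (metis Num_fix)+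

lemma num_unique: fixes x :: 'a shows "\<forall>z z'. Num x z \<longrightarrow> Num x z' \<longrightarrow> z = z'"
proof (rule induct[where P = "\<lambda>x. \<forall>z z'. Num x z \<longrightarrow> Num x z' \<longrightarrow> z = z'"])
  show "df S (\<lambda>e. \<forall>z z'. Num (e 0) z \<longrightarrow> Num (e 0) z' \<longrightarrow> z = z')" by (intro dfs fdi)
  show "\<forall>z z'. Num (0::'a) z \<longrightarrow> Num 0 z' \<longrightarrow> z = z'" by (subst Num_fix, subst (2) Num_fix) auto
  fix x :: 'a assume "\<forall>z z'. Num x z \<longrightarrow> Num x z' \<longrightarrow> z = z'"
  then show "\<forall>z z'. Num (x + 1) z \<longrightarrow> Num (x + 1) z' \<longrightarrow> z = z'"
    by (subst Num_fix, subst (2) Num_fix) auto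
qed

definition num :: "'a \<Rightarrow> 'a" where
  "num x = (THE z. Num x z)"

lemma Num_num: "Num x z \<longleftrightarrow> z = num x"
  unfolding num_def using num_ex[of x] num_unique[of x] by (metis the_equality)

lemma num_0 [simp]: "num 0 = 0"
  using Num_num[of 0 0] Num_fix[of 0 0] by simp

lemma num_Suc [simp]: "num (x + 1) = cSucc (num x)"
  using Num_num[of "x + 1" "cSucc (num x)"] Num_fix[of "x + 1" "cSucc (num x)"] Num_num[of x "num x"] by auto

lemma fd_num: "fd S f \<Longrightarrow> fd S (\<lambda>e. num (f e))"
  by (rule fd_app1[where h = num]) (unfold Num_num[symmetric], intro dfs fdi)

lemma Trm_num [simp]: "Trm k (num x)"
  by (rule induct[where P = "\<lambda>x. Trm k (num x)"], intro dfs fdi fd_num) auto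

lemma Val_num [simp]: "Val (num x) v \<longleftrightarrow> v = x"
proof -
  have "\<forall>v. Val (num x) v \<longleftrightarrow> v = x"
    by (rule induct[where P = "\<lambda>x. \<forall>v. Val (num x) v \<longleftrightarrow> v = x"], intro dfs fdi fd_num) auto
  then show ?thesis by blast
qed

lemma SubT_num [simp]: "SubT k z (num x) u \<longleftrightarrow> u = num x"
proof -
  have "\<forall>u. SubT k z (num x) u \<longleftrightarrow> u = num x"
    by (rule induct[where P = "\<lambda>x. \<forall>u. SubT k z (num x) u \<longleftrightarrow> u = num x"], intro dfs fdi fd_num) auto
  then show ?thesis by blast
qed

lemma Trm_mono: fixes t :: 'a assumes "Trm k t" "k \<le> k'" shows "Trm k' t"
  using assms(1) by (rule Trm_induct[where P = "Trm k'", rotated]) (use assms(2) in \<open>auto intro: dfs fdi\<close>)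

lemma Val_unique: fixes t :: 'a assumes "Trm 0 t" shows "\<exists>!v. Val t v"
proof -
  have "\<exists>v. \<forall>w. Val t w \<longleftrightarrow> w = v"
    using assms
  proof (rule Trm_induct[where P = "\<lambda>t. \<exists>v. \<forall>w. Val t w \<longleftrightarrow> w = v", rotated])
    show "df S (\<lambda>e. \<exists>v. \<forall>w. Val (e 0) w \<longleftrightarrow> w = v)" by (intro dfs fdi)
  qed auto
  then show ?thesis by auto
qed

lemma SubT_ex: fixes t :: 'a
  assumes t: "Trm (k + 1) t" and z: "Trm 0 z" shows "\<exists>u. (\<forall>u'. SubT k z t u' \<longleftrightarrow> u' = u) \<and> Trm k u"
  using t
proof (rule Trm_induct[where P = "\<lambda>t. \<exists>u. (\<forall>u'. SubT k z t u' \<longleftrightarrow> u' = u) \<and> Trm k u", rotated])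
  show "df S (\<lambda>e. \<exists>u. (\<forall>u'. SubT k z (e 0) u' \<longleftrightarrow> u' = u) \<and> Trm k u)" by (intro dfs fdi)
  fix i :: 'a assume i: "i < k + 1"
  show "\<exists>u. (\<forall>u'. SubT k z (cVar i) u' \<longleftrightarrow> u' = u) \<and> Trm k u"
  proof (cases "i = k")
    case True
    have "k \<noteq> j + 1" if "j \<ge> k" for j using that by (metis less_Suc not_le order_refl)
    then show ?thesis using True Trm_mono[OF z, of k] by (intro exI[of _ z]) auto
  next
    case False
    then have "i < k" using i by (simp add: le_less)
    moreover have "i \<noteq> j + 1" if "j \<ge> k" for j using that \<open>i < k\<close> by (metis less_Suc not_le order.strict_trans1 less_le_not_le order_trans)
    ultimately show ?thesis using False by (intro exI[of _ "cVar i"]) auto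
  qed
next
  show "\<exists>u. (\<forall>u'. SubT k z 0 u' \<longleftrightarrow> u' = u) \<and> Trm k u" by auto
next
  fix t :: 'a assume "\<exists>u. (\<forall>u'. SubT k z t u' \<longleftrightarrow> u' = u) \<and> Trm k u"
  then obtain a where "\<And>u'. SubT k z t u' \<longleftrightarrow> u' = a" "Trm k a" by blast
  then show "\<exists>u. (\<forall>u'. SubT k z (cSucc t) u' \<longleftrightarrow> u' = u) \<and> Trm k u"
    by (intro exI[of _ "cSucc a"]) simp
next
  fix t v :: 'a assume "\<exists>u. (\<forall>u'. SubT k z t u' \<longleftrightarrow> u' = u) \<and> Trm k u" "\<exists>u. (\<forall>u'. SubT k z v u' \<longleftrightarrow> u' = u) \<and> Trm k u"
  then obtain a b where *: "\<And>u'. SubT k z t u' \<longleftrightarrow> u' = a" "Trm k a" "\<And>u'. SubT k z v u' \<longleftrightarrow> u' = b" "Trm k b" by blast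
  show "\<exists>u. (\<forall>u'. SubT k z (cPlus t v) u' \<longleftrightarrow> u' = u) \<and> Trm k u"
    using * by (intro exI[of _ "cPlus a b"]) simp
  show "\<exists>u. (\<forall>u'. SubT k z (cTimes t v) u' \<longleftrightarrow> u' = u) \<and> Trm k u"
    using * by (intro exI[of _ "cTimes a b"]) simp
qed

lemma SubT_id: fixes t :: 'a assumes "Trm k t" shows "SubT k z t t"
  using assms by (rule Trm_induct[where P = "\<lambda>t. SubT k z t t", rotated]) (auto intro: dfs fdi)

lemma Dp_mono: fixes p :: 'a assumes "Dp n k p d" "d \<le> d'" shows "Dp n k p d'"
proof -
  have "\<forall>k d d'. Dp n k p d \<longrightarrow> d \<le> d' \<longrightarrow> Dp n k p d'"
  proof (rule less_induct'[where P = "\<lambda>p. \<forall>k d d'. Dp n k p d \<longrightarrow> d \<le> d' \<longrightarrow> Dp n k p d'"])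
    show "df S (\<lambda>e. \<forall>k d d'. Dp n k (e 0) d \<longrightarrow> d \<le> d' \<longrightarrow> Dp n k (e 0) d')" by (intro dfs fdi)
    fix p :: 'a assume IH: "\<And>q. q < p \<Longrightarrow> \<forall>k d d'. Dp n k q d \<longrightarrow> d \<le> d' \<longrightarrow> Dp n k q d'"
    show "\<forall>k d d'. Dp n k p d \<longrightarrow> d \<le> d' \<longrightarrow> Dp n k p d'"
    proof (intro allI impI)
      fix k d d' :: 'a assume D: "Dp n k p d" "d \<le> d'"
      from Dp_fix[THEN iffD1, OF D(1)] consider t u where "Trm k t" "Trm k u" "p = cEq t u \<or> p = cLe t u"
        | i t where "i < of_nat n" "Trm k t" "p = cTr i t" | q where "Dp n k q d" "p = cNeg q"
        | q r where "Dp n k q d" "Dp n k r d" "p = cImp q r" | q c where "Dp n (k + 1) q c" "p = cEx q" "d = c + 1"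
        by blast
      then show "Dp n k p d'"
      proof cases
        case 3
        then have "q < p" by simp
        then have "Dp n k q d'" using IH 3(1) D(2) by blast
        then show ?thesis using 3 by simp
      next
        case 4
        then have "q < p" "r < p" by simp_all
        then have "Dp n k q d'" "Dp n k r d'" using IH 4(1,2) D(2) by blast+
        then show ?thesis using 4 by simp
      next
        case 5
        have "c + 1 \<le> d'" using D(2) 5(3) by simp
        then obtain b where "d' = (c + 1) + b" by (metis le_iff_add)
        then have b: "d' = (c + b) + 1" by (simp add: ac_simps)
        have "q < p" using 5 by simp
        moreover have "c \<le> c + b" by simp
        ultimately have "Dp n (k + 1) q (c + b)" using IH 5(1) by blast
        then show ?thesis using 5(2) b by auto
      qed auto
    qed
  qed
  then show ?thesis using assms by blast
qed

text \<open>Codes exceed those of their parts, so the code itself bounds the quantifier depth. This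
  crude bound decides how large the blocks of bounds have to be.\<close>

lemma Form_Dp: fixes p :: 'a assumes "Form n k p" shows "Dp n k p p"
proof (rule Form_induct[where P = "\<lambda>k p. Dp n k p p", OF _ assms])
  show "df S (\<lambda>e. Dp n (e 0) (e 1) (e 1))" by (intro dfs fdi)
  fix k p :: 'a assume "Dp n k p p"
  then show "Dp n k (cNeg p) (cNeg p)" by (simp add: Dp_mono less_imp_le)
next
  fix k p q :: 'a assume "Dp n k p p" "Dp n k q q"
  then show "Dp n k (cImp p q) (cImp p q)" by (simp add: Dp_mono less_imp_le)
next
  fix k p :: 'a assume D: "Dp n (k + 1) p p"
  obtain c where c: "cEx p = c + 1" using zero_or_Suc[of "cEx p"] by auto
  have "p < c + 1" unfolding c[symmetric] by simp
  then have "p \<le> c" by simp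
  then have "Dp n (k + 1) p c" using D Dp_mono by blast
  then have "Dp n k (cEx p) (c + 1)" unfolding Dp_simps by blast
  then show "Dp n k (cEx p) (cEx p)" by (simp only: c[symmetric])
qed auto

lemma Dp_Form: fixes p :: 'a assumes "Dp n k p d" shows "Form n k p"
proof -
  have "\<forall>k d. Dp n k p d \<longrightarrow> Form n k p"
  proof (rule less_induct'[where P = "\<lambda>p. \<forall>k d. Dp n k p d \<longrightarrow> Form n k p"])
    show "df S (\<lambda>e. \<forall>k d. Dp n k (e 0) d \<longrightarrow> Form n k (e 0))" by (intro dfs fdi)
    fix p :: 'a assume IH: "\<And>q. q < p \<Longrightarrow> \<forall>k d. Dp n k q d \<longrightarrow> Form n k q"
    show "\<forall>k d. Dp n k p d \<longrightarrow> Form n k p"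
    proof (intro allI impI)
      fix k d :: 'a assume D: "Dp n k p d"
      from Dp_fix[THEN iffD1, OF D] consider t u where "Trm k t" "Trm k u" "p = cEq t u \<or> p = cLe t u"
        | i t where "i < of_nat n" "Trm k t" "p = cTr i t" | q where "Dp n k q d" "p = cNeg q"
        | q r where "Dp n k q d" "Dp n k r d" "p = cImp q r" | q c where "Dp n (k + 1) q c" "p = cEx q"
        by blast
      then show "Form n k p"
      proof cases
        case 3
        then have "Form n k q" using IH[of q] by simp blast
        then show ?thesis using 3 by simp
      next
        case 4
        then have "q < p" "r < p" by simp_all
        then have "Form n k q" "Form n k r" using IH 4(1,2) by blast+
        then show ?thesis using 4 by simp
      next
        case 5
        then have "q < p" by simp
        then have "Form n (k + 1) q" using IH 5(1) by blast
        then show ?thesis using 5 by simp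
      qed auto
    qed
  qed
  then show ?thesis using assms by blast
qed

text \<open>Existence and uniqueness are proved together with preservation of depth, which makes an
  instance of a quantified formula simpler than the formula itself.\<close>

lemma Sub_ex: fixes p :: 'a
  assumes "Form n (k + 1) p" and z: "Trm 0 z"
  shows "\<exists>q. (\<forall>q'. Sub k z p q' \<longleftrightarrow> q' = q) \<and> Form n k q \<and> (\<forall>d. Dp n (k + 1) p d \<longrightarrow> Dp n k q d)"
proof -
  have "\<forall>j. k + 1 = j + 1 \<longrightarrow> (\<exists>q. (\<forall>q'. Sub j z p q' \<longleftrightarrow> q' = q) \<and> Form n j q \<and> (\<forall>d. Dp n (j + 1) p d \<longrightarrow> Dp n j q d))"
  \<comment> \<open>Writing the variable bound as \<open>j + 1\<close> with \<open>j\<close>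
    quantified inside allows it to grow when the induction enters an existential formula.\<close>
  proof (rule Form_induct[where P = "\<lambda>k p. \<forall>j. k = j + 1 \<longrightarrow>
      (\<exists>q. (\<forall>q'. Sub j z p q' \<longleftrightarrow> q' = q) \<and> Form n j q \<and> (\<forall>d. Dp n (j + 1) p d \<longrightarrow> Dp n j q d))", OF _ assms(1)])
    show "df S (\<lambda>e. \<forall>j. e 0 = j + 1 \<longrightarrow>
      (\<exists>q. (\<forall>q'. Sub j z (e 1) q' \<longleftrightarrow> q' = q) \<and> Form n j q \<and> (\<forall>d. Dp n (j + 1) (e 1) d \<longrightarrow> Dp n j q d)))"
      by (intro dfs fdi)
  next
    fix k t u :: 'a assume tu: "Trm k t" "Trm k u"
    have *: "\<exists>a b. (\<forall>u'. SubT j z t u' \<longleftrightarrow> u' = a) \<and> Trm j a \<and> (\<forall>u'. SubT j z u u' \<longleftrightarrow> u' = b) \<and> Trm j b"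
      if "k = j + 1" for j using SubT_ex[OF _ z] tu that by metis
    show "\<forall>j. k = j + 1 \<longrightarrow> (\<exists>q. (\<forall>q'. Sub j z (cEq t u) q' \<longleftrightarrow> q' = q) \<and> Form n j q \<and> (\<forall>d. Dp n (j + 1) (cEq t u) d \<longrightarrow> Dp n j q d))"
    proof (intro allI impI)
      fix j assume "k = j + 1"
      then obtain a b where "\<forall>u'. SubT j z t u' \<longleftrightarrow> u' = a" "Trm j a" "\<forall>u'. SubT j z u u' \<longleftrightarrow> u' = b" "Trm j b" using * by metis
      then show "\<exists>q. (\<forall>q'. Sub j z (cEq t u) q' \<longleftrightarrow> q' = q) \<and> Form n j q \<and> (\<forall>d. Dp n (j + 1) (cEq t u) d \<longrightarrow> Dp n j q d)"
        by (intro exI[of _ "cEq a b"]) simp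
    qed
    show "\<forall>j. k = j + 1 \<longrightarrow> (\<exists>q. (\<forall>q'. Sub j z (cLe t u) q' \<longleftrightarrow> q' = q) \<and> Form n j q \<and> (\<forall>d. Dp n (j + 1) (cLe t u) d \<longrightarrow> Dp n j q d))"
    proof (intro allI impI)
      fix j assume "k = j + 1"
      then obtain a b where "\<forall>u'. SubT j z t u' \<longleftrightarrow> u' = a" "Trm j a" "\<forall>u'. SubT j z u u' \<longleftrightarrow> u' = b" "Trm j b" using * by metis
      then show "\<exists>q. (\<forall>q'. Sub j z (cLe t u) q' \<longleftrightarrow> q' = q) \<and> Form n j q \<and> (\<forall>d. Dp n (j + 1) (cLe t u) d \<longrightarrow> Dp n j q d)"
        by (intro exI[of _ "cLe a b"]) simp
    qed
  next
    fix k i t :: 'a assume t: "i < of_nat n" "Trm k t"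
    show "\<forall>j. k = j + 1 \<longrightarrow> (\<exists>q. (\<forall>q'. Sub j z (cTr i t) q' \<longleftrightarrow> q' = q) \<and> Form n j q \<and> (\<forall>d. Dp n (j + 1) (cTr i t) d \<longrightarrow> Dp n j q d))"
    proof (intro allI impI)
      fix j assume "k = j + 1"
      then obtain a where "\<forall>u'. SubT j z t u' \<longleftrightarrow> u' = a" "Trm j a" using SubT_ex[OF _ z] t by metis
      then show "\<exists>q. (\<forall>q'. Sub j z (cTr i t) q' \<longleftrightarrow> q' = q) \<and> Form n j q \<and> (\<forall>d. Dp n (j + 1) (cTr i t) d \<longrightarrow> Dp n j q d)"
        by (intro exI[of _ "cTr i a"]) (simp add: t)
    qed
  next
    fix k p :: 'a assume IH: "\<forall>j. k = j + 1 \<longrightarrow> (\<exists>q. (\<forall>q'. Sub j z p q' \<longleftrightarrow> q' = q) \<and> Form n j q \<and> (\<forall>d. Dp n (j + 1) p d \<longrightarrow> Dp n j q d))"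
    show "\<forall>j. k = j + 1 \<longrightarrow> (\<exists>q. (\<forall>q'. Sub j z (cNeg p) q' \<longleftrightarrow> q' = q) \<and> Form n j q \<and> (\<forall>d. Dp n (j + 1) (cNeg p) d \<longrightarrow> Dp n j q d))"
    proof (intro allI impI)
      fix j assume "k = j + 1"
      then obtain a where "\<forall>q'. Sub j z p q' \<longleftrightarrow> q' = a" "Form n j a" "\<forall>d. Dp n (j + 1) p d \<longrightarrow> Dp n j a d" using IH by metis
      then show "\<exists>q. (\<forall>q'. Sub j z (cNeg p) q' \<longleftrightarrow> q' = q) \<and> Form n j q \<and> (\<forall>d. Dp n (j + 1) (cNeg p) d \<longrightarrow> Dp n j q d)"
        by (intro exI[of _ "cNeg a"]) simp
    qed
  next
    fix k p r :: 'a assume IH: "\<forall>j. k = j + 1 \<longrightarrow> (\<exists>q. (\<forall>q'. Sub j z p q' \<longleftrightarrow> q' = q) \<and> Form n j q \<and> (\<forall>d. Dp n (j + 1) p d \<longrightarrow> Dp n j q d))"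
      "\<forall>j. k = j + 1 \<longrightarrow> (\<exists>q. (\<forall>q'. Sub j z r q' \<longleftrightarrow> q' = q) \<and> Form n j q \<and> (\<forall>d. Dp n (j + 1) r d \<longrightarrow> Dp n j q d))"
    show "\<forall>j. k = j + 1 \<longrightarrow> (\<exists>q. (\<forall>q'. Sub j z (cImp p r) q' \<longleftrightarrow> q' = q) \<and> Form n j q \<and> (\<forall>d. Dp n (j + 1) (cImp p r) d \<longrightarrow> Dp n j q d))"
    proof (intro allI impI)
      fix j assume j: "k = j + 1"
      obtain a where "\<forall>q'. Sub j z p q' \<longleftrightarrow> q' = a" "Form n j a" "\<forall>d. Dp n (j + 1) p d \<longrightarrow> Dp n j a d" using IH(1) j by metis
      moreover obtain b where "\<forall>q'. Sub j z r q' \<longleftrightarrow> q' = b" "Form n j b" "\<forall>d. Dp n (j + 1) r d \<longrightarrow> Dp n j b d" using IH(2) j by metis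
      ultimately show "\<exists>q. (\<forall>q'. Sub j z (cImp p r) q' \<longleftrightarrow> q' = q) \<and> Form n j q \<and> (\<forall>d. Dp n (j + 1) (cImp p r) d \<longrightarrow> Dp n j q d)"
        by (intro exI[of _ "cImp a b"]) simp
    qed
  next
    fix k p :: 'a assume IH: "\<forall>j. k + 1 = j + 1 \<longrightarrow> (\<exists>q. (\<forall>q'. Sub j z p q' \<longleftrightarrow> q' = q) \<and> Form n j q \<and> (\<forall>d. Dp n (j + 1) p d \<longrightarrow> Dp n j q d))"
    show "\<forall>j. k = j + 1 \<longrightarrow> (\<exists>q. (\<forall>q'. Sub j z (cEx p) q' \<longleftrightarrow> q' = q) \<and> Form n j q \<and> (\<forall>d. Dp n (j + 1) (cEx p) d \<longrightarrow> Dp n j q d))"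
    proof (intro allI impI)
      fix j assume j: "k = j + 1"
      then obtain a where "\<forall>q'. Sub (j + 1) z p q' \<longleftrightarrow> q' = a" "Form n (j + 1) a" "\<forall>d. Dp n (j + 1 + 1) p d \<longrightarrow> Dp n (j + 1) a d"
        using IH by metis
      then show "\<exists>q. (\<forall>q'. Sub j z (cEx p) q' \<longleftrightarrow> q' = q) \<and> Form n j q \<and> (\<forall>d. Dp n (j + 1) (cEx p) d \<longrightarrow> Dp n j q d)"
        by (intro exI[of _ "cEx a"]) auto
    qed
  qed
  then show ?thesis by blast
qed

lemma Sub_id: fixes p :: 'a assumes "Form n k p" shows "Sub k z p p"
  by (rule Form_induct[where P = "\<lambda>k p. Sub k z p p", OF _ assms]) (auto intro: dfs fdi SubT_id)

lemma Form_mono: fixes p :: 'a assumes "Form n k p" "k \<le> k'" shows "Form n k' p"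
proof -
  have "\<forall>k'. k \<le> k' \<longrightarrow> Form n k' p"
  proof (rule Form_induct[where P = "\<lambda>k p. \<forall>k'. k \<le> k' \<longrightarrow> Form n k' p", OF _ assms(1)])
    show "df S (\<lambda>e. \<forall>k'. e 0 \<le> k' \<longrightarrow> Form n k' (e 1))" by (intro dfs fdi)
  qed (auto intro: Trm_mono)
  then show ?thesis using assms(2) by blast
qed

end

section \<open>Truth sets from \<open>RT(!\<omega>)\<close>\<close>

lemma add_self_le: fixes k j :: "'a::arith" shows "k + k \<le> j + j \<longleftrightarrow> k \<le> j"
  by (metis add_mono add_strict_mono not_le)

lemma add_self_eq: fixes k j :: "'a::arith" shows "k + k = j + j \<longleftrightarrow> k = j"
  by (metis add_self_le order_antisym order_refl)

lemma pr_mono: "a \<le> c \<Longrightarrow> b \<le> d \<Longrightarrow> pr a b \<le> pr c d"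
  unfolding pr_def by (intro add_mono mult_mono) auto

context aca
begin

text \<open>Recursion along a measure, carried out on coded finite sets: the table is extended by
  all arguments of measure \<open>j\<close>, and \<open>loc\<close> guarantees that this does not
  affect the earlier entries.\<close>

lemma measured_recursion:
  assumes G: "df S (\<lambda>e. G (e 0) (e 1))" and r: "df S (\<lambda>e. e 0 = r (e 1))"
    and loc: "\<And>x W W'. (\<And>y. r y < r x \<Longrightarrow> y \<in> els W \<longleftrightarrow> y \<in> els W') \<Longrightarrow> G x W \<longleftrightarrow> G x W'"
  shows "\<exists>W. \<forall>x<N. x \<in> els W \<longleftrightarrow> G x W"
proof -
  have G': "df S (\<lambda>e. G (f e) (g e))" if "fd S f" "fd S g" for f g using df_app2[OF G that] .
  have r': "fd S (\<lambda>e. r (f e))" if "fd S f" for f using fd_app1[OF r that] .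
  have "\<exists>W. (\<forall>x\<in>els W. r x < j \<and> x < N) \<and> (\<forall>x<N. r x < j \<longrightarrow> (x \<in> els W \<longleftrightarrow> G x W))" for j
  proof (rule induct[where P = "\<lambda>j. \<exists>W. (\<forall>x\<in>els W. r x < j \<and> x < N) \<and> (\<forall>x<N. r x < j \<longrightarrow> (x \<in> els W \<longleftrightarrow> G x W))"])
    show "df S (\<lambda>e. \<exists>W. (\<forall>x\<in>els W. r x < e 0 \<and> x < N) \<and> (\<forall>x<N. r x < e 0 \<longrightarrow> (x \<in> els W \<longleftrightarrow> G x W)))"
      by (intro dfs fdi G' r')
    obtain c :: 'a where "els c = {}" using fins_empty by (auto simp: fins_def)
    then show "\<exists>W. (\<forall>x\<in>els W. r x < 0 \<and> x < N) \<and> (\<forall>x<N. r x < 0 \<longrightarrow> (x \<in> els W \<longleftrightarrow> G x W))"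
      by (intro exI[of _ c]) auto
    fix j assume "\<exists>W. (\<forall>x\<in>els W. r x < j \<and> x < N) \<and> (\<forall>x<N. r x < j \<longrightarrow> (x \<in> els W \<longleftrightarrow> G x W))"
    then obtain W where W: "\<forall>x\<in>els W. r x < j \<and> x < N" "\<forall>x<N. r x < j \<longrightarrow> (x \<in> els W \<longleftrightarrow> G x W)" by blast
    have "{x. x \<in> els W \<or> x < N \<and> r x = j \<and> G x W} \<in> S" by (rule df_comp) (intro dfs fdi G' r')
    then have "fins {x. x \<in> els W \<or> x < N \<and> r x = j \<and> G x W}" by (rule finsI[of _ N]) (use W in auto)
    then obtain V where V: "els V = {x. x \<in> els W \<or> x < N \<and> r x = j \<and> G x W}" by (auto simp: fins_def)
    have "x \<in> els V \<longleftrightarrow> G x V" if x: "x < N" "r x < j + 1" for x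
    proof -
      have "y \<in> els V \<longleftrightarrow> y \<in> els W" if "r y < r x" for y
      proof -
        have "r y < j" using that x(2) by (metis less_Suc order.strict_trans2)
        then show ?thesis unfolding V by auto
      qed
      then have "G x V \<longleftrightarrow> G x W" by (rule loc)
      moreover have "x \<in> els V \<longleftrightarrow> G x W" using x W unfolding V less_Suc_cases by auto
      ultimately show ?thesis by simp
    qed
    moreover have "\<forall>x\<in>els V. r x < j + 1 \<and> x < N" using W(1) unfolding V less_Suc_cases by auto
    ultimately show "\<exists>W. (\<forall>x\<in>els W. r x < j + 1 \<and> x < N) \<and> (\<forall>x<N. r x < j + 1 \<longrightarrow> (x \<in> els W \<longleftrightarrow> G x W))"
      by blast
  qed
  moreover have "\<exists>J. \<forall>x<N. \<exists>y\<le>J. y = r x" by (rule collection) (intro dfs fdi r', blast)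
  then obtain J where "\<forall>x<N. r x < J + 1" by auto
  ultimately show ?thesis by meson
qed

section \<open>Splitting finite sets into blocks\<close>

lemma hcard_Un:
  assumes F: "fins F" "hcard F i" and G: "fins G" "hcard G j" and "F \<inter> G = {}"
  shows "hcard (F \<union> G) (i + j)"
proof -
  obtain f where f: "F = els f" using F by (auto simp: fins_def)
  have "\<forall>c. hcard (els c) j \<longrightarrow> (\<forall>y\<in>els c. y \<notin> els f) \<longrightarrow>
      (\<forall>d. (\<forall>y\<in>els d. y \<in> els f \<or> y \<in> els c) \<and> els f \<subseteq> els d \<and> els c \<subseteq> els d \<longrightarrow> hcard (els d) (i + j))"
  proof (rule induct[where P = "\<lambda>j. \<forall>c. hcard (els c) j \<longrightarrow> (\<forall>y\<in>els c. y \<notin> els f) \<longrightarrow>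
      (\<forall>d. (\<forall>y\<in>els d. y \<in> els f \<or> y \<in> els c) \<and> els f \<subseteq> els d \<and> els c \<subseteq> els d \<longrightarrow> hcard (els d) (i + j))"])
    show "df S (\<lambda>e. \<forall>c. hcard (els c) (e 0) \<longrightarrow> (\<forall>y\<in>els c. y \<notin> els f) \<longrightarrow>
      (\<forall>d. (\<forall>y\<in>els d. y \<in> els f \<or> y \<in> els c) \<and> els f \<subseteq> els d \<and> els c \<subseteq> els d \<longrightarrow> hcard (els d) (i + e 0)))"
      by (intro dfs fdi)
    have "els d = els f" if "hcard (els c) 0" "\<forall>y\<in>els d. y \<in> els f \<or> y \<in> els c" "els f \<subseteq> els d" for c d
      using that hcard_0[of "els c"] by (auto simp: fins_def)
    then show "\<forall>c. hcard (els c) 0 \<longrightarrow> (\<forall>y\<in>els c. y \<notin> els f) \<longrightarrow>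
      (\<forall>d. (\<forall>y\<in>els d. y \<in> els f \<or> y \<in> els c) \<and> els f \<subseteq> els d \<and> els c \<subseteq> els d \<longrightarrow> hcard (els d) (i + 0))"
      using F(2) f by (metis add.right_neutral)
    fix j assume IH: "\<forall>c. hcard (els c) j \<longrightarrow> (\<forall>y\<in>els c. y \<notin> els f) \<longrightarrow>
      (\<forall>d. (\<forall>y\<in>els d. y \<in> els f \<or> y \<in> els c) \<and> els f \<subseteq> els d \<and> els c \<subseteq> els d \<longrightarrow> hcard (els d) (i + j))"
    show "\<forall>c. hcard (els c) (j + 1) \<longrightarrow> (\<forall>y\<in>els c. y \<notin> els f) \<longrightarrow>
      (\<forall>d. (\<forall>y\<in>els d. y \<in> els f \<or> y \<in> els c) \<and> els f \<subseteq> els d \<and> els c \<subseteq> els d \<longrightarrow> hcard (els d) (i + (j + 1)))"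
    proof (intro allI impI, elim conjE)
      fix c d assume c: "hcard (els c) (j + 1)" "\<forall>y\<in>els c. y \<notin> els f"
        and d: "\<forall>y\<in>els d. y \<in> els f \<or> y \<in> els c" "els f \<subseteq> els d" "els c \<subseteq> els d"
      have fc: "fins (els x)" for x by (auto simp: fins_def)
      have "els c \<noteq> {}" using hcard_unique[OF fins_empty hcard_empty] c(1) by (metis Suc_neq_0(1))
      then obtain y where y: "y \<in> els c" by blast
      have "fins (els c - {y})" "fins (els d - {y})"
        by (rule fins_subset[OF fc]; auto intro: S_Diff S_sing)+
      then obtain c' d' where cd: "els c' = els c - {y}" "els d' = els d - {y}" unfolding fins_def by metis
      have "insert y (els c') = els c" using y cd by auto
      then have "hcard (els c') j" using hcard_remove[OF fc, of y c' j] c(1) cd by auto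
      then have "hcard (els d') (i + j)" using IH[rule_format, of c' d'] c d cd y by auto
      moreover have "y \<notin> els d'" using cd by simp
      ultimately have "hcard (insert y (els d')) (i + j + 1)" by (intro hcard_insert fc)
      moreover have "insert y (els d') = els d" using cd y d by auto
      ultimately show "hcard (els d) (i + (j + 1))" by (simp add: add.assoc)
    qed
  qed
  moreover obtain c d where "G = els c" "F \<union> G = els d" using G(1) fins_Un[OF F(1) G(1)] by (auto simp: fins_def)
  ultimately show ?thesis using assms f by (metis (no_types, lifting) Un_iff Un_upper1 Un_upper2 disjoint_iff)
qed

lemma hcard_subset_eq:
  assumes "fins F" "fins G" "F \<subseteq> G" "hcard F k" "hcard G k" shows "F = G"
proof -
  have D: "fins (G - F)" using assms(2) by (rule fins_subset) (use assms in \<open>auto intro: S_Diff fins_S\<close>)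
  then obtain j where j: "hcard (G - F) j" using hcard_ex by blast
  have "F \<union> (G - F) = G" using assms(3) by auto
  then have "hcard G (k + j)" using hcard_Un[OF assms(1,4) D j] by auto
  then have "k + j = k" using hcard_unique[OF assms(2)] assms(5) by blast
  then have "G - F = {}" using j hcard_0[OF D] by simp
  then show ?thesis using assms(3) by auto
qed

text \<open>Two initial segments of \<open>X\<close> are comparable, and comparable sets of the same
  cardinality agree. An exactly large set therefore determines its two blocks.\<close>

lemma initial_unique:
  assumes F: "fins F" "hcard F k" and G: "fins G" "hcard G k" and X: "F \<subseteq> X" "G \<subseteq> X"
    and iF: "\<And>y z. y \<in> X \<Longrightarrow> y \<notin> F \<Longrightarrow> z \<in> F \<Longrightarrow> z < y"
    and iG: "\<And>y z. y \<in> X \<Longrightarrow> y \<notin> G \<Longrightarrow> z \<in> G \<Longrightarrow> z < y"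
  shows "F = G"
proof -
  have "F \<subseteq> G \<or> G \<subseteq> F"
  proof (rule ccontr)
    assume "\<not> (F \<subseteq> G \<or> G \<subseteq> F)"
    then obtain y z where yz: "y \<in> F" "y \<notin> G" "z \<in> G" "z \<notin> F" by blast
    then have "z < y" using iG[of y z] X by blast
    moreover have "y < z" using iF[of z y] X yz by blast
    ultimately show False by simp
  qed
  then show ?thesis using hcard_subset_eq F G by blast
qed

text \<open>The earlier truth predicates enter through \<open>U\<close>, where \<open>pr i v\<close>
  stands for the truth of \<open>v\<close> under the \<open>i\<close>-th of them.\<close>

definition At :: "'a set \<Rightarrow> 'a \<Rightarrow> bool" where
  "At U e \<longleftrightarrow> (\<exists>t u v w. e = cEq t u \<and> Val t v \<and> Val u w \<and> v = w) \<or>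
     (\<exists>t u v w. e = cLe t u \<and> Val t v \<and> Val u w \<and> v \<le> w) \<or>
     (\<exists>i t v. e = cTr i t \<and> Val t v \<and> pr i v \<in> U)"

definition nxt :: "'a \<Rightarrow> 'a \<Rightarrow> 'a \<Rightarrow> bool" where
  "nxt B c b \<longleftrightarrow> b \<in> els B \<and> c < b \<and> (\<forall>y\<in>els B. c < y \<longrightarrow> b \<le> y)"

text \<open>Evaluation of \<open>e\<close> at position \<open>c\<close>, where an existential quantifier moves to the next
  element \<open>b\<close> of \<open>B\<close> and ranges over the instances whose code is at most \<open>b / 2\<close>.\<close>

definition Cl :: "'a set \<Rightarrow> 'a \<Rightarrow> 'a \<Rightarrow> 'a \<Rightarrow> 'a \<Rightarrow> bool" where
  "Cl U B W e c \<longleftrightarrow> At U e \<or> (\<exists>p. e = cNeg p \<and> pr p c \<notin> els W) \<or>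
     (\<exists>p q. e = cImp p q \<and> (pr p c \<in> els W \<longrightarrow> pr q c \<in> els W)) \<or>
     (\<exists>p. e = cEx p \<and> (\<exists>b. nxt B c b \<and> (\<exists>x q. Sub 0 (num x) p q \<and> q + q \<le> b \<and> pr q b \<in> els W)))"

definition Good :: "'a set \<Rightarrow> 'a \<Rightarrow> 'a \<Rightarrow> bool" where
  "Good U W B \<longleftrightarrow> (\<forall>e c. e \<le> B \<longrightarrow> c \<le> B \<longrightarrow> (pr e c \<in> els W \<longleftrightarrow> Cl U B W e c))"

lemma df_Cl: assumes "U \<in> S" "fd S f" "fd S g" "fd S h" "fd S k"
  shows "df S (\<lambda>e. Cl U (f e) (g e) (h e) (k e))"
  by (rule df_app4[where P = "Cl U", OF _ assms(2-5)])
    (unfold Cl_def At_def nxt_def, intro dfs fdi fd_num assms(1))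

lemma df_Good: assumes "U \<in> S" "fd S f" "fd S g" shows "df S (\<lambda>e. Good U (f e) (g e))"
  by (rule df_app2[where P = "Good U", OF _ assms(2-3)]) (unfold Good_def, intro dfs fdi df_Cl assms(1))

lemma nxt_less: "nxt B c b \<Longrightarrow> b < B"
  unfolding nxt_def using elm_less by blast

lemma le_self_add: "q + q \<le> b \<Longrightarrow> q \<le> (b::'a)"
  using order_trans[of q "q + q" b] by simp

text \<open>The measure \<open>(B - c) (B + 1) + e\<close> orders the arguments lexicographically:
  connectives shrink the formula at the same position, and a quantifier moves to a later position
  whatever instance it takes.\<close>

lemma Good_ex: assumes U: "U \<in> S" shows "\<exists>W. Good U W B"
proof -
  define r where "r x = (if \<exists>e c d. x = pr e c \<and> c + d = B
     then (THE m. \<exists>e c d. x = pr e c \<and> c + d = B \<and> m = d * (B + 1) + e) else 0)" for x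
  have r: "r (pr e c) = d * (B + 1) + e" if "c + d = B" for e c d
    unfolding r_def using that by auto
  have "m = r x \<longleftrightarrow> (\<exists>e c d. x = pr e c \<and> c + d = B \<and> m = d * (B + 1) + e) \<or>
     \<not> (\<exists>e c d. x = pr e c \<and> c + d = B) \<and> m = 0" for m x
    using r by (cases "\<exists>e c d. x = pr e c \<and> c + d = B") (auto simp: r_def)
  then have dr: "df S (\<lambda>e. e 0 = r (e 1))" by simp (intro dfs fdi)
  define G where "G x W \<longleftrightarrow> (\<exists>e c. x = pr e c \<and> e \<le> B \<and> c \<le> B \<and> Cl U B W e c)" for x W
  have rl: "r (pr p c) < r (pr e c)" if pe: "p < e" and cB: "c \<le> B" for p e c
  proof -
    obtain d where "c + d = B" using cB by (metis le_iff_add)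
    then show ?thesis using r pe by simp
  qed
  have rb: "r (pr q b) < r (pr e c)" if qB: "q \<le> B" and cb: "c < b" and bB: "b \<le> B" for q b e c
  proof -
    obtain d where d: "b + d = B" using bB by (metis le_iff_add)
    obtain j where j: "b = c + 1 + j" using cb by (metis Suc_le le_iff_add)
    have "c + (1 + j + d) = B" using d j by (simp add: ac_simps)
    then have "r (pr e c) = (1 + j + d) * (B + 1) + e" by (rule r)
    moreover have "r (pr q b) = d * (B + 1) + q" using d by (rule r)
    moreover have "d * (B + 1) + q < d * (B + 1) + (B + 1)" using qB by simp
    moreover have "d * (B + 1) + (B + 1) \<le> (1 + j + d) * (B + 1) + e"
    proof -
      have "(1 + j + d) * (B + 1) + e = d * (B + 1) + (B + 1) + (j * (B + 1) + e)"
        by (simp add: algebra_simps)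
      then show ?thesis by simp
    qed
    ultimately show ?thesis by order
  qed
  have "\<exists>W. \<forall>x<pr B B + 1. x \<in> els W \<longleftrightarrow> G x W"
  proof (rule measured_recursion[OF _ dr])
    show "df S (\<lambda>e. G (e 0) (e 1))" unfolding G_def by (intro dfs fdi df_Cl U)
    fix x W W' assume A: "\<And>y. r y < r x \<Longrightarrow> y \<in> els W \<longleftrightarrow> y \<in> els W'"
    have "Cl U B W e c \<longleftrightarrow> Cl U B W' e c" if x: "x = pr e c" "e \<le> B" "c \<le> B" for e c
    proof -
      have 1: "pr p c \<in> els W \<longleftrightarrow> pr p c \<in> els W'" if "p < e" for p
        using A rl[OF that x(3)] x(1) by blast
      have 2: "q + q \<le> b \<and> pr q b \<in> els W \<longleftrightarrow> q + q \<le> b \<and> pr q b \<in> els W'" if "nxt B c b" for q b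
      proof (cases "q + q \<le> b")
        case True
        have b: "b < B" using that by (rule nxt_less)
        have c: "c < b" using that by (simp add: nxt_def)
        have "q \<le> B" using le_self_add[OF True] b by order
        then have "r (pr q b) < r (pr e c)" using c less_imp_le[OF b] by (rule rb)
        then have "pr q b \<in> els W \<longleftrightarrow> pr q b \<in> els W'" using A[of "pr q b"] x(1) by simp
        then show ?thesis by simp
      qed simp
      have n: "(\<exists>p. e = cNeg p \<and> pr p c \<notin> els W) \<longleftrightarrow> (\<exists>p. e = cNeg p \<and> pr p c \<notin> els W')"
        using 1 by auto
      have i: "(\<exists>p q. e = cImp p q \<and> (pr p c \<in> els W \<longrightarrow> pr q c \<in> els W)) \<longleftrightarrow>
          (\<exists>p q. e = cImp p q \<and> (pr p c \<in> els W' \<longrightarrow> pr q c \<in> els W'))"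
        using 1 by auto
      have x: "(\<exists>b. nxt B c b \<and> (\<exists>x q. Sub 0 (num x) p q \<and> q + q \<le> b \<and> pr q b \<in> els W)) \<longleftrightarrow>
          (\<exists>b. nxt B c b \<and> (\<exists>x q. Sub 0 (num x) p q \<and> q + q \<le> b \<and> pr q b \<in> els W'))" for p
        using 2 by blast
      show ?thesis unfolding Cl_def n i x ..
    qed
    then show "G x W \<longleftrightarrow> G x W'" unfolding G_def by metis
  qed
  then obtain W where W: "\<forall>x<pr B B + 1. x \<in> els W \<longleftrightarrow> G x W" by blast
  have "pr e c \<in> els W \<longleftrightarrow> Cl U B W e c" if "e \<le> B" "c \<le> B" for e c
    using W that pr_mono[OF that] by (auto simp: G_def)
  then show ?thesis unfolding Good_def by blast
qed

text \<open>The first \<open>d\<close> elements after \<open>c\<close> in one set and after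
  \<open>c'\<close> in the other exist and coincide; \<open>f\<close> is this common
  segment.\<close>

definition Agree :: "'a \<Rightarrow> 'a \<Rightarrow> 'a \<Rightarrow> 'a \<Rightarrow> 'a \<Rightarrow> bool" where
  "Agree d c B c' B' \<longleftrightarrow> (\<exists>f. hcard (els f) d \<and> els f \<subseteq> els B \<and> els f \<subseteq> els B' \<and>
     (\<forall>y\<in>els f. c < y \<and> c' < y) \<and>
     (\<forall>y\<in>els B. c < y \<longrightarrow> y \<in> els f \<or> (\<forall>z\<in>els f. z < y)) \<and>
     (\<forall>y\<in>els B'. c' < y \<longrightarrow> y \<in> els f \<or> (\<forall>z\<in>els f. z < y)))"

lemma fins_els [simp]: "fins (els c)"
  by (auto simp: fins_def)

lemma fins_min: assumes "fins F" "F \<noteq> {}" shows "\<exists>b\<in>F. \<forall>y\<in>F. b \<le> y"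
proof -
  obtain f where f: "F = els f" using assms by (auto simp: fins_def)
  obtain y where "y \<in> els f" using assms f by blast
  then have "\<exists>x. x \<in> els f \<and> (\<forall>y<x. y \<notin> els f)"
    by (rule least[where P = "\<lambda>y. y \<in> els f", rotated]) (intro dfs fdi)
  then show ?thesis unfolding f using not_less by blast
qed

lemma Agree_Suc:
  assumes "Agree (d + 1) c B c' B'"
  shows "\<exists>b. nxt B c b \<and> nxt B' c' b \<and> Agree d b B b B'"
proof -
  obtain f where f: "hcard (els f) (d + 1)" "els f \<subseteq> els B" "els f \<subseteq> els B'" "\<forall>y\<in>els f. c < y \<and> c' < y"
     "\<forall>y\<in>els B. c < y \<longrightarrow> y \<in> els f \<or> (\<forall>z\<in>els f. z < y)"
     "\<forall>y\<in>els B'. c' < y \<longrightarrow> y \<in> els f \<or> (\<forall>z\<in>els f. z < y)"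
    using assms unfolding Agree_def by blast
  have "els f \<noteq> {}" using hcard_unique[OF fins_empty hcard_empty] f(1) by (metis Suc_neq_0(1))
  then obtain b where b: "b \<in> els f" "\<forall>y\<in>els f. b \<le> y" using fins_min[OF fins_els] by blast
  have "fins (els f - {b})" by (rule fins_subset[OF fins_els]) (auto intro: S_Diff S_sing)
  then obtain g where g: "els g = els f - {b}" by (auto simp: fins_def)
  have "insert b (els g) = els f" using b g by auto
  then have hg: "hcard (els g) d" using hcard_remove[OF fins_els, of b g d] f(1) g by auto
  have n: "nxt B c b" "nxt B' c' b"
  proof -
    have "b \<le> y" if "y \<in> els B" "c < y" for y
      using f(5)[rule_format, OF that] b less_imp_le by blast
    moreover have "b \<le> y" if "y \<in> els B'" "c' < y" for y
      using f(6)[rule_format, OF that] b less_imp_le by blast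
    ultimately show "nxt B c b" "nxt B' c' b" unfolding nxt_def using f(2-4) b(1) by blast+
  qed
  moreover have "Agree d b B b B'"
    unfolding Agree_def
  proof (intro exI[of _ g] conjI ballI impI)
    show "b < y" if "y \<in> els g" for y using that g b by (auto simp: le_less)
    then show "b < y" if "y \<in> els g" for y using that .
    fix y assume y: "b < y"
    have cb: "c < y" "c' < y" using y b(1) f(4) order.strict_trans by blast+
    show "y \<in> els g \<or> (\<forall>z\<in>els g. z < y)" if "y \<in> els B"
      using f(5) that cb y g by blast
    show "y \<in> els g \<or> (\<forall>z\<in>els g. z < y)" if "y \<in> els B'"
      using f(6) that cb y g by blast
  qed (use hg f g in auto)
  ultimately show ?thesis by blast
qed

lemma nxt_unique: "nxt B c b \<Longrightarrow> nxt B c b' \<Longrightarrow> b = b'"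
  unfolding nxt_def by (meson order_antisym)

lemma df_Agree: assumes "fd S f" "fd S g" "fd S h" shows "df S (\<lambda>e. Agree (f e) (g e) B (h e) B')"
  by (rule df_app3[where P = "\<lambda>d c c'. Agree d c B c' B'", OF _ assms]) (unfold Agree_def, intro dfs fdi)

text \<open>A formula of depth \<open>d\<close> consults only the next \<open>d\<close> bounds. The
  outer induction on the depth treats quantifiers; connectives keep the depth and are handled by an
  inner induction on the code.\<close>

lemma locality:
  assumes U: "U \<in> S" and W: "Good U W B" "Good U W' B'"
  shows "\<forall>e c c'. Dp n 0 e d \<longrightarrow> e \<le> B \<and> e \<le> B' \<and> c \<le> B \<and> c' \<le> B' \<longrightarrow> Agree d c B c' B' \<longrightarrow>
    (pr e c \<in> els W \<longleftrightarrow> pr e c' \<in> els W')"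
proof (rule less_induct'[where P = "\<lambda>d. \<forall>e c c'. Dp n 0 e d \<longrightarrow> e \<le> B \<and> e \<le> B' \<and> c \<le> B \<and> c' \<le> B' \<longrightarrow>
    Agree d c B c' B' \<longrightarrow> (pr e c \<in> els W \<longleftrightarrow> pr e c' \<in> els W')"])
  show "df S (\<lambda>v. \<forall>e c c'. Dp n 0 e (v 0) \<longrightarrow> e \<le> B \<and> e \<le> B' \<and> c \<le> B \<and> c' \<le> B' \<longrightarrow>
    Agree (v 0) c B c' B' \<longrightarrow> (pr e c \<in> els W \<longleftrightarrow> pr e c' \<in> els W'))"
    by (intro dfs fdi df_Agree)
  fix d assume IH: "\<And>d'. d' < d \<Longrightarrow> \<forall>e c c'. Dp n 0 e d' \<longrightarrow> e \<le> B \<and> e \<le> B' \<and> c \<le> B \<and> c' \<le> B' \<longrightarrow>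
    Agree d' c B c' B' \<longrightarrow> (pr e c \<in> els W \<longleftrightarrow> pr e c' \<in> els W')"
  show "\<forall>e c c'. Dp n 0 e d \<longrightarrow> e \<le> B \<and> e \<le> B' \<and> c \<le> B \<and> c' \<le> B' \<longrightarrow> Agree d c B c' B' \<longrightarrow>
    (pr e c \<in> els W \<longleftrightarrow> pr e c' \<in> els W')"
  proof (intro allI, rule less_induct'[where P = "\<lambda>e. Dp n 0 e d \<longrightarrow> e \<le> B \<and> e \<le> B' \<and> c \<le> B \<and> c' \<le> B' \<longrightarrow>
      Agree d c B c' B' \<longrightarrow> (pr e c \<in> els W \<longleftrightarrow> pr e c' \<in> els W')" for c c'])
    fix c c'
    show "df S (\<lambda>v. Dp n 0 (v 0) d \<longrightarrow> v 0 \<le> B \<and> v 0 \<le> B' \<and> c \<le> B \<and> c' \<le> B' \<longrightarrow>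
      Agree d c B c' B' \<longrightarrow> (pr (v 0) c \<in> els W \<longleftrightarrow> pr (v 0) c' \<in> els W'))"
      by (intro dfs fdi df_Agree)
    fix e assume IHe: "\<And>y. y < e \<Longrightarrow> Dp n 0 y d \<longrightarrow> y \<le> B \<and> y \<le> B' \<and> c \<le> B \<and> c' \<le> B' \<longrightarrow>
      Agree d c B c' B' \<longrightarrow> (pr y c \<in> els W \<longleftrightarrow> pr y c' \<in> els W')"
    show "Dp n 0 e d \<longrightarrow> e \<le> B \<and> e \<le> B' \<and> c \<le> B \<and> c' \<le> B' \<longrightarrow>
      Agree d c B c' B' \<longrightarrow> (pr e c \<in> els W \<longleftrightarrow> pr e c' \<in> els W')"
    proof (intro impI, elim conjE)
      assume D: "Dp n 0 e d" and le: "e \<le> B" "e \<le> B'" "c \<le> B" "c' \<le> B'" and ag: "Agree d c B c' B'"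
      have w: "pr e c \<in> els W \<longleftrightarrow> Cl U B W e c" "pr e c' \<in> els W' \<longleftrightarrow> Cl U B' W' e c'"
        using W le unfolding Good_def by blast+
      have smaller: "pr y c \<in> els W \<longleftrightarrow> pr y c' \<in> els W'" if "y < e" "Dp n 0 y d" for y
      proof -
        have "y \<le> B" "y \<le> B'" using that(1) le(1,2) by order+
        then show ?thesis using IHe that le ag by blast
      qed
      from Dp_fix[THEN iffD1, OF D] consider t u where "e = cEq t u \<or> e = cLe t u"
        | i t where "e = cTr i t" | q where "Dp n 0 q d" "e = cNeg q"
        | q r where "Dp n 0 q d" "Dp n 0 r d" "e = cImp q r"
        | q d' where "Dp n (0 + 1) q d'" "e = cEx q" "d = d' + 1"
        by blast
      then show "pr e c \<in> els W \<longleftrightarrow> pr e c' \<in> els W'"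
      proof cases
        case 1
        then show ?thesis unfolding w Cl_def by auto
      next
        case 2
        then show ?thesis unfolding w Cl_def by auto
      next
        case 3
        then show ?thesis unfolding w Cl_def using smaller[of q] by (auto simp: At_def)
      next
        case 4
        then show ?thesis unfolding w Cl_def using smaller[of q] smaller[of r] by (auto simp: At_def)
      next
        case 5
        obtain b where b: "nxt B c b" "nxt B' c' b" "Agree d' b B b B'"
          using Agree_Suc ag 5(3) by blast
        have key: "pr r b \<in> els W \<longleftrightarrow> pr r b \<in> els W'" if r: "Sub 0 (num x) q r" "r + r \<le> b" for x r
        proof -
          have "Form n (0 + 1) q"
            using Dp_Form[OF 5(1)] .
          then obtain s where s: "\<forall>q'. Sub 0 (num x) q q' \<longleftrightarrow> q' = s"
              "\<forall>d. Dp n (0 + 1) q d \<longrightarrow> Dp n 0 s d"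
            using Sub_ex[of n 0 q "num x"] Trm_num by blast
          then have "Dp n 0 r d'" using r(1) 5(1) by simp
          moreover have "b < B" "b < B'" using b nxt_less by blast+
          moreover have "r \<le> b" using r(2) by (rule le_self_add)
          ultimately show ?thesis using IH[of d'] b(3) 5(3) by (meson less_add_one less_imp_le order_trans)
        qed
        have n1: "nxt B c b' \<longleftrightarrow> b' = b" for b' using b(1) nxt_unique by blast
        have n2: "nxt B' c' b' \<longleftrightarrow> b' = b" for b' using b(2) nxt_unique by blast
        have "Cl U B W e c \<longleftrightarrow> (\<exists>x r. Sub 0 (num x) q r \<and> r + r \<le> b \<and> pr r b \<in> els W)"
          unfolding Cl_def 5(2) by (simp add: n1 At_def)
        moreover have "Cl U B' W' e c' \<longleftrightarrow> (\<exists>x r. Sub 0 (num x) q r \<and> r + r \<le> b \<and> pr r b \<in> els W')"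
          unfolding Cl_def 5(2) by (simp add: n2 At_def)
        ultimately show ?thesis unfolding w using key by blast
      qed
    qed
  qed
qed

end

context aca
begin

lemma Form_nz: "Form n k p \<Longrightarrow> p \<noteq> (0::'a)"
  by (subst (asm) Form_fix) auto

lemma ext_agree:
  assumes U: "U \<in> S" and W: "Good U W B" "Good U W' B'"
    and F: "hcard (els f) k" "els f \<subseteq> els B" "els f \<subseteq> els B'" "\<forall>y\<in>els f. c < y \<and> c' < y"
      "\<forall>y\<in>els B. c < y \<longrightarrow> y \<in> els f \<or> (\<forall>z\<in>els f. z < y)"
      "\<forall>y\<in>els B'. c' < y \<longrightarrow> y \<in> els f \<or> (\<forall>z\<in>els f. z < y)"
    and e: "Dp n 0 e k" "e \<le> B" "e \<le> B'" "c \<le> B" "c' \<le> B'"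
  shows "pr e c \<in> els W \<longleftrightarrow> pr e c' \<in> els W'"
proof -
  have "Agree k c B c' B'" unfolding Agree_def using F by blast
  then show ?thesis using locality[OF U W, of n k] e by blast
qed

text \<open>Ensures that formula and position lie in the range covered by \<open>Good\<close>: a
  nonempty block beyond \<open>a\<close> has a code above \<open>a\<close>.\<close>

lemma block_bounds:
  fixes B :: 'a
  assumes "hcard (els B) k" "\<forall>y\<in>els B. a < y" "a = k + k" "e \<le> k" "e \<noteq> 0"
  shows "e \<le> B" "a \<le> B"
proof -
  have "k \<noteq> 0" using assms(4,5) by auto
  then have "els B \<noteq> {}" using hcard_unique[OF fins_empty hcard_empty] assms(1) by metis
  then obtain y where "y \<in> els B" by blast
  then have "a < B" using assms(2) elm_less order.strict_trans by blast
  then show "a \<le> B" by simp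
  moreover have "e \<le> a" using assms(3,4) order_trans[of e k a] by simp
  ultimately show "e \<le> B" by order
qed

end

section \<open>Stable evaluations on a homogeneous set\<close>

locale aca_rt = aca + rca_rt
begin

text \<open>Even minima \<open>a = k + k\<close> leave exactly two blocks of \<open>k\<close>
  elements. Unequal values cannot occur throughout, because only boundedly many patterns of values
  exist for formulas with code at most \<open>k\<close>.\<close>

lemma stable_set:
  assumes U: "U \<in> S"
  shows "\<exists>L\<in>S. inf_set L \<and> (\<forall>a\<in>L. \<exists>k. a = k + k) \<and>
    (\<forall>a k B B' W W' e. a \<in> L \<longrightarrow> a = k + k \<longrightarrow> els B \<subseteq> L \<longrightarrow> els B' \<subseteq> L \<longrightarrow>
       (\<forall>y\<in>els B. a < y) \<longrightarrow> (\<forall>y\<in>els B. \<forall>z\<in>els B'. y < z) \<longrightarrow> (\<forall>y\<in>els B'. a < y) \<longrightarrow>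
       hcard (els B) k \<longrightarrow> hcard (els B') k \<longrightarrow> Good U W B \<longrightarrow> Good U W' B' \<longrightarrow>
       e \<le> k \<longrightarrow> Form n 0 e \<longrightarrow> (pr e a \<in> els W \<longleftrightarrow> pr e a \<in> els W'))"
proof -
  define P where "P s a k B B' W W' \<longleftrightarrow> a \<in> els s \<and> (\<forall>y\<in>els s. a \<le> y) \<and> a = k + k \<and>
     (\<forall>y\<in>els s. y = a \<or> y \<in> els B \<or> y \<in> els B') \<and> els B \<subseteq> els s \<and> els B' \<subseteq> els s \<and>
     (\<forall>y\<in>els B. a < y) \<and> (\<forall>y\<in>els B. \<forall>z\<in>els B'. y < z) \<and> (\<forall>y\<in>els B'. a < y) \<and>
     hcard (els B) k \<and> hcard (els B') k \<and> Good U W B \<and> Good U W' B' \<and>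
     (\<forall>e\<le>k. Form n 0 e \<longrightarrow> (pr e a \<in> els W \<longleftrightarrow> pr e a \<in> els W'))" for s a k B B' W W'
  define D where "D = {s. \<exists>a k B B' W W'. P s a k B B' W W'}"
  have DS: "D \<in> S" unfolding D_def P_def by (rule df_comp) (intro dfs fdi df_Good U)
  have MS: "{x::'a. \<exists>k. x = k + k} \<in> S" by (rule df_comp) (intro dfs fdi)
  have Minf: "inf_set {x::'a. \<exists>k. x = k + k}"
    unfolding inf_set_def by (intro allI, rule_tac x = "x + x" in exI) auto
  from rt_set[OF MS Minf DS]
  obtain L where L: "L \<in> S" "inf_set L" "L \<subseteq> {x. \<exists>k. x = k + k}"
    and h: "(\<forall>c. xl c \<and> els c \<subseteq> L \<longrightarrow> c \<in> D) \<or> (\<forall>c. xl c \<and> els c \<subseteq> L \<longrightarrow> c \<notin> D)"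
    by blast
  have mk: "\<exists>s. xl s \<and> els s = insert a (els B \<union> els B')"
    if "a = k + k" "\<forall>y\<in>els B. a < y" "\<forall>y\<in>els B. \<forall>z\<in>els B'. y < z" "\<forall>y\<in>els B'. a < y"
      "hcard (els B) k" "hcard (els B') k" for a k B B' :: 'a
  proof (rule xl_of)
    show "fins (els B \<union> els B')" by (intro fins_Un fins_els)
    show "hcard (els B \<union> els B') a" unfolding that(1) using that(3)
      by (intro hcard_Un fins_els that) fastforce
  qed (use that in auto)
  have "\<not> (\<forall>c. xl c \<and> els c \<subseteq> L \<longrightarrow> c \<notin> D)"
  proof
    assume ND: "\<forall>c. xl c \<and> els c \<subseteq> L \<longrightarrow> c \<notin> D"
    obtain a where a: "a \<in> L" using L(2) unfolding inf_set_def by blast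
    obtain k where k: "a = k + k" using L(3) a by blast
    obtain N where N: "\<forall>c. lcode c \<and> (\<forall>y\<in>els c. y < k + 1) \<longrightarrow> c < N" using codes_bounded by blast
    \<comment> \<open>The number \<open>t\<close> codes the set of formulas true at \<open>a\<close>
      when a block beyond \<open>a + x\<close> supplies the bounds. Some pattern recurs for
      unboundedly many \<open>x\<close>, which gives two successive blocks with the same
      pattern.\<close>
    define R where "R x t \<longleftrightarrow> (\<exists>B W. els B \<subseteq> L \<and> (\<forall>y\<in>els B. a + x < y) \<and> hcard (els B) k \<and> Good U W B \<and>
      lcode t \<and> (\<forall>e\<le>k. e \<in> els t \<longleftrightarrow> Form n 0 e \<and> pr e a \<in> els W))" for x t
    have "\<exists>t<N. inf_set {x \<in> UNIV. R x t}"
    proof (rule inf_pigeon[OF S_UNIV])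
      show "inf_set (UNIV :: 'a set)" unfolding inf_set_def by blast
      show "df S (\<lambda>e. R (e 0) (e 1))" unfolding R_def by (intro dfs fdi df_Good U L)
      fix x
      obtain F where F: "fins F" "F \<subseteq> L" "\<forall>y\<in>F. a + x < y" "hcard F k" using subset_of_card[OF L(1,2)] by metis
      obtain B where B: "F = els B" using F(1) by (auto simp: fins_def)
      obtain W where W: "Good U W B" using Good_ex[OF U] by blast
      have "{e. e \<le> k \<and> Form n 0 e \<and> pr e a \<in> els W} \<in> S" by (rule df_comp) (intro dfs fdi)
      then have "fins {e. e \<le> k \<and> Form n 0 e \<and> pr e a \<in> els W}" by (rule finsI[of _ "k + 1"]) simp
      then obtain t where t: "lcode t" "els t = {e. e \<le> k \<and> Form n 0 e \<and> pr e a \<in> els W}"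
        using lcode_fins by blast
      have "t < N" using N t by simp
      moreover have "R x t" unfolding R_def using F B W t by blast
      ultimately show "\<exists>t<N. R x t" by blast
    qed
    then obtain t where t: "inf_set {x. R x t}" by auto
    then obtain x where "R x t" unfolding inf_set_def by blast
    then obtain B W where B: "els B \<subseteq> L" "\<forall>y\<in>els B. a + x < y" "hcard (els B) k" "Good U W B"
      "\<forall>e\<le>k. e \<in> els t \<longleftrightarrow> Form n 0 e \<and> pr e a \<in> els W" unfolding R_def by blast
    obtain x' where x': "x' \<ge> B" "R x' t" using t unfolding inf_set_def by blast
    then obtain B' W' where B': "els B' \<subseteq> L" "\<forall>y\<in>els B'. a + x' < y" "hcard (els B') k" "Good U W' B'"
      "\<forall>e\<le>k. e \<in> els t \<longleftrightarrow> Form n 0 e \<and> pr e a \<in> els W'" unfolding R_def by blast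
    have lt: "a < y" if "a + u < y" for u y
    proof -
      have "a \<le> a + u" by simp
      then show ?thesis using that by order
    qed
    have aB: "\<forall>y\<in>els B. a < y" "\<forall>y\<in>els B'. a < y" using B(2) B'(2) lt by blast+
    have BB: "\<forall>y\<in>els B. \<forall>z\<in>els B'. y < z"
    proof (intro ballI)
      fix y z assume y: "y \<in> els B" "z \<in> els B'"
      have "y < B" using y(1) by (rule elm_less)
      moreover have "x' \<le> a + x'" by simp
      ultimately show "y < z" using B'(2) y(2) x'(1) by (meson order.strict_trans1 order.strict_trans2 order.strict_trans)
    qed
    obtain s where s: "xl s" "els s = insert a (els B \<union> els B')" using mk[OF k aB(1) BB aB(2) B(3) B'(3)] by blast
    have "P s a k B B' W W'" unfolding P_def
    proof (intro conjI)
      show "\<forall>y\<in>els s. a \<le> y" using s(2) aB by (auto intro: less_imp_le)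
    qed (use s(2) k aB BB B B' in auto)
    then have "s \<in> D" unfolding D_def by blast
    moreover have "els s \<subseteq> L" using s(2) B(1) B'(1) a by auto
    ultimately show False using ND s(1) by blast
  qed
  then have h: "\<forall>c. xl c \<and> els c \<subseteq> L \<longrightarrow> c \<in> D" using h by blast
  have fin: "pr e a \<in> els W \<longleftrightarrow> pr e a \<in> els W'"
    if as: "a \<in> L" "a = k + k" "els B \<subseteq> L" "els B' \<subseteq> L" "\<forall>y\<in>els B. a < y" "\<forall>y\<in>els B. \<forall>z\<in>els B'. y < z"
      "\<forall>y\<in>els B'. a < y" "hcard (els B) k" "hcard (els B') k" "Good U W B" "Good U W' B'" "e \<le> k" "Form n 0 e"
    for a k B B' W W' e
  proof -
    obtain s where s: "xl s" "els s = insert a (els B \<union> els B')" using mk[OF as(2,5,6,7,8,9)] by blast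
    then have "els s \<subseteq> L" using as(1,3,4) by auto
    then have "s \<in> D" using h s(1) by blast
    then obtain a1 k1 B1 B1' W1 W1' where "P s a1 k1 B1 B1' W1 W1'" unfolding D_def by blast
    then have p: "a1 \<in> els s" "\<forall>y\<in>els s. a1 \<le> y" "a1 = k1 + k1"
     "\<forall>y\<in>els s. y = a1 \<or> y \<in> els B1 \<or> y \<in> els B1'" "els B1 \<subseteq> els s" "els B1' \<subseteq> els s"
     "\<forall>y\<in>els B1. a1 < y" "\<forall>y\<in>els B1. \<forall>z\<in>els B1'. y < z" "\<forall>y\<in>els B1'. a1 < y"
     "hcard (els B1) k1" "hcard (els B1') k1" "Good U W1 B1" "Good U W1' B1'"
     "\<forall>e\<le>k1. Form n 0 e \<longrightarrow> (pr e a1 \<in> els W1 \<longleftrightarrow> pr e a1 \<in> els W1')"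
      unfolding P_def by blast+
    have "a \<le> a1" using p(1) s(2) as(5,7) by (auto intro: less_imp_le)
    moreover have "a1 \<le> a" using p(2) s(2) by simp
    ultimately have a1: "a1 = a" by simp
    then have k1: "k1 = k" using p(3) as(2) add_self_eq by metis
    have X: "els B \<union> els B' = els B1 \<union> els B1'"
      using s(2) p(4-7,9) as(5,7) a1 by fastforce
    \<comment> \<open>Membership in \<open>D\<close> only asserts that some division into blocks
      gives equal values, so this division has to be identified with the given one.\<close>
    have B1: "els B1 = els B"
    proof (rule initial_unique[where X = "els B \<union> els B'"])
      show "hcard (els B1) k" using p(10) k1 by simp
      show "z < y" if "y \<in> els B \<union> els B'" "y \<notin> els B1" "z \<in> els B1" for y z
        using that p(8) X by blast
      show "z < y" if "y \<in> els B \<union> els B'" "y \<notin> els B" "z \<in> els B" for y z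
        using that as(6) by blast
    qed (use as(8) X in auto)
    have B1': "els B1' = els B'" using B1 X p(8) as(6) by fastforce
    have nz: "e \<noteq> 0" using as(13) by (rule Form_nz)
    have D: "Dp n 0 e k" using Form_Dp[OF as(13)] as(12) by (rule Dp_mono)
    note bb = block_bounds[OF _ _ as(2) as(12) nz]
    \<comment> \<open>The codes \<open>B\<close> and \<open>B1\<close> may differ although the sets
      agree, and \<open>Good\<close> refers to the codes; \<open>ext_agree\<close> bridges the
      gap.\<close>
    have "pr e a \<in> els W \<longleftrightarrow> pr e a \<in> els W1"
      by (rule ext_agree[OF U as(10) p(12), of B k a a n e]) (use B1 as D bb[of B] bb[of B1] in auto)
    moreover have "pr e a \<in> els W' \<longleftrightarrow> pr e a \<in> els W1'"
      by (rule ext_agree[OF U as(11) p(13), of B' k a a n e]) (use B1' as D bb[of B'] bb[of B1'] in auto)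
    ultimately show ?thesis using p(14) as(12,13) a1 k1 by simp
  qed
  show ?thesis
  proof (rule bexI[OF _ L(1)], intro conjI allI impI)
    show "inf_set L" by fact
    show "\<forall>a\<in>L. \<exists>k. a = k + k" using L(3) by blast
  qed (rule fin; assumption)
qed

text \<open>Truth is the common value at all positions \<open>a = k + k\<close> of \<open>L\<close>
  for which the code is at most \<open>k\<close>; the work lies in showing independence of the block
  and of the position.\<close>

lemma truth_set:
  assumes U: "U \<in> S"
  shows "\<exists>T\<in>S.
    (\<forall>t u v w. Trm 0 t \<longrightarrow> Trm 0 u \<longrightarrow> Val t v \<longrightarrow> Val u w \<longrightarrow> (cEq t u \<in> T \<longleftrightarrow> v = w) \<and> (cLe t u \<in> T \<longleftrightarrow> v \<le> w)) \<and>
    (\<forall>i x. i < of_nat n \<longrightarrow> (cTr i (num x) \<in> T \<longleftrightarrow> pr i x \<in> U)) \<and>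
    (\<forall>p. Form n 0 p \<longrightarrow> (cNeg p \<in> T \<longleftrightarrow> p \<notin> T)) \<and>
    (\<forall>p q. Form n 0 p \<longrightarrow> Form n 0 q \<longrightarrow> (cImp p q \<in> T \<longleftrightarrow> (p \<in> T \<longrightarrow> q \<in> T))) \<and>
    (\<forall>p. Form n 0 (cEx p) \<longrightarrow> (cEx p \<in> T \<longleftrightarrow> (\<exists>x q. Sub 0 (num x) p q \<and> q \<in> T)))"
proof -
  obtain L where L0: "L \<in> S" and L1: "inf_set L \<and> (\<forall>a\<in>L. \<exists>k. a = k + k) \<and>
    (\<forall>a k B B' W W' e. a \<in> L \<longrightarrow> a = k + k \<longrightarrow> els B \<subseteq> L \<longrightarrow> els B' \<subseteq> L \<longrightarrow>
       (\<forall>y\<in>els B. a < y) \<longrightarrow> (\<forall>y\<in>els B. \<forall>z\<in>els B'. y < z) \<longrightarrow> (\<forall>y\<in>els B'. a < y) \<longrightarrow>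
       hcard (els B) k \<longrightarrow> hcard (els B') k \<longrightarrow> Good U W B \<longrightarrow> Good U W' B' \<longrightarrow>
       e \<le> k \<longrightarrow> Form n 0 e \<longrightarrow> (pr e a \<in> els W \<longleftrightarrow> pr e a \<in> els W'))"
    using stable_set[OF U, of n] by (rule bexE)
  note L = L0 L1[THEN conjunct1] and ev = L1[THEN conjunct2, THEN conjunct1]
    and st = L1[THEN conjunct2, THEN conjunct2, rule_format]
  define cf where "cf a k B W \<longleftrightarrow> a \<in> L \<and> a = k + k \<and> els B \<subseteq> L \<and> (\<forall>y\<in>els B. a < y) \<and>
    hcard (els B) k \<and> Good U W B" for a k B W
  have blk: "\<exists>B. els B \<subseteq> L \<and> (\<forall>y\<in>els B. b < y) \<and> hcard (els B) k" for b k
    using subset_of_card[OF L, of b k] unfolding fins_def by blast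
  have lt: "u < y" "v < y" "w < y" if "u + v + w < y" for u v w y :: 'a
  proof -
    have "u \<le> u + v + w" "v \<le> u + v + w" "w \<le> u + v + w"
      by (simp_all add: add.assoc add_increasing add_increasing2)
    then show "u < y" "v < y" "w < y" using that by order+
  qed
  \<comment> \<open>Two blocks need not be separated from each other, but both can be compared with
    a third one beyond them.\<close>
  have st2: "pr e a \<in> els W \<longleftrightarrow> pr e a \<in> els W'"
    if c: "cf a k B W" "cf a k B' W'" "e \<le> k" "Form n 0 e" for a k B B' W W' e
  proof -
    obtain B2 where B2: "els B2 \<subseteq> L" "\<forall>y\<in>els B2. a + B + B' < y" "hcard (els B2) k" using blk by blast
    obtain W2 where W2: "Good U W2 B2" using Good_ex[OF U] by blast
    have b2: "\<forall>z\<in>els B2. a < z \<and> B < z \<and> B' < z" using B2(2) lt by blast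
    then have b3: "\<forall>y\<in>els B. \<forall>z\<in>els B2. y < z" "\<forall>y\<in>els B'. \<forall>z\<in>els B2. y < z"
      using elm_less order.strict_trans by blast+
    note cc = c(1,2)[unfolded cf_def]
    have "pr e a \<in> els W \<longleftrightarrow> pr e a \<in> els W2"
      by (rule st[of a k B B2]; use cc c(3,4) B2 W2 b2 b3 in blast)
    moreover have "pr e a \<in> els W' \<longleftrightarrow> pr e a \<in> els W2"
      by (rule st[of a k B' B2]; use cc c(3,4) B2 W2 b2 b3 in blast)
    ultimately show ?thesis by blast
  qed
  \<comment> \<open>A block for the smaller \<open>k0\<close> beyond both positions is prolonged to
    a block for \<open>k\<close>. Since the depth of the formula is at most \<open>k0\<close>, only
    the common part is consulted.\<close>
  have ind0: "pr e a \<in> els W \<longleftrightarrow> pr e a0 \<in> els W0"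
    if c: "cf a k B W" "cf a0 k0 B0 W0" "e \<le> k0" "k0 \<le> k" "Form n 0 e" for a k B W a0 k0 B0 W0 e
  proof -
    obtain j where j: "k = k0 + j" using c(4) by (metis le_iff_add)
    have ek: "e \<le> k" using c(3,4) by order
    have nz: "e \<noteq> 0" using c(5) by (rule Form_nz)
    obtain f where f: "els f \<subseteq> L" "\<forall>y\<in>els f. a + a0 + 0 < y" "hcard (els f) k0" using blk by blast
    obtain g where g: "els g \<subseteq> L" "\<forall>y\<in>els g. a + a0 + f < y" "hcard (els g) j" using blk by blast
    have f2: "\<forall>y\<in>els f. a < y \<and> a0 < y" using f(2) lt by blast
    have g2: "\<forall>y\<in>els g. a < y \<and> a0 < y \<and> f < y" using g(2) lt by blast
    have fg: "\<forall>y\<in>els f. \<forall>z\<in>els g. y < z" using g2 elm_less order.strict_trans by blast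
    obtain B1 where B1: "els B1 = els f \<union> els g" using fins_Un[OF fins_els fins_els] unfolding fins_def by metis
    have h1: "hcard (els B1) k" unfolding B1 j using f(3) g(3) fg by (intro hcard_Un fins_els) fastforce+
    obtain W1 where W1: "Good U W1 B1" using Good_ex[OF U] by blast
    obtain V where V: "Good U V f" using Good_ex[OF U] by blast
    have ca: "cf a k B1 W1" unfolding cf_def using c(1) B1 f g f2 g2 h1 W1 by (auto simp: cf_def)
    have cb: "cf a0 k0 f V" unfolding cf_def using c(2) f f2 V by (auto simp: cf_def)
    have "pr e a0 \<in> els V \<longleftrightarrow> pr e a \<in> els W1"
    proof (rule ext_agree[OF U V W1 f(3)])
      show "Dp n 0 e k0" using Form_Dp[OF c(5)] c(3) by (rule Dp_mono)
      show "e \<le> f" "a0 \<le> f" using block_bounds[of f k0 a0 e] cb c(3) nz by (auto simp: cf_def)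
      show "e \<le> B1" "a \<le> B1" using block_bounds[of B1 k a e] ca ek nz by (auto simp: cf_def)
    qed (use B1 f2 fg in auto)
    moreover have "pr e a \<in> els W \<longleftrightarrow> pr e a \<in> els W1" by (rule st2[OF c(1) ca ek c(5)])
    moreover have "pr e a0 \<in> els W0 \<longleftrightarrow> pr e a0 \<in> els V" by (rule st2[OF c(2) cb c(3) c(5)])
    ultimately show ?thesis by simp
  qed
  define T where "T = {e. Form n 0 e \<and> (\<exists>a k B W. (a \<in> L \<and> a = k + k \<and> els B \<subseteq> L \<and> (\<forall>y\<in>els B. a < y) \<and>
    hcard (els B) k \<and> Good U W B) \<and> e \<le> k \<and> pr e a \<in> els W)}"
  have TS: "T \<in> S" unfolding T_def by (rule df_comp) (intro dfs fdi df_Good U L)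
  have T: "e \<in> T \<longleftrightarrow> pr e a \<in> els W" if c: "cf a k B W" "e \<le> k" "Form n 0 e" for e a k B W
  proof
    assume "e \<in> T"
    then obtain a0 k0 B0 W0 where c0: "cf a0 k0 B0 W0" "e \<le> k0" "pr e a0 \<in> els W0" unfolding T_def cf_def by blast
    show "pr e a \<in> els W"
    proof (cases "k0 \<le> k")
      case True
      then show ?thesis using ind0[OF c(1) c0(1,2) True c(3)] c0(3) by blast
    next
      case False
      then have "k \<le> k0" by simp
      then show ?thesis using ind0[OF c0(1) c(1,2) _ c(3)] c0(3) by blast
    qed
  next
    assume "pr e a \<in> els W"
    then show "e \<in> T" unfolding T_def using c unfolding cf_def by blast
  qed
  have big: "\<exists>a k B W. cf a k B W \<and> N \<le> k" for N
  proof -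
    obtain a where a: "a \<in> L" "N + N \<le> a" using L(2) unfolding inf_set_def by blast
    obtain k where k: "a = k + k" using ev a by blast
    obtain B where "els B \<subseteq> L" "\<forall>y\<in>els B. a < y" "hcard (els B) k" using blk by blast
    moreover obtain W where "Good U W B" using Good_ex[OF U] by blast
    ultimately have "cf a k B W" unfolding cf_def using a k by blast
    then show ?thesis using a(2) k add_self_le by blast
  qed
  have Cl: "e \<in> T \<longleftrightarrow> Cl U B W e a" if c: "cf a k B W" "e \<le> k" "Form n 0 e" for e a k B W
  proof -
    have "e \<le> B" "a \<le> B" using block_bounds[of B k a e] c Form_nz[OF c(3)] by (auto simp: cf_def)
    then show ?thesis using T[OF c] c(1) unfolding cf_def Good_def by blast
  qed
  have atom: "(cEq t u \<in> T \<longleftrightarrow> v = w) \<and> (cLe t u \<in> T \<longleftrightarrow> v \<le> w)" if "Trm 0 t" "Trm 0 u" "Val t v" "Val u w" for t u v w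
  proof -
    have 1: "Val t v' \<longleftrightarrow> v' = v" "Val u v' \<longleftrightarrow> v' = w" for v'
      using Val_unique[OF that(1)] Val_unique[OF that(2)] that(3,4) by blast+
    obtain a k B W where c: "cf a k B W" "cEq t u + cLe t u \<le> k" using big by metis
    have "cEq t u \<le> cEq t u + cLe t u" "cLe t u \<le> cEq t u + cLe t u" by simp_all
    then have "cEq t u \<le> k" "cLe t u \<le> k" using c(2) by order+
    then show ?thesis using Cl[OF c(1), of "cEq t u"] Cl[OF c(1), of "cLe t u"] that
      by (auto simp add: Cl_def At_def 1)
  qed
  have tr: "cTr i (num x) \<in> T \<longleftrightarrow> pr i x \<in> U" if "i < of_nat n" for i x
  proof -
    obtain a k B W where c: "cf a k B W" "cTr i (num x) \<le> k" using big by metis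
    then show ?thesis using Cl[OF c] that by (simp add: Cl_def At_def)
  qed
  have neg: "cNeg p \<in> T \<longleftrightarrow> p \<notin> T" if "Form n 0 p" for p
  proof -
    obtain a k B W where c: "cf a k B W" "cNeg p \<le> k" using big by metis
    have "p < cNeg p" by simp
    then have "p \<le> k" using c(2) by order
    then show ?thesis using Cl[OF c] T[OF c(1), of p] that by (simp add: Cl_def At_def)
  qed
  have imp: "cImp p q \<in> T \<longleftrightarrow> (p \<in> T \<longrightarrow> q \<in> T)" if "Form n 0 p" "Form n 0 q" for p q
  proof -
    obtain a k B W where c: "cf a k B W" "cImp p q \<le> k" using big by metis
    have "p < cImp p q" "q < cImp p q" by simp_all
    then have "p \<le> k" "q \<le> k" using c(2) by order+
    then show ?thesis using Cl[OF c] T[OF c(1), of p] T[OF c(1), of q] that by (simp add: Cl_def At_def)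
  qed
  have ex: "cEx p \<in> T \<longleftrightarrow> (\<exists>x q. Sub 0 (num x) p q \<and> q \<in> T)" if F: "Form n 0 (cEx p)" for p
  proof -
    have Fp: "Form n (0 + 1) p" using F by simp
    have inst: "Form n 0 q \<and> (\<forall>d. Dp n (0 + 1) p d \<longrightarrow> Dp n 0 q d)" if q: "Sub 0 (num x) p q" for x q
    proof -
      obtain s where s: "\<forall>q'. Sub 0 (num x) p q' \<longleftrightarrow> q' = s" "Form n 0 s"
          "\<forall>d. Dp n (0 + 1) p d \<longrightarrow> Dp n 0 s d"
        using Sub_ex[OF Fp Trm_num, of x] by blast
      then have "q = s" using q by simp
      then show ?thesis using s by simp
    qed
    \<comment> \<open>Evaluating the quantifier at \<open>a\<close> moves to
      \<open>b = k' + k'\<close> with \<open>k - 1\<close> elements left. The body has depth less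
      than \<open>k\<close>, so these elements can be completed to a block for \<open>b\<close>
      without changing the value; the condition \<open>q + q \<le> b\<close> is exactly what makes
      the instance eligible at \<open>b\<close>.\<close>
    have main: "cEx p \<in> T \<longleftrightarrow> (\<exists>x q. Sub 0 (num x) p q \<and> q + q \<le> b \<and> q \<in> T)"
      if c: "cf a k B W" "cEx p \<le> k" and b: "nxt B a b" for a k B W b
    proof -
      have n: "nxt B a b' \<longleftrightarrow> b' = b" for b' using b nxt_unique by blast
      have bB: "b \<in> els B" "a < b" "\<forall>y\<in>els B. b \<le> y" using b c(1) unfolding nxt_def cf_def by blast+
      then have bL: "b \<in> L" using c(1) unfolding cf_def by blast
      obtain k' where k': "b = k' + k'" using ev bL by blast
      have key: "pr q b \<in> els W \<longleftrightarrow> q \<in> T" if q: "Sub 0 (num x) p q" "q + q \<le> b" for x q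
      proof -
        obtain d' where d': "Dp n (0 + 1) p d'" "cEx p = d' + 1" using Form_Dp[OF F] by auto
        have "d' + 1 \<le> k" using c(2) d'(2) by simp
        then obtain r where "k = d' + 1 + r" by (metis le_iff_add)
        then have r: "k = (d' + r) + 1" by (simp add: ac_simps)
        have Dq: "Dp n 0 q (d' + r)" using inst[OF q(1)] d'(1) Dp_mono[of n 0 q d' "d' + r"] by simp
        have Fq: "Form n 0 q" using inst[OF q(1)] by blast
        have qk: "q \<le> k'" using q(2) k' add_self_le by blast
        have "fins (els B - {b})" by (rule fins_subset[OF fins_els]) (auto intro: S_Diff S_sing)
        then obtain f where f: "els f = els B - {b}" by (auto simp: fins_def)
        have "insert b (els f) = els B" using bB f by auto
        then have hf: "hcard (els f) (d' + r)" using hcard_remove[OF fins_els, of b f "d' + r"] c(1) f r by (auto simp: cf_def)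
        have kk: "k < k'"
        proof (rule ccontr)
          assume "\<not> k < k'"
          then have "k' + k' \<le> k + k" by (simp add: add_self_le)
          then show False using bB(2) c(1) k' unfolding cf_def by simp
        qed
        have "d' + r \<le> k" using r by simp
        then have "d' + r \<le> k'" using kk by order
        then obtain j where j: "k' = (d' + r) + j" by (metis le_iff_add)
        obtain g where g: "els g \<subseteq> L" "\<forall>y\<in>els g. b + B + 0 < y" "hcard (els g) j" using blk by blast
        have g2: "\<forall>y\<in>els g. b < y \<and> B < y" using g(2) lt by blast
        have f2: "\<forall>y\<in>els f. b < y \<and> y < B" using f bB(3) elm_less by (auto simp: le_less)
        have fg: "\<forall>y\<in>els f. \<forall>z\<in>els g. y < z" using f2 g2 order.strict_trans by blast
        obtain B1 where B1: "els B1 = els f \<union> els g" using fins_Un[OF fins_els fins_els] unfolding fins_def by metis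
        have h1: "hcard (els B1) k'" unfolding B1 j using hf g(3) fg by (intro hcard_Un fins_els) fastforce+
        obtain W1 where W1: "Good U W1 B1" using Good_ex[OF U] by blast
        have ca: "cf b k' B1 W1" unfolding cf_def using bL k' B1 f g f2 g2 h1 W1 c(1) by (auto simp: cf_def)
        have W: "Good U W B" using c(1) by (simp add: cf_def)
        have "pr q b \<in> els W \<longleftrightarrow> pr q b \<in> els W1"
        proof (rule ext_agree[OF U W W1 hf])
          show "Dp n 0 q (d' + r)" by (rule Dq)
          show "b \<le> B" using elm_less[OF bB(1)] by simp
          then show "q \<le> B" using le_self_add[OF q(2)] by order
          show "q \<le> B1" "b \<le> B1" using block_bounds[of B1 k' b q] ca qk Form_nz[OF Fq] by (auto simp: cf_def)
        qed (use B1 f f2 fg in auto)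
        then show ?thesis using T[OF ca qk Fq] by simp
      qed
      have "cEx p \<in> T \<longleftrightarrow> (\<exists>x q. Sub 0 (num x) p q \<and> q + q \<le> b \<and> pr q b \<in> els W)"
        unfolding Cl[OF c F] Cl_def by (simp add: n At_def)
      then show ?thesis using key by blast
    qed
    have nx: "\<exists>b. nxt B a b" if c: "cf a k B W" "cEx p \<le> k" for a k B W
    proof -
      have "k \<noteq> 0" using c(2) by auto
      then have "els B \<noteq> {}" using hcard_unique[OF fins_empty hcard_empty] c(1) unfolding cf_def by metis
      then obtain b where "b \<in> els B" "\<forall>y\<in>els B. b \<le> y" using fins_min[OF fins_els] by blast
      then show ?thesis using c(1) unfolding cf_def nxt_def by blast
    qed
    show ?thesis
    proof
      assume A: "cEx p \<in> T"
      obtain a k B W where c: "cf a k B W" "cEx p \<le> k" using big by metis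
      obtain b where "nxt B a b" using nx[OF c] by blast
      then show "\<exists>x q. Sub 0 (num x) p q \<and> q \<in> T" using main[OF c] A by blast
    next
      \<comment> \<open>A position with \<open>q \<le> k\<close> admits the instance
        \<open>q\<close>, since then \<open>q + q \<le> a < b\<close>.\<close>
      assume "\<exists>x q. Sub 0 (num x) p q \<and> q \<in> T"
      then obtain x q where q: "Sub 0 (num x) p q" "q \<in> T" by blast
      obtain a k B W where c: "cf a k B W" "cEx p + q \<le> k" using big by metis
      have "cEx p \<le> cEx p + q" "q \<le> cEx p + q" by simp_all
      then have le: "cEx p \<le> k" "q \<le> k" using c(2) by order+
      obtain b where b: "nxt B a b" using nx[OF c(1) le(1)] by blast
      have "q + q \<le> k + k" using le(2) by (simp add: add_self_le)
      also have "k + k = a" using c(1) by (simp add: cf_def)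
      also have "a \<le> b" using b unfolding nxt_def by (blast intro: less_imp_le)
      finally show "cEx p \<in> T" using main[OF c(1) le(1) b] q by blast
    qed
  qed
  show ?thesis using TS atom tr neg imp ex by (intro bexI[of _ T] conjI) auto
qed

end

section \<open>Ramsey's theorem for finite exponents, with arithmetical solutions\<close>

definition hom :: "'a::arith set \<Rightarrow> 'a set \<Rightarrow> 'a \<Rightarrow> bool" where
  "hom Y A k \<longleftrightarrow> (\<forall>s. lcode s \<and> els s \<subseteq> Y \<and> hcard (els s) k \<longrightarrow> s \<in> A) \<or>
     (\<forall>s. lcode s \<and> els s \<subseteq> Y \<and> hcard (els s) k \<longrightarrow> s \<notin> A)"

definition ramsey :: "'a::arith set set \<Rightarrow> 'a \<Rightarrow> bool" where
  "ramsey S k \<longleftrightarrow> (\<forall>X\<in>S. inf_set X \<longrightarrow> (\<forall>A\<in>S. \<exists>Y\<in>S. inf_set Y \<and> Y \<subseteq> X \<and> hom Y A k))"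

context aca
begin

text \<open>The colour of \<open>s\<close> enlarged by \<open>x\<close>: the least code of that set
  is described rather than computed, so that definability is immediate.\<close>

definition cola :: "'a set \<Rightarrow> 'a \<Rightarrow> 'a \<Rightarrow> bool" where
  "cola A s x \<longleftrightarrow> (\<exists>c. c \<in> A \<and> lcode c \<and> (\<forall>y\<in>els c. y = x \<or> y \<in> els s) \<and> els s \<subseteq> els c \<and> x \<in> els c)"

lemma cola_iff: assumes "lcode c" "els c = insert x (els s)" shows "cola A s x \<longleftrightarrow> c \<in> A"
proof
  assume "cola A s x"
  then obtain d where d: "d \<in> A" "lcode d" "\<forall>y\<in>els d. y = x \<or> y \<in> els s" "els s \<subseteq> els d" "x \<in> els d"
    unfolding cola_def by blast
  then have "els d = els c" using assms(2) by auto
  then have "d = c" using lcode_unique d(2) assms(1) by blast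
  then show "c \<in> A" using d(1) by simp
next
  assume "c \<in> A"
  then show "cola A s x" unfolding cola_def using assms by (intro exI[of _ c]) auto
qed

text \<open>In the terms of the Erdos-Rado argument, \<open>x\<close> realizes the type
  \<open>G\<close> over \<open>F\<close>.\<close>

definition cmp :: "'a set \<Rightarrow> 'a set \<Rightarrow> 'a \<Rightarrow> 'a \<Rightarrow> 'a \<Rightarrow> 'a \<Rightarrow> bool" where
  "cmp X A k F G x \<longleftrightarrow> x \<in> X \<and> (\<forall>y\<in>els F. y < x) \<and>
     (\<forall>s. lcode s \<and> els s \<subseteq> els F \<and> hcard (els s) k \<longrightarrow> (cola A s x \<longleftrightarrow> s \<in> els G))"

lemma df_cola: "A \<in> S \<Longrightarrow> fd S f \<Longrightarrow> fd S g \<Longrightarrow> df S (\<lambda>e. cola A (f e) (g e))"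
  by (rule df_app2[where P = "cola A"]) (unfold cola_def, intro dfs fdi)

lemma df_cmp: "X \<in> S \<Longrightarrow> A \<in> S \<Longrightarrow> fd S f \<Longrightarrow> fd S g \<Longrightarrow> fd S h \<Longrightarrow> df S (\<lambda>e. cmp X A k (f e) (g e) (h e))"
  by (rule df_app3[where P = "cmp X A k"]) (unfold cmp_def, intro dfs fdi df_cola)

text \<open>Types over \<open>F\<close> are sets of codes of subsets of \<open>F\<close>, so two
  applications of \<open>codes_bounded\<close> bound their number.\<close>

lemma type_pigeon:
  assumes X: "X \<in> S" and A: "A \<in> S" and V: "V \<in> S" "inf_set V" "V \<subseteq> X" "\<forall>x\<in>V. \<forall>y\<in>els F. y < x"
  shows "\<exists>G. inf_set {x\<in>V. cmp X A k F G x}"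
proof -
  obtain N where N: "\<forall>c. lcode c \<and> (\<forall>y\<in>els c. y < F) \<longrightarrow> c < N" using codes_bounded by blast
  obtain N' where N': "\<forall>c. lcode c \<and> (\<forall>y\<in>els c. y < N) \<longrightarrow> c < N'" using codes_bounded by blast
  have "\<exists>G<N'. inf_set {x\<in>V. cmp X A k F G x}"
  proof (rule inf_pigeon[OF V(1,2), where R = "\<lambda>x G. cmp X A k F G x"])
    show "df S (\<lambda>e. cmp X A k F (e 1) (e 0))" by (intro df_cmp X A fdi)
    fix x assume x: "x \<in> V"
    have "{s. lcode s \<and> els s \<subseteq> els F \<and> cola A s x} \<in> S" by (rule df_comp) (intro dfs fdi df_cola A)
    moreover have "s < N" if "lcode s" "els s \<subseteq> els F" for s
      using N that elm_less by blast
    ultimately have "fins {s. lcode s \<and> els s \<subseteq> els F \<and> cola A s x}" by (intro finsI[of _ N]) auto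
    then obtain G where G: "lcode G" "els G = {s. lcode s \<and> els s \<subseteq> els F \<and> cola A s x}" using lcode_fins by blast
    have "\<forall>y\<in>els G. y < N" using G(2) \<open>\<And>s. lcode s \<Longrightarrow> els s \<subseteq> els F \<Longrightarrow> s < N\<close> by auto
    then have "G < N'" using N' G(1) by blast
    moreover have "cmp X A k F G x" unfolding cmp_def using x V(3,4) G(2) by auto
    ultimately show "\<exists>G<N'. cmp X A k F G x" by blast
  qed
  then show ?thesis by blast
qed

lemma inf_set_mono: "inf_set A \<Longrightarrow> A \<subseteq> B \<Longrightarrow> inf_set B"
  unfolding inf_set_def by blast

lemma inf_set_above: "inf_set A \<Longrightarrow> inf_set {x\<in>A. b < (x::'a)}"
  unfolding inf_set_def mem_Collect_eq
proof
  fix x assume A: "\<forall>x. \<exists>y\<ge>x. y \<in> A"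
  obtain y where y: "y \<ge> x + b + 1" "y \<in> A" using A by blast
  have "x \<le> x + b + 1" by (simp add: add.assoc)
  moreover have "b < x + b + 1" by (simp add: add_increasing)
  ultimately have "x \<le> y" "b < y" using y(1) by order+
  then show "\<exists>y\<ge>x. y \<in> A \<and> b < y" using y(2) by blast
qed

lemma fd_u1: "fd S f \<Longrightarrow> fd S (\<lambda>e. u1 (f e))" and fd_u2: "fd S f \<Longrightarrow> fd S (\<lambda>e. u2 (f e))"
proof -
  have "fn S (\<lambda>e. u1 (e 0))" "fn S (\<lambda>e. u2 (e 0))" by (intro fn_u1 fn_u2 fn_var)+
  then have "df S (\<lambda>e. e 0 = u1 (e 1))" "df S (\<lambda>e. e 0 = u2 (e 1))"
    unfolding fn_def by (simp_all add: df_sg)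
  then show "fd S f \<Longrightarrow> fd S (\<lambda>e. u1 (f e))" "fd S f \<Longrightarrow> fd S (\<lambda>e. u2 (f e))"
    by (auto intro: fd_app1[where h = u1] fd_app1[where h = u2])
qed

text \<open>A prehomogeneous set: the elements are added one at a time, always keeping infinitely
  many candidates \<open>x\<close> for which the colours of the sets \<open>s \<union> {x}\<close>, \<open>s \<subseteq> F\<close>, are as prescribed
  by \<open>G\<close>.\<close>

lemma prehomogeneous:
  assumes X: "X \<in> S" "inf_set X" and A: "A \<in> S"
  shows "\<exists>Y\<in>S. \<exists>B\<in>S. inf_set Y \<and> Y \<subseteq> X \<and>
    (\<forall>s x. lcode s \<longrightarrow> els s \<subseteq> Y \<longrightarrow> hcard (els s) k \<longrightarrow> x \<in> Y \<longrightarrow> (\<forall>y\<in>els s. y < x) \<longrightarrow> (cola A s x \<longleftrightarrow> s \<in> B))"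
proof -
  \<comment> \<open>A common candidate \<open>x\<close> for both stages is demanded so that the old
    and the new type prescribe the same colours to subsets of the old set.\<close>
  define St where "St w v \<longleftrightarrow> (\<exists>y. cmp X A k (u1 w) (u2 w) y \<and> y \<in> els (u1 v) \<and> els (u1 w) \<subseteq> els (u1 v) \<and>
     (\<forall>z\<in>els (u1 v). z = y \<or> z \<in> els (u1 w)) \<and> (\<exists>x. cmp X A k (u1 w) (u2 w) x \<and> cmp X A k (u1 v) (u2 v) x))" for w v
  define Inv where "Inv w \<longleftrightarrow> els (u1 w) \<subseteq> X \<and> inf_set {x. cmp X A k (u1 w) (u2 w) x}" for w
  obtain F0 :: 'a where F0: "els F0 = {}" using fins_empty by (auto simp: fins_def)
  obtain G0 where G0: "inf_set {x\<in>X. cmp X A k F0 G0 x}"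
    using type_pigeon[OF X(1) A X subset_refl, of F0 k] F0 by auto
  have "inf_set {x. cmp X A k F0 G0 x}" by (rule inf_set_mono[OF G0]) auto
  then have i0: "Inv (pr F0 G0)" unfolding Inv_def using F0 by simp
  have "\<exists>f. df S (\<lambda>e. e 0 = f (e 1)) \<and> f 0 = pr F0 G0 \<and> (\<forall>i. Inv (f i) \<and> St (f i) (f (i + 1)))"
  proof (rule dependent_choice[where St = St and Inv = Inv and ?w0.0 = "pr F0 G0", OF _ _ i0])
    show "df S (\<lambda>e. St (e 0) (e 1))" unfolding St_def by (intro dfs fdi df_cmp fd_u1 fd_u2 X A)
    have "df S (\<lambda>e. inf_set {x. cmp X A k (u1 (e 0)) (u2 (e 0)) x})"
      by (rule df_inf_set) (intro df_cmp fd_u1 fd_u2 fdi X A)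
    then show "df S (\<lambda>e. Inv (e 0))" unfolding Inv_def by (intro dfs fdi fd_u1 X)
    fix w assume w: "Inv w"
    let ?C = "{x. cmp X A k (u1 w) (u2 w) x}"
    obtain y where y: "cmp X A k (u1 w) (u2 w) y" using w unfolding Inv_def inf_set_def by blast
    obtain F where F: "els F = insert y (els (u1 w))" using fins_insert[OF fins_els] unfolding fins_def by metis
    define V where "V = {x. cmp X A k (u1 w) (u2 w) x \<and> y < x}"
    have V: "x \<in> V \<longleftrightarrow> cmp X A k (u1 w) (u2 w) x \<and> y < x" for x by (simp add: V_def)
    have "V \<in> S" unfolding V_def by (rule df_comp) (intro dfs fdi df_cmp X A)
    moreover have iC: "inf_set ?C" using w unfolding Inv_def by (rule conjunct2)
    have "inf_set V" using inf_set_above[OF iC, of y] unfolding V_def mem_Collect_eq .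
    moreover have "V \<subseteq> X" unfolding subset_eq by (simp add: V cmp_def)
    moreover have "\<forall>x\<in>V. \<forall>z\<in>els F. z < x" unfolding F by (simp add: V cmp_def)
    ultimately obtain G where "inf_set {x\<in>V. cmp X A k F G x}"
      using type_pigeon[OF X(1) A, of V F k] by blast
    then have G: "inf_set {x. cmp X A k F G x}" and G': "\<exists>x. x \<in> V \<and> cmp X A k F G x"
      by (rule inf_set_mono) (blast, use \<open>inf_set {x\<in>V. cmp X A k F G x}\<close> in \<open>unfold inf_set_def, blast\<close>)
    then obtain x where x: "cmp X A k (u1 w) (u2 w) x" "cmp X A k F G x" unfolding V by blast
    have "St w (pr F G)" unfolding St_def u_pr F
      by (intro exI[of _ y] conjI exI[of _ x] ballI x y) auto
    moreover have "Inv (pr F G)"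
      unfolding Inv_def u_pr F using G w[unfolded Inv_def] y[unfolded cmp_def] by simp
    ultimately show "\<exists>v. St w v \<and> Inv v" by blast
  qed
  then obtain f where f: "df S (\<lambda>e. e 0 = f (e 1))" "f 0 = pr F0 G0" "\<And>i. Inv (f i)" "\<And>i. St (f i) (f (i + 1))"
    by blast
  note fdf = fd_app1[OF f(1)]
  define FF GG where "FF i = els (u1 (f i))" and "GG i = els (u2 (f i))" for i
  define CC where "CC i x \<longleftrightarrow> cmp X A k (u1 (f i)) (u2 (f i)) x" for i x
  have CCD: "x \<in> X" "y \<in> FF i \<Longrightarrow> y < x" "lcode s \<Longrightarrow> els s \<subseteq> FF i \<Longrightarrow> hcard (els s) k \<Longrightarrow> cola A s x \<longleftrightarrow> s \<in> GG i"
    if "CC i x" for i x y s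
    using that unfolding CC_def cmp_def FF_def GG_def by blast+
  have step: "\<exists>y. CC i y \<and> FF (i + 1) = insert y (FF i) \<and> (\<exists>x. CC i x \<and> CC (i + 1) x)" for i
    using f(4)[of i] unfolding St_def CC_def FF_def by blast
  have FF0: "FF 0 = {}" unfolding FF_def f(2) using F0 by simp
  \<comment> \<open>The candidate shared by consecutive stages transfers the colours from the new
    type to the old one.\<close>
  have CCS: "CC i x" if c: "CC (i + 1) x" for i x
  proof -
    obtain y z where y: "FF (i + 1) = insert y (FF i)" "CC i z" "CC (i + 1) z" using step by blast
    have "cola A s x \<longleftrightarrow> s \<in> GG i" if s: "lcode s" "els s \<subseteq> FF i" "hcard (els s) k" for s
    proof -
      have "els s \<subseteq> FF (i + 1)" using s(2) y(1) by blast
      then show ?thesis using CCD(3)[OF c s(1) _ s(3)] CCD(3)[OF y(3) s(1) _ s(3)] CCD(3)[OF y(2) s] by blast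
    qed
    moreover have "\<forall>z\<in>FF i. z < x" using CCD(2)[OF c] y(1) by blast
    ultimately show ?thesis using CCD(1)[OF c] unfolding CC_def cmp_def FF_def GG_def by blast
  qed
  have dF: "df S (\<lambda>e. h e \<in> FF (g e))" if "fd S g" "fd S h" for g h
    unfolding FF_def by (intro dfs fd_u1 fdf that)
  have dG: "df S (\<lambda>e. h e \<in> GG (g e))" if "fd S g" "fd S h" for g h
    unfolding GG_def by (intro dfs fd_u2 fdf that)
  have dC: "df S (\<lambda>e. CC (g e) (h e))" if "fd S g" "fd S h" for g h
    unfolding CC_def by (intro df_cmp X A fd_u1 fd_u2 fdf that)
  have later: "(\<forall>x. CC (i + j) x \<longrightarrow> CC i x) \<and> (\<forall>x. x \<in> FF (i + j) \<longrightarrow> x \<in> FF i \<or> CC i x) \<and> (\<forall>x. x \<in> FF i \<longrightarrow> x \<in> FF (i + j))" for i j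
  proof (rule induct[where P = "\<lambda>j. (\<forall>x. CC (i + j) x \<longrightarrow> CC i x) \<and> (\<forall>x. x \<in> FF (i + j) \<longrightarrow> x \<in> FF i \<or> CC i x) \<and> (\<forall>x. x \<in> FF i \<longrightarrow> x \<in> FF (i + j))"])
    show "df S (\<lambda>e. (\<forall>x. CC (i + e 0) x \<longrightarrow> CC i x) \<and> (\<forall>x. x \<in> FF (i + e 0) \<longrightarrow> x \<in> FF i \<or> CC i x) \<and> (\<forall>x. x \<in> FF i \<longrightarrow> x \<in> FF (i + e 0)))"
      by (intro dfi fdi dC dF)
    fix j assume IH: "(\<forall>x. CC (i + j) x \<longrightarrow> CC i x) \<and> (\<forall>x. x \<in> FF (i + j) \<longrightarrow> x \<in> FF i \<or> CC i x) \<and> (\<forall>x. x \<in> FF i \<longrightarrow> x \<in> FF (i + j))"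
    obtain y where y: "CC (i + j) y" "FF (i + j + 1) = insert y (FF (i + j))" using step by blast
    show "(\<forall>x. CC (i + (j + 1)) x \<longrightarrow> CC i x) \<and> (\<forall>x. x \<in> FF (i + (j + 1)) \<longrightarrow> x \<in> FF i \<or> CC i x) \<and> (\<forall>x. x \<in> FF i \<longrightarrow> x \<in> FF (i + (j + 1)))"
      unfolding add.assoc[symmetric] y(2) using IH CCS y(1) by blast
  qed simp
  define Y where "Y = {y. \<exists>i. y \<in> FF i}"
  have YS: "Y \<in> S" unfolding Y_def by (rule df_comp) (intro dfi fdi dF)
  have out: "CC i x" if x: "x \<in> Y" "x \<notin> FF i" for i x
  proof -
    obtain j where j: "x \<in> FF j" using x unfolding Y_def by blast
    show ?thesis
    proof (cases "i \<le> j")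
      case True
      then obtain d where "j = i + d" by (metis le_iff_add)
      then show ?thesis using later[of i d] j x(2) by blast
    next
      case False
      then obtain d where "i = j + d" by (metis le_iff_add linear)
      then show ?thesis using later[of j d] j x(2) by blast
    qed
  qed
  have YX: "Y \<subseteq> X"
    using f(3) unfolding Y_def FF_def Inv_def by blast
  have Yinf: "\<exists>i. \<exists>y. y \<in> FF i \<and> m \<le> y" for m
  proof (rule induct[where P = "\<lambda>m. \<exists>i. \<exists>y. y \<in> FF i \<and> m \<le> y"])
    show "df S (\<lambda>e. \<exists>i. \<exists>y. y \<in> FF i \<and> e 0 \<le> y)" by (intro dfi fdi dF)
    show "\<exists>i y. y \<in> FF i \<and> 0 \<le> y" using step[of 0] by (metis insertI1 zero_le)
    fix m assume "\<exists>i y. y \<in> FF i \<and> m \<le> y"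
    then obtain i y where y: "y \<in> FF i" "m \<le> y" by blast
    obtain z where z: "CC i z" "FF (i + 1) = insert z (FF i)" using step by blast
    have "y < z" using CCD(2)[OF z(1) y(1)] .
    then have "m + 1 \<le> z" using y(2) unfolding Suc_le by order
    then show "\<exists>i y. y \<in> FF i \<and> m + 1 \<le> y" using z(2) by blast
  qed
  then have Yi: "inf_set Y" unfolding inf_set_def Y_def by blast
  define B where "B = {s. \<exists>i. (\<forall>y\<in>els s. y \<in> FF i) \<and> s \<in> GG i}"
  have BS: "B \<in> S" unfolding B_def by (rule df_comp) (intro dfi fdi dF dG)
  have "cola A s x \<longleftrightarrow> s \<in> B"
    if s: "lcode s" "els s \<subseteq> Y" "hcard (els s) k" "x \<in> Y" "\<forall>y\<in>els s. y < x" for s x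
  proof -
    obtain j0 where "x \<in> FF j0" using s(4) unfolding Y_def by blast
    \<comment> \<open>At the stage just before \<open>x\<close> enters, all smaller elements of
      \<open>Y\<close> are already present, since anything entering later exceeds the elements
      chosen so far.\<close>
    then have "\<exists>j. x \<in> FF j \<and> (\<forall>i<j. x \<notin> FF i)"
      by (rule least[where P = "\<lambda>j. x \<in> FF j", rotated]) (intro dF fdi)
    then obtain j where j: "x \<in> FF j" "\<forall>i<j. x \<notin> FF i" by blast
    have "j \<noteq> 0" using j(1) FF0 by auto
    then obtain i where i: "j = i + 1" using zero_or_Suc by blast
    have xi: "x \<notin> FF i" using j(2) i by simp
    have Fj: "FF j = insert x (FF i)" using step[of i] j(1) xi i by auto
    have sF: "els s \<subseteq> FF i"
    proof
      fix z assume z: "z \<in> els s"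
      then have "z < x" using s(5) by blast
      show "z \<in> FF i"
      proof (rule ccontr)
        assume "z \<notin> FF i"
        then have "z \<notin> FF j" using Fj \<open>z < x\<close> by auto
        then have "CC j z" using out z s(2) by blast
        then have "x < z" using CCD(2) j(1) by blast
        then show False using \<open>z < x\<close> by order
      qed
    qed
    have c1: "cola A s x \<longleftrightarrow> s \<in> GG i" using CCD(3)[OF out[OF s(4) xi] s(1) sF s(3)] .
    \<comment> \<open>Different stages agree about \<open>s\<close>: any element of \<open>Y\<close>
      that is large enough is a candidate at both.\<close>
    have "s \<in> GG i \<longleftrightarrow> s \<in> GG i'" if si': "els s \<subseteq> FF i'" for i'
    proof -
      obtain z where z: "z \<in> Y" "z \<ge> u1 (f i) + u1 (f i')" using Yi unfolding inf_set_def by blast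
      have "u1 (f i) \<le> u1 (f i) + u1 (f i')" "u1 (f i') \<le> u1 (f i) + u1 (f i')" by simp_all
      then have "u1 (f i) \<le> z" "u1 (f i') \<le> z" using z(2) by order+
      then have "z \<notin> FF i" "z \<notin> FF i'" unfolding FF_def using elm_less not_le by blast+
      then show ?thesis using CCD(3)[OF out[OF z(1)] s(1) _ s(3)] sF si' by blast
    qed
    then have "s \<in> B \<longleftrightarrow> s \<in> GG i" unfolding B_def using sF by blast
    then show ?thesis using c1 by blast
  qed
  then show ?thesis using YS BS Yi YX by blast
qed

lemma ramsey_0: "ramsey S (0::'a)"
  unfolding ramsey_def
proof (intro ballI impI)
  fix X A assume X: "X \<in> S" "inf_set X" "A \<in> S"
  have e0: "els s = {}" if "hcard (els s) 0" for s :: 'a using that hcard_0 by auto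
  have "s = t" if "lcode s" "lcode t" "hcard (els s) 0" "hcard (els t) 0" for s t :: 'a
    using lcode_unique[of s t] that(1,2) e0[OF that(3)] e0[OF that(4)] by simp
  then have "hom X A 0" unfolding hom_def by (metis (no_types))
  then show "\<exists>Y\<in>S. inf_set Y \<and> Y \<subseteq> X \<and> hom Y A 0" using X by blast
qed

text \<open>On a prehomogeneous set the colour of a set depends only on the set without its greatest
  element, which lowers the exponent by one.\<close>

lemma ramsey_Suc: assumes R: "ramsey S k" shows "ramsey S (k + 1)"
  unfolding ramsey_def
proof (intro ballI impI)
  fix X A assume X: "X \<in> S" "inf_set X" "A \<in> S"
  obtain Y B where Y: "Y \<in> S" "B \<in> S" "inf_set Y" "Y \<subseteq> X" and pre: "\<forall>s x. lcode s \<longrightarrow> els s \<subseteq> Y \<longrightarrow>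
      hcard (els s) k \<longrightarrow> x \<in> Y \<longrightarrow> (\<forall>y\<in>els s. y < x) \<longrightarrow> (cola A s x \<longleftrightarrow> s \<in> B)"
    using prehomogeneous[OF X, of k] by (elim bexE conjE) (erule that, assumption+)
  obtain Z where Z: "Z \<in> S" "inf_set Z" "Z \<subseteq> Y" "hom Z B k" using R Y unfolding ramsey_def by blast
  have red: "\<exists>s. lcode s \<and> els s \<subseteq> Z \<and> hcard (els s) k \<and> (t \<in> A \<longleftrightarrow> s \<in> B)"
    if t: "lcode t" "els t \<subseteq> Z" "hcard (els t) (k + 1)" for t
  proof -
    have ne: "els t \<noteq> {}" using hcard_unique[OF fins_empty hcard_empty] t(3) by (metis Suc_neq_0(1))
    have "\<exists>m\<in>els t. \<forall>y\<in>els t. y \<le> m"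
    proof -
      have "\<exists>b. (\<forall>y\<in>els t. y \<le> b) \<and> (\<forall>b'<b. \<not> (\<forall>y\<in>els t. y \<le> b'))"
        by (rule least[where P = "\<lambda>b. \<forall>y\<in>els t. y \<le> b" and x = t]) (intro dfs fdi, use elm_less less_imp_le in blast)
      then obtain b where b: "\<forall>y\<in>els t. y \<le> b" "\<forall>b'<b. \<not> (\<forall>y\<in>els t. y \<le> b')" by blast
      have "b \<in> els t"
      proof (rule ccontr)
        assume nb: "b \<notin> els t"
        obtain y where y: "y \<in> els t" using ne by blast
        have "b \<noteq> 0"
        proof
          assume "b = 0"
          then have "y = 0" using b(1) y by auto
          then show False using y nb \<open>b = 0\<close> by simp
        qed
        then obtain c where c: "b = c + 1" using zero_or_Suc by blast
        have "\<forall>y\<in>els t. y \<le> c"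
        proof
          fix y assume "y \<in> els t"
          then have "y \<le> b" "y \<noteq> b" using b(1) nb by auto
          then have "y < b" by order
          then show "y \<le> c" using c by simp
        qed
        moreover have "c < b" using c by simp
        ultimately show False using b(2) by blast
      qed
      then show ?thesis using b(1) by blast
    qed
    then obtain x where x: "x \<in> els t" "\<forall>y\<in>els t. y \<le> x" by blast
    have "fins (els t - {x})" by (rule fins_subset[OF fins_els]) (auto intro: S_Diff S_sing)
    then obtain s where s: "lcode s" "els s = els t - {x}" using lcode_fins by blast
    have ins: "els t = insert x (els s)" using x(1) s(2) by auto
    then have hs: "hcard (els s) k" using hcard_remove[OF fins_els, of x s k] t(3) s(2) by auto
    have "\<forall>y\<in>els s. y < x" using x(2) s(2) by (auto simp: less_le)
    then have "cola A s x \<longleftrightarrow> s \<in> B" using pre s t(2) Z(3) x(1) hs by blast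
    moreover have "cola A s x \<longleftrightarrow> t \<in> A" using cola_iff[OF t(1) ins] .
    ultimately show ?thesis using s t(2) hs by blast
  qed
  have "hom Z A (k + 1)"
    using Z(4)[unfolded hom_def]
  proof
    assume *: "\<forall>s. lcode s \<and> els s \<subseteq> Z \<and> hcard (els s) k \<longrightarrow> s \<in> B"
    have "\<forall>t. lcode t \<and> els t \<subseteq> Z \<and> hcard (els t) (k + 1) \<longrightarrow> t \<in> A"
    proof (intro allI impI, elim conjE)
      fix t assume "lcode t" "els t \<subseteq> Z" "hcard (els t) (k + 1)"
      from red[OF this] obtain s where "lcode s \<and> els s \<subseteq> Z \<and> hcard (els s) k" "t \<in> A \<longleftrightarrow> s \<in> B" by blast
      then show "t \<in> A" using * by simp
    qed
    then show ?thesis unfolding hom_def by (rule disjI1)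
  next
    assume *: "\<forall>s. lcode s \<and> els s \<subseteq> Z \<and> hcard (els s) k \<longrightarrow> s \<notin> B"
    have "\<forall>t. lcode t \<and> els t \<subseteq> Z \<and> hcard (els t) (k + 1) \<longrightarrow> t \<notin> A"
    proof (intro allI impI, elim conjE)
      fix t assume "lcode t" "els t \<subseteq> Z" "hcard (els t) (k + 1)"
      from red[OF this] obtain s where "lcode s \<and> els s \<subseteq> Z \<and> hcard (els s) k" "t \<in> A \<longleftrightarrow> s \<in> B" by blast
      then show "t \<notin> A" using * by simp
    qed
    then show ?thesis unfolding hom_def by (rule disjI2)
  qed
  moreover have "Z \<subseteq> X" using Z(3) Y(4) by (rule subset_trans)
  ultimately show "\<exists>Y\<in>S. inf_set Y \<and> Y \<subseteq> X \<and> hom Y A (k + 1)"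
    using Z(1,2) by blast
qed

end

section \<open>\<open>RT(!\<omega>)\<close> from a truth set\<close>

abbreviation "cAnd p q \<equiv> cNeg (cImp p (cNeg q))"

definition xsg :: "nat \<Rightarrow> 'a \<Rightarrow> nat \<Rightarrow> 'a xtm" where
  "xsg k x i = (if i < k then XV i else if i = k then XC x else XV (i - 1))"

lemma xsg_up: "(XV 0 ## (\<lambda>i. xlift (xsg k x i))) = xsg (Suc k) x"
  by (rule ext) (auto simp: xsg_def cns_def split: nat.split)

primrec xctm :: "nat \<Rightarrow> 'a xtm \<Rightarrow> bool" where
  "xctm k (XV i) = (i < k)"
| "xctm k (XC c) = True"
| "xctm k (XAdd t u) = (xctm k t \<and> xctm k u)"
| "xctm k (XMul t u) = (xctm k t \<and> xctm k u)"

primrec xcl :: "nat \<Rightarrow> 'a xfm \<Rightarrow> bool" where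
  "xcl k (XEq t u) = (xctm k t \<and> xctm k u)"
| "xcl k (XLe t u) = (xctm k t \<and> xctm k u)"
| "xcl k (XIn t A) = xctm k t"
| "xcl k (XNeg p) = xcl k p"
| "xcl k (XImp p q) = (xcl k p \<and> xcl k q)"
| "xcl k (XBEx t p) = (xctm k t \<and> xcl (Suc k) p)"
| "xcl k (XEx p) = xcl (Suc k) p"

primrec xsz :: "'a xfm \<Rightarrow> nat" where
  "xsz (XEq t u) = 0"
| "xsz (XLe t u) = 0"
| "xsz (XIn t A) = 0"
| "xsz (XNeg p) = Suc (xsz p)"
| "xsz (XImp p q) = Suc (xsz p + xsz q)"
| "xsz (XBEx t p) = Suc (xsz p)"
| "xsz (XEx p) = Suc (xsz p)"

lemma xsz_sub [simp]: "xsz (xsub \<sigma> p) = xsz p"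
  by (induction p arbitrary: \<sigma>) auto

lemma xctm_sub: "xctm (Suc k) t \<Longrightarrow> xctm k (xsub_tm (xsg k x) t)"
  by (induction t) (auto simp: xsg_def)

lemma xcl_sub: "xcl (Suc k) p \<Longrightarrow> xcl k (xsub (xsg k x) p)"
  by (induction p arbitrary: k) (auto simp: xctm_sub xsg_up)

lemma xsub_tm_comp: "xsub_tm \<tau> (xsub_tm \<sigma> t) = xsub_tm (\<lambda>i. xsub_tm \<tau> (\<sigma> i)) t"
  by (induction t) auto

lemma xlift_sub: "xsub_tm (xsg (Suc k) x) (xlift t) = xlift (xsub_tm (xsg k x) t)"
proof -
  have "(\<lambda>i. xsub_tm (xsg (Suc k) x) (XV (Suc i))) = (\<lambda>i. xlift (xsg k x i))"
    by (auto simp: xsg_def)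
  then show ?thesis by (simp add: xsub_tm_comp)
qed

lemma xlift_sub0: "xsub_tm (xsg 0 x) (xlift t) = t"
proof -
  have "xsub_tm XV t = t" by (induction t) auto
  then show ?thesis by (simp add: xsub_tm_comp xsg_def)
qed

lemma xctm_lift: "xctm k t \<Longrightarrow> xctm (Suc k) (xlift t)"
  by (induction t) auto

lemma xsat_sg: "xsat e (xsub (xsg 0 x) p) = xsat (x ## e) p"
proof -
  have "(\<lambda>i. xev e (xsg 0 x i)) = x ## e" by (rule cns_eqI) (auto simp: xsg_def)
  then show ?thesis by (simp add: xsat_sub)
qed

text \<open>Because \<open>T\<close> is a member of \<open>S\<close>, statements about all sets
  definable in the language with truth set \<open>T\<close> become arithmetical over
  \<open>S\<close>. The set \<open>U\<close> supplies the truth values of the lower truth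
  predicates.\<close>

locale aca_truth = aca S for S :: "'a::arith set set" +
  fixes n :: nat and U T :: "'a set"
  assumes T: "T \<in> S"
    and T_Eq: "Trm 0 t \<Longrightarrow> Trm 0 u \<Longrightarrow> Val t v \<Longrightarrow> Val u w \<Longrightarrow> cEq t u \<in> T \<longleftrightarrow> v = w"
    and T_Le: "Trm 0 t \<Longrightarrow> Trm 0 u \<Longrightarrow> Val t v \<Longrightarrow> Val u w \<Longrightarrow> cLe t u \<in> T \<longleftrightarrow> v \<le> w"
    and T_Tr: "i < of_nat n \<Longrightarrow> cTr i (num x) \<in> T \<longleftrightarrow> pr i x \<in> U"
    and T_Neg: "Form n 0 p \<Longrightarrow> cNeg p \<in> T \<longleftrightarrow> p \<notin> T"
    and T_Imp: "Form n 0 p \<Longrightarrow> Form n 0 q \<Longrightarrow> cImp p q \<in> T \<longleftrightarrow> (p \<in> T \<longrightarrow> q \<in> T)"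
    and T_Ex: "Form n 0 (cEx p) \<Longrightarrow> cEx p \<in> T \<longleftrightarrow> (\<exists>x q. Sub 0 (num x) p q \<and> q \<in> T)"
begin

definition Def :: "'a \<Rightarrow> 'a set" where
  "Def p = {x. \<exists>q. Sub 0 (num x) p q \<and> q \<in> T}"

text \<open>The codes \<open>p\<close> range over all formulas of the model, also nonstandard ones;
  parameters are included because numerals can be written into them.\<close>

definition DS :: "'a set set" where
  "DS = {Def p |p. Form n 1 p}"

lemma df_Def: "fd S f \<Longrightarrow> fd S g \<Longrightarrow> df S (\<lambda>e. f e \<in> Def (g e))"
  by (rule df_app2[where P = "\<lambda>x p. x \<in> Def p"]) (unfold Def_def mem_Collect_eq, intro dfs fdi fd_num T)

lemma Def_S: "Def p \<in> S"
  using df_comp[of "\<lambda>x. x \<in> Def p"] by (simp add: df_Def fdi)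

lemma DS_S: "DS \<subseteq> S"
  unfolding DS_def using Def_S by blast

definition cd :: "'a set \<Rightarrow> 'a" where
  "cd A = (SOME p. Form n 1 p \<and> Def p = A)"

lemma cd: assumes "A \<in> DS" shows "Form n 1 (cd A)" "Def (cd A) = A"
proof -
  have "\<exists>p. Form n 1 p \<and> Def p = A" using assms unfolding DS_def by blast
  from someI_ex[OF this] show "Form n 1 (cd A)" "Def (cd A) = A" unfolding cd_def by auto
qed

primrec tc :: "'a xtm \<Rightarrow> 'a" where
  "tc (XV i) = cVar (of_nat i)"
| "tc (XC c) = num c"
| "tc (XAdd t u) = cPlus (tc t) (tc u)"
| "tc (XMul t u) = cTimes (tc t) (tc u)"

text \<open>The code of \<open>x \<in> A\<close> is that of \<open>\<exists>v (v = x \<and> \<phi>(v))\<close>, so that the possibly nonstandard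
  formula \<open>\<phi>\<close> defining \<open>A\<close> need not be shifted.\<close>

primrec fc :: "'a xfm \<Rightarrow> 'a" where
  "fc (XEq t u) = cEq (tc t) (tc u)"
| "fc (XLe t u) = cLe (tc t) (tc u)"
| "fc (XIn t A) = cEx (cAnd (cEq (cVar 0) (tc (xlift t))) (cd A))"
| "fc (XNeg p) = cNeg (fc p)"
| "fc (XImp p q) = cImp (fc p) (fc q)"
| "fc (XBEx t p) = cEx (cAnd (cLe (cVar 0) (tc (xlift t))) (fc p))"
| "fc (XEx p) = cEx (fc p)"

lemma Trm_tc: "xctm k t \<Longrightarrow> Trm (of_nat k) (tc t)"
  by (induction t) auto

lemma Val_tc: "xctm 0 t \<Longrightarrow> Val (tc t) v \<longleftrightarrow> v = xev e t"
  by (induction t arbitrary: v) auto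

lemma Form_fc: "xsets p \<subseteq> DS \<Longrightarrow> xcl k p \<Longrightarrow> Form n (of_nat k) (fc p)"
proof (induction p arbitrary: k)
  case (XIn t A)
  have "Form n 1 (cd A)" using cd XIn by auto
  then have "Form n (of_nat k + 1) (cd A)" by (rule Form_mono) simp
  moreover have "Trm (of_nat (Suc k)) (tc (xlift t))" using XIn by (intro Trm_tc xctm_lift) auto
  ultimately show ?case by (simp add: add.commute zero_less_iff_neq_zero)
next
  case (XBEx t p)
  have "Trm (of_nat (Suc k)) (tc (xlift t))" using XBEx by (intro Trm_tc xctm_lift) auto
  moreover have "Form n (of_nat (Suc k)) (fc p)" using XBEx.prems by (intro XBEx.IH) auto
  ultimately show ?case by (simp add: add.commute zero_less_iff_neq_zero)
next
  case (XEx p)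
  then have "Form n (of_nat (Suc k)) (fc p)" by (intro XEx.IH) auto
  then show ?case by (simp add: add.commute)
qed (auto intro: Trm_tc)

lemma SubT_tc: "SubT (of_nat k) (num x) (tc t) (tc (xsub_tm (xsg k x) t))"
proof (induction t)
  case (XV i)
  consider "i < k" | "i = k" | j where "i = Suc j" "k \<le> j"
    by (metis Suc_le_D less_Suc_eq_le not_less_eq linorder_neqE_nat Suc_leI Suc_le_mono)
  then show ?case by cases (auto simp: xsg_def add.commute)
qed auto

lemma Sub_fc: "xsets p \<subseteq> DS \<Longrightarrow> Sub (of_nat k) (num x) (fc p) (fc (xsub (xsg k x) p))"
proof (induction p arbitrary: k)
  case (XEq t u) then show ?case using SubT_tc by auto
next
  case (XLe t u) then show ?case using SubT_tc by auto
next
  case (XIn t A)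
  have "Form n 1 (cd A)" using cd XIn by auto
  then have "Form n (of_nat k + 1) (cd A)" by (rule Form_mono) simp
  then have "Sub (of_nat k + 1) (num x) (cd A) (cd A)" by (rule Sub_id)
  moreover have "SubT (of_nat k + 1) (num x) (tc (xlift t)) (tc (xlift (xsub_tm (xsg k x) t)))"
    using SubT_tc[of "Suc k" x "xlift t"] by (simp add: xlift_sub add.commute)
  ultimately show ?case by (simp add: zero_less_iff_neq_zero)
next
  case (XBEx t p)
  have "SubT (of_nat k + 1) (num x) (tc (xlift t)) (tc (xlift (xsub_tm (xsg k x) t)))"
    using SubT_tc[of "Suc k" x "xlift t"] by (simp add: xlift_sub add.commute)
  moreover have "Sub (of_nat k + 1) (num x) (fc p) (fc (xsub (xsg (Suc k) x) p))"
    using XBEx.IH[of "Suc k"] XBEx.prems by (simp add: add.commute)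
  ultimately show ?case by (simp add: zero_less_iff_neq_zero xsg_up)
next
  case (XEx p)
  have "Sub (of_nat k + 1) (num x) (fc p) (fc (xsub (xsg (Suc k) x) p))"
    using XEx.IH[of "Suc k"] XEx.prems by (simp add: add.commute)
  then show ?case by (simp add: xsg_up)
qed auto

lemma T_And: "Form n 0 p \<Longrightarrow> Form n 0 q \<Longrightarrow> cAnd p q \<in> T \<longleftrightarrow> p \<in> T \<and> q \<in> T"
  by (simp add: T_Neg T_Imp)

lemma Sub_unique: assumes "Form n (0 + 1) p" "Sub 0 (num x) p q" "Sub 0 (num x) p r" shows "q = r"
proof -
  obtain s where "\<forall>q'. Sub 0 (num x) p q' \<longleftrightarrow> q' = s" using Sub_ex[OF assms(1) Trm_num, of x] by blast
  then show ?thesis using assms by simp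
qed

text \<open>Tarski's adequacy for formulas that are standard except for the numerals and the codes
  put in place of set parameters. The induction is on \<open>xsz\<close>, as instances are not
  subformulas.\<close>

lemma T_fc: "xsets p \<subseteq> DS \<Longrightarrow> xcl 0 p \<Longrightarrow> fc p \<in> T \<longleftrightarrow> xsat e p"
proof (induction "xsz p" arbitrary: p rule: less_induct)
  case less
  have F: "Form n 0 (fc p)" using Form_fc[OF less.prems] by simp
  have T0: "Trm 0 (tc t)" if "xctm 0 t" for t using Trm_tc[OF that] by simp
  have inst: "Sub 0 (num x) (fc q) r \<longleftrightarrow> r = fc (xsub (xsg 0 x) q)" if "xsets q \<subseteq> DS" "xcl 1 q" for q r x
  proof -
    have "Form n (0 + 1) (fc q)" using Form_fc[OF that] by simp
    then show ?thesis using Sub_unique Sub_fc[OF that(1), of 0 x] by auto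
  qed
  have c0: "xcl 0 (xsub (xsg 0 x) q)" if "xcl 1 q" for x q
    using xcl_sub[of 0 q x] that by simp
  show ?case
  proof (cases p)
    case (XEq t u)
    then show ?thesis using less.prems T_Eq[OF T0 T0, of t u] Val_tc[of t _ e] Val_tc[of u _ e] by simp
  next
    case (XLe t u)
    then show ?thesis using less.prems T_Le[OF T0 T0, of t u] Val_tc[of t _ e] Val_tc[of u _ e] by simp
  next
    case (XIn t A)
    have A: "Form n 1 (cd A)" "Def (cd A) = A" using cd XIn less.prems by auto
    have t: "xctm 0 t" using XIn less.prems by simp
    \<comment> \<open>The closed term \<open>t\<close> was shifted across the quantifier that guards
      the set, so instantiating that quantifier restores it.\<close>
    have st: "SubT 0 (num x) (tc (xlift t)) u \<longleftrightarrow> u = tc t" for x u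
    proof -
      have "Trm (of_nat (Suc 0)) (tc (xlift t))" using t by (intro Trm_tc xctm_lift)
      then have "Trm (0 + 1) (tc (xlift t))" by simp
      from SubT_ex[OF this Trm_num, of x] obtain s where "\<forall>u. SubT 0 (num x) (tc (xlift t)) u \<longleftrightarrow> u = s" by blast
      moreover have "SubT 0 (num x) (tc (xlift t)) (tc t)" using SubT_tc[of 0 x "xlift t"] by (simp add: xlift_sub0)
      ultimately show ?thesis by auto
    qed
    have ra: "Form n 0 r" if "Sub 0 (num x) (cd A) r" for r x
    proof -
      have "Form n (0 + 1) (cd A)" using A by simp
      from Sub_ex[OF this Trm_num, of x] show ?thesis using that by auto
    qed
    have nn: "\<not> (0::'a) \<ge> j + 1" for j by simp
    have "fc p \<in> T \<longleftrightarrow> (\<exists>x r. Sub 0 (num x) (cd A) r \<and> cAnd (cEq (num x) (tc t)) r \<in> T)"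
    proof -
      have "Sub 0 (num x) (cAnd (cEq (cVar 0) (tc (xlift t))) (cd A)) q \<longleftrightarrow>
          (\<exists>r. Sub 0 (num x) (cd A) r \<and> q = cAnd (cEq (num x) (tc t)) r)" for x q
        by (simp add: st) blast
      moreover have "fc p = cEx (cAnd (cEq (cVar 0) (tc (xlift t))) (cd A))" unfolding XIn by simp
      ultimately show ?thesis using T_Ex[of "cAnd (cEq (cVar 0) (tc (xlift t))) (cd A)"] F by metis
    qed
    also have "\<dots> \<longleftrightarrow> (\<exists>x r. Sub 0 (num x) (cd A) r \<and> x = xev e t \<and> r \<in> T)"
    proof -
      have "cAnd (cEq (num x) (tc t)) r \<in> T \<longleftrightarrow> x = xev e t \<and> r \<in> T" if "Sub 0 (num x) (cd A) r" for x r
        using T_And[of "cEq (num x) (tc t)" r] ra[OF that] T0[OF t] T_Eq[of "num x" "tc t" x "xev e t"] Val_tc[OF t, of _ e] by simp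
      then show ?thesis by blast
    qed
    also have "\<dots> \<longleftrightarrow> xev e t \<in> Def (cd A)" unfolding Def_def by auto
    finally show ?thesis using XIn A by simp
  next
    case (XNeg q)
    then show ?thesis using less F by (simp add: T_Neg)
  next
    case (XImp q r)
    then show ?thesis using less F by (simp add: T_Imp)
  next
    case (XBEx t q)
    have t: "xctm 0 t" and q: "xcl 1 q" "xsets q \<subseteq> DS" using XBEx less.prems by auto
    define r where "r = XNeg (XImp (XLe (XV 0) (xlift t)) (XNeg q))"
    have fr: "fc p = cEx (fc r)" unfolding XBEx r_def by simp
    have rr: "xcl 1 r" "xsets r \<subseteq> DS" using q xctm_lift[OF t] by (auto simp: r_def)
    have "fc p \<in> T \<longleftrightarrow> (\<exists>x. fc (xsub (xsg 0 x) r) \<in> T)"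
      using T_Ex[of "fc r"] F unfolding fr by (simp add: inst[OF rr(2,1)])
    also have "\<dots> \<longleftrightarrow> (\<exists>x. x \<le> xev e t \<and> fc (xsub (xsg 0 x) q) \<in> T)"
    proof -
      have "fc (xsub (xsg 0 x) r) \<in> T \<longleftrightarrow> x \<le> xev e t \<and> fc (xsub (xsg 0 x) q) \<in> T" for x
      proof -
        have "Form n 0 (fc (xsub (xsg 0 x) q))" using Form_fc[of "xsub (xsg 0 x) q" 0] q c0[OF q(1), of x] by simp
        moreover have "xsub_tm (xsg 0 x) (XV 0) = XC x" by (simp add: xsg_def)
        ultimately show ?thesis unfolding r_def
          using T_And[of "cLe (num x) (tc t)"] T0[OF t] T_Le[of "num x" "tc t" x "xev e t"] Val_tc[OF t, of _ e]
          by (simp add: xlift_sub0)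
      qed
      then show ?thesis by simp
    qed
    also have "\<dots> \<longleftrightarrow> (\<exists>x. x \<le> xev e t \<and> xsat e (xsub (xsg 0 x) q))"
    proof -
      have "fc (xsub (xsg 0 x) q) \<in> T \<longleftrightarrow> xsat e (xsub (xsg 0 x) q)" for x
        using less.hyps[of "xsub (xsg 0 x) q"] q XBEx c0[OF q(1), of x] by simp
      then show ?thesis by simp
    qed
    finally show ?thesis using XBEx by (simp add: xsat_sg)
  next
    case (XEx q)
    have q: "xcl 1 q" "xsets q \<subseteq> DS" using XEx less.prems by auto
    have "fc p \<in> T \<longleftrightarrow> (\<exists>x. fc (xsub (xsg 0 x) q) \<in> T)"
      using T_Ex[of "fc q"] F XEx by (simp add: inst[OF q(2,1)])
    also have "\<dots> \<longleftrightarrow> (\<exists>x. xsat e (xsub (xsg 0 x) q))"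
    proof -
      have "fc (xsub (xsg 0 x) q) \<in> T \<longleftrightarrow> xsat e (xsub (xsg 0 x) q)" for x
        using less.hyps[of "xsub (xsg 0 x) q"] q XEx c0[OF q(1), of x] by simp
      then show ?thesis by simp
    qed
    finally show ?thesis using XEx by (simp add: xsat_sg)
  qed
qed

lemma xctm_mix: "xctm (Suc k) (xsub_tm (\<lambda>i. if i < Suc k then XV i else XC (e i)) t)"
  by (induction t) auto

lemma xcl_mix: "xcl (Suc k) (xsub (\<lambda>i. if i < Suc k then XV i else XC (e i)) p)"
proof (induction p arbitrary: k e)
  case (XBEx t p)
  have "(XV 0 ## (\<lambda>i. xlift (if i < Suc k then XV i else XC (e i)))) =
    (\<lambda>i. if i < Suc (Suc k) then XV i else XC (e (i - 1)))"
    by (auto simp: cns_def fun_eq_iff split: nat.split)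
  then show ?case using XBEx.IH[of "Suc k" "\<lambda>i. e (i - 1)"] xctm_mix by simp
next
  case (XEx p)
  have "(XV 0 ## (\<lambda>i. xlift (if i < Suc k then XV i else XC (e i)))) =
    (\<lambda>i. if i < Suc (Suc k) then XV i else XC (e (i - 1)))"
    by (auto simp: cns_def fun_eq_iff split: nat.split)
  then show ?case using XEx.IH[of "Suc k" "\<lambda>i. e (i - 1)"] by simp
qed (auto simp: xctm_mix)

text \<open>A formula over parameters from \<open>DS\<close> has itself a code, obtained by
  \<open>fc\<close>, so it again defines a member of \<open>DS\<close>; induction is inherited from
  \<open>S\<close>.\<close>

lemma aca_DS: "aca DS"
proof
  fix A x assume "A \<in> DS" "0 \<in> A" and "\<And>x. x \<in> A \<Longrightarrow> x + 1 \<in> A"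
  then show "x \<in> A" using DS_S aind by blast
next
  fix P e assume "df DS P"
  then obtain p where p: "xsets p \<subseteq> DS" "\<And>e. P e = xsat e p" by (auto simp: df_def)
  define q where "q = xsub (\<lambda>i. if i < Suc 0 then XV i else XC (e (i - 1))) p"
  have q: "xsets q \<subseteq> DS" "xcl 1 q"
    using p xcl_mix[of 0 "\<lambda>i. e (i - 1)" p] by (simp_all add: q_def)
  have F: "Form n 1 (fc q)" using Form_fc[OF q] by simp
  have "x \<in> Def (fc q) \<longleftrightarrow> P (x ## e)" for x
  proof -
    have "Sub 0 (num x) (fc q) r \<longleftrightarrow> r = fc (xsub (xsg 0 x) q)" for r
      using Sub_unique[of "fc q" x] F Sub_fc[OF q(1), of 0 x] by auto
    then have "x \<in> Def (fc q) \<longleftrightarrow> fc (xsub (xsg 0 x) q) \<in> T" by (simp add: Def_def)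
    also have "\<dots> \<longleftrightarrow> xsat e (xsub (xsg 0 x) q)" by (rule T_fc) (use q xcl_sub[of 0 q x] in simp_all)
    also have "\<dots> \<longleftrightarrow> xsat (x ## e) q" by (rule xsat_sg)
    also have "\<dots> \<longleftrightarrow> xsat (x ## e) p"
    proof -
      have "(\<lambda>i. xev (x ## e) (if i < Suc 0 then XV i else XC (e (i - 1)))) = x ## e"
        by (rule cns_eqI) auto
      then show ?thesis unfolding q_def xsat_sub by simp
    qed
    finally show ?thesis using p by simp
  qed
  then have "{x. P (x ## e)} = Def (fc q)" by auto
  then show "{x. P (x ## e)} \<in> DS" unfolding DS_def using F by blast
qed

lemma slice_DS: assumes "i < n" shows "{v. pr (of_nat i) v \<in> U} \<in> DS"
proof -
  have lt: "(of_nat i :: 'a) < of_nat n" using assms by simp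
  have "Form n (1 :: 'a) (cTr (of_nat i) (cVar 0))" using lt by simp
  moreover have "Def (cTr (of_nat i) (cVar (0 :: 'a))) = {v. pr (of_nat i) v \<in> U}"
    unfolding Def_def using T_Tr[OF lt] by auto
  ultimately show ?thesis unfolding DS_def by blast
qed

text \<open>Solutions are quantified over as codes, so the assertion is arithmetical in
  \<open>T\<close> and induction on the exponent is available in \<open>S\<close>, also for
  nonstandard \<open>k\<close>. The induction step itself is performed inside \<open>DS\<close>, so
  that the solutions stay definable.\<close>

lemma ramsey_DS: "ramsey DS k"
proof -
  interpret D: aca DS by (rule aca_DS)
  have *: "ramsey DS k \<longleftrightarrow> (\<forall>p. Form n 1 p \<longrightarrow> (\<forall>x. \<exists>y. x \<le> y \<and> y \<in> Def p) \<longrightarrow> (\<forall>r. Form n 1 r \<longrightarrow>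
    (\<exists>q. Form n 1 q \<and> (\<forall>x. \<exists>y. x \<le> y \<and> y \<in> Def q) \<and> (\<forall>y. y \<in> Def q \<longrightarrow> y \<in> Def p) \<and>
      ((\<forall>s. lcode s \<and> (\<forall>y\<in>els s. y \<in> Def q) \<and> hcard (els s) k \<longrightarrow> s \<in> Def r) \<or>
       (\<forall>s. lcode s \<and> (\<forall>y\<in>els s. y \<in> Def q) \<and> hcard (els s) k \<longrightarrow> s \<notin> Def r)))))" for k
  proof -
    have all: "(\<forall>X\<in>DS. P X) \<longleftrightarrow> (\<forall>p. Form n 1 p \<longrightarrow> P (Def p))" for P
      unfolding DS_def by blast
    have ex: "(\<exists>X\<in>DS. P X) \<longleftrightarrow> (\<exists>p. Form n 1 p \<and> P (Def p))" for P
      unfolding DS_def by blast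
    show ?thesis by (simp only: ramsey_def all ex) (simp only: hom_def inf_set_def subset_eq Ball_def)
  qed
  show ?thesis unfolding *
    by (rule induct[where P = "\<lambda>k. \<forall>p. Form n 1 p \<longrightarrow> (\<forall>x. \<exists>y. x \<le> y \<and> y \<in> Def p) \<longrightarrow> (\<forall>r. Form n 1 r \<longrightarrow>
    (\<exists>q. Form n 1 q \<and> (\<forall>x. \<exists>y. x \<le> y \<and> y \<in> Def q) \<and> (\<forall>y. y \<in> Def q \<longrightarrow> y \<in> Def p) \<and>
      ((\<forall>s. lcode s \<and> (\<forall>y\<in>els s. y \<in> Def q) \<and> hcard (els s) k \<longrightarrow> s \<in> Def r) \<or>
       (\<forall>s. lcode s \<and> (\<forall>y\<in>els s. y \<in> Def q) \<and> hcard (els s) k \<longrightarrow> s \<notin> Def r))))"],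
       intro dfs fdi df_Def, unfold *[symmetric], rule D.ramsey_0, rule D.ramsey_Suc)
qed

text \<open>The homogeneous set consists of the minima \<open>a\<close> of a descending sequence of sets in
  which each set is homogeneous for the colouring of the \<open>a\<close>-element sets induced by the
  preceding minimum.\<close>

lemma large_homogeneous:
  assumes X: "X \<in> DS" "inf_set X" and D: "D \<in> DS"
  shows "\<exists>L\<in>S. inf_set L \<and> L \<subseteq> X \<and>
    ((\<forall>c. xl c \<and> els c \<subseteq> L \<longrightarrow> c \<in> D) \<or> (\<forall>c. xl c \<and> els c \<subseteq> L \<longrightarrow> c \<notin> D))"
proof -
  interpret D: aca DS by (rule aca_DS)
  have DS': "D \<in> S" using D DS_S by blast
  define mn where "mn p a \<longleftrightarrow> a \<in> Def p \<and> (\<forall>y. y \<in> Def p \<longrightarrow> a \<le> y)" for p a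
  define red where "red a q \<longleftrightarrow> (\<forall>s. lcode s \<and> (\<forall>y\<in>els s. y \<in> Def q) \<and> hcard (els s) a \<longrightarrow> cola D s a)" for a q
  define blue where "blue a q \<longleftrightarrow> (\<forall>s. lcode s \<and> (\<forall>y\<in>els s. y \<in> Def q) \<and> hcard (els s) a \<longrightarrow> \<not> cola D s a)" for a q
  define Inv where "Inv p \<longleftrightarrow> Form n 1 p \<and> (\<forall>x. \<exists>y. x \<le> y \<and> y \<in> Def p)" for p
  define St where "St p q \<longleftrightarrow> (\<exists>a. mn p a \<and> (\<forall>y. y \<in> Def q \<longrightarrow> y \<in> Def p \<and> a < y) \<and> (red a q \<or> blue a q))" for p q
  have dmn: "df S (\<lambda>e. mn (f e) (g e))" if "fd S f" "fd S g" for f g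
    by (rule df_app2[where P = mn, OF _ that]) (unfold mn_def, intro dfs fdi df_Def)
  have dred: "df S (\<lambda>e. red (f e) (g e))" if "fd S f" "fd S g" for f g
    by (rule df_app2[where P = red, OF _ that]) (unfold red_def, intro dfs fdi df_Def df_cola DS')
  have dblue: "df S (\<lambda>e. blue (f e) (g e))" if "fd S f" "fd S g" for f g
    by (rule df_app2[where P = blue, OF _ that]) (unfold blue_def, intro dfs fdi df_Def df_cola DS')
  obtain p0 where p0: "Form n 1 p0" "Def p0 = X" using X(1) unfolding DS_def by blast
  have i0: "Inv p0" unfolding Inv_def using p0 X(2) unfolding inf_set_def by blast
  have "\<exists>f. df S (\<lambda>e. e 0 = f (e 1)) \<and> f 0 = p0 \<and> (\<forall>i. Inv (f i) \<and> St (f i) (f (i + 1)))"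
  proof (rule dependent_choice[where St = St and Inv = Inv and ?w0.0 = p0, OF _ _ i0])
    show "df S (\<lambda>e. St (e 0) (e 1))" unfolding St_def by (intro dfs fdi dmn dred dblue df_Def)
    show "df S (\<lambda>e. Inv (e 0))" unfolding Inv_def by (intro dfs fdi df_Def)
    fix p assume p: "Inv p"
    then obtain y where "y \<in> Def p" unfolding Inv_def by blast
    then have "\<exists>a. a \<in> Def p \<and> (\<forall>y<a. y \<notin> Def p)"
      by (rule least[where P = "\<lambda>a. a \<in> Def p", rotated]) (intro df_Def fdi)
    then obtain a where a: "mn p a" unfolding mn_def using not_less by blast
    have pD: "Def p \<in> DS" unfolding DS_def using p Inv_def by blast
    have X1: "{x. x \<in> Def p \<and> a < x} \<in> DS" by (rule D.df_comp) (intro dfi fdi pD)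
    have "inf_set {x. x \<in> Def p \<and> a < x}" using inf_set_above[of "Def p" a] p unfolding Inv_def inf_set_def by simp
    \<comment> \<open>The exponent for this instance of Ramsey's theorem is the minimum
      \<open>a\<close> itself: an exactly large set with minimum \<open>a\<close> has
      \<open>a\<close> further elements.\<close>
    moreover have "{s. cola D s a} \<in> DS" by (rule D.df_comp) (intro D.df_cola D fdi)
    ultimately obtain Y where Y: "Y \<in> DS" "inf_set Y" "Y \<subseteq> {x. x \<in> Def p \<and> a < x}" "hom Y {s. cola D s a} a"
      using ramsey_DS[of a] X1 unfolding ramsey_def by blast
    obtain q where q: "Form n 1 q" "Def q = Y" using Y(1) unfolding DS_def by blast
    have "red a q \<or> blue a q" using Y(4) unfolding red_def blue_def hom_def q(2) subset_eq by simp
    then have "St p q" unfolding St_def using a Y(3) q(2) by blast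
    moreover have "Inv q" unfolding Inv_def using q Y(2) unfolding inf_set_def by blast
    ultimately show "\<exists>q. St p q \<and> Inv q" by blast
  qed
  then obtain f where f: "df S (\<lambda>e. e 0 = f (e 1))" "f 0 = p0" "\<And>i. Inv (f i)" "\<And>i. St (f i) (f (i + 1))"
    by blast
  note fdf = fd_app1[OF f(1)]
  have mono: "Def (f (i + j)) \<subseteq> Def (f i)" for i j
  proof -
    have "\<forall>y. y \<in> Def (f (i + j)) \<longrightarrow> y \<in> Def (f i)"
    proof (rule induct[where P = "\<lambda>j. \<forall>y. y \<in> Def (f (i + j)) \<longrightarrow> y \<in> Def (f i)"])
      show "df S (\<lambda>e. \<forall>y. y \<in> Def (f (i + e 0)) \<longrightarrow> y \<in> Def (f i))" by (intro dfs fdi df_Def fdf)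
      fix j assume "\<forall>y. y \<in> Def (f (i + j)) \<longrightarrow> y \<in> Def (f i)"
      then show "\<forall>y. y \<in> Def (f (i + (j + 1))) \<longrightarrow> y \<in> Def (f i)"
        using f(4)[of "i + j"] unfolding St_def add.assoc by blast
    qed simp
    then show ?thesis by blast
  qed
  have mn_unique: "mn p a \<Longrightarrow> mn p b \<Longrightarrow> a = b" for p a b unfolding mn_def by (meson order_antisym)
  have stepmn: "\<exists>a. mn (f i) a \<and> (\<forall>y\<in>Def (f (i + 1)). a < y) \<and> (red a (f (i + 1)) \<or> blue a (f (i + 1)))" for i
    using f(4)[of i] unfolding St_def by blast
  define L1 where "L1 = {a. \<exists>i. mn (f i) a \<and> red a (f (i + 1))}"
  define L0 where "L0 = {a. \<exists>i. mn (f i) a \<and> blue a (f (i + 1))}"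
  have S1: "L1 \<in> S" "L0 \<in> S" unfolding L1_def L0_def by (rule df_comp, intro dfs fdi dmn dred dblue fdf)+
  \<comment> \<open>The sets descend and each lies above the minimum of its predecessor, so a larger
    minimum belongs to a later stage.\<close>
  have later: "b \<in> Def (f (i + 1))" if m: "mn (f i) a" "mn (f j) b" "a < b" for i j a b
  proof -
    have "\<not> j \<le> i"
    proof
      assume "j \<le> i"
      then obtain d where "i = j + d" by (metis le_iff_add)
      then have "a \<in> Def (f j)" using mono[of j d] m(1) unfolding mn_def by blast
      then have "b \<le> a" using m(2) unfolding mn_def by blast
      then show False using m(3) by simp
    qed
    then have "i + 1 \<le> j" by (simp add: Suc_le)
    then obtain d where "j = i + 1 + d" by (metis le_iff_add)
    then show ?thesis using mono[of "i + 1" d] m(2) unfolding mn_def by blast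
  qed
  have unb: "\<exists>i. \<exists>a. mn (f i) a \<and> m \<le> a" for m
  proof (rule induct[where P = "\<lambda>m. \<exists>i. \<exists>a. mn (f i) a \<and> m \<le> a"])
    show "df S (\<lambda>e. \<exists>i. \<exists>a. mn (f i) a \<and> e 0 \<le> a)" by (intro dfs fdi dmn fdf)
    show "\<exists>i a. mn (f i) a \<and> 0 \<le> a" using stepmn[of 0] by auto
    fix m assume "\<exists>i a. mn (f i) a \<and> m \<le> a"
    then obtain i a where a: "mn (f i) a" "m \<le> a" by blast
    obtain b where b: "mn (f (i + 1)) b" using stepmn by blast
    have "a < b" using stepmn[of i] mn_unique[OF a(1)] b unfolding mn_def by blast
    then have "m + 1 \<le> b" using a(2) unfolding Suc_le by order
    then show "\<exists>i a. mn (f i) a \<and> m + 1 \<le> a" using b by blast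
  qed
  have "inf_set L1 \<or> inf_set L0"
  proof (rule ccontr)
    assume "\<not> (inf_set L1 \<or> inf_set L0)"
    then obtain b c where bc: "\<And>y. y \<in> L1 \<Longrightarrow> y < b" "\<And>y. y \<in> L0 \<Longrightarrow> y < c" unfolding inf_set_def not_le[symmetric] by metis
    obtain i a where a: "mn (f i) a" "b + c \<le> a" using unb by blast
    have "a \<in> L1 \<or> a \<in> L0" using stepmn[of i] mn_unique[OF a(1)] a(1) unfolding L1_def L0_def by blast
    then have "a < b \<or> a < c" using bc by blast
    moreover have "b \<le> b + c" "c \<le> b + c" by simp_all
    ultimately show False using a(2) by (metis not_le order_trans)
  qed
  have sX: "L1 \<subseteq> X" "L0 \<subseteq> X"
    using mono[of 0] f(2) p0(2) unfolding L1_def L0_def mn_def by auto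
  have split: "\<exists>a s. lcode s \<and> els c = insert a (els s) \<and> (\<forall>y\<in>els s. a < y) \<and> hcard (els s) a" if c: "xl c" for c :: 'a
  proof -
    obtain a where a: "a \<in> els c" "\<forall>y\<in>els c. a \<le> y" "hcard (els c) (a + 1)" using c unfolding xl_def by blast
    have "fins (els c - {a})" by (rule fins_subset[OF fins_els]) (auto intro: S_Diff S_sing)
    then obtain s where s: "lcode s" "els s = els c - {a}" using lcode_fins by blast
    have "els c = insert a (els s)" using a(1) s(2) by auto
    moreover from this have "hcard (els s) a" using hcard_remove[OF fins_els, of a s a] a(3) s(2) by auto
    moreover have "\<forall>y\<in>els s. a < y" using a(2) s(2) by (auto simp: less_le)
    ultimately show ?thesis using s(1) by blast
  qed
  have h1: "c \<in> D" if c: "xl c" "els c \<subseteq> L1" for c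
  proof -
    obtain a s where s: "lcode s" "els c = insert a (els s)" "\<forall>y\<in>els s. a < y" "hcard (els s) a" using split[OF c(1)] by blast
    obtain i where i: "mn (f i) a" "red a (f (i + 1))" using c(2) s(2) unfolding L1_def by blast
    have "\<forall>y\<in>els s. y \<in> Def (f (i + 1))" using later[OF i(1)] s(2,3) c(2) unfolding L1_def by blast
    then have "cola D s a" using i(2) s unfolding red_def by blast
    then show ?thesis using cola_iff[of c a s D] c(1) s(2) unfolding xl_def by blast
  qed
  have h0: "c \<notin> D" if c: "xl c" "els c \<subseteq> L0" for c
  proof -
    obtain a s where s: "lcode s" "els c = insert a (els s)" "\<forall>y\<in>els s. a < y" "hcard (els s) a" using split[OF c(1)] by blast
    obtain i where i: "mn (f i) a" "blue a (f (i + 1))" using c(2) s(2) unfolding L0_def by blast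
    have "\<forall>y\<in>els s. y \<in> Def (f (i + 1))" using later[OF i(1)] s(2,3) c(2) unfolding L0_def by blast
    then have "\<not> cola D s a" using i(2) s unfolding blue_def by blast
    then show ?thesis using cola_iff[of c a s D] c(1) s(2) unfolding xl_def by blast
  qed
  from \<open>inf_set L1 \<or> inf_set L0\<close> show ?thesis
  proof
    assume "inf_set L1"
    then show ?thesis using S1(1) sX(1) h1 by (intro bexI[of _ L1] conjI disjI1 allI impI) simp_all
  next
    assume "inf_set L0"
    then show ?thesis using S1(2) sX(2) h0 by (intro bexI[of _ L0] conjI disjI2 allI impI) simp_all
  qed
qed

end

section \<open>The structures of second-order arithmetic\<close>

definition std :: "'a set set \<Rightarrow> (nat \<Rightarrow> 'a set) \<Rightarrow> 'a::arith mdl" where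
  "std S T = \<lparr>zr = 0, sc = (\<lambda>x. x + 1), pl = (+), ti = (*), le = (\<le>), sts = S, trs = T\<rparr>"

lemma std_simps [simp]:
  "zr (std S T) = 0" "sc (std S T) = (\<lambda>x. x + 1)" "pl (std S T) = (+)" "ti (std S T) = (*)"
  "le (std S T) = (\<le>)" "sts (std S T) = S" "trs (std S T) = T"
  by (simp_all add: std_def)

lemma sat_connectives [simp]:
  "sat M e X (p \<^bold>\<and> q) \<longleftrightarrow> sat M e X p \<and> sat M e X q"
  "sat M e X (p \<^bold>\<or> q) \<longleftrightarrow> sat M e X p \<or> sat M e X q"
  "sat M e X (p \<^bold>\<longleftrightarrow> q) \<longleftrightarrow> (sat M e X p \<longleftrightarrow> sat M e X q)"
  by auto

lemma sat_universal:
  "sat M e X (All p) \<longleftrightarrow> (\<forall>x. sat M (x ## e) X p)" "sat M e X (All2 p) \<longleftrightarrow> (\<forall>A\<in>sts M. sat M e (A ## X) p)"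
  by auto

lemma ev_numeral [simp]: "ev (std S T) e (numeral_tm n) = of_nat n"
  by (induction n) (auto simp: add.commute)

lemma ev_pair [simp]: "ev (std S T) e (pair t u) = pr (ev (std S T) e t) (ev (std S T) e u)"
  by (simp add: pair_def pr_def)

lemma ev_code [simp]:
  "ev (std S T) e code_Zero = 0"
  "ev (std S T) e (code_Var t) = cVar (ev (std S T) e t)"
  "ev (std S T) e (code_Succ t) = cSucc (ev (std S T) e t)"
  "ev (std S T) e (code_Plus t u) = cPlus (ev (std S T) e t) (ev (std S T) e u)"
  "ev (std S T) e (code_Times t u) = cTimes (ev (std S T) e t) (ev (std S T) e u)"
  "ev (std S T) e (code_Eq t u) = cEq (ev (std S T) e t) (ev (std S T) e u)"
  "ev (std S T) e (code_Le t u) = cLe (ev (std S T) e t) (ev (std S T) e u)"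
  "ev (std S T) e (code_Tr t u) = cTr (ev (std S T) e t) (ev (std S T) e u)"
  "ev (std S T) e (code_Neg t) = cNeg (ev (std S T) e t)"
  "ev (std S T) e (code_Imp t u) = cImp (ev (std S T) e t) (ev (std S T) e u)"
  "ev (std S T) e (code_Ex t) = cEx (ev (std S T) e t)"
  by (simp_all add: code_Zero_def code_Var_def code_Succ_def code_Plus_def code_Times_def code_Eq_def
      code_Le_def code_Tr_def code_Neg_def code_Imp_def code_Ex_def)

lemma sat_BEx [simp]: "sat (std S T) e X (BEx t p) \<longleftrightarrow> (\<exists>x\<le>ev (std S T) e t. sat (std S T) (x ## e) X p)"
  by (simp add: BEx_def)

lemma sat_mem [simp]: "sat (std S T) e X (mem t c) \<longleftrightarrow> ev (std S T) e t \<in> els (ev (std S T) e c)"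
  by (simp add: mem_def els_def elm_bounded Suc_le)

lemma sat_mem_quantifiers [simp]:
  "sat (std S T) e X (Ex_mem c p) \<longleftrightarrow> (\<exists>x. x \<in> els (ev (std S T) e c) \<and> sat (std S T) (x ## e) X p)"
  "sat (std S T) e X (All_mem c p) \<longleftrightarrow> (\<forall>x. x \<in> els (ev (std S T) e c) \<longrightarrow> sat (std S T) (x ## e) X p)"
  "sat (std S T) e X (All_pair_mem c p) \<longleftrightarrow>
    (\<forall>x y. pr x y \<in> els (ev (std S T) e c) \<longrightarrow> sat (std S T) (y ## x ## e) X p)"
  by (simp_all add: Ex_mem_def All_mem_def All_pair_mem_def)

lemma sat_least_code [simp]: "sat (std S T) e X (least_code c) \<longleftrightarrow> lcode (ev (std S T) e c)"
  by (simp add: least_code_def lcode_def set_eq_iff Suc_le) blast?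

lemma sat_has_card [simp]:
  fixes S :: "'a::arith set set" shows
  "sat (std S T) e X (has_card c k) \<longleftrightarrow> hcard (els (ev (std S T) e c)) (ev (std S T) e k)"
  by (simp add: has_card_def hcard_def hb_def Suc_le Ball_def Bex_def iff_conv_conj_imp[of "x = x'" "y = y'" for x x' y y' :: 'a])

lemma sat_exactly_large [simp]: "sat (std S T) e X (exactly_large c) \<longleftrightarrow> xl (ev (std S T) e c)"
  by (simp add: exactly_large_def xl_def Ball_def Bex_def)

lemma sat_infinite_set [simp]: "sat (std S T) e X (infinite_set i) \<longleftrightarrow> inf_set (X i)"
  by (simp add: infinite_set_def inf_set_def)

lemma sat_two_coloring [simp]: "sat (std S T) e X (two_coloring i) \<longleftrightarrow> col (X i)"
  by (auto simp add: two_coloring_def col_def Ball_def)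

lemma sat_RT: "sat (std S T) e X RT_exactly_large \<longleftrightarrow> rtx S"
  by (simp add: RT_exactly_large_def rtx_def subset_def coded_subset_def subset_iff sat_universal del: sat.simps(5))

lemma sat_is_numeral [simp]:
  "sat (std S T) e X (is_numeral x z) \<longleftrightarrow> Num (ev (std S T) e x) (ev (std S T) e z)"
  by (simp add: is_numeral_def Num_def disj_imp)

lemma sat_is_term [simp]:
  "sat (std S T) e X (is_term k t) \<longleftrightarrow> Trm (ev (std S T) e k) (ev (std S T) e t)"
  by (simp add: is_term_def Trm_def disj_imp Suc_le)

lemma sat_has_value [simp]:
  "sat (std S T) e X (has_value t v) \<longleftrightarrow> Val (ev (std S T) e t) (ev (std S T) e v)"
  by (simp add: has_value_def Val_def disj_imp Suc_le)

lemma sat_is_subst_tm [simp]: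
  "sat (std S T) e X (is_subst_tm k z t u) \<longleftrightarrow>
    SubT (ev (std S T) e k) (ev (std S T) e z) (ev (std S T) e t) (ev (std S T) e u)"
  by (simp add: is_subst_tm_def SubT_def disj_imp Suc_le)

lemma sat_is_formula [simp]:
  "sat (std S T) e X (is_formula n k p) \<longleftrightarrow> Form n (ev (std S T) e k) (ev (std S T) e p)"
  by (simp add: is_formula_def Form_def disj_imp Suc_le)

lemma sat_is_subst_fm [simp]:
  "sat (std S T) e X (is_subst_fm k z p q) \<longleftrightarrow>
    Sub (ev (std S T) e k) (ev (std S T) e z) (ev (std S T) e p) (ev (std S T) e q)"
  by (simp add: is_subst_fm_def Sub_def disj_imp Suc_le)

lemma sat_truth:
  "sat (std S T) e X (truth_Eq n) \<longleftrightarrow>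
    (\<forall>t u v w. Trm 0 t \<longrightarrow> Trm 0 u \<longrightarrow> Val t v \<longrightarrow> Val u w \<longrightarrow> (cEq t u \<in> T n \<longleftrightarrow> v = w))"
  "sat (std S T) e X (truth_Le n) \<longleftrightarrow>
    (\<forall>t u v w. Trm 0 t \<longrightarrow> Trm 0 u \<longrightarrow> Val t v \<longrightarrow> Val u w \<longrightarrow> (cLe t u \<in> T n \<longleftrightarrow> v \<le> w))"
  "sat (std S T) e X (truth_Tr n i) \<longleftrightarrow> (\<forall>x z. Num x z \<longrightarrow> (cTr (of_nat i) z \<in> T n \<longleftrightarrow> x \<in> T i))"
  "sat (std S T) e X (truth_Neg n) \<longleftrightarrow> (\<forall>p. Form n 0 p \<longrightarrow> (cNeg p \<in> T n \<longleftrightarrow> p \<notin> T n))"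
  "sat (std S T) e X (truth_Imp n) \<longleftrightarrow> (\<forall>p q. Form n 0 p \<longrightarrow> Form n 0 q \<longrightarrow>
    (cImp p q \<in> T n \<longleftrightarrow> (p \<in> T n \<longrightarrow> q \<in> T n)))"
  "sat (std S T) e X (truth_Ex n) \<longleftrightarrow> (\<forall>p. Form n 0 (cEx p) \<longrightarrow>
    (cEx p \<in> T n \<longleftrightarrow> (\<exists>x z q. Num x z \<and> Sub 0 z p q \<and> q \<in> T n)))"
  unfolding truth_Eq_def truth_Le_def truth_Tr_def truth_Neg_def truth_Imp_def truth_Ex_def
  by simp_all (blast+)?

lemma sat_induction_axiom:
  "sat M e X (induction_axiom p) \<longleftrightarrow> (sat M (zr M ## e) X p \<longrightarrow>
    (\<forall>x. sat M (x ## e) X p \<longrightarrow> sat M (sc M x ## e) X p) \<longrightarrow> (\<forall>x. sat M (x ## e) X p))"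
proof -
  have "(\<lambda>i. (y ## x ## e) (if i < 1 then i else i + 1)) = y ## e" for x y
    by (rule cns_eqI) auto
  then have "sat M (y ## x ## e) X (shift_fm 1 1 p) \<longleftrightarrow> sat M (y ## e) X p" for x y
    by (simp only: sat_shift)
  then show ?thesis by (simp add: induction_axiom_def sat_subst)
qed

lemma sat_comprehension_axiom:
  "sat M e X (comprehension_axiom p q) \<longleftrightarrow> ((\<forall>x. sat M (x ## e) X p \<longleftrightarrow> sat M (x ## e) X q) \<longrightarrow>
    (\<exists>A\<in>sts M. \<forall>x. x \<in> A \<longleftrightarrow> sat M (x ## e) X p))"
proof -
  have *: "sat M e (A ## X) (shift2_fm 1 0 p) \<longleftrightarrow> sat M e X p" for e A
    by (simp add: sat_shift2)
  show ?thesis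
    by (simp only: comprehension_axiom_def sat_universal sat.simps(3,6,8) sat_connectives(3) ev.simps(1) cns_simps(1) *)
qed

lemma sat_basic_axioms: assumes "q \<in> basic_axioms" shows "sat (std S T) e X q"
proof -
  have *: "x \<le> 1 + y \<longleftrightarrow> x \<le> y \<or> x = 1 + y" for x y :: 'a
    using less_Suc[of x y] unfolding add.commute[of 1 y] by (auto simp: le_less)
  show ?thesis
    using assms unfolding basic_axioms_def
    by (auto simp: algebra_simps *)
qed

section \<open>Definability by formulas\<close>

primrec no_ex2 :: "fm \<Rightarrow> bool" where
  "no_ex2 (t \<^bold>= u) = True"
| "no_ex2 (t \<^bold>\<le> u) = True"
| "no_ex2 (In t X) = True"
| "no_ex2 (Tr i t) = True"
| "no_ex2 (\<^bold>\<not> p) = no_ex2 p"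
| "no_ex2 (p \<^bold>\<longrightarrow> q) = (no_ex2 p \<and> no_ex2 q)"
| "no_ex2 (Ex p) = no_ex2 p"
| "no_ex2 (Ex2 p) = False"

primrec tri :: "fm \<Rightarrow> nat set" where
  "tri (t \<^bold>= u) = {}"
| "tri (t \<^bold>\<le> u) = {}"
| "tri (In t X) = {}"
| "tri (Tr i t) = {i}"
| "tri (\<^bold>\<not> p) = tri p"
| "tri (p \<^bold>\<longrightarrow> q) = tri p \<union> tri q"
| "tri (Ex p) = tri p"
| "tri (Ex2 p) = tri p"

lemma finite_tri: "finite (tri p)"
  by (induction p) auto

lemma tri_truth_free: "truth_free p \<longleftrightarrow> tri p = {}"
  by (induction p) auto

lemma no_ex2_set_free: "set_free p \<Longrightarrow> no_ex2 p"
  by (induction p) auto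

lemma no_ex2_bounded: "p \<in> bounded_formulas \<Longrightarrow> no_ex2 p"
  by (induction rule: bounded_formulas.induct) (auto simp: BEx_def BAll_def)

lemma tmd_ev: "tmd (\<lambda>e. ev (std S T) e t)"
  by (induction t) (auto intro: tmi)

lemma cns_eta: "e 0 ## (\<lambda>i. e (Suc i)) = e"
  by (rule cns_eqI[symmetric]) auto

lemma df_sat:
  "no_ex2 p \<Longrightarrow> (\<forall>i\<in>tri p. T i \<in> D) \<Longrightarrow> set_free p \<or> range X \<subseteq> D \<Longrightarrow> df D (\<lambda>e. sat (std S T) e X p)"
proof (induction p)
  case (Ex p)
  have "df D (\<lambda>e. sat (std S T) (e 0 ## (\<lambda>i. e (Suc i))) X p)" unfolding cns_eta using Ex by simp
  then have "df D (\<lambda>e. \<exists>x. sat (std S T) (x ## e) X p)" by (rule df_ex[where P = "\<lambda>x e. sat (std S T) (x ## e) X p"])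
  then show ?case by simp
next
  case (Imp p q)
  then have "df D (\<lambda>e. sat (std S T) e X p)" "df D (\<lambda>e. sat (std S T) e X q)" by auto
  then show ?case by (simp add: df_imp)
next
  case (Neg p)
  then have "df D (\<lambda>e. sat (std S T) e X p)" by simp
  then show ?case by (simp add: df_not)
next
  case (In t Y)
  then have "X Y \<in> D" by auto
  then show ?case using df_in[OF fd_fn[OF fn_tmd[OF tmd_ev]]] by simp
next
  case (Tr i t)
  then have "T i \<in> D" by simp
  then show ?case using df_in[OF fd_fn[OF fn_tmd[OF tmd_ev]]] by simp
next
  case (Eq t u)
  show ?case using df_eq[OF fd_fn[OF fn_tmd[OF tmd_ev]] fd_fn[OF fn_tmd[OF tmd_ev]]] by simp
next
  case (Le t u)
  show ?case using df_le[OF fd_fn[OF fn_tmd[OF tmd_ev]] fd_fn[OF fn_tmd[OF tmd_ev]]] by simp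
qed auto

primrec xctms :: "'a xtm \<Rightarrow> 'a set" where
  "xctms (XV i) = {}"
| "xctms (XC c) = {c}"
| "xctms (XAdd t u) = xctms t \<union> xctms u"
| "xctms (XMul t u) = xctms t \<union> xctms u"

primrec xcons :: "'a xfm \<Rightarrow> 'a set" where
  "xcons (XEq t u) = xctms t \<union> xctms u"
| "xcons (XLe t u) = xctms t \<union> xctms u"
| "xcons (XIn t A) = xctms t"
| "xcons (XNeg p) = xcons p"
| "xcons (XImp p q) = xcons p \<union> xcons q"
| "xcons (XBEx t p) = xctms t \<union> xcons p"
| "xcons (XEx p) = xcons p"

lemma finite_xctms: "finite (xctms t)"
  by (induction t) auto

lemma finite_xcons: "finite (xcons p)"
  by (induction p) (auto simp: finite_xctms)

lemma finite_xsets: "finite (xsets p)"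
  by (induction p) auto

primrec trm :: "('a \<Rightarrow> nat) \<Rightarrow> nat \<Rightarrow> 'a xtm \<Rightarrow> tm" where
  "trm ix k (XV i) = Var i"
| "trm ix k (XC c) = Var (k + ix c)"
| "trm ix k (XAdd t u) = trm ix k t \<^bold>+ trm ix k u"
| "trm ix k (XMul t u) = trm ix k t \<^bold>\<cdot> trm ix k u"

text \<open>In the scope of \<open>k\<close> variables the parameter \<open>c\<close> is the value of variable \<open>k + ix c\<close>.\<close>

primrec trf :: "('a \<Rightarrow> nat) \<Rightarrow> ('a set \<Rightarrow> nat \<Rightarrow> tm \<Rightarrow> fm) \<Rightarrow> nat \<Rightarrow> 'a xfm \<Rightarrow> fm" where
  "trf ix at k (XEq t u) = (trm ix k t \<^bold>= trm ix k u)"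
| "trf ix at k (XLe t u) = (trm ix k t \<^bold>\<le> trm ix k u)"
| "trf ix at k (XIn t A) = at A k (trm ix k t)"
| "trf ix at k (XNeg p) = (\<^bold>\<not> trf ix at k p)"
| "trf ix at k (XImp p q) = (trf ix at k p \<^bold>\<longrightarrow> trf ix at k q)"
| "trf ix at k (XBEx t p) = BEx (trm ix k t) (trf ix at (Suc k) p)"
| "trf ix at k (XEx p) = Ex (trf ix at (Suc k) p)"

lemma ev_trm: "\<forall>c\<in>xctms t. e (k + ix c) = c \<Longrightarrow> ev (std S T) e (trm ix k t) = xev e t"
  by (induction t) auto

text \<open>The atoms for set parameters are left open: they become \<open>In\<close> for
  second-order structures, and defining formulas when the sets are the definable ones.\<close>

lemma sat_trf:
  assumes "\<And>A k e u. A \<in> xsets p \<Longrightarrow> \<forall>c\<in>C. e (k + ix c) = c \<Longrightarrow>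
      sat (std S T) e X (at A k u) \<longleftrightarrow> ev (std S T) e u \<in> A"
    and "xcons p \<subseteq> C" "\<forall>c\<in>C. e (k + ix c) = c"
  shows "sat (std S T) e X (trf ix at k p) \<longleftrightarrow> xsat e p"
  using assms
proof (induction p arbitrary: e k)
  case (XEx p)
  have "sat (std S T) (x ## e) X (trf ix at (Suc k) p) \<longleftrightarrow> xsat (x ## e) p" for x
    by (rule XEx.IH) (use XEx.prems in auto)
  then show ?case by simp
next
  case (XBEx t p)
  have "sat (std S T) (x ## e) X (trf ix at (Suc k) p) \<longleftrightarrow> xsat (x ## e) p" for x
    by (rule XBEx.IH) (use XBEx.prems in auto)
  moreover have "ev (std S T) e (trm ix k t) = xev e t" by (rule ev_trm) (use XBEx.prems in auto)
  ultimately show ?case by simp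
next
  case (XImp p q)
  have "sat (std S T) e X (trf ix at k p) \<longleftrightarrow> xsat e p" "sat (std S T) e X (trf ix at k q) \<longleftrightarrow> xsat e q"
    by (rule XImp.IH; use XImp.prems in auto)+
  then show ?case by simp
next
  case (XNeg p)
  have "sat (std S T) e X (trf ix at k p) \<longleftrightarrow> xsat e p"
    by (rule XNeg.IH) (use XNeg.prems in auto)
  then show ?case by simp
next
  case (XIn t A)
  have "ev (std S T) e (trm ix k t) = xev e t" by (rule ev_trm) (use XIn.prems in auto)
  then show ?case using XIn.prems(1)[OF _ XIn.prems(3)] by simp
next
  case (XEq t u)
  have "ev (std S T) e (trm ix k t) = xev e t" "ev (std S T) e (trm ix k u) = xev e u"
    by (rule ev_trm; use XEq.prems in auto)+
  then show ?case by simp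
next
  case (XLe t u)
  have "ev (std S T) e (trm ix k t) = xev e t" "ev (std S T) e (trm ix k u) = xev e u"
    by (rule ev_trm; use XLe.prems in auto)+
  then show ?case by simp
qed

lemma bounded_trf: "xbnd p \<Longrightarrow> (\<And>A k t. at A k t \<in> bounded_formulas) \<Longrightarrow> trf ix at k p \<in> bounded_formulas"
  by (induction p arbitrary: k) (auto intro: bounded_formulas.intros)

text \<open>Both formulas of a comprehension axiom must be read under one assignment, so a whole
  finite set of formulas is translated at once.\<close>

lemma formulas_of:
  assumes S: "S \<noteq> {}" and P: "finite P" "\<forall>p\<in>P. xsets p \<subseteq> S \<and> xbnd p"
  shows "\<exists>f E X. range X \<subseteq> S \<and> (\<forall>p\<in>P. f p \<in> bounded_formulas \<and>
    (\<forall>x y. sat (std S T) (y ## x ## E) X (f p) \<longleftrightarrow> xsat (y ## x ## e) p))"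
proof -
  \<comment> \<open>Variables 0 and 1 stay as witness and argument; the others are frozen to their
    values in \<open>e\<close>.\<close>
  define g where "g p = xsub (\<lambda>i. if i < 2 then XV i else XC (e (i - 2))) p" for p
  have g: "xsat (y ## x ## e') (g p) \<longleftrightarrow> xsat (y ## x ## e) p" for x y e' p
  proof -
    have "xev (y ## x ## e') (if i < 2 then XV i else XC (e (i - 2))) = (y ## x ## e) i" for i
      by (cases i rule: nat.exhaust[case_product nat.exhaust]) (auto simp: cns_def split: nat.split)
    then show ?thesis unfolding g_def xsat_sub by (simp only:)
  qed
  define C where "C = (\<Union>p\<in>P. xcons (g p))"
  define DD where "DD = (\<Union>p\<in>P. xsets p)"
  have fC: "countable C" "countable DD" unfolding C_def DD_def
    using P(1) finite_xcons finite_xsets by (auto intro!: countable_finite)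
  \<comment> \<open>Pads the assignment of sets in case no set parameter occurs.\<close>
  obtain A0 where A0: "A0 \<in> S" using S by blast
  define E where "E i = from_nat_into C i" for i
  define X where "X i = from_nat_into (insert A0 DD) i" for i
  define f where "f p = trf (to_nat_on C) (\<lambda>A k t. In t (to_nat_on (insert A0 DD) A)) 2 (g p)" for p
  have "range X \<subseteq> insert A0 DD" unfolding X_def using range_from_nat_into_subset[of "insert A0 DD"] by auto
  then have r1: "range X \<subseteq> S" using A0 P(2) unfolding DD_def by blast
  have r2: "f p \<in> bounded_formulas" if "p \<in> P" for p
    unfolding f_def by (rule bounded_trf) (use P(2)[rule_format, OF that] in \<open>auto simp: g_def intro: bounded_formulas.intros\<close>)
  have r3: "sat (std S T) (y ## x ## E) X (f p) \<longleftrightarrow> xsat (y ## x ## e) p" if p: "p \<in> P" for p x y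
    unfolding f_def g[symmetric, of y x p E]
  proof (rule sat_trf[where C = C])
    fix A k u and e :: "nat \<Rightarrow> 'a" assume "A \<in> xsets (g p)"
    then have "A \<in> insert A0 DD" using p unfolding g_def DD_def by auto
    then show "sat (std S T) e X (In u (to_nat_on (insert A0 DD) A)) \<longleftrightarrow> ev (std S T) e u \<in> A"
      unfolding X_def using fC by (simp add: from_nat_into_to_nat_on)
  next
    show "\<forall>c\<in>C. (y ## x ## E) (2 + to_nat_on C c) = c"
      unfolding E_def using fC by (simp add: from_nat_into_to_nat_on)
  next
    show "xcons (g p) \<subseteq> C" using p unfolding C_def by blast
  qed
  show ?thesis
    by (rule exI[of _ f], rule exI[of _ E], rule exI[of _ X]) (intro conjI ballI allI r1 r2 r3)
qed

lemma rca_of_RCA0: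
  fixes S :: "'a::arith set set"
  assumes "S \<noteq> {}" and val: "\<And>q. q \<in> RCA0 \<Longrightarrow> valid (std S T) q"
  shows "rca S"
proof
  fix P e x
  assume P: "bd S P" and 0: "\<exists>y. P (y ## (0::'a) ## e)"
    and step: "\<And>x. \<exists>y. P (y ## x ## e) \<Longrightarrow> \<exists>y. P (y ## (x + 1) ## e)"
  obtain p where p: "xsets p \<subseteq> S \<and> xbnd p" "\<And>e. P e = xsat e p" using P unfolding bd_def by blast
  have fin: "finite {p}" and ok: "\<forall>r\<in>{p}. xsets r \<subseteq> S \<and> xbnd r" using p(1) by auto
  obtain f E X where fE: "range X \<subseteq> S" "\<forall>p\<in>{p}. f p \<in> bounded_formulas \<and>
      (\<forall>x y. sat (std S T) (y ## x ## E) X (f p) \<longleftrightarrow> xsat (y ## x ## e) p)"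
    using formulas_of[OF assms(1) fin ok, of T e] by (elim exE conjE) (rule that)
  have "Ex (f p) \<in> Sigma01" using fE(2) unfolding Sigma01_def by blast
  then have "valid (std S T) (induction_axiom (Ex (f p)))" using val unfolding RCA0_def by blast
  then have "sat (std S T) E X (induction_axiom (Ex (f p)))" using fE(1) unfolding valid_def by simp
  moreover have "sat (std S T) (x ## E) X (Ex (f p)) \<longleftrightarrow> (\<exists>y. P (y ## x ## e))" for x
    using fE(2) p(2) by simp
  ultimately show "\<exists>y. P (y ## x ## e)" using 0 step unfolding sat_induction_axiom std_simps by metis
next
  fix P Q e
  assume PQ: "bd S P" "bd S Q" and eq: "\<And>x. (\<exists>y. P (y ## x ## e)) \<longleftrightarrow> (\<forall>y. Q (y ## (x::'a) ## e))"
  obtain p where p: "xsets p \<subseteq> S \<and> xbnd p" "\<And>e. P e = xsat e p" using PQ unfolding bd_def by blast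
  obtain q where q: "xsets q \<subseteq> S \<and> xbnd q" "\<And>e. Q e = xsat e q" using PQ unfolding bd_def by blast
  have fin: "finite {p, q}" and ok: "\<forall>r\<in>{p, q}. xsets r \<subseteq> S \<and> xbnd r" using p(1) q(1) by auto
  obtain f E X where fE: "range X \<subseteq> S" "\<forall>p\<in>{p, q}. f p \<in> bounded_formulas \<and>
      (\<forall>x y. sat (std S T) (y ## x ## E) X (f p) \<longleftrightarrow> xsat (y ## x ## e) p)"
    using formulas_of[OF assms(1) fin ok, of T e] by (elim exE conjE) (rule that)
  have "Ex (f p) \<in> Sigma01" "All (f q) \<in> Pi01" using fE(2) unfolding Sigma01_def Pi01_def by blast+
  then have "valid (std S T) (comprehension_axiom (Ex (f p)) (All (f q)))" using val unfolding RCA0_def by blast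
  then have "sat (std S T) E X (comprehension_axiom (Ex (f p)) (All (f q)))" using fE(1) unfolding valid_def by simp
  moreover have sp: "sat (std S T) (x ## E) X (Ex (f p)) \<longleftrightarrow> (\<exists>y. P (y ## x ## e))"
    "sat (std S T) (x ## E) X (All (f q)) \<longleftrightarrow> (\<forall>y. Q (y ## x ## e))" for x
    using fE(2) p(2) q(2) by simp_all
  ultimately obtain A where A: "A \<in> S" "\<forall>x. x \<in> A \<longleftrightarrow> (\<exists>y. P (y ## x ## e))"
    unfolding sat_comprehension_axiom sp std_simps using eq by blast
  have "{x. \<exists>y. P (y ## x ## e)} = A" using A(2) by (simp add: set_eq_iff)
  then show "{x. \<exists>y. P (y ## x ## e)} \<in> S" using A(1) by simp
qed

lemma tri_bounded: "p \<in> bounded_formulas \<Longrightarrow> tri p = {}"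
  by (induction rule: bounded_formulas.induct) (auto simp: BEx_def BAll_def)

context aca
begin

lemma sat_induction:
  assumes "df S (\<lambda>e. sat (std S T) e X p)" shows "sat (std S T) e X (induction_axiom p)"
  unfolding sat_induction_axiom std_simps
proof (intro allI impI)
  fix x
  assume 0: "sat (std S T) (0 ## e) X p"
    and step: "\<forall>x. sat (std S T) (x ## e) X p \<longrightarrow> sat (std S T) ((x + 1) ## e) X p"
  have "df S (\<lambda>v. sat (std S T) (\<lambda>i. (v 0 ## e) i) X p)"
    by (rule df_sub[OF assms, where \<sigma> = "\<lambda>i v. (v 0 ## e) i"]) (intro tmd_cns tmi)
  then show "sat (std S T) (x ## e) X p"
    using induct[where P = "\<lambda>x. sat (std S T) (x ## e) X p"] 0 step by blast
qed

lemma RCA0_valid: assumes "q \<in> RCA0" shows "valid (std S T) q"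
  unfolding valid_def
proof (intro allI impI)
  fix e :: "nat \<Rightarrow> 'a" and X :: "nat \<Rightarrow> 'a set" assume "range X \<subseteq> sts (std S T)"
  then have X: "range X \<subseteq> S" by simp
  have sg: "df S (\<lambda>e. sat (std S T) e X p)" if "p \<in> Sigma01" for p
    using that X unfolding Sigma01_def by (auto intro!: df_sat simp: tri_bounded no_ex2_bounded simp del: sat.simps)
  consider "q \<in> basic_axioms" | p where "q = induction_axiom p" "p \<in> Sigma01"
    | p r where "q = comprehension_axiom p r" "p \<in> Sigma01"
    using assms unfolding RCA0_def by blast
  then show "sat (std S T) e X q"
  proof cases
    case 1 then show ?thesis by (rule sat_basic_axioms)
  next
    case 2 then show ?thesis using sat_induction[OF sg] by simp
  next
    case (3 p r)
    have "{x. sat (std S T) (x ## e) X p} \<in> S" by (rule acomp[OF sg[OF 3(2)]])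
    then show ?thesis unfolding 3(1) sat_comprehension_axiom std_simps
      by (intro impI bexI[of _ "{x. sat (std S T) (x ## e) X p}"] allI) (simp_all only: mem_Collect_eq)
  qed
qed

end

section \<open>Truth predicates from \<open>RT(!\<omega>)\<close>\<close>

definition (in aca) truth_spec :: "nat \<Rightarrow> 'a set \<Rightarrow> 'a set \<Rightarrow> bool" where
  "truth_spec n U T \<longleftrightarrow>
    (\<forall>t u v w. Trm 0 t \<longrightarrow> Trm 0 u \<longrightarrow> Val t v \<longrightarrow> Val u w \<longrightarrow> (cEq t u \<in> T \<longleftrightarrow> v = w) \<and> (cLe t u \<in> T \<longleftrightarrow> v \<le> w)) \<and>
    (\<forall>i x. i < of_nat n \<longrightarrow> (cTr i (num x) \<in> T \<longleftrightarrow> pr i x \<in> U)) \<and>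
    (\<forall>p. Form n 0 p \<longrightarrow> (cNeg p \<in> T \<longleftrightarrow> p \<notin> T)) \<and>
    (\<forall>p q. Form n 0 p \<longrightarrow> Form n 0 q \<longrightarrow> (cImp p q \<in> T \<longleftrightarrow> (p \<in> T \<longrightarrow> q \<in> T))) \<and>
    (\<forall>p. Form n 0 (cEx p) \<longrightarrow> (cEx p \<in> T \<longleftrightarrow> (\<exists>x q. Sub 0 (num x) p q \<and> q \<in> T)))"

text \<open>The recursion on \<open>n\<close> takes place outside the model. Full induction
  nevertheless holds, because every truth predicate mentioned in a formula is a member of
  \<open>S\<close>.\<close>

lemma truth_from_RT:
  fixes S :: "'a::arith set set"
  assumes S: "S \<noteq> {}" and val: "\<And>q. q \<in> RCA0 \<union> {RT_exactly_large} \<Longrightarrow> valid (std S T0) q"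
  shows "\<exists>T. \<forall>q\<in>PA_Tr. valid (std S T) q"
proof -
  have "rca S" by (rule rca_of_RCA0[OF S, of T0]) (use val in blast)
  moreover have "rtx S"
  proof -
    obtain A where "A \<in> S" using S by blast
    then have "range (\<lambda>_::nat. A) \<subseteq> sts (std S T0)" by simp
    moreover have "valid (std S T0) RT_exactly_large" using val by blast
    ultimately have "sat (std S T0) (\<lambda>_. 0) (\<lambda>_. A) RT_exactly_large" unfolding valid_def by blast
    then show ?thesis unfolding sat_RT .
  qed
  ultimately have rr: "rca_rt S" by (intro rca_rt.intro rca_rt_axioms.intro)
  have "aca S" by (rule rca_rt.aca[OF rr])
  then interpret aca_rt S using rr by (rule aca_rt.intro)
  define tset where "tset n U = (SOME T. T \<in> S \<and> truth_spec n U T)" for n U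
  have tset: "tset n U \<in> S" "truth_spec n U (tset n U)" if "U \<in> S" for n U
  proof -
    have "\<exists>T. T \<in> S \<and> truth_spec n U T"
      using truth_set[OF that, of n] unfolding truth_spec_def Bex_def .
    from someI_ex[OF this] show "tset n U \<in> S" "truth_spec n U (tset n U)" unfolding tset_def by auto
  qed
  \<comment> \<open>\<open>Us n\<close> is the disjoint union of the truth sets with index below
    \<open>n\<close>, the form in which \<open>truth_set\<close> expects the atoms.\<close>
  define Us where "Us = rec_nat {} (\<lambda>n U. {z. z \<in> U \<or> (\<exists>v. v \<in> tset n U \<and> z = pr (of_nat n) v)})"
  define T where "T i = tset i (Us i)" for i
  have Us_0: "Us 0 = {}" and Us_Suc: "Us (Suc n) = {z. z \<in> Us n \<or> (\<exists>v. v \<in> T n \<and> z = pr (of_nat n) v)}" for n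
    unfolding Us_def T_def by simp_all
  have US: "Us n \<in> S" for n
  proof (induction n)
    case 0
    show ?case unfolding Us_0 using df_comp[of "\<lambda>x. False"] by (simp add: df_const)
  next
    case (Suc n)
    have "T n \<in> S" unfolding T_def by (rule tset(1)[OF Suc])
    then show ?case unfolding Us_Suc by (intro df_comp dfi fdi Suc)
  qed
  have TS: "T n \<in> S" and spec: "truth_spec n (Us n) (T n)" for n
    unfolding T_def using tset[OF US] by auto
  have U: "pr (of_nat i) x \<in> Us n \<longleftrightarrow> i < n \<and> x \<in> T i" for i n x
    by (induction n) (auto simp: Us_0 Us_Suc less_Suc_eq)
  have "sat (std S T) e X q" if q: "q \<in> PA_Tr" for q e X
  proof -
    consider "q \<in> basic_axioms" | p where "q = induction_axiom p" "p \<in> lang_Tr" | n where "q \<in> truth_axioms n"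
      using q unfolding PA_Tr_def by blast
    then show ?thesis
    proof cases
      case 1 then show ?thesis by (rule sat_basic_axioms)
    next
      case 2
      then have "set_free p" by (simp add: lang_Tr_def)
      then have "df S (\<lambda>e. sat (std S T) e X p)" using TS by (intro df_sat no_ex2_set_free) auto
      then show ?thesis unfolding 2 by (rule sat_induction)
    next
      case 3
      note sp = spec[of n, unfolded truth_spec_def]
      have "sat (std S T) e X (truth_Tr n i)" if "i < n" for i
      proof -
        have "cTr (of_nat i) (num x) \<in> T n \<longleftrightarrow> x \<in> T i" for x
          using sp U[of i x n] that by simp
        then show ?thesis unfolding sat_truth Num_num by simp
      qed
      moreover have "sat (std S T) e X (truth_Eq n)" "sat (std S T) e X (truth_Le n)"
        unfolding sat_truth using conjunct1[OF sp] by blast+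
      moreover have "sat (std S T) e X (truth_Neg n)" unfolding sat_truth using sp by blast
      moreover have "sat (std S T) e X (truth_Imp n)" unfolding sat_truth using sp by blast
      moreover have "sat (std S T) e X (truth_Ex n)" unfolding sat_truth Num_num using sp by simp
      ultimately show ?thesis using 3 unfolding truth_axioms_def by blast
    qed
  qed
  then show ?thesis unfolding valid_def by blast
qed

section \<open>\<open>RT(!\<omega>)\<close> for the definable sets\<close>

lemma set_free_trf: "(\<And>A k u. A \<in> xsets p \<Longrightarrow> set_free (at A k u)) \<Longrightarrow> set_free (trf ix at k p)"
  by (induction p arbitrary: k) (auto simp: BEx_def)

text \<open>Below a standard number there are only standard ones, so the axioms for single standard
  indices cover all truth predicates that occur in formulas of \<open>L_n\<close>, even nonstandard
  ones.\<close>

lemma less_of_nat: "i < (of_nat n :: 'a::arith) \<Longrightarrow> \<exists>j<n. i = of_nat j"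
proof (induction n)
  case (Suc n)
  then have "i < of_nat n + 1" by (simp add: add.commute)
  then have "i < of_nat n \<or> i = of_nat n" by (simp add: le_less)
  then show ?case using Suc.IH less_Suc_eq by blast
qed simp

text \<open>Comprehension over definable sets is obtained by inserting their defining formulas for
  the set parameters; the induction scheme for the extended language becomes set induction.\<close>

lemma aca_definable:
  fixes S S0 :: "'a::arith set set" and T :: "nat \<Rightarrow> 'a set"
  assumes ind: "\<And>p e. set_free p \<Longrightarrow> sat (std S0 T) e X0 (induction_axiom p)"
    and S: "S = {{x. sat (std S0 T) (x ## e) X0 p} |p e. set_free p}"
  shows "aca S"
proof
  fix A x assume A: "A \<in> S" "0 \<in> A" "\<And>x. x \<in> A \<Longrightarrow> x + 1 \<in> A"
  obtain p e where p: "set_free p" "A = {x. sat (std S0 T) (x ## e) X0 p}" using A(1) unfolding S by blast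
  show "x \<in> A" using ind[OF p(1), of e] A(2,3) unfolding sat_induction_axiom std_simps p(2) mem_Collect_eq by blast
next
  fix P e assume "df S P"
  then obtain p where p: "xsets p \<subseteq> S" "\<And>e. P e = xsat e p" by (auto simp: df_def)
  have "\<forall>A\<in>S. \<exists>q e. set_free q \<and> A = {x. sat (std S0 T) (x ## e) X0 q}" unfolding S by blast
  then obtain fA eA where fe: "\<And>A. A \<in> S \<Longrightarrow> set_free (fA A)"
    "\<And>A. A \<in> S \<Longrightarrow> A = {x. sat (std S0 T) (x ## eA A) X0 (fA A)}" by metis
  define g where "g = xsub (\<lambda>i. if i < Suc 0 then XV i else XC (e (i - 1))) p"
  have g: "xsat (x ## e') g \<longleftrightarrow> P (x ## e)" for x e'
  proof -
    have "(\<lambda>i. xev (x ## e') (if i < Suc 0 then XV i else XC (e (i - 1)))) = x ## e"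
      by (rule cns_eqI) auto
    then show ?thesis unfolding g_def xsat_sub p(2) by (simp only:)
  qed
  \<comment> \<open>A defining formula comes with an entire assignment, so the parameters form a
    countable set rather than a finite one; the single assignment \<open>E\<close> lists them
    all.\<close>
  define C where "C = xcons g \<union> (\<Union>A\<in>xsets p. range (eA A))"
  have C: "countable C" unfolding C_def
    by (intro countable_Un countable_UN countable_finite finite_xcons finite_xsets countable_image countableI_type)
  define ix E where "ix = to_nat_on C" and "E = from_nat_into C"
  have E: "E (ix c) = c" if "c \<in> C" for c
    unfolding ix_def E_def using from_nat_into_to_nat_on[OF C that] .
  define at where "at A k u = psub (\<lambda>i. case i of 0 \<Rightarrow> u | Suc j \<Rightarrow> Var (k + ix (eA A j))) (\<lambda>X. X) (fA A)" for A k u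
  have "sat (std S0 T) (x ## E) X0 (trf ix at 1 g) \<longleftrightarrow> xsat (x ## E) g" for x
  proof (rule sat_trf[where C = C])
    fix A k e u assume A: "A \<in> xsets g" and e: "\<forall>c\<in>C. e (k + ix c) = c"
    have A': "A \<in> xsets p" "A \<in> S" using A p(1) unfolding g_def by auto
    have "(\<lambda>i. ev (std S0 T) e (case i of 0 \<Rightarrow> u | Suc j \<Rightarrow> Var (k + ix (eA A j)))) = ev (std S0 T) e u ## eA A"
    proof (rule cns_eqI)
      fix i
      have "eA A i \<in> C" unfolding C_def using A'(1) by blast
      then show "ev (std S0 T) e (case Suc i of 0 \<Rightarrow> u | Suc j \<Rightarrow> Var (k + ix (eA A j))) = eA A i" using e by simp
    qed simp
    then have "sat (std S0 T) e X0 (at A k u) \<longleftrightarrow> sat (std S0 T) (ev (std S0 T) e u ## eA A) X0 (fA A)"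
      unfolding at_def sat_psub by (simp only:)
    also have "\<dots> \<longleftrightarrow> ev (std S0 T) e u \<in> A" by (subst (3) fe(2)[OF A'(2)]) (simp only: mem_Collect_eq)
    finally show "sat (std S0 T) e X0 (at A k u) \<longleftrightarrow> ev (std S0 T) e u \<in> A" .
  next
    show "xcons g \<subseteq> C" unfolding C_def by blast
    show "\<forall>c\<in>C. (x ## E) (1 + ix c) = c" using E by simp
  qed
  then have "{x. P (x ## e)} = {x. sat (std S0 T) (x ## E) X0 (trf ix at 1 g)}" unfolding g by simp
  moreover have "set_free (trf ix at 1 g)"
    by (rule set_free_trf) (use fe(1) p(1) in \<open>auto simp: at_def set_free_psub g_def\<close>)
  ultimately show "{x. P (x ## e)} \<in> S" unfolding S by blast
qed

text \<open>Two formulas mention only finitely many truth predicates, so one index \<open>n\<close>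
  serves both the given set and the colouring.\<close>

lemma RT_from_truth:
  fixes S0 :: "'a::arith set set"
  assumes S0: "S0 \<noteq> {}" and val: "\<And>q. q \<in> PA_Tr \<Longrightarrow> valid (std S0 T) q"
  shows "\<exists>S. S \<noteq> {} \<and> (\<forall>q\<in>RCA0 \<union> {RT_exactly_large}. valid (std S T) q)"
proof -
  obtain A0 where A0: "A0 \<in> S0" using S0 by blast
  define X0 where "X0 = (\<lambda>_::nat. A0)"
  have sat: "sat (std S0 T) e X0 q" if "q \<in> PA_Tr" for q e
    using val[OF that] A0 unfolding valid_def X0_def by auto
  define S where "S = {{x. sat (std S0 T) (x ## e) X0 p} |p e. set_free p}"
  have "aca S"
    by (rule aca_definable[OF _ S_def], rule sat) (auto simp: PA_Tr_def lang_Tr_def)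
  then interpret aca S .
  have TS: "T j \<in> S" for j
  proof -
    have "T j = {x. sat (std S0 T) (x ## (\<lambda>_. 0)) X0 (Tr j (Var 0))}" by simp
    then show ?thesis unfolding S_def using set_free.simps(4) by blast
  qed
  have truth: "aca_truth S n {z. \<exists>j<n. \<exists>v\<in>T j. z = pr (of_nat j) v} (T n)" for n
  proof
    have ax: "sat (std S0 T) (\<lambda>_. 0) X0 q" if "q \<in> truth_axioms n" for q
      using sat that unfolding PA_Tr_def by blast
    show "T n \<in> S" by (rule TS)
    show "cEq t u \<in> T n \<longleftrightarrow> v = w" if "Trm 0 t" "Trm 0 u" "Val t v" "Val u w" for t u v w
      using ax[of "truth_Eq n"] that unfolding truth_axioms_def sat_truth by simp
    show "cLe t u \<in> T n \<longleftrightarrow> v \<le> w" if "Trm 0 t" "Trm 0 u" "Val t v" "Val u w" for t u v w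
      using ax[of "truth_Le n"] that unfolding truth_axioms_def sat_truth by simp
    show "cNeg p \<in> T n \<longleftrightarrow> p \<notin> T n" if "Form n 0 p" for p
      using ax[of "truth_Neg n"] that unfolding truth_axioms_def sat_truth by simp
    show "cImp p q \<in> T n \<longleftrightarrow> (p \<in> T n \<longrightarrow> q \<in> T n)" if "Form n 0 p" "Form n 0 q" for p q
      using ax[of "truth_Imp n"] that unfolding truth_axioms_def sat_truth by simp
    show "cEx p \<in> T n \<longleftrightarrow> (\<exists>x q. Sub 0 (num x) p q \<and> q \<in> T n)" if "Form n 0 (cEx p)" for p
      using ax[of "truth_Ex n"] that unfolding truth_axioms_def sat_truth Num_num by simp
    show "cTr i (num x) \<in> T n \<longleftrightarrow> pr i x \<in> {z. \<exists>j<n. \<exists>v\<in>T j. z = pr (of_nat j) v}" if i: "i < of_nat n" for i x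
    proof -
      obtain j where j: "j < n" "i = of_nat j" using less_of_nat[OF i] by blast
      have "truth_Tr n j \<in> truth_axioms n" using j(1) unfolding truth_axioms_def by blast
      from ax[OF this] show ?thesis unfolding sat_truth Num_num j(2) using j(1) by auto
    qed
  qed
  have "rtx S"
    unfolding rtx_def
  proof (intro ballI impI)
    fix M C assume M: "M \<in> S" "inf_set M" and C: "C \<in> S" "col C"
    obtain p e where p: "set_free p" "M = {x. sat (std S0 T) (x ## e) X0 p}" using M(1) unfolding S_def by blast
    obtain q d where q: "set_free q" "C = {x. sat (std S0 T) (x ## d) X0 q}" using C(1) unfolding S_def by blast
    obtain n where n: "\<forall>i\<in>tri p \<union> tri q. i < n"
      using finite_tri[of p] finite_tri[of q] finite_nat_set_iff_bounded[of "tri p \<union> tri q"] by auto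
    interpret t: aca_truth S n "{z. \<exists>j<n. \<exists>v\<in>T j. z = pr (of_nat j) v}" "T n" by (rule truth)
    interpret D: aca t.DS by (rule t.aca_DS)
    have TD: "T i \<in> t.DS" if "i < n" for i
    proof -
      have "{v. pr (of_nat i) v \<in> {z. \<exists>j<n. \<exists>v\<in>T j. z = pr (of_nat j) v}} = T i" using that by auto
      then show ?thesis using t.slice_DS[OF that] by simp
    qed
    have dM: "df t.DS (\<lambda>e. sat (std S0 T) e X0 p)" and dC: "df t.DS (\<lambda>e. sat (std S0 T) e X0 q)"
      using p(1) q(1) n TD by (auto intro!: df_sat no_ex2_set_free)
    have MD: "M \<in> t.DS" unfolding p(2) by (rule D.acomp[OF dM])
    have CD: "C \<in> t.DS" unfolding q(2) by (rule D.acomp[OF dC])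
    have "{c. pr c 0 \<in> C} \<in> t.DS" by (rule D.df_comp) (intro dfi fdi CD)
    from t.large_homogeneous[OF MD M(2) this] obtain L where L: "L \<in> S" "inf_set L" "L \<subseteq> M"
      "(\<forall>c. xl c \<and> els c \<subseteq> L \<longrightarrow> pr c 0 \<in> C) \<or> (\<forall>c. xl c \<and> els c \<subseteq> L \<longrightarrow> pr c 0 \<notin> C)"
      unfolding mem_Collect_eq by blast
    have "\<exists>i\<le>1. \<forall>c. xl c \<and> els c \<subseteq> L \<longrightarrow> pr c i \<in> C"
      using L(4)
    proof
      assume "\<forall>c. xl c \<and> els c \<subseteq> L \<longrightarrow> pr c 0 \<in> C"
      then show ?thesis by (intro exI[of _ 0]) simp
    next
      assume "\<forall>c. xl c \<and> els c \<subseteq> L \<longrightarrow> pr c 0 \<notin> C"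
      moreover have "\<forall>c. xl c \<longrightarrow> (pr c 0 \<in> C \<longleftrightarrow> pr c 1 \<notin> C)" using C(2) unfolding col_def by (rule conjunct2)
      ultimately show ?thesis by (intro exI[of _ 1]) simp
    qed
    then show "\<exists>L\<in>S. inf_set L \<and> L \<subseteq> M \<and> (\<exists>i\<le>1. \<forall>c. xl c \<and> els c \<subseteq> L \<longrightarrow> pr c i \<in> C)"
      using L(1-3) by (intro bexI[of _ L] conjI)
  qed
  then have "valid (std S T) RT_exactly_large" unfolding valid_def sat_RT by blast
  then have "\<forall>q\<in>RCA0 \<union> {RT_exactly_large}. valid (std S T) q" using RCA0_valid by blast
  moreover have "S \<noteq> {}" using TS by blast
  ultimately show ?thesis by blast
qed

section \<open>The number part of a model\<close>

text \<open>The part of both theories that concerns numbers alone. Induction for existential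
  formulas without sets and truth predicates is common to them and suffices for the laws of
  \<open>arith\<close>.\<close>

locale peano =
  fixes M :: "'a mdl"
  assumes basic_ax: "q \<in> basic_axioms \<Longrightarrow> sat M e (\<lambda>_. {}) q"
    and ind_ax: "q \<in> bounded_formulas \<Longrightarrow> set_free q \<Longrightarrow> truth_free q \<Longrightarrow>
      sat M e (\<lambda>_. {}) (induction_axiom (Ex q))"
begin

abbreviation Z where "Z \<equiv> zr M"
abbreviation S where "S \<equiv> sc M"
abbreviation add (infixl "\<oplus>" 65) where "a \<oplus> b \<equiv> pl M a b"
abbreviation mul (infixl "\<otimes>" 70) where "a \<otimes> b \<equiv> ti M a b"
abbreviation leq (infix "\<sqsubseteq>" 50) where "a \<sqsubseteq> b \<equiv> le M a b"

lemma basic [simp]: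
  "S a \<noteq> Z" "Z \<noteq> S a" "S a = S b \<longleftrightarrow> a = b" "a \<oplus> Z = a" "a \<oplus> S b = S (a \<oplus> b)"
  "a \<otimes> Z = Z" "a \<otimes> S b = a \<otimes> b \<oplus> a" "a \<sqsubseteq> Z \<longleftrightarrow> a = Z" "a \<sqsubseteq> S b \<longleftrightarrow> a \<sqsubseteq> b \<or> a = S b"
proof -
  have *: "\<forall>q\<in>basic_axioms. sat M (\<lambda>i. if i = 0 then a else b) (\<lambda>_. {}) q" using basic_ax by blast
  show "S a \<noteq> Z" "S a = S b \<longleftrightarrow> a = b" "a \<oplus> Z = a" "a \<oplus> S b = S (a \<oplus> b)"
    "a \<otimes> Z = Z" "a \<otimes> S b = a \<otimes> b \<oplus> a" "a \<sqsubseteq> Z \<longleftrightarrow> a = Z" "a \<sqsubseteq> S b \<longleftrightarrow> a \<sqsubseteq> b \<or> a = S b"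
    using * unfolding basic_axioms_def by auto
  then show "Z \<noteq> S a" by metis
qed

text \<open>Within \<open>q\<close> variable 0 is the existential witness, variable 1 the induction
  variable, and parameters start at variable 2.\<close>

lemma induct:
  assumes q: "q \<in> bounded_formulas" "set_free q" "truth_free q"
    and P: "\<And>x. P x \<longleftrightarrow> (\<exists>y. sat M (y ## x ## e) (\<lambda>_. {}) q)"
    and "P Z" "\<And>x. P x \<Longrightarrow> P (S x)"
  shows "P x"
  using ind_ax[OF q, of e] assms(5,6) unfolding sat_induction_axiom sat.simps P by blast

lemma add_Z: "Z \<oplus> x = x"
  by (rule induct[where P = "\<lambda>x. Z \<oplus> x = x" and q = "Zero \<^bold>+ Var 1 \<^bold>= Var 1"])
    (auto intro: bounded_formulas.intros)

lemma add_S: "S a \<oplus> x = S (a \<oplus> x)"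
  by (rule induct[where P = "\<lambda>x. S a \<oplus> x = S (a \<oplus> x)" and e = "\<lambda>_. a" and
        q = "Succ (Var 2) \<^bold>+ Var 1 \<^bold>= Succ (Var 2 \<^bold>+ Var 1)"])
    (auto intro: bounded_formulas.intros)

lemma add_comm: "a \<oplus> x = x \<oplus> a"
  by (rule induct[where P = "\<lambda>x. a \<oplus> x = x \<oplus> a" and e = "\<lambda>_. a" and q = "Var 2 \<^bold>+ Var 1 \<^bold>= Var 1 \<^bold>+ Var 2"])
    (auto intro: bounded_formulas.intros simp: add_Z add_S)

lemma add_assoc: "(a \<oplus> b) \<oplus> x = a \<oplus> (b \<oplus> x)"
  by (rule induct[where P = "\<lambda>x. (a \<oplus> b) \<oplus> x = a \<oplus> (b \<oplus> x)" and e = "a ## (\<lambda>_. b)" and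
        q = "(Var 2 \<^bold>+ Var 3) \<^bold>+ Var 1 \<^bold>= Var 2 \<^bold>+ (Var 3 \<^bold>+ Var 1)"])
    (auto intro: bounded_formulas.intros)

lemma mul_Z: "Z \<otimes> x = Z"
  by (rule induct[where P = "\<lambda>x. Z \<otimes> x = Z" and q = "Zero \<^bold>\<cdot> Var 1 \<^bold>= Zero"])
    (auto intro: bounded_formulas.intros)

lemma mul_S: "S a \<otimes> x = a \<otimes> x \<oplus> x"
proof (rule induct[where P = "\<lambda>x. S a \<otimes> x = a \<otimes> x \<oplus> x" and e = "\<lambda>_. a" and
        q = "Succ (Var 2) \<^bold>\<cdot> Var 1 \<^bold>= Var 2 \<^bold>\<cdot> Var 1 \<^bold>+ Var 1"])
  fix x assume "S a \<otimes> x = a \<otimes> x \<oplus> x"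
  then show "S a \<otimes> S x = a \<otimes> S x \<oplus> S x" by (simp add: add_assoc add_comm[of x a])
qed (auto intro: bounded_formulas.intros)

lemma mul_comm: "a \<otimes> x = x \<otimes> a"
  by (rule induct[where P = "\<lambda>x. a \<otimes> x = x \<otimes> a" and e = "\<lambda>_. a" and q = "Var 2 \<^bold>\<cdot> Var 1 \<^bold>= Var 1 \<^bold>\<cdot> Var 2"])
    (auto intro: bounded_formulas.intros simp: mul_Z mul_S)

lemma distrib: "a \<otimes> (b \<oplus> x) = a \<otimes> b \<oplus> a \<otimes> x"
  by (rule induct[where P = "\<lambda>x. a \<otimes> (b \<oplus> x) = a \<otimes> b \<oplus> a \<otimes> x" and e = "a ## (\<lambda>_. b)" and
        q = "Var 2 \<^bold>\<cdot> (Var 3 \<^bold>+ Var 1) \<^bold>= Var 2 \<^bold>\<cdot> Var 3 \<^bold>+ Var 2 \<^bold>\<cdot> Var 1"])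
    (auto intro: bounded_formulas.intros simp: add_assoc)

lemma mul_assoc: "(a \<otimes> b) \<otimes> x = a \<otimes> (b \<otimes> x)"
  by (rule induct[where P = "\<lambda>x. (a \<otimes> b) \<otimes> x = a \<otimes> (b \<otimes> x)" and e = "a ## (\<lambda>_. b)" and
        q = "(Var 2 \<^bold>\<cdot> Var 3) \<^bold>\<cdot> Var 1 \<^bold>= Var 2 \<^bold>\<cdot> (Var 3 \<^bold>\<cdot> Var 1)"])
    (auto intro: bounded_formulas.intros simp: distrib)

lemma cancel: "a \<oplus> b = a \<oplus> c \<longleftrightarrow> b = c"
proof -
  have "b \<oplus> a = c \<oplus> a \<longrightarrow> b = c"
    by (rule induct[where P = "\<lambda>a. b \<oplus> a = c \<oplus> a \<longrightarrow> b = c" and e = "b ## (\<lambda>_. c)" and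
          q = "Var 2 \<^bold>+ Var 1 \<^bold>= Var 3 \<^bold>+ Var 1 \<^bold>\<longrightarrow> Var 2 \<^bold>= Var 3"])
      (auto intro: bounded_formulas.intros)
  then show ?thesis using add_comm by metis
qed

lemma zero_or_succ: "x = Z \<or> (\<exists>y. x = S y)"
  by (rule induct[where P = "\<lambda>x. x = Z \<or> (\<exists>y. x = S y)" and q = "Var 1 \<^bold>= Zero \<^bold>\<or> Var 1 \<^bold>= Succ (Var 0)"])
    (auto intro: bounded_formulas.intros)

lemma add_eq_Z: "a \<oplus> b = Z \<longleftrightarrow> a = Z \<and> b = Z"
  using zero_or_succ[of b] by auto

lemma mul_eq_Z: "a \<otimes> b = Z \<longleftrightarrow> a = Z \<or> b = Z"
  using zero_or_succ[of b] by (auto simp: add_eq_Z mul_Z)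

lemma leq_refl: "x \<sqsubseteq> x"
  using zero_or_succ[of x] by auto

lemma leq_add: "a \<sqsubseteq> a \<oplus> x"
  by (rule induct[where P = "\<lambda>x. a \<sqsubseteq> a \<oplus> x" and e = "\<lambda>_. a" and q = "Var 2 \<^bold>\<le> Var 2 \<^bold>+ Var 1"])
    (auto intro: bounded_formulas.intros simp: leq_refl)

lemma leq_ex: "a \<sqsubseteq> x \<longrightarrow> (\<exists>c. x = a \<oplus> c)"
proof (rule induct[where P = "\<lambda>x. a \<sqsubseteq> x \<longrightarrow> (\<exists>c. x = a \<oplus> c)" and e = "\<lambda>_. a" and
      q = "Var 2 \<^bold>\<le> Var 1 \<^bold>\<longrightarrow> Var 1 \<^bold>= Var 2 \<^bold>+ Var 0"])
  fix x assume IH: "a \<sqsubseteq> x \<longrightarrow> (\<exists>c. x = a \<oplus> c)"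
  show "a \<sqsubseteq> S x \<longrightarrow> (\<exists>c. S x = a \<oplus> c)"
  proof
    assume "a \<sqsubseteq> S x"
    then consider c where "x = a \<oplus> c" | "a = S x" using IH by auto
    then show "\<exists>c. S x = a \<oplus> c"
    proof cases
      case 1 then show ?thesis by (intro exI[of _ "S c"]) simp
    next
      case 2 then show ?thesis by (intro exI[of _ Z]) simp
    qed
  qed
qed (auto intro: bounded_formulas.intros exI[of _ Z])

lemma leq_iff: "a \<sqsubseteq> b \<longleftrightarrow> (\<exists>c. b = a \<oplus> c)"
  using leq_add leq_ex by blast

lemma total: "a \<sqsubseteq> x \<or> x \<sqsubseteq> a"
proof (rule induct[where P = "\<lambda>x. a \<sqsubseteq> x \<or> x \<sqsubseteq> a" and e = "\<lambda>_. a" and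
      q = "Var 2 \<^bold>\<le> Var 1 \<^bold>\<or> Var 1 \<^bold>\<le> Var 2"])
  show "a \<sqsubseteq> Z \<or> Z \<sqsubseteq> a" using leq_add[of Z a] by (simp add: add_Z)
  fix x assume "a \<sqsubseteq> x \<or> x \<sqsubseteq> a"
  then consider "a \<sqsubseteq> x" | c where "a = x \<oplus> c" using leq_ex by blast
  then show "a \<sqsubseteq> S x \<or> S x \<sqsubseteq> a"
  proof cases
    case 1 then show ?thesis by simp
  next
    case 2
    from zero_or_succ[of c] show ?thesis
    proof
      assume "c = Z" then show ?thesis using 2 leq_refl by simp
    next
      assume "\<exists>d. c = S d"
      then obtain d where "a = S x \<oplus> d" using 2 by (auto simp: add_S)
      then show ?thesis using leq_add by simp
    qed
  qed
qed (auto intro: bounded_formulas.intros)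

lemma antisym: "a \<sqsubseteq> b \<Longrightarrow> b \<sqsubseteq> a \<Longrightarrow> a = b"
proof -
  assume "a \<sqsubseteq> b" "b \<sqsubseteq> a"
  then obtain c d where cd: "b = a \<oplus> c" "a = b \<oplus> d" unfolding leq_iff by blast
  have "a \<oplus> (c \<oplus> d) = a \<oplus> Z" using cd by (simp add: add_assoc[symmetric])
  then have "c = Z" unfolding cancel add_eq_Z by simp
  then show ?thesis using cd by simp
qed

text \<open>Truncated subtraction, an operation that the algebraic type classes demand.\<close>

definition mns :: "'a \<Rightarrow> 'a \<Rightarrow> 'a" where
  "mns a b = (if b \<sqsubseteq> a then THE c. a = b \<oplus> c else Z)"

lemma mns_add [simp]: "mns (b \<oplus> c) b = c"
  unfolding mns_def by (simp add: leq_add cancel)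

lemma mns_Z: "a \<sqsubseteq> b \<Longrightarrow> mns a b = Z"
proof (cases "b \<sqsubseteq> a")
  case True
  assume "a \<sqsubseteq> b"
  then have "a = b \<oplus> Z" using True antisym by simp
  then show ?thesis using mns_add by metis
qed (simp add: mns_def)

lemma mns_mns: "mns (mns a b) c = mns a (b \<oplus> c)"
proof -
  consider d where "a = b \<oplus> c \<oplus> d" | d where "a = b \<oplus> d" "d \<sqsubseteq> c" | "a \<sqsubseteq> b"
    using total[of a b] total unfolding leq_iff by (metis add_assoc)
  then show ?thesis
  proof cases
    case 1 then show ?thesis using mns_add[of "b \<oplus> c" d] mns_add[of b "c \<oplus> d"] by (simp add: add_assoc)
  next
    case 2
    then obtain f where "c = d \<oplus> f" unfolding leq_iff by blast
    then have "a \<sqsubseteq> b \<oplus> c" using 2 leq_add[of "b \<oplus> d" f] by (simp add: add_assoc)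
    then show ?thesis using 2 by (simp add: mns_Z)
  next
    case 3
    then obtain f where "b = a \<oplus> f" unfolding leq_iff by blast
    then have "a \<sqsubseteq> b \<oplus> c" using leq_add[of a "f \<oplus> c"] by (simp add: add_assoc)
    moreover have "Z \<sqsubseteq> c" using leq_add[of Z c] by (simp add: add_Z)
    ultimately show ?thesis using 3 by (simp add: mns_Z)
  qed
qed

lemma mul_mns: "a \<otimes> mns b c = mns (a \<otimes> b) (a \<otimes> c)"
  using total[of b c]
proof
  assume bc: "b \<sqsubseteq> c"
  then obtain d where "c = b \<oplus> d" unfolding leq_iff by blast
  then show ?thesis using bc leq_add by (simp add: mns_Z distrib)
next
  assume "c \<sqsubseteq> b"
  then obtain d where "b = c \<oplus> d" unfolding leq_iff by blast
  then show ?thesis by (simp add: distrib)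
qed

end

instance nat :: arith
  by standard simp

lemma peano_nat: "peano (std {} T :: nat mdl)"
proof
  show "sat (std {} T) e (\<lambda>_. {}) q" if "q \<in> basic_axioms" for q and e :: "nat \<Rightarrow> nat"
    using that by (rule sat_basic_axioms)
  show "sat (std {} T) e (\<lambda>_. {}) (induction_axiom (Ex q))" for q and e :: "nat \<Rightarrow> nat"
    unfolding sat_induction_axiom
  proof (intro impI allI)
    fix x
    assume "sat (std {} T) (zr (std {} T) ## e) (\<lambda>_. {}) (Ex q)"
      and "\<forall>x. sat (std {} T) (x ## e) (\<lambda>_. {}) (Ex q) \<longrightarrow> sat (std {} T) (sc (std {} T) x ## e) (\<lambda>_. {}) (Ex q)"
    then show "sat (std {} T) (x ## e) (\<lambda>_. {}) (Ex q)"
      by (induction x) (simp_all del: sat.simps)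
  qed
qed

section \<open>A type for an arbitrary model\<close>

text \<open>The semiring operations on the following type are those of one fixed countable structure,
  which is chosen to be a counterexample if there is one.\<close>

definition transfers :: "'a mdl \<Rightarrow> bool" where
  "transfers M \<longleftrightarrow>
    (\<forall>S T. S \<noteq> {} \<longrightarrow> (\<forall>q\<in>RCA0 \<union> {RT_exactly_large}. valid (M\<lparr>sts := S, trs := T\<rparr>) q) \<longrightarrow>
      (\<exists>T'. \<forall>q\<in>PA_Tr. valid (M\<lparr>sts := S, trs := T'\<rparr>) q)) \<and>
    (\<forall>S T. S \<noteq> {} \<longrightarrow> (\<forall>q\<in>PA_Tr. valid (M\<lparr>sts := S, trs := T\<rparr>) q) \<longrightarrow>
      (\<exists>S'. S' \<noteq> {} \<and> (\<forall>q\<in>RCA0 \<union> {RT_exactly_large}. valid (M\<lparr>sts := S', trs := T\<rparr>) q)))"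

definition M0 :: "nat mdl" where
  "M0 = (SOME M. peano M \<and> (transfers M \<longrightarrow> (\<forall>M' :: nat mdl. peano M' \<longrightarrow> transfers M')))"

text \<open>The existence behind the choice is the drinker's principle, with the standard model as
  the structure in case no counterexample exists.\<close>

lemma M0: "peano M0" "transfers M0 \<Longrightarrow> peano (M' :: nat mdl) \<Longrightarrow> transfers M'"
proof -
  have "\<exists>M :: nat mdl. peano M \<and> (transfers M \<longrightarrow> (\<forall>M' :: nat mdl. peano M' \<longrightarrow> transfers M'))"
    using peano_nat by blast
  from someI_ex[OF this] show "peano M0" "transfers M0 \<Longrightarrow> peano (M' :: nat mdl) \<Longrightarrow> transfers M'"
    unfolding M0_def by blast+
qed

interpretation M0: peano M0 by (rule M0)

text \<open>A copy of \<open>nat\<close>, introduced because \<open>nat\<close> already carries its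
  own arithmetic.\<close>

datatype mnat = MN (un: nat)

instantiation mnat :: arith
begin

definition "0 = MN (zr M0)"
definition "1 = MN (sc M0 (zr M0))"
definition "a + b = MN (pl M0 (un a) (un b))"
definition "a * b = MN (ti M0 (un a) (un b))"
definition "a - b = MN (M0.mns (un a) (un b))"
definition "a \<le> b \<longleftrightarrow> le M0 (un a) (un b)"
definition "a < b \<longleftrightarrow> a \<le> b \<and> \<not> b \<le> (a :: mnat)"

lemmas mnat_defs = zero_mnat_def one_mnat_def plus_mnat_def times_mnat_def minus_mnat_def less_eq_mnat_def

lemma mnat_le: "a \<le> b \<longleftrightarrow> (\<exists>c. b = a + (c :: mnat))"
  unfolding mnat_defs M0.leq_iff by (metis mnat.exhaust_sel mnat.sel)

lemma mnat_eq: "a = b \<longleftrightarrow> un a = un b"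
  by (cases a, cases b) simp

instance
proof
  fix a b c :: mnat
  note M = mnat_eq mnat_defs
  show add_assoc: "a + b + c = a + (b + c)" by (simp add: M M0.add_assoc)
  show add_comm: "a + b = b + a" by (simp add: M M0.add_comm)
  show "0 + a = a" by (simp add: M M0.add_Z)
  show "a * b * c = a * (b * c)" by (simp add: M M0.mul_assoc)
  show "a * b = b * a" by (simp add: M M0.mul_comm)
  show "1 * a = a" by (simp add: M M0.mul_S M0.mul_Z M0.add_Z)
  show "(a + b) * c = a * c + b * c" by (simp add: M M0.distrib M0.mul_comm[of _ "un c"])
  show "a * (b + c) = a * b + a * c" by (simp add: M M0.distrib)
  show "0 * a = 0" "a * 0 = 0" by (simp_all add: M M0.mul_Z)
  show "(0 :: mnat) \<noteq> 1" by (simp add: M)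
  show "a + b - a = b" by (simp add: M)
  show "a - b - c = a - (b + c)" by (simp add: M M0.mns_mns)
  show "a * (b - c) = a * b - a * c" by (simp add: M M0.mul_mns)
  show "a * b \<noteq> 0" if "a \<noteq> 0" "b \<noteq> 0" using that by (simp add: M M0.mul_eq_Z)
  show "(a < b) = (a \<le> b \<and> \<not> b \<le> a)" by (rule less_mnat_def)
  show "a \<le> a" by (simp add: M M0.leq_refl)
  show trans: "a \<le> c" if "a \<le> b" "b \<le> c" using that unfolding mnat_le
    by (elim exE) (simp add: M M0.add_assoc, metis mnat.sel)
  show "a = b" if "a \<le> b" "b \<le> a" using that by (simp add: M M0.antisym)
  show "a \<le> b \<or> b \<le> a" by (simp add: M M0.total)
  show "c + a \<le> c + b" if "a \<le> b" using that unfolding mnat_le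
    by (elim exE) (simp add: M M0.add_assoc, metis mnat.sel)
  show "(a \<le> b) = (\<exists>c. b = a + c)" by (rule mnat_le)
  show "(0 :: mnat) < 1" unfolding less_mnat_def by (simp add: M M0.leq_refl)
  have less: "\<exists>d. y = x + d \<and> d \<noteq> 0" if "x < y" for x y :: mnat
    using that unfolding less_mnat_def mnat_le by (metis M0.basic(4) mnat.collapse mnat.sel plus_mnat_def zero_mnat_def)
  show "c * a < c * b" if "a < b" "0 < c"
  proof -
    obtain d where d: "b = a + d" "d \<noteq> 0" using less[OF \<open>a < b\<close>] by blast
    have c: "c \<noteq> 0" using that(2) unfolding less_mnat_def by auto
    have cd: "un c \<noteq> zr M0" "un d \<noteq> zr M0" using c d(2) by (auto simp: M)
    have eq: "un (c * b) = pl M0 (un (c * a)) (ti M0 (un c) (un d))" by (simp add: d(1) M M0.distrib)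
    have "c * a \<le> c * b" unfolding less_eq_mnat_def eq by (rule M0.leq_add)
    moreover have "\<not> c * b \<le> c * a"
    proof
      assume "c * b \<le> c * a"
      then have "un (c * b) = un (c * a)" using \<open>c * a \<le> c * b\<close> M0.antisym unfolding less_eq_mnat_def by blast
      then have "pl M0 (un (c * a)) (ti M0 (un c) (un d)) = pl M0 (un (c * a)) (zr M0)" using eq by simp
      then show False using cd unfolding M0.cancel M0.mul_eq_Z by simp
    qed
    ultimately show ?thesis unfolding less_mnat_def by blast
  qed
  show "a - b + b = a" if "b \<le> a"
  proof -
    obtain d where "a = b + d" using \<open>b \<le> a\<close> unfolding mnat_le by blast
    then show ?thesis by (simp add: M M0.add_comm)
  qed
  show "a + 1 \<le> b" if "a < b"
  proof -
    obtain d where d: "b = a + d" "d \<noteq> 0" using less[OF \<open>a < b\<close>] by blast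
    then obtain f where "un d = sc M0 f" using M0.zero_or_succ[of "un d"] by (auto simp: M)
    then have "un b = pl M0 (un (a + 1)) f" using d(1) by (simp add: M M0.add_S)
    then show ?thesis unfolding less_eq_mnat_def by (simp add: M0.leq_add)
  qed
qed

end

lemma sat_iso:
  assumes h: "bij h" and ops: "h (zr M) = zr M'" "\<And>x. h (sc M x) = sc M' (h x)"
    "\<And>x y. h (pl M x y) = pl M' (h x) (h y)" "\<And>x y. h (ti M x y) = ti M' (h x) (h y)"
    "\<And>x y. le M x y \<longleftrightarrow> le M' (h x) (h y)"
    and sets: "sts M' = (`) h ` sts M" "\<And>i. trs M' i = h ` trs M i"
  shows "sat M e X p \<longleftrightarrow> sat M' (\<lambda>i. h (e i)) (\<lambda>i. h ` X i) p"
proof (induction p arbitrary: e X)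
  case (Ex p)
  have "(\<lambda>i. h ((x ## e) i)) = h x ## (\<lambda>i. h (e i))" for x
    by (rule cns_eqI) auto
  then have "sat M e X (Ex p) \<longleftrightarrow> (\<exists>x. sat M' (h x ## (\<lambda>i. h (e i))) (\<lambda>i. h ` X i) p)" by (simp add: Ex)
  also have "\<dots> \<longleftrightarrow> (\<exists>y. sat M' (y ## (\<lambda>i. h (e i))) (\<lambda>i. h ` X i) p)"
    using bij_is_surj[OF h] by (metis surj_def)
  finally show ?case by simp
next
  case (Ex2 p)
  have "(\<lambda>i. h ` (A ## X) i) = h ` A ## (\<lambda>i. h ` X i)" for A
    by (rule cns_eqI) auto
  then show ?case by (simp add: Ex2 sets)
next
  have ev: "h (ev M e t) = ev M' (\<lambda>i. h (e i)) t" for t e by (induction t) (auto simp: ops)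
  have eq: "h x = h y \<longleftrightarrow> x = y" for x y using bij_is_inj[OF h] by (auto dest: injD)
  have im: "h x \<in> h ` A \<longleftrightarrow> x \<in> A" for x A using bij_is_inj[OF h] by (rule inj_image_mem_iff)
  { case (Eq t u) then show ?case by (simp add: ev[symmetric] eq) }
  { case (Le t u) then show ?case by (simp add: ev[symmetric] ops) }
  { case (In t Y) then show ?case by (simp add: ev[symmetric] im) }
  { case (Tr i t) then show ?case by (simp add: ev[symmetric] im sets) }
qed auto

lemma valid_M0:
  "valid (M0\<lparr>sts := S, trs := T\<rparr>) p \<longleftrightarrow> valid (std ((`) MN ` S) (\<lambda>i. MN ` T i)) p"
proof -
  have bij: "bij MN" by (rule bijI[OF injI]) (auto intro: mnat.exhaust simp: surj_def)
  have iso: "sat (M0\<lparr>sts := S, trs := T\<rparr>) e X p \<longleftrightarrow>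
      sat (std ((`) MN ` S) (\<lambda>i. MN ` T i)) (\<lambda>i. MN (e i)) (\<lambda>i. MN ` X i) p" for e X
    by (rule sat_iso[OF bij]) (simp_all add: mnat_defs M0.add_comm[of _ "sc M0 (zr M0)"] M0.add_S M0.add_Z)
  show ?thesis
  proof
    assume v: "valid (M0\<lparr>sts := S, trs := T\<rparr>) p"
    show "valid (std ((`) MN ` S) (\<lambda>i. MN ` T i)) p"
      unfolding valid_def
    proof (intro allI impI)
      fix e :: "nat \<Rightarrow> mnat" and X :: "nat \<Rightarrow> mnat set"
      assume "range X \<subseteq> sts (std ((`) MN ` S) (\<lambda>i. MN ` T i))"
      then have "\<forall>i. X i \<in> (`) MN ` S" unfolding std_simps image_subset_iff by blast
      then have "\<forall>i. \<exists>A. A \<in> S \<and> X i = MN ` A" by blast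
      then obtain Y where Y: "\<And>i. Y i \<in> S" "\<And>i. X i = MN ` Y i" by metis
      have "X = (\<lambda>i. MN ` Y i)" "e = (\<lambda>i. MN (un (e i)))" using Y by auto
      moreover have "sat (M0\<lparr>sts := S, trs := T\<rparr>) (\<lambda>i. un (e i)) Y p"
        using v Y(1) unfolding valid_def by (simp add: image_subset_iff)
      ultimately show "sat (std ((`) MN ` S) (\<lambda>i. MN ` T i)) e X p" unfolding iso by simp
    qed
  next
    assume v: "valid (std ((`) MN ` S) (\<lambda>i. MN ` T i)) p"
    show "valid (M0\<lparr>sts := S, trs := T\<rparr>) p"
      unfolding valid_def iso
    proof (intro allI impI)
      fix e and X :: "nat \<Rightarrow> nat set"
      assume "range X \<subseteq> sts (M0\<lparr>sts := S, trs := T\<rparr>)"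
      then have "X i \<in> S" for i by auto
      then have "range (\<lambda>i. MN ` X i) \<subseteq> sts (std ((`) MN ` S) (\<lambda>i. MN ` T i))" by auto
      then show "sat (std ((`) MN ` S) (\<lambda>i. MN ` T i)) (\<lambda>i. MN (e i)) (\<lambda>i. MN ` X i) p"
        using v unfolding valid_def by blast
    qed
  qed
qed

text \<open>The two constructions apply to the type \<open>mnat\<close>, that is, to
  \<open>M0\<close>; its choice as a potential counterexample then settles all structures.\<close>

lemma transfers: assumes "peano (M :: nat mdl)" shows "transfers M"
proof (rule M0(2)[OF _ assms])
  have im: "MN ` un ` A = A" for A by (force simp: image_image)
  show "transfers M0"
    unfolding transfers_def
  proof (intro conjI allI impI)
    fix S T assume S: "S \<noteq> {}" and v: "\<forall>q\<in>RCA0 \<union> {RT_exactly_large}. valid (M0\<lparr>sts := S, trs := T\<rparr>) q"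
    have ne: "(`) MN ` S \<noteq> {}" using S by simp
    have v': "valid (std ((`) MN ` S) (\<lambda>i. MN ` T i)) q" if "q \<in> RCA0 \<union> {RT_exactly_large}" for q
      using v that unfolding valid_M0 by (rule bspec)
    have "\<exists>T'. \<forall>q\<in>PA_Tr. valid (std ((`) MN ` S) T') q"
      by (rule truth_from_RT[OF ne]) (rule v')
    then obtain T' where T': "\<forall>q\<in>PA_Tr. valid (std ((`) MN ` S) T') q" ..
    have "valid (M0\<lparr>sts := S, trs := \<lambda>i. un ` T' i\<rparr>) q" if "q \<in> PA_Tr" for q
      unfolding valid_M0 im using T' that by simp
    then show "\<exists>T'. \<forall>q\<in>PA_Tr. valid (M0\<lparr>sts := S, trs := T'\<rparr>) q" by blast
  next
    fix S T assume S: "S \<noteq> {}" and v: "\<forall>q\<in>PA_Tr. valid (M0\<lparr>sts := S, trs := T\<rparr>) q"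
    have ne: "(`) MN ` S \<noteq> {}" using S by simp
    have v': "valid (std ((`) MN ` S) (\<lambda>i. MN ` T i)) q" if "q \<in> PA_Tr" for q
      using v that unfolding valid_M0 by (rule bspec)
    have "\<exists>S'. S' \<noteq> {} \<and> (\<forall>q\<in>RCA0 \<union> {RT_exactly_large}. valid (std S' (\<lambda>i. MN ` T i)) q)"
      by (rule RT_from_truth[OF ne]) (rule v')
    then obtain S' where S': "S' \<noteq> {}"
      "\<forall>q\<in>RCA0 \<union> {RT_exactly_large}. valid (std S' (\<lambda>i. MN ` T i)) q" by (elim exE conjE)
    have "valid (M0\<lparr>sts := (`) un ` S', trs := T\<rparr>) q" if "q \<in> RCA0 \<union> {RT_exactly_large}" for q
      unfolding valid_M0 image_image im using S'(2) that by auto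
    moreover have "(`) un ` S' \<noteq> {}" using S'(1) by simp
    ultimately show "\<exists>S'. S' \<noteq> {} \<and> (\<forall>q\<in>RCA0 \<union> {RT_exactly_large}. valid (M0\<lparr>sts := S', trs := T\<rparr>) q)"
      by (intro exI[of _ "(`) un ` S'"] conjI ballI)
  qed
qed

lemma transfersD:
  assumes "transfers M" "S \<noteq> {}"
  shows "\<forall>q\<in>RCA0 \<union> {RT_exactly_large}. valid (M\<lparr>sts := S, trs := T\<rparr>) q \<Longrightarrow>
      \<exists>T'. \<forall>q\<in>PA_Tr. valid (M\<lparr>sts := S, trs := T'\<rparr>) q"
    and "\<forall>q\<in>PA_Tr. valid (M\<lparr>sts := S, trs := T\<rparr>) q \<Longrightarrow>
      \<exists>S'. S' \<noteq> {} \<and> (\<forall>q\<in>RCA0 \<union> {RT_exactly_large}. valid (M\<lparr>sts := S', trs := T\<rparr>) q)"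
  by (erule assms(1)[unfolded transfers_def, THEN conjunct1, THEN spec, of S, THEN spec, of T, THEN HOL.mp, OF assms(2), THEN HOL.mp])
    (erule assms(1)[unfolded transfers_def, THEN conjunct2, THEN spec, of S, THEN spec, of T, THEN HOL.mp, OF assms(2), THEN HOL.mp])

section \<open>Equality of the arithmetical consequences\<close>

text \<open>Supplies the hypothesis of \<open>completeness\<close> that makes the term model
  infinite.\<close>

lemma (in lang_ex2) numerals_differ:
  assumes B: "basic_axioms \<subseteq> T" "basic_axioms \<subseteq> L" and "m \<noteq> n"
  shows "proves L T (\<^bold>\<not> (numeral_tm m \<^bold>= numeral_tm n))"
proof -
  have "proves L T (\<^bold>\<not> (Succ (Var 0) \<^bold>= Zero))"
    using B by (intro proves.axiom) (auto simp: basic_axioms_def)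
  note succ = proves_psub[OF this, where \<xi> = "\<lambda>X. X"]
  have S0: "proves L T (\<^bold>\<not> (Succ t \<^bold>= Zero))" for t
    using succ[of "\<lambda>_. t"] by simp
  have "proves L T (Succ (Var 0) \<^bold>= Succ (Var 1) \<^bold>\<longrightarrow> Var 0 \<^bold>= Var 1)"
    using B by (intro proves.axiom) (auto simp: basic_axioms_def)
  note inj = proves_psub[OF this, where \<xi> = "\<lambda>X. X"]
  have SS: "proves L T (Succ t \<^bold>= Succ u \<^bold>\<longrightarrow> t \<^bold>= u)" for t u
    using inj[of "\<lambda>i. if i = 0 then t else u"] by simp
  have hS: "hyp T {Zero \<^bold>= Succ t} (Succ t \<^bold>= Zero)" for t
  proof -
    have "(Zero \<^bold>= Succ t \<^bold>\<longrightarrow> subst_fm 0 Zero (Var 0 \<^bold>= Zero) \<^bold>\<longrightarrow> subst_fm 0 (Succ t) (Var 0 \<^bold>= Zero)) \<in> logical_axioms"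
      by (rule logical_axioms.intros)
    then have "hyp T {Zero \<^bold>= Succ t} (Zero \<^bold>= Succ t \<^bold>\<longrightarrow> Zero \<^bold>= Zero \<^bold>\<longrightarrow> Succ t \<^bold>= Zero)"
      by (intro hyp_ax) auto
    moreover have "hyp T {Zero \<^bold>= Succ t} (Zero \<^bold>= Succ t)" by (rule hyp.asm) auto
    ultimately have "hyp T {Zero \<^bold>= Succ t} (Zero \<^bold>= Zero \<^bold>\<longrightarrow> Succ t \<^bold>= Zero)" by (rule hyp.mp)
    then show ?thesis using hyp_triv by (rule hyp.mp)
  qed
  have "hyp T {} (\<^bold>\<not> (Zero \<^bold>= Succ t))" for t
  proof (rule neg_intro)
    show "hyp T {Zero \<^bold>= Succ t} Fls" by (rule exfalso[OF hS prv[OF S0]]) auto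
  qed auto
  then have ZS: "proves L T (\<^bold>\<not> (Zero \<^bold>= Succ t))" for t by (rule hyp_empty)
  have step: "proves L T (\<^bold>\<not> (Succ t \<^bold>= Succ u))" if ne: "proves L T (\<^bold>\<not> (t \<^bold>= u))" for t u
  proof (rule hyp_empty, rule neg_intro)
    have "hyp T {Succ t \<^bold>= Succ u} (t \<^bold>= u)"
      by (rule hyp.mp[OF prv[OF SS]]) (auto intro: hyp.asm)
    then show "hyp T {Succ t \<^bold>= Succ u} Fls"
      by (rule exfalso) (auto intro: prv ne)
  qed auto
  show ?thesis using \<open>m \<noteq> n\<close>
  proof (induction m arbitrary: n)
    case 0 then show ?case using ZS by (cases n) auto
  next
    case (Suc m) then show ?case using S0 step by (cases n) auto
  qed
qed

lemma set_free_syntax [simp]: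
  "set_free (mem t c)" "set_free (is_numeral t u)" "set_free (is_term t u)" "set_free (has_value t u)"
  "set_free (is_subst_tm t u v w)" "set_free (is_formula n t u)" "set_free (is_subst_fm t u v w)"
proof -
  show mem: "set_free (mem t c)" for t c by (simp add: mem_def BEx_def)
  note d = mem Ex_mem_def All_mem_def All_pair_mem_def
  show "set_free (is_numeral t u)" by (simp add: is_numeral_def d)
  show trm: "set_free (is_term t u)" for t u by (simp add: is_term_def d)
  show "set_free (has_value t u)" by (simp add: has_value_def d)
  show sub: "set_free (is_subst_tm t u v w)" for t u v w by (simp add: is_subst_tm_def d)
  show "set_free (is_formula n t u)" by (simp add: is_formula_def d trm)
  show "set_free (is_subst_fm t u v w)" by (simp add: is_subst_fm_def d sub)
qed

lemma set_free_basic: "basic_axioms \<subseteq> lang_PA"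
  by (auto simp: basic_axioms_def lang_PA_def)

lemma set_free_induction: "set_free (induction_axiom p) = set_free p"
  and truth_free_induction: "truth_free (induction_axiom p) = truth_free p"
  by (auto simp: induction_axiom_def subst_fm_psub shift_fm_psub set_free_psub truth_free_psub)

lemma PA_Tr_lang: "PA_Tr \<subseteq> lang_Tr"
proof -
  have "truth_axioms n \<subseteq> lang_Tr" for n
    by (auto simp: truth_axioms_def lang_Tr_def truth_Eq_def truth_Le_def truth_Tr_def truth_Neg_def
        truth_Imp_def truth_Ex_def)
  then show ?thesis
    unfolding PA_Tr_def using set_free_basic by (auto simp: lang_Tr_def lang_PA_def set_free_induction)
qed

lemma RCA0_lang: "RCA0 \<union> {RT_exactly_large} \<subseteq> lang_2"
proof -
  have b: "truth_free p" if "p \<in> bounded_formulas" for p using tri_bounded[OF that] tri_truth_free by blast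
  have mem: "truth_free (mem t c)" for t c by (simp add: mem_def BEx_def)
  note d = mem Ex_mem_def All_mem_def All_pair_mem_def
  have xl: "truth_free (exactly_large c)" for c
    by (simp add: exactly_large_def least_code_def has_card_def d)
  have "truth_free RT_exactly_large"
    by (simp add: RT_exactly_large_def infinite_set_def two_coloring_def subset_def coded_subset_def xl d)
  moreover have "truth_free q" if "q \<in> RCA0" for q
    using that set_free_basic b unfolding RCA0_def Sigma01_def Pi01_def
    by (auto simp: lang_PA_def truth_free_induction comprehension_axiom_def shift2_fm_psub truth_free_psub)
  ultimately show ?thesis unfolding lang_2_def by blast
qed

text \<open>This is how a counterexample survives the passage to a model of the other theory: a
  formula of arithmetic sees only the number part.\<close>

lemma sat_update:
  assumes "set_free p" "truth_free p \<or> T = trs M"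
  shows "sat (M\<lparr>sts := S, trs := T\<rparr>) e X p \<longleftrightarrow> sat M e X' p"
proof -
  have "ev (M\<lparr>sts := S, trs := T\<rparr>) e t = ev M e t" for e t by (induction t) auto
  then show ?thesis using assms by (induction p arbitrary: e) auto
qed

lemma peano_of_valid:
  fixes X :: "nat \<Rightarrow> 'a set"
  assumes X: "range X \<subseteq> sts M" and val: "\<And>q. q \<in> basic_axioms \<Longrightarrow> valid M q"
    "\<And>q. q \<in> bounded_formulas \<Longrightarrow> set_free q \<Longrightarrow> truth_free q \<Longrightarrow> valid M (induction_axiom (Ex q))"
  shows "peano M"
proof
  have s: "sat M e (\<lambda>_. {}) q" if "valid M q" "set_free q" "truth_free q" for e q
  proof -
    have "sat M e X q" using that(1) X unfolding valid_def by blast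
    then show ?thesis
      using sat_update[OF that(2), of "trs M" M "sts M" e X X]
        sat_update[OF that(2), of "trs M" M "sts M" e X "\<lambda>_. {}"] by simp
  qed
  show "sat M e (\<lambda>_. {}) q" if "q \<in> basic_axioms" for e q
    using s val(1)[OF that] set_free_basic that unfolding lang_PA_def by blast
  show "sat M e (\<lambda>_. {}) (induction_axiom (Ex q))" if "q \<in> bounded_formulas" "set_free q" "truth_free q" for e q
    using that by (intro s val(2)) (auto simp: set_free_induction truth_free_induction)
qed

theorem theorem20:
  fixes p :: fm
  assumes "p \<in> lang_PA" and "sentence p"
  shows "proves lang_2 (RCA0 \<union> {RT_exactly_large}) p \<longleftrightarrow> proves lang_Tr PA_Tr p"
proof
  have p: "set_free p" "truth_free p" using assms(1) by (auto simp: lang_PA_def)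
  {
    assume prv: "proves lang_2 (RCA0 \<union> {RT_exactly_large}) p"
    show "proves lang_Tr PA_Tr p"
    proof (rule ccontr)
      assume np: "\<not> proves lang_Tr PA_Tr p"
      have pl: "p \<in> lang_Tr" using p by (simp add: lang_Tr_def)
      have B: "basic_axioms \<subseteq> PA_Tr" unfolding PA_Tr_def by blast
      have num: "proves lang_Tr PA_Tr (\<^bold>\<not> (numeral_tm m \<^bold>= numeral_tm n))" if "m \<noteq> n" for m n
        by (rule LTr.numerals_differ[OF B _ that]) (use B PA_Tr_lang in blast)
      have "\<exists>(M :: nat mdl) e X. range X \<subseteq> sts M \<and> \<not> sat M e X p \<and>
          (\<forall>q. proves lang_Tr PA_Tr q \<longrightarrow> valid M q)"
        by (rule LTr.completeness[OF np pl]) (rule num)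
      then obtain M :: "nat mdl" and e X where M: "range X \<subseteq> sts M" "\<not> sat M e X p"
        "\<forall>q. proves lang_Tr PA_Tr q \<longrightarrow> valid M q" by (elim exE conjE)
      have val: "valid M q" if "q \<in> PA_Tr" for q
        using M(3) proves.axiom[OF that] PA_Tr_lang that by blast
      have "peano M"
        by (rule peano_of_valid[OF M(1)]; rule val) (auto simp: PA_Tr_def lang_Tr_def)
      then have t: "transfers M" by (rule transfers)
      have v: "\<forall>q\<in>PA_Tr. valid (M\<lparr>sts := sts M, trs := trs M\<rparr>) q" using val by simp
      have "sts M \<noteq> {}" using M(1) by blast
      \<comment> \<open>Here the truth component stays, and the second-order part is replaced by one
        satisfying the other theory.\<close>
      from transfersD(2)[OF t this v] obtain S where S: "S \<noteq> {}"
        "\<forall>q\<in>RCA0 \<union> {RT_exactly_large}. valid (M\<lparr>sts := S, trs := trs M\<rparr>) q"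
        by blast
      then have "valid (M\<lparr>sts := S, trs := trs M\<rparr>) p" by (intro soundness[OF prv]) blast
      moreover obtain A where "A \<in> S" using S(1) by blast
      ultimately have "sat (M\<lparr>sts := S, trs := trs M\<rparr>) e (\<lambda>_. A) p" unfolding valid_def by auto
      then show False using M(2) sat_update[OF p(1), of "trs M" M S e "\<lambda>_. A" X] by simp
    qed
  next
    assume prv: "proves lang_Tr PA_Tr p"
    let ?T = "RCA0 \<union> {RT_exactly_large}"
    show "proves lang_2 ?T p"
    proof (rule ccontr)
      assume np: "\<not> proves lang_2 ?T p"
      have pl: "p \<in> lang_2" using p by (simp add: lang_2_def)
      have B: "basic_axioms \<subseteq> ?T" unfolding RCA0_def by blast
      have num: "proves lang_2 ?T (\<^bold>\<not> (numeral_tm m \<^bold>= numeral_tm n))" if "m \<noteq> n" for m n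
        by (rule L2.numerals_differ[OF B _ that]) (use B RCA0_lang in blast)
      have "\<exists>(M :: nat mdl) e X. range X \<subseteq> sts M \<and> \<not> sat M e X p \<and>
          (\<forall>q. proves lang_2 ?T q \<longrightarrow> valid M q)"
        by (rule L2.completeness[OF np pl]) (rule num)
      then obtain M :: "nat mdl" and e X where M: "range X \<subseteq> sts M" "\<not> sat M e X p"
        "\<forall>q. proves lang_2 ?T q \<longrightarrow> valid M q" by (elim exE conjE)
      have val: "valid M q" if "q \<in> ?T" for q
        using M(3) proves.axiom[OF that] RCA0_lang that by blast
      have "peano M"
        by (rule peano_of_valid[OF M(1)]; rule val) (auto simp: RCA0_def Sigma01_def)
      then have t: "transfers M" by (rule transfers)
      have v: "\<forall>q\<in>?T. valid (M\<lparr>sts := sts M, trs := trs M\<rparr>) q" using val by simp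
      have "sts M \<noteq> {}" using M(1) by blast
      \<comment> \<open>Here the sets stay, and the truth component is replaced.\<close>
      from transfersD(1)[OF t this v] obtain T where T: "\<forall>q\<in>PA_Tr. valid (M\<lparr>sts := sts M, trs := T\<rparr>) q"
        by blast
      then have "valid (M\<lparr>sts := sts M, trs := T\<rparr>) p" by (intro soundness[OF prv]) blast
      then have "sat (M\<lparr>sts := sts M, trs := T\<rparr>) e X p" using M(1) unfolding valid_def by auto
      then show False using M(2) sat_update[OF p(1), of T M "sts M" e X X] p(2) by simp
    qed
  }
qed

end
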